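(* Let $u$ be the unitary on $\ell^2(\mathbb{N}_0)\otimes\mathbb{C}^2$ defining a generalized micromaser coupling $\alpha$, $\alpha(z)=u^*zu$ on $\mathcal{B}(\ell^2(\mathbb{N}_0))\otimes M_2$, with coefficients $\alpha_n,\alpha_n^+,\beta_n,\beta_n^+$. If $\beta_n\neq 0$ for all $n\in\mathbb{N}$, then the generalized micromaser coupling $\alpha$ is asymptotically complete.
   Context: $\mathbb{N}=\{1,2,\dots\}$, $\mathbb{N}_0=\{0,1,2,\dots\}$; $M_2$ denotes the complex $2\times2$ matrices. Generalized micromaser coupling: let $\mathcal{H}=\ell^2(\mathbb{N}_0)$ with canonical orthonormal basis $(\delta_n)_{n\ge0}$ and let $\epsilon_0=\binom{0}{1}$, $\epsilon_1=\binom{1}{0}$ in $\mathbb{C}^2$; put $\delta_{n,0}=\delta_n\otimes\epsilon_0$, $\delta_{n,1}=\delta_n\otimes\epsilon_1$. Let $\mathcal{H}_0$ be spanned by $\delta_{0,0}$ and, for $n\ge1$, $\mathcal{H}_n$ by $\{\delta_{n-1,1},\delta_{n,0}\}$, so that $\mathcal{H}\otimes\mathbb{C}^2=\bigoplus_{n\ge0}\mathcal{H}_n$. Let $u$ be a unitary on $\mathcal{H}\otimes\mathbb{C}^2$ leaving every $\mathcal{H}_n$ invariant: on $\mathcal{H}_0$ it is multiplication by a number $\alpha_0$ with $|\alpha_0|=1$, and on $\mathcal{H}_n$, $n\ge1$, it is given by $$u\,\delta_{n-1,1}=\alpha_n^+\delta_{n-1,1}+\beta_n\delta_{n,0},\qquad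 u\,\delta_{n,0}=\beta_n^+\delta_{n-1,1}+\alpha_n\delta_{n,0}.$$ The automorphism $\alpha$ of $\mathcal{B}(\mathcal{H})\otimes M_2$ determined by $\alpha(x\otimes y)=u^*(x\otimes y)u$ is called a generalized micromaser coupling. Asymptotic completeness: let $\mathcal{C}$ be a von Neumann algebra and $\alpha$ a $*$-automorphism of $\mathcal{B}(\mathcal{H})\otimes\mathcal{C}$. Put $\mathcal{C}_n:=\bigotimes_{j=1}^n\mathcal{C}_{(j)}$ with copies $\mathcal{C}_{(j)}$ of $\mathcal{C}$, let $\alpha_{(j)}$ act as $\alpha$ on $\mathcal{B}(\mathcal{H})\otimes\mathcal{C}_{(j)}$ and trivially on the other factors, and $J_n(a):=\alpha_{(1)}\cdots\alpha_{(n)}(a\otimes1)$ for $a\in\mathcal{B}(\mathcal{H})$; $J=J_1$. For faithful normal states $\varphi$ on $\mathcal{B}(\mathcal{H})$ and $\psi$ on $\mathcal{C}$ with $(\varphi\otimes\psi)J=\varphi$, $J:(\mathcal{B}(\mathcal{H}),\varphi)\to(\mathcal{B}(\mathcal{H})\otimes\mathcal{C},\varphi\otimes\psi)$ is asymptotically complete if $\lim_{n\to\infty}\|Q_nJ_n(a)-J_n(a)\|_{\varphi\otimes\psi_n}=0$ for all $a\in\mathcal{B}(\mathcal{H})$, where $\psi_n$ is the product state of $n$ copies of $\psi$ on $\mathcal{C}_n$, $\|x\|_\chi=\chi(x^*x)^{1/2}$, and $Q_n:\mathcal{B}(\mathcal{H})\otimes\mathcal{C}_n\to1\otimes\mathcal{C}_n$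 is the conditional expectation determined by $Q_n(a\otimes c)=\varphi(a)\,1\otimes c$. The automorphism $\alpha$ itself is called asymptotically complete if there exist faithful normal states $\varphi$ on $\mathcal{B}(\mathcal{H})$ and $\psi$ on $\mathcal{C}$ with $(\varphi\otimes\psi)\circ\alpha=\varphi\otimes\psi$, and for any choice of such states (and hence for all choices of such states) the induced transition $J:(\mathcal{B}(\mathcal{H}),\varphi)\to(\mathcal{B}(\mathcal{H})\otimes\mathcal{C},\varphi\otimes\psi)$, $J(a)=\alpha(a\otimes1)$, is asymptotically complete. *)

theory Defs
  imports "HOL-Analysis.Analysis" "HOL-Library.Function_Algebras"
begin

section \<open>Hilbert spaces with an orthonormal basis, and their bounded operators\<close>

text \<open>
  \<open>ell2 A\<close> is the Hilbert space with orthonormal basis indexed by \<open>A\<close>; its vectors vanish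
  outside \<open>A\<close>.  Hence \<open>ell2 A \<otimes> ell2 B\<close> is \<open>ell2 (A \<times> B)\<close>, and the \<open>n\<close>-fold tensor power of
  \<open>ell2 UNIV\<close> is \<open>ell2\<close> of the set of words of length \<open>n\<close>.  Addition and subtraction of vectors
  and of operators are the pointwise ones.
\<close>

type_synonym 'i vec = "'i \<Rightarrow> complex"
type_synonym 'i op = "'i vec \<Rightarrow> 'i vec"

definition ell2 :: "'i set \<Rightarrow> 'i vec set" where
  "ell2 A = {f. (\<forall>i. i \<notin> A \<longrightarrow> f i = 0) \<and> (\<lambda>i. (cmod (f i))\<^sup>2) summable_on A}"

definition ip :: "'i vec \<Rightarrow> 'i vec \<Rightarrow> complex" where
  "ip f g = (\<Sum>\<^sub>\<infinity>i. cnj (f i) * g i)"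

definition ell2_norm :: "'i vec \<Rightarrow> real" where
  "ell2_norm f = sqrt (\<Sum>\<^sub>\<infinity>i. (cmod (f i))\<^sup>2)"

definition ket :: "'i \<Rightarrow> 'i vec" where
  "ket i = (\<lambda>j. if j = i then 1 else 0)"

definition vscale :: "complex \<Rightarrow> 'i vec \<Rightarrow> 'i vec" where
  "vscale c f = (\<lambda>i. c * f i)"

definition oscale :: "complex \<Rightarrow> 'i op \<Rightarrow> 'i op" where
  "oscale c T = (\<lambda>f. vscale c (T f))"

definition clinear_map_on ::
  "'v::plus set \<Rightarrow> (complex \<Rightarrow> 'v \<Rightarrow> 'v) \<Rightarrow> (complex \<Rightarrow> 'w::plus \<Rightarrow> 'w) \<Rightarrow> ('v \<Rightarrow> 'w) \<Rightarrow> bool" where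
  "clinear_map_on V s t L \<longleftrightarrow>
     (\<forall>x\<in>V. \<forall>y\<in>V. L (x + y) = L x + L y) \<and> (\<forall>c. \<forall>x\<in>V. L (s c x) = t c (L x))"

text \<open>
  Operators are made total by sending everything outside \<open>ell2 A\<close> to \<open>0\<close>, so that equality of
  functions is equality of operators and the product of operators is \<open>(\<circ>)\<close>.
\<close>

definition bop :: "'i set \<Rightarrow> 'i op set" where
  "bop A = {T. (\<forall>f\<in>ell2 A. T f \<in> ell2 A) \<and> clinear_map_on (ell2 A) vscale vscale T \<and>
               (\<exists>C. \<forall>f\<in>ell2 A. ell2_norm (T f) \<le> C * ell2_norm f) \<and>
               (\<forall>f. f \<notin> ell2 A \<longrightarrow> T f = 0)}"

definition id_op :: "'i set \<Rightarrow> 'i op" where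
  "id_op A = (\<lambda>f. if f \<in> ell2 A then f else 0)"

definition adj :: "'i set \<Rightarrow> 'i op \<Rightarrow> 'i op" where
  "adj A T = (THE S. S \<in> bop A \<and> (\<forall>f\<in>ell2 A. \<forall>g\<in>ell2 A. ip f (T g) = ip (S f) g))"

definition unitary_op :: "'i set \<Rightarrow> 'i op \<Rightarrow> bool" where
  "unitary_op A u \<longleftrightarrow> u \<in> bop A \<and> adj A u \<circ> u = id_op A \<and> u \<circ> adj A u = id_op A"

definition pos_op :: "'i set \<Rightarrow> 'i op \<Rightarrow> bool" where
  "pos_op A T \<longleftrightarrow> T \<in> bop A \<and> (\<forall>f\<in>ell2 A. ip f (T f) \<in> \<real>\<^sub>\<ge>\<^sub>0)"

definition op_le :: "'i set \<Rightarrow> 'i op \<Rightarrow> 'i op \<Rightarrow> bool" where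
  "op_le A S T \<longleftrightarrow> pos_op A (T - S)"

section \<open>Tensor products of operators\<close>

text \<open>
  First \<open>x\<close> is applied in the first variable, for each value of the second one, and then \<open>y\<close> in
  the second variable; see \<open>tensor_op_product\<close> below.
\<close>

definition tensor_op :: "'a set \<Rightarrow> 'b set \<Rightarrow> 'a op \<Rightarrow> 'b op \<Rightarrow> ('a \<times> 'b) op" where
  "tensor_op A B x y =
     (\<lambda>f. if f \<in> ell2 (A \<times> B)
          then (\<lambda>(a, b). y (\<lambda>b'. x (\<lambda>a'. f (a', b')) a) b) else 0)"

definition tensor_vec :: "'a vec \<Rightarrow> 'b vec \<Rightarrow> ('a \<times> 'b) vec" where
  "tensor_vec f g = (\<lambda>(a, b). f a * g b)"

text \<open>Transport of an operator along the unitary induced by an injection \<open>g\<close> of the index set.\<close>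

definition reindex_op :: "('i \<Rightarrow> 'j) \<Rightarrow> 'i set \<Rightarrow> 'i op \<Rightarrow> 'j op" where
  "reindex_op g B T =
     (\<lambda>f. if f \<in> ell2 (g ` B)
          then (\<lambda>j. if j \<in> g ` B
                    then T (\<lambda>i. if i \<in> B then f (g i) else 0) (inv_into B g j) else 0)
          else 0)"

definition words :: "nat \<Rightarrow> 'k list set" where
  "words n = {w. length w = n}"

text \<open>The operator \<open>c\<^sub>1 \<otimes> \<dots> \<otimes> c\<^sub>n\<close> on the \<open>n\<close>-fold tensor power of \<open>ell2 UNIV\<close>.\<close>

fun tensor_list :: "'k op list \<Rightarrow> 'k list op" where
  "tensor_list [] = id_op (words 0)"
| "tensor_list (c # cs) =
     reindex_op (\<lambda>(k, w). k # w) (UNIV \<times> words (length cs))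
       (tensor_op UNIV (words (length cs)) c (tensor_list cs))"

section \<open>Faithful normal states\<close>

definition state :: "'i set \<Rightarrow> ('i op \<Rightarrow> complex) \<Rightarrow> bool" where
  "state A \<phi> \<longleftrightarrow> clinear_map_on (bop A) oscale (*) \<phi> \<and>
     (\<forall>T. pos_op A T \<longrightarrow> \<phi> T \<in> \<real>\<^sub>\<ge>\<^sub>0) \<and> \<phi> (id_op A) = 1"

definition op_lub :: "'i set \<Rightarrow> 'i op set \<Rightarrow> 'i op \<Rightarrow> bool" where
  "op_lub A D T \<longleftrightarrow> T \<in> bop A \<and> (\<forall>S\<in>D. op_le A S T) \<and>
     (\<forall>R\<in>bop A. (\<forall>S\<in>D. op_le A S R) \<longrightarrow> op_le A T R)"

text \<open>Normality: suprema of upward directed sets of positive operators are preserved.\<close>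

definition normal_state :: "'i set \<Rightarrow> ('i op \<Rightarrow> complex) \<Rightarrow> bool" where
  "normal_state A \<phi> \<longleftrightarrow> state A \<phi> \<and>
     (\<forall>D T. D \<noteq> {} \<and> (\<forall>S\<in>D. pos_op A S) \<and>
            (\<forall>S\<in>D. \<forall>S'\<in>D. \<exists>R\<in>D. op_le A S R \<and> op_le A S' R) \<and> op_lub A D T
        \<longrightarrow> Re (\<phi> T) = (SUP S\<in>D. Re (\<phi> S)))"

definition faithful_normal_state :: "'i set \<Rightarrow> ('i op \<Rightarrow> complex) \<Rightarrow> bool" where
  "faithful_normal_state A \<phi> \<longleftrightarrow> normal_state A \<phi> \<and>
     (\<forall>x\<in>bop A. \<phi> (adj A x \<circ> x) = 0 \<longrightarrow> x = 0)"

definition state_norm :: "'i set \<Rightarrow> ('i op \<Rightarrow> complex) \<Rightarrow> 'i op \<Rightarrow> real" where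
  "state_norm A \<omega> x = sqrt (Re (\<omega> (adj A x \<circ> x)))"

section \<open>Asymptotic completeness\<close>

text \<open>
  Throughout, \<open>\<H> = ell2 UNIV\<close> over the index type \<open>'a\<close> and \<open>\<C>\<close> is the full matrix algebra
  \<open>bop UNIV\<close> over a finite index type \<open>'k\<close>, so that \<open>\<B>(\<H>) \<otimes> \<C>\<^sub>n\<close> is
  \<open>bop (UNIV \<times> words n)\<close>.  Since \<open>\<C>\<^sub>n\<close> is finite-dimensional, \<open>\<B>(\<H>) \<otimes> \<C>\<^sub>n\<close> is spanned by the
  elementary tensors; a linear map on it is therefore determined by its values there, and no
  continuity is needed in the descriptions below.
\<close>

definition product_functional ::
  "'a set \<Rightarrow> 'b set \<Rightarrow> ('a op \<Rightarrow> complex) \<Rightarrow> ('b op \<Rightarrow> complex) \<Rightarrow> ('a \<times> 'b) op \<Rightarrow> complex" where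
  "product_functional A B \<phi> \<psi> =
     (THE \<omega>. \<omega> \<in> extensional (bop (A \<times> B)) \<and>
             clinear_map_on (bop (A \<times> B)) oscale (*) \<omega> \<and>
             (\<forall>x\<in>bop A. \<forall>y\<in>bop B. \<omega> (tensor_op A B x y) = \<phi> x * \<psi> y))"

definition power_functional :: "nat \<Rightarrow> ('k::finite op \<Rightarrow> complex) \<Rightarrow> 'k list op \<Rightarrow> complex" where
  "power_functional n \<psi> =
     (THE \<omega>. \<omega> \<in> extensional (bop (words n)) \<and>
             clinear_map_on (bop (words n)) oscale (*) \<omega> \<and>
             (\<forall>cs. length cs = n \<and> set cs \<subseteq> bop UNIV \<longrightarrow>
                   \<omega> (tensor_list cs) = prod_list (map \<psi> cs)))"

text \<open>
  \<open>place n j z c\<close> is the operator on \<open>\<H> \<otimes> K\<^sup>\<otimes>\<^sup>n\<close> that is \<open>z\<close> on \<open>\<H>\<close> and the \<open>j\<close>-th copy of \<open>K\<close>,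
  and \<open>c\<close> on the other \<open>n - 1\<close> copies.  Copies are numbered from \<open>0\<close>, so
  \<open>slot_map n j \<alpha>\<close> is \<open>\<alpha>\<^sub>(\<^sub>j\<^sub>+\<^sub>1\<^sub>)\<close>.
\<close>

definition place :: "nat \<Rightarrow> nat \<Rightarrow> ('a \<times> 'k) op \<Rightarrow> 'k list op \<Rightarrow> ('a \<times> 'k list) op" where
  "place n j z c =
     reindex_op (\<lambda>((a, k), w). (a, take j w @ k # drop j w)) (UNIV \<times> words (n - 1))
       (tensor_op UNIV (words (n - 1)) z c)"

definition slot_map ::
  "nat \<Rightarrow> nat \<Rightarrow> (('a \<times> 'k::finite) op \<Rightarrow> ('a \<times> 'k) op)
     \<Rightarrow> ('a \<times> 'k list) op \<Rightarrow> ('a \<times> 'k list) op" where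
  "slot_map n j \<alpha> =
     (THE \<beta>. \<beta> \<in> extensional (bop (UNIV \<times> words n)) \<and>
             clinear_map_on (bop (UNIV \<times> words n)) oscale oscale \<beta> \<and>
             (\<forall>z\<in>bop UNIV. \<forall>c\<in>bop (words (n - 1)). \<beta> (place n j z c) = place n j (\<alpha> z) c))"

definition Jn ::
  "(('a \<times> 'k::finite) op \<Rightarrow> ('a \<times> 'k) op) \<Rightarrow> nat \<Rightarrow> 'a op \<Rightarrow> ('a \<times> 'k list) op" where
  "Jn \<alpha> n a = foldr (\<lambda>j. slot_map n j \<alpha>) [0..<n] (tensor_op UNIV (words n) a (id_op (words n)))"

definition Qn ::
  "('a op \<Rightarrow> complex) \<Rightarrow> nat \<Rightarrow> ('a \<times> 'k::finite list) op \<Rightarrow> ('a \<times> 'k list) op" where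
  "Qn \<phi> n =
     (THE Q. Q \<in> extensional (bop (UNIV \<times> words n)) \<and>
             clinear_map_on (bop (UNIV \<times> words n)) oscale oscale Q \<and>
             (\<forall>a\<in>bop UNIV. \<forall>c\<in>bop (words n).
                Q (tensor_op UNIV (words n) a c)
                  = oscale (\<phi> a) (tensor_op UNIV (words n) (id_op UNIV) c)))"

definition transition_asymptotically_complete ::
  "('a op \<Rightarrow> complex) \<Rightarrow> ('k::finite op \<Rightarrow> complex)
     \<Rightarrow> (('a \<times> 'k) op \<Rightarrow> ('a \<times> 'k) op) \<Rightarrow> bool" where
  "transition_asymptotically_complete \<phi> \<psi> \<alpha> \<longleftrightarrow>
     (\<forall>a\<in>bop UNIV.
        (\<lambda>n. state_norm (UNIV \<times> words n)
               (product_functional UNIV (words n) \<phi> (power_functional n \<psi>))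
               (Qn \<phi> n (Jn \<alpha> n a) - Jn \<alpha> n a)) \<longlonglongrightarrow> 0)"

definition invariant_states ::
  "(('a \<times> 'k::finite) op \<Rightarrow> ('a \<times> 'k) op)
     \<Rightarrow> ('a op \<Rightarrow> complex) \<Rightarrow> ('k op \<Rightarrow> complex) \<Rightarrow> bool" where
  "invariant_states \<alpha> \<phi> \<psi> \<longleftrightarrow>
     faithful_normal_state UNIV \<phi> \<and> faithful_normal_state UNIV \<psi> \<and>
     (\<forall>z\<in>bop UNIV. product_functional UNIV UNIV \<phi> \<psi> (\<alpha> z) = product_functional UNIV UNIV \<phi> \<psi> z)"

definition asymptotically_complete ::
  "(('a \<times> 'k::finite) op \<Rightarrow> ('a \<times> 'k) op) \<Rightarrow> bool" where
  "asymptotically_complete \<alpha> \<longleftrightarrow>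
     (\<exists>\<phi> \<psi>. invariant_states \<alpha> \<phi> \<psi>) \<and>
     (\<forall>\<phi> \<psi>. invariant_states \<alpha> \<phi> \<psi> \<longrightarrow> transition_asymptotically_complete \<phi> \<psi> \<alpha>)"

section \<open>The generalized micromaser\<close>

text \<open>
  The basis vector \<open>\<epsilon>\<^sub>i\<close> of \<open>\<complex>\<^sup>2\<close> has the index \<open>i\<close> in the two-element type \<open>2\<close>, so
  \<open>\<delta>\<^sub>n\<^sub>,\<^sub>i\<close> is \<open>ket (n, i)\<close>.  The values of \<open>\<alpha>p\<close>, \<open>\<beta>\<close>, \<open>\<beta>p\<close> (for \<open>\<alpha>\<^sup>+\<close>, \<open>\<beta>\<close>, \<open>\<beta>\<^sup>+\<close>) at \<open>0\<close>
  play no role.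
\<close>

definition generalized_micromaser ::
  "(nat \<times> 2) op \<Rightarrow> (nat \<Rightarrow> complex) \<Rightarrow> (nat \<Rightarrow> complex) \<Rightarrow> (nat \<Rightarrow> complex) \<Rightarrow> (nat \<Rightarrow> complex)
     \<Rightarrow> bool" where
  "generalized_micromaser u \<alpha> \<alpha>p \<beta> \<beta>p \<longleftrightarrow>
     unitary_op UNIV u \<and>
     cmod (\<alpha> 0) = 1 \<and> u (ket (0, 0)) = vscale (\<alpha> 0) (ket (0, 0)) \<and>
     (\<forall>n\<ge>1. u (ket (n - 1, 1)) = vscale (\<alpha>p n) (ket (n - 1, 1)) + vscale (\<beta> n) (ket (n, 0)) \<and>
            u (ket (n, 0)) = vscale (\<beta>p n) (ket (n - 1, 1)) + vscale (\<alpha> n) (ket (n, 0)))"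

definition coupling :: "'i op \<Rightarrow> 'i op \<Rightarrow> 'i op" where
  "coupling u z = adj UNIV u \<circ> z \<circ> u"

section \<open>Action of \<open>tensor_op\<close> on product vectors\<close>

lemma tensor_vec_ell2:
  assumes "f \<in> ell2 A" "g \<in> ell2 B"
  shows "tensor_vec f g \<in> ell2 (A \<times> B)"
proof -
  have "(\<lambda>(a, b). (cmod (f a))\<^sup>2 * (cmod (g b))\<^sup>2) summable_on (A \<times> B)"
  proof (rule summable_on_SigmaI)
    show "((\<lambda>b. case (a, b) of (a, b) \<Rightarrow> (cmod (f a))\<^sup>2 * (cmod (g b))\<^sup>2)
            has_sum (cmod (f a))\<^sup>2 * (\<Sum>\<^sub>\<infinity>b\<in>B. (cmod (g b))\<^sup>2)) B" for a
      using assms(2) by (auto simp: ell2_def intro!: has_sum_cmult_right has_sum_infsum)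
    show "(\<lambda>a. (cmod (f a))\<^sup>2 * (\<Sum>\<^sub>\<infinity>b\<in>B. (cmod (g b))\<^sup>2)) summable_on A"
      using assms(1) by (auto simp: ell2_def intro!: summable_on_cmult_left)
  qed auto
  then show ?thesis
    using assms by (auto simp: ell2_def tensor_vec_def norm_mult power_mult_distrib case_prod_unfold)
qed

lemma tensor_op_product:
  assumes "x \<in> bop A" "y \<in> bop B" "f \<in> ell2 A" "g \<in> ell2 B"
  shows "tensor_op A B x y (tensor_vec f g) = tensor_vec (x f) (y g)"
proof -
  have 1: "x (\<lambda>a'. f a' * g b') = (\<lambda>a. g b' * x f a)" for b'
  proof -
    have "(\<lambda>a'. f a' * g b') = vscale (g b') f"
      by (simp add: vscale_def mult.commute)
    then show ?thesis
      using assms by (simp add: bop_def clinear_map_on_def) (simp add: vscale_def)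
  qed
  have 2: "y (\<lambda>b'. g b' * x f a) = (\<lambda>b. x f a * y g b)" for a
  proof -
    have "(\<lambda>b'. g b' * x f a) = vscale (x f a) g"
      by (simp add: vscale_def mult.commute)
    then show ?thesis
      using assms by (simp add: bop_def clinear_map_on_def) (simp add: vscale_def)
  qed
  show ?thesis
    using tensor_vec_ell2[OF assms(3,4)]
    by (simp add: tensor_op_def) (simp add: tensor_vec_def 1 2)
qed

end

theory Submission
  imports Defs
begin

text \<open>
  Let \<open>T\<^sub>k\<^sub>l x\<close> be the \<open>(k, l)\<close> block of \<open>u\<^sup>* (x \<otimes> 1) u\<close> over the atom, so that \<open>J\<^sub>n a\<close> has the blocks
  \<open>T (T \<dots> (T a))\<close>.  A Cholesky factor \<open>c\<close> of \<open>\<psi>\<close> turns \<open>T\<close> into maps \<open>R\<^sub>s\<close>, \<open>s = (k, t)\<close>, with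
  \<open>\<parallel>Q\<^sub>n (J\<^sub>n a) - J\<^sub>n a\<parallel>\<^sup>2 = (\<Sum>S. \<parallel>Y\<^sub>S\<parallel>\<^sub>\<phi>\<^sup>2)\<close>, where \<open>Y\<^sub>S = R\<^sub>S a - \<phi> (R\<^sub>S a)\<close> and \<open>S\<close> ranges over words of
  length \<open>n\<close>.  Invariance of \<open>\<phi> \<otimes> \<psi>\<close> becomes the duality
  \<open>(\<Sum>s. \<phi> ((R\<^sub>s x)\<^sup>* y (R\<^sub>s z))) = \<phi> (x\<^sup>* (P y) z)\<close> with a \<open>\<phi>\<close>-preserving unital positive map \<open>P\<close>.

  The numbers \<open>\<Sum>S. \<bar>\<phi> (R\<^sub>S a)\<bar>\<^sup>2\<close> increase with \<open>n\<close> and are bounded, so the bounded operators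
  \<open>X\<^sub>n = (\<Sum>S. cnj (b\<^sub>S) Y\<^sub>S)\<close>, where \<open>b\<^sub>S\<close> is a fixed matrix entry of \<open>Y\<^sub>S\<close>, satisfy
  \<open>\<omega> (R\<^sub>S X\<^sub>n) \<longrightarrow> 0\<close> for all words \<open>S\<close> and for \<open>\<omega> = \<phi>\<close>.  The functionals \<open>\<omega>\<close> with this property are
  stable under \<open>\<omega> \<mapsto> \<omega> \<circ> T\<^sub>k\<^sub>l\<close> and under norm limits.  As the \<open>\<beta>\<^sub>n\<close> do not vanish, a stream of
  ground-state atoms drives \<open>\<phi>\<close> to the vacuum, from which the remaining blocks reach all vector
  functionals of the basis.  Hence \<open>\<Sum>S. \<bar>b\<^sub>S\<bar>\<^sup>2 \<longrightarrow> 0\<close>, and duality rules out an escape of mass to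
  infinity, which turns this into convergence in \<open>\<parallel>\<cdot>\<parallel>\<^sub>\<phi>\<close>.  Invariant states exist because the weights
  \<open>2\<^sup>-\<^sup>n\<close> on the number of quanta are constant on the blocks of \<open>u\<close>.
\<close>

subsection \<open>Square-summable families\<close>

text \<open>An invariant pair of states is arbitrary, so the density of \<open>\<phi>\<close> is
  unknown and only faithfulness, normality and invariance can be exploited. Two obstacles shape the
  proof. The squared norm to be estimated is quadratic in \<open>a\<close>, whereas the dynamics is
  controlled through linear functionals; the weights \<open>b_S\<close> are conjugate entries of
  \<open>Y_S\<close> itself, so that a sum of squares becomes one matrix entry of the single
  operator \<open>X_n\<close>. Its boundedness, uniform in \<open>n\<close>, holds because all
  \<open>R_S a\<close> of a given length together form a column of norm at most that of
  \<open>a\<close>. The second obstacle is that decay of every matrix entry gives no norm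
  convergence by itself: weight may move to high levels as the words grow. Faithfulness of
  \<open>\<phi>\<close> makes the range of its density dense, and normality makes high levels cheap
  for \<open>\<phi>\<close>; together they cut the problem down to finitely many entries.
  Faithfulness of \<open>\<psi>\<close> has a separate use: it makes \<open>c\<close> invertible, so
  that the blocks \<open>T_kl\<close> are combinations of the maps \<open>R_s\<close>.\<close>

lemma sum_fun_apply: "(\<Sum>i\<in>I. F i) x = (\<Sum>i\<in>I. F i x)"
  by (induction I rule: infinite_finite_induct) auto

lemma ell2_iff: "f \<in> ell2 A \<longleftrightarrow> f \<in> ell2 UNIV \<and> (\<forall>i. i \<notin> A \<longrightarrow> f i = 0)"
proof -
  have "(\<lambda>i. (cmod (f i))\<^sup>2) summable_on A \<longleftrightarrow> (\<lambda>i. (cmod (f i))\<^sup>2) summable_on UNIV"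
    if "\<forall>i. i \<notin> A \<longrightarrow> f i = 0"
    by (rule summable_on_cong_neutral) (use that in auto)
  then show ?thesis
    by (auto simp: ell2_def)
qed

lemma ell2_UNIV: "f \<in> ell2 A \<Longrightarrow> f \<in> ell2 UNIV"
  by (simp add: ell2_iff[of f A])

lemma ell2_summable: "f \<in> ell2 A \<Longrightarrow> (\<lambda>i. (cmod (f i))\<^sup>2) summable_on UNIV"
  using ell2_UNIV by (auto simp: ell2_def)

lemma ell2_outside: "f \<in> ell2 A \<Longrightarrow> i \<notin> A \<Longrightarrow> f i = 0"
  by (auto simp: ell2_def)

lemma ell2_UNIV_I: "(\<lambda>i. (cmod (f i))\<^sup>2) summable_on UNIV \<Longrightarrow> f \<in> ell2 UNIV"
  by (simp add: ell2_def)

lemma ell2_zero [simp]: "0 \<in> ell2 A"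
  by (auto simp: ell2_def)

lemma ell2_scale [simp]: "f \<in> ell2 A \<Longrightarrow> vscale c f \<in> ell2 A"
  by (auto simp: ell2_def vscale_def norm_mult power_mult_distrib intro!: summable_on_cmult_right)

lemma ell2_add [simp]:
  assumes "f \<in> ell2 A" "g \<in> ell2 A"
  shows "f + g \<in> ell2 A"
proof -
  have *: "(cmod (f i + g i))\<^sup>2 \<le> 2 * (cmod (f i))\<^sup>2 + 2 * (cmod (g i))\<^sup>2" for i
  proof -
    have "(cmod (f i + g i))\<^sup>2 \<le> (cmod (f i) + cmod (g i))\<^sup>2"
      by (intro power_mono norm_triangle_ineq) auto
    also have "\<dots> \<le> 2 * (cmod (f i))\<^sup>2 + 2 * (cmod (g i))\<^sup>2"
      using sum_squares_bound[of "cmod (f i)" "cmod (g i)"] by (simp add: power2_sum)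
    finally show ?thesis .
  qed
  have "(\<lambda>i. (cmod (f i + g i))\<^sup>2) summable_on A"
  proof (rule summable_on_comparison_test)
    show "(\<lambda>i. 2 * (cmod (f i))\<^sup>2 + 2 * (cmod (g i))\<^sup>2) summable_on A"
      using assms by (intro summable_on_add summable_on_cmult_right) (auto simp: ell2_def)
  qed (use * in auto)
  then show ?thesis
    using assms by (auto simp: ell2_def)
qed

lemma vec_diff_eq: "f - g = f + vscale (-1) g"
  by (simp add: vscale_def fun_eq_iff)

lemma ell2_diff [simp]:
  assumes "f \<in> ell2 A" "g \<in> ell2 A"
  shows "f - g \<in> ell2 A"
  unfolding vec_diff_eq using assms by simp

lemma ell2_sum [simp]: "(\<And>i. i \<in> I \<Longrightarrow> f i \<in> ell2 A) \<Longrightarrow> (\<Sum>i\<in>I. f i) \<in> ell2 A"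
  by (induction I rule: infinite_finite_induct) auto

lemma ell2_finite_support:
  assumes "finite F" "\<And>i. i \<notin> F \<Longrightarrow> f i = 0" "F \<subseteq> A"
  shows "f \<in> ell2 A"
proof -
  have "(\<lambda>i. (cmod (f i))\<^sup>2) summable_on A \<longleftrightarrow> (\<lambda>i. (cmod (f i))\<^sup>2) summable_on F"
    by (rule summable_on_cong_neutral) (use assms in auto)
  then show ?thesis
    using assms by (auto simp: ell2_def)
qed

lemma ell2_ket [simp]: "i \<in> A \<Longrightarrow> ket i \<in> ell2 A"
  by (rule ell2_finite_support[of "{i}"]) (auto simp: ket_def)

section \<open>Inner product, norm and the Cauchy--Schwarz inequality\<close>

lemma ip_summable:
  assumes "f \<in> ell2 A" "g \<in> ell2 B"
  shows "(\<lambda>i. cnj (f i) * g i) summable_on UNIV"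
proof -
  have "(\<lambda>i. norm (cnj (f i) * g i)) summable_on UNIV"
  proof (rule summable_on_comparison_test)
    show "(\<lambda>i. (cmod (f i))\<^sup>2 + (cmod (g i))\<^sup>2) summable_on UNIV"
      using assms by (intro summable_on_add ell2_summable)
    show "norm (cnj (f i) * g i) \<le> (cmod (f i))\<^sup>2 + (cmod (g i))\<^sup>2" for i
    proof -
      have "2 * cmod (f i) * cmod (g i) \<le> (cmod (f i))\<^sup>2 + (cmod (g i))\<^sup>2"
        by (rule sum_squares_bound)
      moreover have "0 \<le> cmod (f i) * cmod (g i)"
        by simp
      ultimately have "cmod (f i) * cmod (g i) \<le> (cmod (f i))\<^sup>2 + (cmod (g i))\<^sup>2"
        by linarith
      then show ?thesis
        by (simp add: norm_mult)
    qed
  qed auto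
  then show ?thesis
    by (rule abs_summable_summable)
qed

lemma ip_add_right:
  "f \<in> ell2 A \<Longrightarrow> g \<in> ell2 B \<Longrightarrow> h \<in> ell2 B' \<Longrightarrow> ip f (g + h) = ip f g + ip f h"
  unfolding ip_def by (subst infsum_add[symmetric]) (auto intro: ip_summable simp: distrib_left)

lemma ip_scale_right [simp]: "ip f (vscale c g) = c * ip f g"
  unfolding ip_def vscale_def by (subst infsum_cmult_right'[symmetric]) (simp add: mult_ac)

lemma ip_cnj: "cnj (ip f g) = ip g f"
  unfolding ip_def by (subst infsum_cnj[symmetric]) (simp add: mult_ac)

lemma ip_add_left:
  "f \<in> ell2 A \<Longrightarrow> g \<in> ell2 B \<Longrightarrow> h \<in> ell2 B' \<Longrightarrow> ip (g + h) f = ip g f + ip h f"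
  using ip_add_right[of f A g B h B'] by (metis complex_cnj_add ip_cnj)

lemma ip_scale_left [simp]: "ip (vscale c g) f = cnj c * ip g f"
  using ip_scale_right[of f c g] by (metis complex_cnj_mult ip_cnj)

lemma ip_zero_right [simp]: "ip f 0 = 0"
  by (simp add: ip_def)

lemma ip_zero_left [simp]: "ip 0 f = 0"
  by (simp add: ip_def)

lemma ip_diff_right:
  assumes "f \<in> ell2 A" "g \<in> ell2 B" "h \<in> ell2 B'"
  shows "ip f (g - h) = ip f g - ip f h"
  unfolding vec_diff_eq using ip_add_right[OF assms(1,2) ell2_scale[OF assms(3)]] by simp

lemma ip_diff_left:
  "f \<in> ell2 A \<Longrightarrow> g \<in> ell2 B \<Longrightarrow> h \<in> ell2 B' \<Longrightarrow> ip (g - h) f = ip g f - ip h f"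
  using ip_diff_right[of f A g B h B'] by (metis complex_cnj_diff ip_cnj)

lemma ip_sum_right:
  "f \<in> ell2 A \<Longrightarrow> (\<And>i. i \<in> I \<Longrightarrow> g i \<in> ell2 B) \<Longrightarrow> ip f (\<Sum>i\<in>I. g i) = (\<Sum>i\<in>I. ip f (g i))"
proof (induction I rule: infinite_finite_induct)
  case (insert i I)
  have "ip f (g i + (\<Sum>i\<in>I. g i)) = ip f (g i) + ip f (\<Sum>i\<in>I. g i)"
    using insert.prems by (intro ip_add_right[where A = A and B = B and B' = B]) auto
  also have "ip f (\<Sum>i\<in>I. g i) = (\<Sum>i\<in>I. ip f (g i))"
    using insert by simp
  finally show ?case
    by (simp only: sum.insert[OF insert.hyps])
qed auto

lemma ip_sum_left:
  "f \<in> ell2 A \<Longrightarrow> (\<And>i. i \<in> I \<Longrightarrow> g i \<in> ell2 B) \<Longrightarrow> ip (\<Sum>i\<in>I. g i) f = (\<Sum>i\<in>I. ip (g i) f)"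
  using ip_sum_right[of f A I g B] by (metis (mono_tags, lifting) cnj_sum ip_cnj sum.cong)

lemma ip_ket_left [simp]: "ip (ket i) f = f i"
proof -
  have "ip (ket i) f = (\<Sum>\<^sub>\<infinity>j\<in>{i}. cnj (ket i j) * f j)"
    unfolding ip_def by (rule infsum_cong_neutral) (auto simp: ket_def)
  then show ?thesis
    by (simp add: ket_def)
qed

lemma ip_ket_right [simp]: "ip f (ket i) = cnj (f i)"
  using ip_cnj[of "ket i" f] by simp

lemma ell2_norm_ge_0 [simp]: "0 \<le> ell2_norm f"
  by (simp add: ell2_norm_def infsum_nonneg)

lemma ell2_norm_power2: "(ell2_norm f)\<^sup>2 = (\<Sum>\<^sub>\<infinity>i. (cmod (f i))\<^sup>2)"
  by (simp add: ell2_norm_def infsum_nonneg)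

lemma ip_self: "f \<in> ell2 A \<Longrightarrow> ip f f = of_real ((ell2_norm f)\<^sup>2)"
proof -
  assume "f \<in> ell2 A"
  have "((\<lambda>i. (cmod (f i))\<^sup>2) has_sum (ell2_norm f)\<^sup>2) UNIV"
    unfolding ell2_norm_power2 using ell2_summable[OF \<open>f \<in> ell2 A\<close>] by (rule has_sum_infsum)
  then have "((\<lambda>i. complex_of_real ((cmod (f i))\<^sup>2)) has_sum of_real ((ell2_norm f)\<^sup>2)) UNIV"
    by (rule has_sum_of_real)
  moreover have "complex_of_real ((cmod z)\<^sup>2) = cnj z * z" for z
    by (simp only: complex_norm_square mult.commute)
  ultimately show ?thesis
    unfolding ip_def by (simp add: infsumI)
qed

lemma ell2_norm_scale [simp]: "ell2_norm (vscale c f) = cmod c * ell2_norm f"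
proof -
  have "(\<Sum>\<^sub>\<infinity>i. (cmod (vscale c f i))\<^sup>2) = (cmod c)\<^sup>2 * (\<Sum>\<^sub>\<infinity>i. (cmod (f i))\<^sup>2)"
    by (subst infsum_cmult_right'[symmetric]) (simp add: vscale_def norm_mult power_mult_distrib)
  then show ?thesis
    by (simp add: ell2_norm_def real_sqrt_mult)
qed

lemma ell2_norm_zero [simp]: "ell2_norm 0 = 0"
  by (simp add: ell2_norm_def)

lemma ell2_norm_ket [simp]: "ell2_norm (ket i) = 1"
proof -
  have "complex_of_real ((ell2_norm (ket i))\<^sup>2) = of_real 1"
    using ip_self[OF ell2_ket[OF UNIV_I], of i] by (simp only: ip_ket_left) (simp add: ket_def)
  then have "(ell2_norm (ket i))\<^sup>2 = 1"
    by (simp only: of_real_eq_iff)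
  then show ?thesis
    using ell2_norm_ge_0[of "ket i"] by (auto simp: power2_eq_1_iff)
qed

lemma sum_le_ell2_norm:
  assumes "f \<in> ell2 A" "finite F"
  shows "(\<Sum>i\<in>F. (cmod (f i))\<^sup>2) \<le> (ell2_norm f)\<^sup>2"
  unfolding ell2_norm_power2
  by (rule finite_sum_le_infsum) (use assms in \<open>auto intro: ell2_summable\<close>)

lemma cmod_le_ell2_norm: "f \<in> ell2 A \<Longrightarrow> cmod (f i) \<le> ell2_norm f"
  using sum_le_ell2_norm[of f A "{i}"] by (simp add: power2_le_iff_abs_le)

lemma ell2_norm_eq_0: "f \<in> ell2 A \<Longrightarrow> ell2_norm f = 0 \<Longrightarrow> f = 0"
  using cmod_le_ell2_norm[of f A] by (simp add: fun_eq_iff)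

text \<open>The minimizer \<open>c = - cnj b / d\<close> gives the bound; for \<open>d = 0\<close>
  the expression is affine in \<open>c\<close>, hence unbounded below unless \<open>b = 0\<close>.
  It serves for the inner product, for states, for positive forms and, with \<open>a = 0\<close>,
  for orthogonality to a subspace.\<close>

lemma quadratic_Cauchy_Schwarz:
  fixes a d :: real and b :: complex
  assumes "\<And>c. 0 \<le> a + 2 * Re (c * b) + (cmod c)\<^sup>2 * d" and "0 \<le> d" "0 \<le> a"
  shows "(cmod b)\<^sup>2 \<le> a * d"
proof (cases "d = 0")
  case True
  show ?thesis
  proof (rule ccontr)
    assume "\<not> ?thesis"
    with True have b: "(cmod b)\<^sup>2 > 0"
      by simp
    \<comment> \<open>This \<open>c\<close> satisfies \<open>c * b = - (a + 1)\<close> and makes the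
      expression \<open>- a - 2\<close>.\<close>
    have "0 \<le> a + 2 * Re ((- of_real (a + 1) / of_real ((cmod b)\<^sup>2) * cnj b) * b)"
      using assms(1)[of "- of_real (a + 1) / of_real ((cmod b)\<^sup>2) * cnj b"] True by simp
    also have "(- of_real (a + 1) / of_real ((cmod b)\<^sup>2) * cnj b) * b = of_real (- (a + 1))"
    proof -
      have "cnj b * b = of_real ((cmod b)\<^sup>2)"
        by (simp only: complex_norm_square mult.commute)
      then show ?thesis
        using b by (simp add: mult.assoc)
    qed
    finally show False
      using assms(3) by simp
  qed
next
  case False
  with assms have d: "d > 0"
    by simp
  have cb: "cnj b * b = of_real ((cmod b)\<^sup>2)"
    by (simp only: complex_norm_square mult.commute)
  have "0 \<le> a + 2 * Re (- (cnj b / of_real d) * b) + (cmod (- (cnj b / of_real d)))\<^sup>2 * d"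
    by (rule assms(1))
  also have "- (cnj b / of_real d) * b = of_real (- ((cmod b)\<^sup>2 / d))"
    using cb by simp
  also have "(cmod (- (cnj b / of_real d)))\<^sup>2 * d = (cmod b)\<^sup>2 / d"
    using d by (simp add: norm_divide power_divide power2_eq_square)
  finally have "(cmod b)\<^sup>2 / d \<le> a"
    by simp
  then show ?thesis
    using d by (simp add: field_simps)
qed

lemma ell2_norm_add_scale:
  assumes "f \<in> ell2 A" "g \<in> ell2 B"
  shows "(ell2_norm (f + vscale c g))\<^sup>2 =
    (ell2_norm f)\<^sup>2 + 2 * Re (c * ip f g) + (cmod c)\<^sup>2 * (ell2_norm g)\<^sup>2"
proof -
  have f: "f \<in> ell2 UNIV" and g: "g \<in> ell2 UNIV"
    using assms ell2_UNIV by auto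
  have "ip (f + vscale c g) (f + vscale c g) =
      ip f f + (c * ip f g + cnj (c * ip f g)) + (cnj c * c) * ip g g"
    using f g by (simp add: ip_add_left[of _ UNIV _ UNIV _ UNIV] ip_add_right[of _ UNIV _ UNIV _ UNIV]
        algebra_simps ip_cnj[of f g])
  also have "cnj c * c = of_real ((cmod c)\<^sup>2)"
    by (simp only: complex_norm_square mult.commute)
  also have "c * ip f g + cnj (c * ip f g) = of_real (2 * Re (c * ip f g))"
    by (rule complex_add_cnj)
  finally have "complex_of_real ((ell2_norm (f + vscale c g))\<^sup>2) =
      of_real ((ell2_norm f)\<^sup>2 + 2 * Re (c * ip f g) + (cmod c)\<^sup>2 * (ell2_norm g)\<^sup>2)"
    using ip_self[of f UNIV] ip_self[of g UNIV] ip_self[of "f + vscale c g" UNIV] f g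
    by (simp only: ell2_add ell2_scale of_real_add of_real_mult)
  then show ?thesis
    using of_real_eq_iff by blast
qed

lemma ip_Cauchy_Schwarz:
  assumes "f \<in> ell2 A" "g \<in> ell2 B"
  shows "cmod (ip f g) \<le> ell2_norm f * ell2_norm g"
proof -
  have "(cmod (ip f g))\<^sup>2 \<le> (ell2_norm f)\<^sup>2 * (ell2_norm g)\<^sup>2"
    using ell2_norm_add_scale[OF assms]
    by (intro quadratic_Cauchy_Schwarz) (metis zero_le_power2, simp_all)
  then have "(cmod (ip f g))\<^sup>2 \<le> (ell2_norm f * ell2_norm g)\<^sup>2"
    by (simp add: power_mult_distrib)
  then show ?thesis
    by (rule power2_le_imp_le) simp
qed

lemma ell2_norm_triangle:
  assumes "f \<in> ell2 A" "g \<in> ell2 B"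
  shows "ell2_norm (f + g) \<le> ell2_norm f + ell2_norm g"
proof -
  have f: "f \<in> ell2 UNIV" and g: "g \<in> ell2 UNIV"
    using assms ell2_UNIV by auto
  have "ip (f + g) (f + g) = ip f f + ip g g + (ip f g + cnj (ip f g))"
    using f g by (simp add: ip_add_left[of _ UNIV _ UNIV _ UNIV] ip_add_right[of _ UNIV _ UNIV _ UNIV]
          algebra_simps ip_cnj[of f g])
  then have "(ell2_norm (f + g))\<^sup>2 = (ell2_norm f)\<^sup>2 + (ell2_norm g)\<^sup>2 + 2 * Re (ip f g)"
    using ip_self[of f UNIV] ip_self[of g UNIV] ip_self[of "f + g" UNIV] f g
    by (simp only: ell2_add complex_add_cnj flip: of_real_add of_real_eq_iff[where 'a = complex])
  moreover have "Re (ip f g) \<le> ell2_norm f * ell2_norm g"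
    using ip_Cauchy_Schwarz[OF assms] complex_Re_le_cmod order_trans by blast
  ultimately have "(ell2_norm (f + g))\<^sup>2 \<le> (ell2_norm f + ell2_norm g)\<^sup>2"
    by (simp add: power2_sum)
  then show ?thesis
    by (rule power2_le_imp_le) simp
qed

lemma ell2_norm_minus_commute: "ell2_norm (f - g) = ell2_norm (g - f)"
  by (simp add: ell2_norm_def norm_minus_commute)

lemma ell2_norm_triangle_diff:
  assumes "f \<in> ell2 A" "g \<in> ell2 B"
  shows "ell2_norm (f - g) \<le> ell2_norm f + ell2_norm g"
  unfolding vec_diff_eq using ell2_norm_triangle[OF assms(1) ell2_scale[OF assms(2), of "-1"]] by simp

section \<open>Truncation, approximation and completeness\<close>

definition trunc :: "'i set \<Rightarrow> 'i vec \<Rightarrow> 'i vec" where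
  "trunc F f = (\<lambda>i. if i \<in> F then f i else 0)"

lemma trunc_eq_sum: "finite F \<Longrightarrow> trunc F f = (\<Sum>i\<in>F. vscale (f i) (ket i))"
  by (auto simp: fun_eq_iff trunc_def sum_fun_apply vscale_def ket_def if_distrib cong: if_cong)

lemma trunc_ell2: "f \<in> ell2 A \<Longrightarrow> trunc F f \<in> ell2 A"
  unfolding ell2_def trunc_def
  by (auto intro: summable_on_comparison_test[where f = "\<lambda>i. (cmod (f i))\<^sup>2"])

lemma ell2_norm_trunc_finite: "finite F \<Longrightarrow> (ell2_norm (trunc F f))\<^sup>2 = (\<Sum>i\<in>F. (cmod (f i))\<^sup>2)"
proof -
  assume "finite F"
  have "(\<Sum>\<^sub>\<infinity>i. (cmod (trunc F f i))\<^sup>2) = (\<Sum>\<^sub>\<infinity>i\<in>F. (cmod (f i))\<^sup>2)"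
    by (rule infsum_cong_neutral) (auto simp: trunc_def)
  then show ?thesis
    using \<open>finite F\<close> by (simp add: ell2_norm_power2)
qed

lemma ell2_norm_trunc_split:
  assumes "f \<in> ell2 A"
  shows "(ell2_norm f)\<^sup>2 = (ell2_norm (trunc F f))\<^sup>2 + (ell2_norm (f - trunc F f))\<^sup>2"
  unfolding ell2_norm_power2
proof (subst infsum_add[symmetric])
  show "(\<lambda>i. (cmod (trunc F f i))\<^sup>2) summable_on UNIV" "(\<lambda>i. (cmod ((f - trunc F f) i))\<^sup>2) summable_on UNIV"
    using ell2_summable[OF trunc_ell2[OF assms]] ell2_summable[OF ell2_diff[OF assms trunc_ell2[OF assms]]] .
qed (auto simp: trunc_def intro!: infsum_cong)

text \<open>By Pythagoras the squared tail is the part of the sum that \<open>G\<close> misses. The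
  bound is claimed for every larger \<open>G\<close> so that it can be applied to initial segments
  of the natural numbers.\<close>

lemma ell2_approx:
  assumes "f \<in> ell2 A" "e > 0"
  obtains F where "finite F" "F \<subseteq> A"
    "\<And>G. finite G \<Longrightarrow> F \<subseteq> G \<Longrightarrow> ell2_norm (f - trunc G f) \<le> e"
proof -
  obtain F where F: "finite F" "dist (\<Sum>i\<in>F. (cmod (f i))\<^sup>2) (\<Sum>\<^sub>\<infinity>i. (cmod (f i))\<^sup>2) \<le> e\<^sup>2"
    using infsum_finite_approximation[OF ell2_summable[OF assms(1)], of "e\<^sup>2"] assms(2) by auto
  have "ell2_norm (f - trunc G f) \<le> e" if "finite G" "F \<inter> A \<subseteq> G" for G
  proof -
    have "(\<Sum>i\<in>F. (cmod (f i))\<^sup>2) = (\<Sum>i\<in>F \<inter> A. (cmod (f i))\<^sup>2)"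
      using F(1) assms(1) by (intro sum.mono_neutral_right) (auto simp: ell2_outside)
    also have "\<dots> \<le> (\<Sum>i\<in>G. (cmod (f i))\<^sup>2)"
      using that by (intro sum_mono2) auto
    finally have "(ell2_norm f)\<^sup>2 - (ell2_norm (trunc G f))\<^sup>2 \<le> e\<^sup>2"
      using F(2) that(1) by (simp add: dist_real_def ell2_norm_power2[symmetric] ell2_norm_trunc_finite)
    then have "(ell2_norm (f - trunc G f))\<^sup>2 \<le> e\<^sup>2"
      using ell2_norm_trunc_split[OF assms(1), of G] by simp
    then show ?thesis
      using assms(2) by (simp add: power2_le_iff_abs_le)
  qed
  then show thesis
    using that[of "F \<inter> A"] F(1) by auto
qed

text \<open>Vectors that are given by their coordinates, such as adjoints or limits, enter
  \<open>ell2\<close> through bounds on finite partial sums.\<close>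

lemma ell2_bounded_sums:
  assumes "\<And>F. finite F \<Longrightarrow> (\<Sum>i\<in>F. (cmod (f i))\<^sup>2) \<le> C\<^sup>2" "\<And>i. i \<notin> A \<Longrightarrow> f i = 0" "0 \<le> C"
  shows "f \<in> ell2 A" and "ell2_norm f \<le> C"
proof -
  have s: "(\<lambda>i. (cmod (f i))\<^sup>2) summable_on UNIV"
    using assms(1) by (intro nonneg_bdd_above_summable_on bdd_aboveI[where M = "C\<^sup>2"]) auto
  then show "f \<in> ell2 A"
    using assms(2) by (simp add: ell2_iff[of f A] ell2_UNIV_I)
  have "(ell2_norm f)\<^sup>2 \<le> C\<^sup>2"
    unfolding ell2_norm_power2 using s assms(1) by (intro infsum_le_finite_sums) auto
  then show "ell2_norm f \<le> C"
    using assms(3) by (simp add: power2_le_iff_abs_le)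
qed

text \<open>The candidate is the coordinatewise limit. A bound on finite partial sums of
  \<open>X n - X m\<close> survives \<open>m \<rightarrow> \<infinity>\<close>, which gives
  membership and norm convergence at once.\<close>

lemma ell2_complete:
  assumes X: "\<And>n. X n \<in> ell2 A"
    and C: "\<And>e. e > 0 \<Longrightarrow> \<exists>N. \<forall>m\<ge>N. \<forall>n\<ge>N. ell2_norm (X m - X n) \<le> e"
  obtains l where "l \<in> ell2 A" "(\<lambda>n. ell2_norm (X n - l)) \<longlonglongrightarrow> 0"
proof -
  have "Cauchy (\<lambda>n. X n i)" for i
  proof (rule metric_CauchyI)
    fix e :: real assume "e > 0"
    then obtain N where N: "\<forall>m\<ge>N. \<forall>n\<ge>N. ell2_norm (X m - X n) \<le> e / 2"
      using C[of "e / 2"] by auto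
    have "dist (X m i) (X n i) < e" if "m \<ge> N" "n \<ge> N" for m n
    proof -
      have "cmod ((X m - X n) i) \<le> e / 2"
        using cmod_le_ell2_norm[OF ell2_diff[OF X X], of m n i] N that by force
      then show ?thesis
        using \<open>e > 0\<close> by (simp add: dist_norm)
    qed
    then show "\<exists>N. \<forall>m\<ge>N. \<forall>n\<ge>N. dist (X m i) (X n i) < e"
      by blast
  qed
  then have "\<forall>i. \<exists>l. (\<lambda>n. X n i) \<longlonglongrightarrow> l"
    by (simp add: Cauchy_convergent_iff convergent_def)
  then obtain l where l: "\<And>i. (\<lambda>n. X n i) \<longlonglongrightarrow> l i"
    using choice[of "\<lambda>i l. (\<lambda>n. X n i) \<longlonglongrightarrow> l"] by blast
  have out: "l i = 0" if "i \<notin> A" for i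
    using l[of i] ell2_outside[OF X that] by (simp add: LIMSEQ_const_iff)
  have bd: "X n - l \<in> ell2 A \<and> ell2_norm (X n - l) \<le> e"
    if e: "e > 0" and N: "\<forall>m\<ge>N. ell2_norm (X n - X m) \<le> e" for e n N
  proof -
    have "(\<Sum>i\<in>F. (cmod ((X n - l) i))\<^sup>2) \<le> e\<^sup>2" if "finite F" for F
    proof (rule LIMSEQ_le_const2)
      show "(\<lambda>m. \<Sum>i\<in>F. (cmod ((X n - X m) i))\<^sup>2) \<longlonglongrightarrow> (\<Sum>i\<in>F. (cmod ((X n - l) i))\<^sup>2)"
        by (auto intro!: tendsto_intros l)
      show "\<exists>N. \<forall>m\<ge>N. (\<Sum>i\<in>F. (cmod ((X n - X m) i))\<^sup>2) \<le> e\<^sup>2"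
      proof (intro exI allI impI)
        fix m assume "m \<ge> N"
        then have "(ell2_norm (X n - X m))\<^sup>2 \<le> e\<^sup>2"
          using N by (intro power_mono) auto
        then show "(\<Sum>i\<in>F. (cmod ((X n - X m) i))\<^sup>2) \<le> e\<^sup>2"
          by (rule order_trans[OF sum_le_ell2_norm[OF ell2_diff[OF X X] that]])
      qed
    qed
    moreover have "(X n - l) i = 0" if "i \<notin> A" for i
      using out[OF that] ell2_outside[OF X that] by simp
    ultimately show ?thesis
      using ell2_bounded_sums[of "X n - l" e A] e by auto
  qed
  obtain N where "\<forall>m\<ge>N. \<forall>n\<ge>N. ell2_norm (X m - X n) \<le> 1"
    using C[of 1] by auto
  then have "X N - l \<in> ell2 A"
    using bd[of 1 N N] by auto
  then have "X N - (X N - l) \<in> ell2 A"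
    by (rule ell2_diff[OF X])
  moreover have "X N - (X N - l) = l"
    by (simp add: fun_eq_iff)
  ultimately have "l \<in> ell2 A"
    by (simp only:)
  moreover have "(\<lambda>n. ell2_norm (X n - l)) \<longlonglongrightarrow> 0"
  proof (rule LIMSEQ_I)
    fix r :: real assume "r > 0"
    then obtain N where N: "\<forall>m\<ge>N. \<forall>n\<ge>N. ell2_norm (X m - X n) \<le> r / 2"
      using C[of "r / 2"] by auto
    have "ell2_norm (X n - l) \<le> r / 2" if "n \<ge> N" for n
      using bd[of "r / 2" N n] N that \<open>r > 0\<close> by simp
    then have "norm (ell2_norm (X n - l) - 0) < r" if "n \<ge> N" for n
      using that \<open>r > 0\<close> by force
    then show "\<exists>N. \<forall>n\<ge>N. norm (ell2_norm (X n - l) - 0) < r"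
      by blast
  qed
  ultimately show thesis
    using that by blast
qed

subsection \<open>Bounded operators\<close>

text \<open>Operators are functions whose values are functions, so unrestricted pointwise rules
  would rewrite an operator sum down to coordinates. \<open>op_apply\<close> stops at vectors;
  \<open>pointwise\<close> goes further on demand.\<close>

declare plus_fun_apply [simp del] zero_fun_apply [simp del] minus_apply [simp del]

lemma vscale_apply: "vscale c f i = c * f i"
  by (simp add: vscale_def)

lemma op_apply [simp]:
  fixes S T :: "'i op"
  shows "(S + T) f = S f + T f" "(S - T) f = S f - T f" "(0 :: 'i op) f = 0"
  by (simp_all add: plus_fun_apply minus_apply zero_fun_apply)

lemma op_sum_apply:
  fixes T :: "'j \<Rightarrow> 'i op"
  shows "(\<Sum>i\<in>I. T i) f = (\<Sum>i\<in>I. T i f)"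
  by (rule sum_fun_apply)

lemmas pointwise = plus_fun_apply zero_fun_apply minus_apply vscale_apply

lemma bopI:
  assumes "\<And>f. f \<in> ell2 A \<Longrightarrow> T f \<in> ell2 A"
    and "\<And>f g. f \<in> ell2 A \<Longrightarrow> g \<in> ell2 A \<Longrightarrow> T (f + g) = T f + T g"
    and "\<And>c f. f \<in> ell2 A \<Longrightarrow> T (vscale c f) = vscale c (T f)"
    and "\<And>f. f \<in> ell2 A \<Longrightarrow> ell2_norm (T f) \<le> C * ell2_norm f"
    and "\<And>f. f \<notin> ell2 A \<Longrightarrow> T f = 0"
  shows "T \<in> bop A"
  using assms unfolding bop_def clinear_map_on_def by blast

lemma bop_outside: "T \<in> bop A \<Longrightarrow> f \<notin> ell2 A \<Longrightarrow> T f = 0"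
  by (simp add: bop_def)

lemma bop_ell2 [simp]: "T \<in> bop A \<Longrightarrow> T f \<in> ell2 A"
  by (cases "f \<in> ell2 A") (simp_all add: bop_def)

lemma bop_add: "T \<in> bop A \<Longrightarrow> f \<in> ell2 A \<Longrightarrow> g \<in> ell2 A \<Longrightarrow> T (f + g) = T f + T g"
  unfolding bop_def clinear_map_on_def by blast

lemma bop_scale: "T \<in> bop A \<Longrightarrow> f \<in> ell2 A \<Longrightarrow> T (vscale c f) = vscale c (T f)"
  unfolding bop_def clinear_map_on_def by blast

lemma vscale_0 [simp]: "vscale 0 f = 0" "vscale c 0 = 0"
  by (simp_all add: vscale_def fun_eq_iff pointwise)

lemma vscale_1 [simp]: "vscale 1 f = f"
  by (simp add: vscale_def)

lemma bop_0: "T \<in> bop A \<Longrightarrow> T 0 = 0"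
  using bop_scale[of T A 0 0] by simp

lemma bop_diff: "T \<in> bop A \<Longrightarrow> f \<in> ell2 A \<Longrightarrow> g \<in> ell2 A \<Longrightarrow> T (f - g) = T f - T g"
  unfolding vec_diff_eq by (simp only: bop_add bop_scale ell2_scale)

lemma bop_sum:
  assumes "T \<in> bop A" "\<And>i. i \<in> I \<Longrightarrow> f i \<in> ell2 A"
  shows "T (\<Sum>i\<in>I. f i) = (\<Sum>i\<in>I. T (f i))"
  using assms(2)
proof (induction I rule: infinite_finite_induct)
  case (insert i I)
  have "T (f i + (\<Sum>i\<in>I. f i)) = T (f i) + T (\<Sum>i\<in>I. f i)"
    using insert.prems by (intro bop_add[OF assms(1)]) auto
  also have "T (\<Sum>i\<in>I. f i) = (\<Sum>i\<in>I. T (f i))"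
    using insert by simp
  finally show ?case
    by (simp only: sum.insert[OF insert.hyps])
qed (auto simp: bop_0[OF assms(1)])

lemma bop_bound:
  assumes "T \<in> bop A"
  obtains C where "0 \<le> C" "\<And>f. ell2_norm (T f) \<le> C * ell2_norm f"
proof -
  obtain C where C: "\<And>f. f \<in> ell2 A \<Longrightarrow> ell2_norm (T f) \<le> C * ell2_norm f"
    using assms unfolding bop_def by blast
  have "ell2_norm (T f) \<le> \<bar>C\<bar> * ell2_norm f" for f
  proof (cases "f \<in> ell2 A")
    case True
    have "C * ell2_norm f \<le> \<bar>C\<bar> * ell2_norm f"
      by (rule mult_right_mono) auto
    then show ?thesis
      using C[OF True] by linarith
  qed (simp add: bop_outside[OF assms])
  then show thesis
    using that[of "\<bar>C\<bar>"] by simp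
qed

lemma bop_zero [simp]: "0 \<in> bop A"
  by (rule bopI[where C = 0]) auto

lemma bop_id [simp]: "id_op A \<in> bop A"
  by (rule bopI[where C = 1]) (auto simp: id_op_def)

lemma bop_plus [simp]:
  assumes "S \<in> bop A" "T \<in> bop A"
  shows "S + T \<in> bop A"
proof -
  obtain C where C: "\<And>f. ell2_norm (S f) \<le> C * ell2_norm f"
    using bop_bound[OF assms(1)] by blast
  obtain D where D: "\<And>f. ell2_norm (T f) \<le> D * ell2_norm f"
    using bop_bound[OF assms(2)] by blast
  show ?thesis
  proof (rule bopI[where C = "C + D"])
    fix f assume f: "f \<in> ell2 A"
    have "ell2_norm ((S + T) f) \<le> ell2_norm (S f) + ell2_norm (T f)"
      using ell2_norm_triangle[OF bop_ell2[OF assms(1)] bop_ell2[OF assms(2)]] by simp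
    then show "ell2_norm ((S + T) f) \<le> (C + D) * ell2_norm f"
      using C[of f] D[of f] by (simp add: distrib_right)
  qed (use assms in \<open>auto simp: bop_add bop_scale bop_outside fun_eq_iff pointwise distrib_left\<close>)
qed

lemma bop_oscale [simp]:
  assumes "T \<in> bop A"
  shows "oscale c T \<in> bop A"
proof -
  obtain D where D: "\<And>f. ell2_norm (T f) \<le> D * ell2_norm f"
    using bop_bound[OF assms] by blast
  show ?thesis
  proof (rule bopI[where C = "cmod c * D"])
    fix f assume f: "f \<in> ell2 A"
    show "ell2_norm (oscale c T f) \<le> (cmod c * D) * ell2_norm f"
      using mult_left_mono[OF D[of f], of "cmod c"] by (simp add: oscale_def mult_ac)
  qed (use assms in \<open>auto simp: oscale_def bop_add bop_scale bop_outside fun_eq_iff pointwise distrib_left\<close>)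
qed

lemma op_diff_eq: "S - T = S + oscale (-1) T"
  by (simp add: oscale_def fun_eq_iff pointwise)

lemma bop_minus [simp]: "S \<in> bop A \<Longrightarrow> T \<in> bop A \<Longrightarrow> S - T \<in> bop A"
  unfolding op_diff_eq by simp

lemma bop_sum_ops [simp]: "(\<And>i. i \<in> I \<Longrightarrow> T i \<in> bop A) \<Longrightarrow> (\<Sum>i\<in>I. T i) \<in> bop A"
proof (induction I rule: infinite_finite_induct)
  case (insert i I)
  then have "T i + (\<Sum>i\<in>I. T i) \<in> bop A"
    by (intro bop_plus) auto
  then show ?case
    by (simp only: sum.insert[OF insert.hyps])
qed auto

lemma bop_comp [simp]:
  assumes "S \<in> bop A" "T \<in> bop A"
  shows "S \<circ> T \<in> bop A"
proof -
  obtain C where C: "0 \<le> C" "\<And>f. ell2_norm (S f) \<le> C * ell2_norm f"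
    using bop_bound[OF assms(1)] by blast
  obtain D where D: "\<And>f. ell2_norm (T f) \<le> D * ell2_norm f"
    using bop_bound[OF assms(2)] by blast
  show ?thesis
  proof (rule bopI[where C = "C * D"])
    fix f assume f: "f \<in> ell2 A"
    show "ell2_norm ((S \<circ> T) f) \<le> (C * D) * ell2_norm f"
      using C(2)[of "T f"] mult_left_mono[OF D[of f] C(1)] by (simp add: mult_ac)
  qed (use assms in \<open>auto simp: bop_add bop_scale bop_outside bop_0\<close>)
qed

lemma id_op_apply [simp]: "f \<in> ell2 A \<Longrightarrow> id_op A f = f"
  by (simp add: id_op_def)

lemma id_op_comp [simp]: "T \<in> bop A \<Longrightarrow> id_op A \<circ> T = T"
  by (simp add: fun_eq_iff pointwise)

lemma comp_id_op [simp]: "T \<in> bop A \<Longrightarrow> T \<circ> id_op A = T"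
  by (rule ext) (simp add: id_op_def bop_outside bop_0)

lemma oscale_apply [simp]: "oscale c T f = vscale c (T f)"
  by (simp add: oscale_def)

lemma oscale_comp: "oscale c S \<circ> T = oscale c (S \<circ> T)"
  by (rule ext) simp

lemma comp_oscale: "S \<in> bop A \<Longrightarrow> T \<in> bop A \<Longrightarrow> S \<circ> oscale c T = oscale c (S \<circ> T)"
  by (rule ext) (simp add: bop_scale)

lemma plus_comp: "(S + S') \<circ> T = (S \<circ> T) + (S' \<circ> T)"
  for S S' T :: "'i op"
  by (rule ext) simp

lemma comp_plus: "S \<in> bop A \<Longrightarrow> T \<in> bop A \<Longrightarrow> T' \<in> bop A \<Longrightarrow> S \<circ> (T + T') = (S \<circ> T) + (S \<circ> T')"
  by (rule ext) (simp add: bop_add)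

lemma comp_minus: "S \<in> bop A \<Longrightarrow> T \<in> bop A \<Longrightarrow> T' \<in> bop A \<Longrightarrow> S \<circ> (T - T') = (S \<circ> T) - (S \<circ> T')"
  by (rule ext) (simp add: bop_diff)

lemma sum_comp: "(\<Sum>i\<in>I. S i) \<circ> T = (\<Sum>i\<in>I. S i \<circ> T)"
  for T :: "'i op" and S :: "'j \<Rightarrow> 'i op"
  by (rule ext) (simp add: op_sum_apply)

lemma comp_sum: "S \<in> bop A \<Longrightarrow> (\<And>i. i \<in> I \<Longrightarrow> T i \<in> bop A) \<Longrightarrow> S \<circ> (\<Sum>i\<in>I. T i) = (\<Sum>i\<in>I. S \<circ> T i)"
  by (rule ext) (simp add: op_sum_apply bop_sum)

lemma trunc_ip_expand:
  assumes "T \<in> bop A" "finite F" "F \<subseteq> A"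
  shows "T (trunc F f) = (\<Sum>i\<in>F. vscale (f i) (T (ket i)))"
proof -
  have "T (trunc F f) = (\<Sum>i\<in>F. T (vscale (f i) (ket i)))"
    unfolding trunc_eq_sum[OF assms(2)] using assms by (intro bop_sum) auto
  also have "\<dots> = (\<Sum>i\<in>F. vscale (f i) (T (ket i)))"
    using assms by (intro sum.cong) (auto intro!: bop_scale)
  finally show ?thesis .
qed

text \<open>Finitely supported vectors are dense, and the bound carries the value \<open>0\<close>
  from them to \<open>f\<close>. Matrix entries of operators, the adjoint and the density of a state
  are all identified this way.\<close>

lemma functional_zero:
  assumes add: "\<And>f g. f \<in> ell2 A \<Longrightarrow> g \<in> ell2 A \<Longrightarrow> L (f + g) = L f + (L g :: complex)"
    and scale: "\<And>c f. f \<in> ell2 A \<Longrightarrow> L (vscale c f) = c * L f"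
    and bound: "\<And>f. f \<in> ell2 A \<Longrightarrow> cmod (L f) \<le> C * ell2_norm f"
    and ket: "\<And>i. i \<in> A \<Longrightarrow> L (ket i) = 0"
    and f: "f \<in> ell2 A"
  shows "L f = 0"
proof -
  have fin: "L (\<Sum>i\<in>F. vscale (f i) (ket i)) = 0" if "finite F" "F \<subseteq> A" for F
    using that
  proof (induction F rule: finite_induct)
    case empty
    show ?case
      using scale[OF ell2_zero, of 0] by simp
  next
    case (insert i F)
    have "L (vscale (f i) (ket i) + (\<Sum>i\<in>F. vscale (f i) (ket i))) =
        L (vscale (f i) (ket i)) + L (\<Sum>i\<in>F. vscale (f i) (ket i))"
      using insert.prems by (intro add ell2_sum ell2_scale ell2_ket) auto
    also have "\<dots> = 0"
      using insert by (simp add: scale ket)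
    finally show ?case
      by (simp only: sum.insert[OF insert.hyps])
  qed
  have "cmod (L f) \<le> e" if "e > 0" for e
  proof -
    \<comment> \<open>The constant \<open>C\<close> may be zero or negative;
      \<open>\<bar>C\<bar> + 1\<close> is a positive substitute.\<close>
    have e': "e / (\<bar>C\<bar> + 1) > 0"
      using that by simp
    obtain F where F: "finite F" "F \<subseteq> A" "ell2_norm (f - trunc F f) \<le> e / (\<bar>C\<bar> + 1)"
      using ell2_approx[OF f e'] by (metis order_refl)
    have "L f = L (f - trunc F f) + L (trunc F f)"
      using add[of "f - trunc F f" "trunc F f"] f by (simp add: trunc_ell2)
    also have "L (trunc F f) = 0"
      using fin[OF F(1,2)] by (simp add: trunc_eq_sum[OF F(1)])
    finally have "cmod (L f) \<le> C * ell2_norm (f - trunc F f)"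
      using bound[of "f - trunc F f"] f by (simp add: trunc_ell2)
    also have "\<dots> \<le> (\<bar>C\<bar> + 1) * (e / (\<bar>C\<bar> + 1))"
      using F(3) by (intro mult_mono) auto
    also have "\<dots> = e"
      using that by (simp add: field_simps add_pos_nonneg)
    finally show ?thesis .
  qed
  then have "cmod (L f) \<le> 0"
    by (rule field_le_epsilon[of _ 0, simplified])
  then show ?thesis
    by simp
qed

lemma op_eqI:
  assumes "S \<in> bop A" "T \<in> bop A" "\<And>i j. i \<in> A \<Longrightarrow> j \<in> A \<Longrightarrow> S (ket j) i = T (ket j) i"
  shows "S = T"
proof
  fix f
  show "S f = T f"
  proof (cases "f \<in> ell2 A")
    case True
    have "(S - T) f i = 0" if "i \<in> A" for i
    proof -
      obtain C where C: "\<And>f. ell2_norm ((S - T) f) \<le> C * ell2_norm f"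
        using bop_bound[OF bop_minus[OF assms(1,2)]] by blast
      show ?thesis
      proof (rule functional_zero[where A = A and L = "\<lambda>f. (S - T) f i" and C = C])
        fix f
        show "cmod ((S - T) f i) \<le> C * ell2_norm f"
          using C[of f] cmod_le_ell2_norm[OF bop_ell2[OF bop_minus[OF assms(1,2)]], of f i] by linarith
      qed (use assms that True in \<open>auto simp: bop_add bop_scale pointwise algebra_simps\<close>)
    qed
    moreover have "(S - T) f i = 0" if "i \<notin> A" for i
      using ell2_outside[OF bop_ell2[OF bop_minus[OF assms(1,2)]] that] .
    ultimately have "(S - T) f i = 0" for i
      by blast
    then show ?thesis
      by (simp add: fun_eq_iff pointwise)
  next
    case False
    then show ?thesis
      using assms by (simp add: bop_outside)
  qed
qed

section \<open>Adjoints\<close>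

lemma mult_self_le_cancel: "n * n \<le> c * n \<Longrightarrow> 0 \<le> n \<Longrightarrow> 0 \<le> c \<Longrightarrow> n \<le> (c :: real)"
  by (cases "n = 0") (auto simp: mult_le_cancel_right)

text \<open>The coordinates of the adjoint vector are forced to be \<open>ip (T (ket i)) f\<close>.
  Pairing a finite truncation of this family with itself gives
  \<open>n\<^sup>2 \<le> C * ell2_norm f * n\<close> for its norm \<open>n\<close>, hence a bound
  independent of the truncation.\<close>

lemma adj_exists:
  assumes T: "T \<in> bop A"
  obtains S where "S \<in> bop A" "\<And>f g. f \<in> ell2 A \<Longrightarrow> g \<in> ell2 A \<Longrightarrow> ip f (T g) = ip (S f) g"
proof -
  obtain C where C: "0 \<le> C" "\<And>f. ell2_norm (T f) \<le> C * ell2_norm f"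
    using bop_bound[OF assms] by blast
  define S where "S f = (\<lambda>i. if f \<in> ell2 A \<and> i \<in> A then ip (T (ket i)) f else 0)" for f
  have bd: "S f \<in> ell2 A \<and> ell2_norm (S f) \<le> C * ell2_norm f" if f: "f \<in> ell2 A" for f
  proof -
    have "(\<Sum>i\<in>F. (cmod (S f i))\<^sup>2) \<le> (C * ell2_norm f)\<^sup>2" if F: "finite F" for F
    proof -
      define n where "n = ell2_norm (trunc (F \<inter> A) (S f))"
      have n2: "n\<^sup>2 = (\<Sum>i\<in>F. (cmod (S f i))\<^sup>2)"
        using F by (simp add: n_def ell2_norm_trunc_finite) (intro sum.mono_neutral_left, auto simp: S_def)
      have "complex_of_real (n\<^sup>2) = ip f (T (trunc (F \<inter> A) (S f)))"
      proof -
        have "ip f (T (trunc (F \<inter> A) (S f))) = (\<Sum>i\<in>F \<inter> A. S f i * ip f (T (ket i)))"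
          using F f T by (simp add: trunc_ip_expand[OF T] ip_sum_right[OF f, where B = A])
        also have "\<dots> = (\<Sum>i\<in>F \<inter> A. complex_of_real ((cmod (S f i))\<^sup>2))"
          using f by (intro sum.cong) (auto simp: S_def complex_norm_square ip_cnj simp del: of_real_power)
        also have "\<dots> = complex_of_real (n\<^sup>2)"
          using F by (simp add: n_def ell2_norm_trunc_finite)
        finally show ?thesis ..
      qed
      then have "n\<^sup>2 = cmod (ip f (T (trunc (F \<inter> A) (S f))))"
        by (metis norm_of_real abs_power2)
      also have "\<dots> \<le> ell2_norm f * (C * n)"
        using ip_Cauchy_Schwarz[OF f bop_ell2[OF T]] C(2)[of "trunc (F \<inter> A) (S f)"]
        unfolding n_def by (meson ell2_norm_ge_0 mult_left_mono order_trans)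
      finally have "n * n \<le> (C * ell2_norm f) * n"
        by (simp add: power2_eq_square mult_ac)
      then have "n \<le> C * ell2_norm f"
        by (rule mult_self_le_cancel) (use C(1) in \<open>simp_all add: n_def\<close>)
      then have "n\<^sup>2 \<le> (C * ell2_norm f)\<^sup>2"
        by (intro power_mono) (auto simp: n_def)
      then show ?thesis
        by (simp add: n2)
    qed
    then show ?thesis
      using ell2_bounded_sums[of "S f" "C * ell2_norm f" A] C(1) by (auto simp: S_def)
  qed
  have S: "S \<in> bop A"
  proof (rule bopI[where C = C])
    show "S (f + g) = S f + S g" if "f \<in> ell2 A" "g \<in> ell2 A" for f g
      using that T by (auto simp: S_def fun_eq_iff pointwise ip_add_right[OF bop_ell2[OF T]])
  qed (use bd in \<open>auto simp: S_def fun_eq_iff pointwise\<close>)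
  moreover have "ip f (T g) = ip (S f) g" if f: "f \<in> ell2 A" and g: "g \<in> ell2 A" for f g
  proof -
    have "ip f (T g) - ip (S f) g = 0"
    proof (rule functional_zero[where A = A and L = "\<lambda>g. ip f (T g) - ip (S f) g"
          and C = "ell2_norm f * C + ell2_norm (S f)"])
      fix g assume g: "g \<in> ell2 A"
      have "cmod (ip f (T g)) \<le> ell2_norm f * C * ell2_norm g"
        using ip_Cauchy_Schwarz[OF f bop_ell2[OF T], of g] mult_left_mono[OF C(2)[of g], of "ell2_norm f"]
        by (simp add: mult.assoc)
      moreover have "cmod (ip (S f) g) \<le> ell2_norm (S f) * ell2_norm g"
        using ip_Cauchy_Schwarz[OF bop_ell2[OF S] g] .
      ultimately show "cmod (ip f (T g) - ip (S f) g) \<le> (ell2_norm f * C + ell2_norm (S f)) * ell2_norm g"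
        using norm_triangle_ineq4[of "ip f (T g)" "ip (S f) g"] by (simp add: distrib_right)
    next
      fix i assume "i \<in> A"
      then show "ip f (T (ket i)) - ip (S f) (ket i) = 0"
        using f by (simp add: S_def ip_cnj)
    next
      fix g h assume g: "g \<in> ell2 A" and h: "h \<in> ell2 A"
      have "ip f (T (g + h)) = ip f (T g) + ip f (T h)"
        unfolding bop_add[OF T g h] using f T by (intro ip_add_right[where A = A and B = A and B' = A]) auto
      moreover have "ip (S f) (g + h) = ip (S f) g + ip (S f) h"
        using g h S by (intro ip_add_right[where A = A and B = A and B' = A]) auto
      ultimately show "ip f (T (g + h)) - ip (S f) (g + h) = ip f (T g) - ip (S f) g + (ip f (T h) - ip (S f) h)"
        by simp
    next
      fix c g assume "g \<in> ell2 A"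
      then show "ip f (T (vscale c g)) - ip (S f) (vscale c g) = c * (ip f (T g) - ip (S f) g)"
        using T by (simp add: bop_scale right_diff_distrib)
    qed (rule g)
    then show ?thesis
      by simp
  qed
  ultimately show thesis
    using that by blast
qed

lemma adj_eqI:
  assumes "S \<in> bop A" "\<And>f g. f \<in> ell2 A \<Longrightarrow> g \<in> ell2 A \<Longrightarrow> ip f (T g) = ip (S f) g"
  shows "adj A T = S"
  unfolding adj_def
proof (rule the_equality)
  fix S' assume S': "S' \<in> bop A \<and> (\<forall>f\<in>ell2 A. \<forall>g\<in>ell2 A. ip f (T g) = ip (S' f) g)"
  show "S' = S"
  proof (rule op_eqI)
    fix i j assume "i \<in> A" "j \<in> A"
    then have "ip (S' (ket j)) (ket i) = ip (S (ket j)) (ket i)"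
      using S' assms(2) by (metis ell2_ket)
    then show "S' (ket j) i = S (ket j) i"
      by simp
  qed (use S' assms in auto)
qed (use assms in auto)

lemma adj_bop [simp]: "T \<in> bop A \<Longrightarrow> adj A T \<in> bop A"
  and adj_ip: "T \<in> bop A \<Longrightarrow> f \<in> ell2 A \<Longrightarrow> g \<in> ell2 A \<Longrightarrow> ip (adj A T f) g = ip f (T g)"
proof -
  assume T: "T \<in> bop A"
  obtain S where S: "S \<in> bop A" "\<And>f g. f \<in> ell2 A \<Longrightarrow> g \<in> ell2 A \<Longrightarrow> ip f (T g) = ip (S f) g"
    using adj_exists[OF T] by blast
  have "adj A T = S"
    using S by (rule adj_eqI)
  then show "adj A T \<in> bop A" "f \<in> ell2 A \<Longrightarrow> g \<in> ell2 A \<Longrightarrow> ip (adj A T f) g = ip f (T g)"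
    using S by simp_all
qed

lemma adj_ip_right: "T \<in> bop A \<Longrightarrow> f \<in> ell2 A \<Longrightarrow> g \<in> ell2 A \<Longrightarrow> ip f (adj A T g) = ip (T f) g"
  using adj_ip[of T A g f] by (metis ip_cnj)

lemma adj_adj [simp]: "T \<in> bop A \<Longrightarrow> adj A (adj A T) = T"
  by (rule adj_eqI) (auto simp: adj_ip_right)

lemma adj_comp: "S \<in> bop A \<Longrightarrow> T \<in> bop A \<Longrightarrow> adj A (S \<circ> T) = adj A T \<circ> adj A S"
  by (rule adj_eqI) (auto simp: adj_ip)

lemma adj_plus: "S \<in> bop A \<Longrightarrow> T \<in> bop A \<Longrightarrow> adj A (S + T) = adj A S + adj A T"
  by (rule adj_eqI) (auto simp: adj_ip ip_add_right[where A = A and B = A and B' = A]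
      ip_add_left[where A = A and B = A and B' = A])

lemma adj_oscale: "T \<in> bop A \<Longrightarrow> adj A (oscale c T) = oscale (cnj c) (adj A T)"
  by (rule adj_eqI) (auto simp: adj_ip)

lemma adj_id [simp]: "adj A (id_op A) = id_op A"
  by (rule adj_eqI) auto

lemma adj_zero [simp]: "adj A 0 = 0"
  by (rule adj_eqI) auto

lemma adj_sum: "(\<And>i. i \<in> I \<Longrightarrow> T i \<in> bop A) \<Longrightarrow> adj A (\<Sum>i\<in>I. T i) = (\<Sum>i\<in>I. adj A (T i))"
proof (induction I rule: infinite_finite_induct)
  case (insert i I)
  have "adj A (T i + (\<Sum>i\<in>I. T i)) = adj A (T i) + adj A (\<Sum>i\<in>I. T i)"
    using insert.prems by (intro adj_plus) auto
  also have "adj A (\<Sum>i\<in>I. T i) = (\<Sum>i\<in>I. adj A (T i))"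
    using insert by simp
  finally show ?case
    by (simp only: sum.insert[OF insert.hyps])
qed auto

lemma adj_entry: "T \<in> bop A \<Longrightarrow> i \<in> A \<Longrightarrow> j \<in> A \<Longrightarrow> adj A T (ket j) i = cnj (T (ket i) j)"
  using adj_ip_right[of T A "ket i" "ket j"] by simp

text \<open>With \<open>g\<close> the image of \<open>f\<close>, the squared norm of
  \<open>g\<close> is \<open>ip f (T g)\<close>, and one factor \<open>ell2_norm g\<close>
  cancels.\<close>

lemma adj_bound:
  assumes T: "T \<in> bop A" and C: "0 \<le> C" "\<And>f. f \<in> ell2 A \<Longrightarrow> ell2_norm (T f) \<le> C * ell2_norm f"
  shows "ell2_norm (adj A T f) \<le> C * ell2_norm f"
proof (cases "f \<in> ell2 A")
  case True
  let ?g = "adj A T f"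
  have g: "?g \<in> ell2 A"
    using T by simp
  have "complex_of_real ((ell2_norm ?g)\<^sup>2) = ip f (T ?g)"
    using adj_ip[OF T True g] ip_self[OF g] by simp
  then have "(ell2_norm ?g)\<^sup>2 = cmod (ip f (T ?g))"
    by (metis norm_of_real abs_power2)
  also have "\<dots> \<le> ell2_norm f * (C * ell2_norm ?g)"
    using ip_Cauchy_Schwarz[OF True bop_ell2[OF T]] C(2)[OF g]
    by (meson ell2_norm_ge_0 mult_left_mono order_trans)
  finally have "ell2_norm ?g * ell2_norm ?g \<le> (C * ell2_norm f) * ell2_norm ?g"
    by (simp add: power2_eq_square mult_ac)
  then show ?thesis
    by (rule mult_self_le_cancel) (use C(1) in simp_all)
qed (simp add: bop_outside[OF adj_bop[OF T]] C(1))

lemma ip_adj_comp: "T \<in> bop A \<Longrightarrow> f \<in> ell2 A \<Longrightarrow> ip f ((adj A T \<circ> T) f) = of_real ((ell2_norm (T f))\<^sup>2)"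
  using ip_self[of "T f" A] by (simp add: adj_ip_right)

section \<open>Rank-one operators \<open>|h><f|\<close>\<close>

definition butterfly :: "'i set \<Rightarrow> 'i vec \<Rightarrow> 'i vec \<Rightarrow> 'i op" where
  "butterfly A h f = (\<lambda>g. if g \<in> ell2 A then vscale (ip f g) h else 0)"

lemma butterfly_bop [simp]:
  assumes h: "h \<in> ell2 A" and f: "f \<in> ell2 A"
  shows "butterfly A h f \<in> bop A"
proof (rule bopI[where C = "ell2_norm f * ell2_norm h"])
  fix g assume "g \<in> ell2 A"
  then show "ell2_norm (butterfly A h f g) \<le> ell2_norm f * ell2_norm h * ell2_norm g"
    using mult_right_mono[OF ip_Cauchy_Schwarz[OF f], of g A "ell2_norm h"]
    by (simp add: butterfly_def mult_ac)
qed (use h f in \<open>auto simp: butterfly_def ip_add_right[OF f, where B = A and B' = A] fun_eq_iff pointwise distrib_right\<close>)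

lemma butterfly_apply: "g \<in> ell2 A \<Longrightarrow> butterfly A h f g = vscale (ip f g) h"
  by (simp add: butterfly_def)

lemma adj_butterfly:
  assumes "h \<in> ell2 A" "f \<in> ell2 A"
  shows "adj A (butterfly A h f) = butterfly A f h"
proof (rule adj_eqI)
  fix k g assume "k \<in> ell2 A" "g \<in> ell2 A"
  then show "ip k (butterfly A h f g) = ip (butterfly A f h k) g"
    by (simp add: butterfly_apply ip_cnj)
qed (use assms in simp)

lemma comp_butterfly: "T \<in> bop A \<Longrightarrow> h \<in> ell2 A \<Longrightarrow> T \<circ> butterfly A h f = butterfly A (T h) f"
  by (rule ext) (auto simp: butterfly_def bop_scale bop_0)

lemma butterfly_comp_butterfly:
  "h \<in> ell2 A \<Longrightarrow> g \<in> ell2 A \<Longrightarrow> butterfly A h f \<circ> butterfly A g k = oscale (ip f g) (butterfly A h k)"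
  by (rule ext) (auto simp: butterfly_def fun_eq_iff pointwise mult_ac)

lemma butterfly_scale_left: "butterfly A (vscale c h) f = oscale c (butterfly A h f)"
  by (rule ext) (auto simp: butterfly_def fun_eq_iff pointwise)

lemma butterfly_add_left:
  "butterfly A (h + h') f = butterfly A h f + butterfly A h' f"
  by (rule ext) (auto simp: butterfly_def fun_eq_iff pointwise distrib_left)

text \<open>The scalar action \<open>t\<close> on the codomain is a parameter so that functionals
  and operator-valued maps are covered together; \<open>t0\<close> is what yields
  \<open>\<phi> 0 = 0\<close>.\<close>

lemma clinear_sum:
  fixes \<phi> :: "'i op \<Rightarrow> 'w::ab_group_add"
  assumes lin: "clinear_map_on (bop A) oscale t \<phi>" and t0: "t 0 (\<phi> 0) = 0"
    and "\<And>i. i \<in> I \<Longrightarrow> T i \<in> bop A"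
  shows "\<phi> (\<Sum>i\<in>I. T i) = (\<Sum>i\<in>I. \<phi> (T i))"
  using assms(3)
proof (induction I rule: infinite_finite_induct)
  case (insert i I)
  have "\<phi> (T i + (\<Sum>i\<in>I. T i)) = \<phi> (T i) + \<phi> (\<Sum>i\<in>I. T i)"
    using lin insert.prems by (auto simp: clinear_map_on_def)
  also have "\<phi> (\<Sum>i\<in>I. T i) = (\<Sum>i\<in>I. \<phi> (T i))"
    using insert by simp
  finally show ?case
    by (simp only: sum.insert[OF insert.hyps])
next
  have "oscale 0 0 = (0 :: 'i op)"
    by (simp add: fun_eq_iff pointwise)
  then have z: "\<phi> 0 = 0"
    using lin t0 by (metis bop_zero clinear_map_on_def)
  { case (infinite I)
    then show ?case using z by (simp only: sum.infinite not_False_eq_True)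
  next
    case empty
    then show ?case using z by (simp only: sum.empty) }
qed

subsection \<open>States\<close>

lemma pos_op_adj_comp: "x \<in> bop A \<Longrightarrow> pos_op A (adj A x \<circ> x)"
  by (simp add: pos_op_def ip_adj_comp[simplified])

lemma state_add: "state A \<phi> \<Longrightarrow> x \<in> bop A \<Longrightarrow> y \<in> bop A \<Longrightarrow> \<phi> (x + y) = \<phi> x + \<phi> y"
  by (simp add: state_def clinear_map_on_def)

lemma state_scale: "state A \<phi> \<Longrightarrow> x \<in> bop A \<Longrightarrow> \<phi> (oscale c x) = c * \<phi> x"
  by (simp add: state_def clinear_map_on_def)

lemma state_diff: "state A \<phi> \<Longrightarrow> x \<in> bop A \<Longrightarrow> y \<in> bop A \<Longrightarrow> \<phi> (x - y) = \<phi> x - \<phi> y"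
  unfolding op_diff_eq by (simp add: state_add state_scale)

lemma state_sum: "state A \<phi> \<Longrightarrow> (\<And>i. i \<in> I \<Longrightarrow> x i \<in> bop A) \<Longrightarrow> \<phi> (\<Sum>i\<in>I. x i) = (\<Sum>i\<in>I. \<phi> (x i))"
  by (rule clinear_sum[where t = "(*)" and A = A]) (auto simp: state_def)

lemma state_zero: "state A \<phi> \<Longrightarrow> \<phi> 0 = 0"
  using state_diff[of A \<phi> 0 0] by simp

lemma state_id: "state A \<phi> \<Longrightarrow> \<phi> (id_op A) = 1"
  by (simp add: state_def)

lemma state_pos: "state A \<phi> \<Longrightarrow> pos_op A T \<Longrightarrow> \<phi> T \<in> \<real>\<^sub>\<ge>\<^sub>0"
  by (simp add: state_def)

lemma state_norm_power2:
  assumes "state A \<phi>" "x \<in> bop A"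
  shows "\<phi> (adj A x \<circ> x) = of_real ((state_norm A \<phi> x)\<^sup>2)"
    and "(state_norm A \<phi> x)\<^sup>2 = Re (\<phi> (adj A x \<circ> x))"
proof -
  have "\<phi> (adj A x \<circ> x) \<in> \<real>\<^sub>\<ge>\<^sub>0"
    using state_pos[OF assms(1) pos_op_adj_comp[OF assms(2)]] .
  then obtain r where "\<phi> (adj A x \<circ> x) = of_real r" "0 \<le> r"
    by (auto elim: nonneg_Reals_cases)
  then show "\<phi> (adj A x \<circ> x) = of_real ((state_norm A \<phi> x)\<^sup>2)"
    and "(state_norm A \<phi> x)\<^sup>2 = Re (\<phi> (adj A x \<circ> x))"
    by (simp_all add: state_norm_def)
qed

lemma state_norm_ge_0: "state A \<phi> \<Longrightarrow> x \<in> bop A \<Longrightarrow> 0 \<le> state_norm A \<phi> x"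
  using state_norm_power2[of A \<phi> x] unfolding state_norm_def by (metis real_sqrt_ge_zero zero_le_power2)

lemma adj_comp_expand:
  assumes x: "x \<in> bop A" and y: "y \<in> bop A"
  shows "adj A (x + oscale c y) \<circ> (x + oscale c y) =
    (adj A x \<circ> x) + oscale c (adj A x \<circ> y) + oscale (cnj c) (adj A y \<circ> x) + oscale (cnj c * c) (adj A y \<circ> y)"
proof (rule op_eqI[where A = A])
  fix i j assume "i \<in> A" "j \<in> A"
  show "(adj A (x + oscale c y) \<circ> (x + oscale c y)) (ket j) i =
    ((adj A x \<circ> x) + oscale c (adj A x \<circ> y) + oscale (cnj c) (adj A y \<circ> x) + oscale (cnj c * c) (adj A y \<circ> y)) (ket j) i"
    using x y \<open>j \<in> A\<close> by (simp add: adj_plus adj_oscale bop_add[where A = A] bop_scale[where A = A] pointwise algebra_simps)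
qed (use x y in auto)

lemma state_expand:
  assumes s: "state A \<phi>" and x: "x \<in> bop A" and y: "y \<in> bop A"
  shows "\<phi> (adj A (x + oscale c y) \<circ> (x + oscale c y)) =
    \<phi> (adj A x \<circ> x) + c * \<phi> (adj A x \<circ> y) + cnj c * \<phi> (adj A y \<circ> x) + cnj c * c * \<phi> (adj A y \<circ> y)"
  unfolding adj_comp_expand[OF x y] using s x y by (simp add: state_add state_scale)

text \<open>Polarization: the value at \<open>x + oscale c y\<close> is real, and
  \<open>c = 1\<close> and \<open>c = \<i>\<close> fix the imaginary and the real part.\<close>

lemma state_hermitian:
  assumes s: "state A \<phi>" and x: "x \<in> bop A" and y: "y \<in> bop A"
  shows "\<phi> (adj A y \<circ> x) = cnj (\<phi> (adj A x \<circ> y))"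
proof -
  have "Im (\<phi> (adj A z \<circ> z)) = 0" if "z \<in> bop A" for z
    using state_norm_power2(1)[OF s that] by simp
  then have "Im (\<phi> (adj A (x + oscale c y) \<circ> (x + oscale c y))) = 0" "Im (\<phi> (adj A x \<circ> x)) = 0" "Im (\<phi> (adj A y \<circ> y)) = 0" for c
    using x y by auto
  note h = this(1)[unfolded state_expand[OF assms]] this(2,3)
  have "Im (\<phi> (adj A x \<circ> y)) + Im (\<phi> (adj A y \<circ> x)) = 0"
    using h(1)[of 1] h(2,3) by simp
  moreover have "Re (\<phi> (adj A x \<circ> y)) - Re (\<phi> (adj A y \<circ> x)) = 0"
    using h(1)[of \<i>] h(2,3) by simp
  ultimately show ?thesis
    by (simp add: complex_eq_iff)
qed

lemma state_adj: "state A \<phi> \<Longrightarrow> x \<in> bop A \<Longrightarrow> \<phi> (adj A x) = cnj (\<phi> x)"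
  using state_hermitian[of A \<phi> "id_op A" x] by simp

lemma state_Cauchy_Schwarz:
  assumes s: "state A \<phi>" and x: "x \<in> bop A" and y: "y \<in> bop A"
  shows "cmod (\<phi> (adj A x \<circ> y)) \<le> state_norm A \<phi> x * state_norm A \<phi> y"
proof -
  have "(cmod (\<phi> (adj A x \<circ> y)))\<^sup>2 \<le> (state_norm A \<phi> x)\<^sup>2 * (state_norm A \<phi> y)\<^sup>2"
  proof (rule quadratic_Cauchy_Schwarz)
    fix c
    have "cnj c * c = of_real ((cmod c)\<^sup>2)"
      by (simp only: complex_norm_square mult.commute)
    then have "\<phi> (adj A (x + oscale c y) \<circ> (x + oscale c y)) =
       of_real ((state_norm A \<phi> x)\<^sup>2) + (c * \<phi> (adj A x \<circ> y) + cnj (c * \<phi> (adj A x \<circ> y)))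
       + of_real ((cmod c)\<^sup>2 * (state_norm A \<phi> y)\<^sup>2)"
      unfolding state_expand[OF assms] state_hermitian[OF assms] state_norm_power2(1)[OF s x]
        state_norm_power2(1)[OF s y] by simp
    then have "Re (\<phi> (adj A (x + oscale c y) \<circ> (x + oscale c y))) =
       (state_norm A \<phi> x)\<^sup>2 + 2 * Re (c * \<phi> (adj A x \<circ> y)) + (cmod c)\<^sup>2 * (state_norm A \<phi> y)\<^sup>2"
      unfolding complex_add_cnj by simp
    then show "0 \<le> (state_norm A \<phi> x)\<^sup>2 + 2 * Re (c * \<phi> (adj A x \<circ> y)) + (cmod c)\<^sup>2 * (state_norm A \<phi> y)\<^sup>2"
      using state_norm_power2(2)[OF s, of "x + oscale c y"] x y
      by (metis bop_oscale bop_plus zero_le_power2)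
  qed auto
  then have "(cmod (\<phi> (adj A x \<circ> y)))\<^sup>2 \<le> (state_norm A \<phi> x * state_norm A \<phi> y)\<^sup>2"
    by (simp add: power_mult_distrib)
  then show ?thesis
    by (rule power2_le_imp_le) (simp add: state_norm_ge_0 s x y)
qed

lemma state_norm_triangle:
  assumes s: "state A \<phi>" and x: "x \<in> bop A" and y: "y \<in> bop A"
  shows "state_norm A \<phi> (x + y) \<le> state_norm A \<phi> x + state_norm A \<phi> y"
proof -
  have "(state_norm A \<phi> (x + y))\<^sup>2 = (state_norm A \<phi> x)\<^sup>2 + 2 * Re (\<phi> (adj A x \<circ> y)) + (state_norm A \<phi> y)\<^sup>2"
  proof -
    have o: "oscale 1 y = y"
      by (rule ext) simp
    have "\<phi> (adj A (x + y) \<circ> (x + y)) = \<phi> (adj A x \<circ> x) + (\<phi> (adj A x \<circ> y) + cnj (\<phi> (adj A x \<circ> y))) + \<phi> (adj A y \<circ> y)"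
      using state_expand[OF assms, of 1] state_hermitian[OF assms] unfolding o by simp
    then show ?thesis
      unfolding state_norm_power2(2)[OF s bop_plus[OF x y]] state_norm_power2(1)[OF s x]
        state_norm_power2(1)[OF s y] complex_add_cnj by simp
  qed
  also have "\<dots> \<le> (state_norm A \<phi> x)\<^sup>2 + 2 * (state_norm A \<phi> x * state_norm A \<phi> y) + (state_norm A \<phi> y)\<^sup>2"
    using state_Cauchy_Schwarz[OF assms] complex_Re_le_cmod[of "\<phi> (adj A x \<circ> y)"] by simp
  also have "\<dots> = (state_norm A \<phi> x + state_norm A \<phi> y)\<^sup>2"
    by (simp add: power2_sum)
  finally show ?thesis
    by (rule power2_le_imp_le) (simp add: state_norm_ge_0 s x y)
qed

lemma state_norm_oscale:
  assumes "state A \<phi>" "x \<in> bop A"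
  shows "state_norm A \<phi> (oscale c x) = cmod c * state_norm A \<phi> x"
proof -
  have "\<phi> (adj A (oscale c x) \<circ> oscale c x) = of_real ((cmod c)\<^sup>2) * \<phi> (adj A x \<circ> x)"
    using assms by (simp add: adj_oscale oscale_comp comp_oscale[where A = A] state_scale complex_norm_square mult_ac del: of_real_power)
  then show ?thesis
    by (simp add: state_norm_def real_sqrt_mult)
qed

lemma state_norm_diff:
  assumes "state A \<phi>" "x \<in> bop A" "y \<in> bop A"
  shows "state_norm A \<phi> (x - y) \<le> state_norm A \<phi> x + state_norm A \<phi> y"
  unfolding op_diff_eq
  using state_norm_triangle[OF assms(1,2) bop_oscale[OF assms(3), of "-1"]] assms by (simp add: state_norm_oscale)

lemma state_norm_id: "state A \<phi> \<Longrightarrow> state_norm A \<phi> (id_op A) = 1"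
  by (simp add: state_norm_def state_id)

lemma state_le_norm:
  assumes "state A \<phi>" "x \<in> bop A"
  shows "cmod (\<phi> x) \<le> state_norm A \<phi> x"
  using state_Cauchy_Schwarz[OF assms(1) bop_id assms(2)] assms by (simp add: state_norm_id)

section \<open>Operator inequalities under a state\<close>

lemma Re_ip_sum_adj_comp:
  assumes "\<And>i. i \<in> I \<Longrightarrow> x i \<in> bop A" "f \<in> ell2 A"
  shows "ip f ((\<Sum>i\<in>I. adj A (x i) \<circ> x i) f) = of_real (\<Sum>i\<in>I. (ell2_norm (x i f))\<^sup>2)"
proof -
  have "ip f ((\<Sum>i\<in>I. adj A (x i) \<circ> x i) f) = (\<Sum>i\<in>I. ip f ((adj A (x i) \<circ> x i) f))"
    unfolding op_sum_apply using assms by (intro ip_sum_right[where A = A and B = A]) (auto intro!: bop_ell2)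
  also have "\<dots> = (\<Sum>i\<in>I. of_real ((ell2_norm (x i f))\<^sup>2))"
    using assms by (intro sum.cong ip_adj_comp) auto
  finally show ?thesis
    by simp
qed

text \<open>A pointwise inequality between column norms is an operator inequality between the sums
  of \<open>adj A (x i) \<circ> x i\<close>, and a state is monotone. Families are allowed on both
  sides because the column estimates below compare many operators with one.\<close>

lemma state_norm_mono:
  assumes s: "state A \<phi>" and x: "\<And>i. i \<in> I \<Longrightarrow> x i \<in> bop A" and y: "\<And>j. j \<in> J \<Longrightarrow> y j \<in> bop A"
    and le: "\<And>f. f \<in> ell2 A \<Longrightarrow> (\<Sum>i\<in>I. (ell2_norm (x i f))\<^sup>2) \<le> (\<Sum>j\<in>J. (ell2_norm (y j f))\<^sup>2)"
  shows "(\<Sum>i\<in>I. (state_norm A \<phi> (x i))\<^sup>2) \<le> (\<Sum>j\<in>J. (state_norm A \<phi> (y j))\<^sup>2)"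
proof -
  let ?X = "\<Sum>i\<in>I. adj A (x i) \<circ> x i" and ?Y = "\<Sum>j\<in>J. adj A (y j) \<circ> y j"
  have X: "?X \<in> bop A" and Y: "?Y \<in> bop A"
    using x y by auto
  have "ip f ((?Y - ?X) f) = of_real ((\<Sum>j\<in>J. (ell2_norm (y j f))\<^sup>2) - (\<Sum>i\<in>I. (ell2_norm (x i f))\<^sup>2))"
    if "f \<in> ell2 A" for f
    using ip_diff_right[OF that bop_ell2[OF Y] bop_ell2[OF X]] Re_ip_sum_adj_comp[of I x, OF x that]
      Re_ip_sum_adj_comp[of J y, OF y that] by (simp del: of_real_sum)
  then have "pos_op A (?Y - ?X)"
    using le X Y by (simp add: pos_op_def del: of_real_sum of_real_diff op_apply)
  then have "0 \<le> Re (\<phi> (?Y - ?X))"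
    using state_pos[OF s] complex_nonneg_Reals_iff by blast
  also have "\<phi> (?Y - ?X) = (\<Sum>j\<in>J. \<phi> (adj A (y j) \<circ> y j)) - (\<Sum>i\<in>I. \<phi> (adj A (x i) \<circ> x i))"
    unfolding state_diff[OF s Y X] using s x y by (simp add: state_sum)
  also have "\<dots> = of_real ((\<Sum>j\<in>J. (state_norm A \<phi> (y j))\<^sup>2) - (\<Sum>i\<in>I. (state_norm A \<phi> (x i))\<^sup>2))"
    using state_norm_power2(1)[OF s x] state_norm_power2(1)[OF s y] by simp
  finally show ?thesis
    by simp
qed

definition bounded_by :: "'i op \<Rightarrow> real \<Rightarrow> bool" where
  "bounded_by x C \<longleftrightarrow> 0 \<le> C \<and> (\<forall>f. ell2_norm (x f) \<le> C * ell2_norm f)"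

lemma bop_bounded_by: "x \<in> bop A \<Longrightarrow> \<exists>C. bounded_by x C"
  using bop_bound[of x A] by (metis bounded_by_def)

lemma bounded_by_power2: "bounded_by x C \<Longrightarrow> (ell2_norm (x f))\<^sup>2 \<le> C\<^sup>2 * (ell2_norm f)\<^sup>2"
  by (metis bounded_by_def ell2_norm_ge_0 power_mono power_mult_distrib)

lemma bounded_byI:
  assumes "x \<in> bop A" "0 \<le> C" "\<And>f. f \<in> ell2 A \<Longrightarrow> ell2_norm (x f) \<le> C * ell2_norm f"
  shows "bounded_by x C"
  unfolding bounded_by_def
proof (intro conjI allI assms(2))
  fix f
  show "ell2_norm (x f) \<le> C * ell2_norm f"
    by (cases "f \<in> ell2 A") (use assms in \<open>auto simp: bop_outside\<close>)
qed

lemma state_norm_comp_le: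
  assumes s: "state A \<phi>" and "x \<in> bop A" "y \<in> bop A" "bounded_by x C"
  shows "state_norm A \<phi> (x \<circ> y) \<le> C * state_norm A \<phi> y"
proof -
  have "(\<Sum>i\<in>{()}. (state_norm A \<phi> (x \<circ> y))\<^sup>2) \<le> (\<Sum>i\<in>{()}. (state_norm A \<phi> (oscale (of_real C) y))\<^sup>2)"
    using assms bounded_by_power2[OF assms(4)] by (intro state_norm_mono[OF s]) (auto simp: power_mult_distrib)
  then have "(state_norm A \<phi> (x \<circ> y))\<^sup>2 \<le> (C * state_norm A \<phi> y)\<^sup>2"
    using assms by (simp add: state_norm_oscale bounded_by_def)
  then show ?thesis
    by (rule power2_le_imp_le) (use assms in \<open>auto simp: bounded_by_def state_norm_ge_0\<close>)
qed

lemma state_norm_bounded_by: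
  "state A \<phi> \<Longrightarrow> x \<in> bop A \<Longrightarrow> bounded_by x C \<Longrightarrow> state_norm A \<phi> x \<le> C"
  using state_norm_comp_le[of A \<phi> x "id_op A" C] by (simp add: state_norm_id)

lemma state_bounded_by:
  "state A \<phi> \<Longrightarrow> x \<in> bop A \<Longrightarrow> bounded_by x C \<Longrightarrow> cmod (\<phi> x) \<le> C"
  using state_norm_bounded_by state_le_norm order_trans by metis

lemma state_norm_butterfly:
  assumes s: "state A \<phi>" and "h \<in> ell2 A" "f \<in> ell2 A"
  shows "state_norm A \<phi> (butterfly A h f) \<le> ell2_norm h * ell2_norm f"
proof (rule state_norm_bounded_by[OF s butterfly_bop[OF assms(2,3)] bounded_byI[OF butterfly_bop[OF assms(2,3)]]])
  fix g assume "g \<in> ell2 A"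
  then show "ell2_norm (butterfly A h f g) \<le> ell2_norm h * ell2_norm f * ell2_norm g"
    using mult_right_mono[OF ip_Cauchy_Schwarz[OF assms(3)], of g A "ell2_norm h"]
    by (simp add: butterfly_apply mult_ac)
qed simp

section \<open>Coordinate projections and normal states\<close>

definition proj :: "'i set \<Rightarrow> 'i op" where
  "proj F = (\<lambda>f. if f \<in> ell2 UNIV then trunc F f else 0)"

definition coproj :: "'i set \<Rightarrow> 'i op" where
  "coproj F = proj (- F)"

lemma trunc_norm_le: "f \<in> ell2 A \<Longrightarrow> ell2_norm (trunc F f) \<le> ell2_norm f"
  by (rule power2_le_imp_le) (simp_all add: ell2_norm_trunc_split[of f A F])

lemma trunc_apply: "trunc F f i = (if i \<in> F then f i else 0)"
  by (simp add: trunc_def)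

lemma proj_apply: "f \<in> ell2 UNIV \<Longrightarrow> proj F f = trunc F f"
  by (simp add: proj_def)

lemma proj_bop [simp]: "proj F \<in> bop UNIV"
proof (rule bopI[where C = 1])
  fix f :: "'a vec" assume f: "f \<in> ell2 UNIV"
  then show "ell2_norm (proj F f) \<le> 1 * ell2_norm f"
    using trunc_norm_le[OF f] by (simp add: proj_def)
qed (auto simp: proj_def trunc_ell2 trunc_apply fun_eq_iff pointwise)

lemma coproj_bop [simp]: "coproj F \<in> bop UNIV"
  by (simp add: coproj_def)

lemma proj_bounded_by: "bounded_by (proj F) 1"
  by (rule bounded_byI[OF proj_bop]) (auto simp: proj_def trunc_norm_le)

lemma proj_proj: "proj F \<circ> proj G = proj (F \<inter> G)"
proof
  fix f :: "'a vec"
  show "(proj F \<circ> proj G) f = proj (F \<inter> G) f"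
    by (cases "f \<in> ell2 UNIV") (auto simp: proj_def trunc_ell2 trunc_apply fun_eq_iff pointwise)
qed

lemma proj_idem: "proj F \<circ> proj F = proj F"
  by (simp add: proj_proj)

lemma adj_proj: "adj UNIV (proj F) = proj F"
proof (rule op_eqI[where A = UNIV])
  fix i j :: 'a
  show "adj UNIV (proj F) (ket j) i = proj F (ket j) i"
    by (simp add: adj_entry proj_apply trunc_apply) (simp add: ket_def)
qed auto

lemma proj_coproj: "proj F + coproj F = id_op UNIV"
  by (rule ext) (auto simp: proj_def coproj_def trunc_def id_op_def fun_eq_iff pointwise)

lemma proj_UNIV: "proj UNIV = id_op UNIV"
  by (rule ext) (auto simp: proj_def trunc_def id_op_def)

lemma proj_eq_butterfly_sum: "finite F \<Longrightarrow> proj F = (\<Sum>i\<in>F. butterfly UNIV (ket i) (ket i))"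
  by (rule ext) (auto simp: proj_def butterfly_def op_sum_apply trunc_eq_sum)

lemma ip_proj: "f \<in> ell2 UNIV \<Longrightarrow> ip f (proj F f) = of_real ((ell2_norm (trunc F f))\<^sup>2)"
  using ip_adj_comp[OF proj_bop, of f F] unfolding adj_proj proj_idem by (simp add: proj_def)

lemma pos_op_proj: "pos_op UNIV (proj F)"
  using pos_op_adj_comp[OF proj_bop, of F] unfolding adj_proj proj_idem .

lemma state_norm_proj: "state UNIV \<phi> \<Longrightarrow> (state_norm UNIV \<phi> (proj F))\<^sup>2 = Re (\<phi> (proj F))"
  using state_norm_power2(2)[of UNIV \<phi> "proj F"] unfolding adj_proj proj_idem by simp

text \<open>The finite coordinate projections increase to the identity, so normality makes the mass of
  their complements vanish.\<close>

lemma normal_state_coproj: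
  assumes "normal_state UNIV \<phi>"
  shows "(\<lambda>N. state_norm UNIV \<phi> (coproj {..<N::nat})) \<longlonglongrightarrow> 0"
proof -
  have s: "state UNIV \<phi>"
    using assms by (simp add: normal_state_def)
  let ?D = "range (\<lambda>N. proj {..<N} :: nat op)"
  have diff: "proj {..<M} - proj {..<N} = proj {N..<M}" if "N \<le> M" for M N :: nat
    using that by (intro ext) (auto simp: proj_def trunc_def fun_eq_iff pointwise)
  have le: "op_le UNIV (proj {..<N}) (proj {..<M})" if "N \<le> M" for M N :: nat
    unfolding op_le_def diff[OF that] by (rule pos_op_proj)
  have lub: "op_lub UNIV ?D (id_op UNIV)"
    unfolding op_lub_def
  proof (intro conjI ballI impI)
    fix S :: "nat op" assume "S \<in> ?D"
    then obtain N where N: "S = proj {..<N}"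
      by blast
    have "id_op UNIV - proj {..<N} = coproj {..<N}"
      unfolding proj_coproj[symmetric, of "{..<N}"] by simp
    then show "op_le UNIV S (id_op UNIV)"
      unfolding N op_le_def coproj_def by (simp add: pos_op_proj)
  next
    fix R :: "nat op" assume R: "R \<in> bop UNIV" and ub: "\<forall>S\<in>?D. op_le UNIV S R"
    show "op_le UNIV (id_op UNIV) R"
      unfolding op_le_def pos_op_def
    proof (intro conjI ballI)
      fix f :: "nat vec" assume f: "f \<in> ell2 UNIV"
      have Rf: "ip f (R f) \<in> \<real>" and ge: "(ell2_norm (trunc {..<N} f))\<^sup>2 \<le> Re (ip f (R f))" for N
      proof -
        have "ip f ((R - proj {..<N}) f) \<in> \<real>\<^sub>\<ge>\<^sub>0"
          using ub f by (auto simp: op_le_def pos_op_def simp del: op_apply)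
        also have "ip f ((R - proj {..<N}) f) = ip f (R f) - of_real ((ell2_norm (trunc {..<N} f))\<^sup>2)"
          using ip_diff_right[OF f bop_ell2[OF R] bop_ell2[OF proj_bop]] ip_proj[OF f] by simp
        finally show "ip f (R f) \<in> \<real>" "(ell2_norm (trunc {..<N} f))\<^sup>2 \<le> Re (ip f (R f))"
          by (auto simp: complex_nonneg_Reals_iff complex_is_Real_iff)
      qed
      \<comment> \<open>An upper bound \<open>R\<close> dominates every truncated norm of
        \<open>f\<close>, and the truncations exhaust \<open>f\<close>; so \<open>R\<close>
        dominates the identity.\<close>
      have "(ell2_norm f)\<^sup>2 \<le> Re (ip f (R f))"
      proof (rule field_le_epsilon)
        fix e :: real assume e: "e > 0"
        obtain F where F: "finite F" "\<And>G. finite G \<Longrightarrow> F \<subseteq> G \<Longrightarrow> ell2_norm (f - trunc G f) \<le> sqrt e"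
          using ell2_approx[OF f, of "sqrt e"] e by auto
        obtain N where "F \<subseteq> {..<N}"
          using F(1) finite_nat_iff_bounded by blast
        then have "(ell2_norm (f - trunc {..<N} f))\<^sup>2 \<le> (sqrt e)\<^sup>2"
          using F(2) by (intro power_mono) auto
        then show "(ell2_norm f)\<^sup>2 \<le> Re (ip f (R f)) + e"
          using ell2_norm_trunc_split[OF f, of "{..<N}"] ge[of N] e by simp
      qed
      then show "ip f ((R - id_op UNIV) f) \<in> \<real>\<^sub>\<ge>\<^sub>0"
        using Rf f ip_self[OF f] ip_diff_right[OF f bop_ell2[OF R] f]
        by (simp add: complex_nonneg_Reals_iff complex_is_Real_iff)
    qed (use R in simp)
  qed simp
  have dir: "\<exists>R\<in>?D. op_le UNIV S R \<and> op_le UNIV S' R" if S: "S \<in> ?D" and S': "S' \<in> ?D" for S S'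
  proof -
    obtain N where "S = proj {..<N}"
      using S by (rule rangeE)
    moreover obtain M where "S' = proj {..<M}"
      using S' by (rule rangeE)
    ultimately show ?thesis
      using le[of N "max N M"] le[of M "max N M"] by auto
  qed
  have nrm: "\<And>D T. D \<noteq> {} \<and> (\<forall>S\<in>D. pos_op UNIV S) \<and>
            (\<forall>S\<in>D. \<forall>S'\<in>D. \<exists>R\<in>D. op_le UNIV S R \<and> op_le UNIV S' R) \<and> op_lub UNIV D T
        \<Longrightarrow> Re (\<phi> T) = (SUP S\<in>D. Re (\<phi> S))"
    using assms unfolding normal_state_def by blast
  have "Re (\<phi> (id_op UNIV)) = (SUP S\<in>?D. Re (\<phi> S))"
    by (rule nrm) (use lub dir in \<open>auto simp: pos_op_proj\<close>)
  then have sup: "(SUP N. Re (\<phi> (proj {..<N}))) = 1"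
    using state_id[OF s] by (simp add: image_comp)
  have mono: "Re (\<phi> (proj {..<N})) \<le> Re (\<phi> (proj {..<M}))" if "N \<le> M" for M N :: nat
  proof -
    have "0 \<le> Re (\<phi> (proj {..<M} - proj {..<N}))"
      using state_pos[OF s] le[OF that] unfolding op_le_def complex_nonneg_Reals_iff by blast
    then show ?thesis
      by (simp add: state_diff[OF s])
  qed
  have "bdd_above (range (\<lambda>N::nat. Re (\<phi> (proj {..<N}))))"
  proof (rule bdd_aboveI2)
    fix N :: nat
    show "Re (\<phi> (proj {..<N})) \<le> 1"
      using complex_Re_le_cmod state_bounded_by[OF s proj_bop proj_bounded_by, of "{..<N}"] by (rule order_trans)
  qed
  then have "(\<lambda>N. Re (\<phi> (proj {..<N}))) \<longlonglongrightarrow> 1"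
    using LIMSEQ_incseq_SUP[of "\<lambda>N. Re (\<phi> (proj {..<N}))"] sup mono by (simp add: incseq_def)
  then have "(\<lambda>N. 1 - Re (\<phi> (proj {..<N}))) \<longlonglongrightarrow> 1 - 1"
    by (intro tendsto_intros)
  moreover have "1 - Re (\<phi> (proj {..<N})) = (state_norm UNIV \<phi> (coproj {..<N}))\<^sup>2" for N
  proof -
    have "\<phi> (proj {..<N}) + \<phi> (coproj {..<N}) = 1"
      using state_add[OF s proj_bop coproj_bop, of "{..<N}" "{..<N}"] by (simp only: proj_coproj state_id[OF s])
    then have "Re (\<phi> (proj {..<N})) + Re (\<phi> (coproj {..<N})) = 1"
      by (metis one_complex.sel(1) plus_complex.sel(1))
    then show ?thesis
      using state_norm_proj[OF s, of "- {..<N}"] by (simp add: coproj_def)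
  qed
  ultimately have "(\<lambda>N. (state_norm UNIV \<phi> (coproj {..<N}))\<^sup>2) \<longlonglongrightarrow> 0"
    by simp
  then have "(\<lambda>N. sqrt ((state_norm UNIV \<phi> (coproj {..<N}))\<^sup>2)) \<longlonglongrightarrow> sqrt 0"
    by (rule tendsto_real_sqrt)
  then show ?thesis
    by (simp add: state_norm_ge_0[OF s])
qed

subsection \<open>Words and dense subspaces\<close>

lemma finite_words [simp]: "finite (words n :: 'k::finite list set)"
  using finite_lists_length_eq[of "UNIV :: 'k set" n] by (simp add: words_def)

lemma words_0 [simp]: "words 0 = {[]}"
  by (auto simp: words_def)

lemma sum_words_Suc:
  "(\<Sum>w\<in>words (Suc n). F w) = (\<Sum>s\<in>(UNIV :: 'k::finite set). \<Sum>w\<in>words n. F (s # w))"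
proof -
  have "(\<Sum>w\<in>words (Suc n). F w) = (\<Sum>(s, w)\<in>(UNIV :: 'k set) \<times> words n. F (s # w))"
    by (rule sum.reindex_bij_witness[of _ "\<lambda>(s, w). s # w" "\<lambda>w. (hd w, tl w)"])
      (auto simp: words_def length_Suc_conv)
  then show ?thesis
    by (simp add: sum.cartesian_product)
qed

lemma sum_words_add:
  "(\<Sum>w\<in>words (n + m). F w) = (\<Sum>v\<in>(words n :: 'k::finite list set). \<Sum>w\<in>words m. F (v @ w))"
  by (induction n arbitrary: F) (simp_all add: sum_words_Suc)

lemma sum_mult_le_sqrt:
  "(\<Sum>i\<in>I. \<bar>f i\<bar> * \<bar>g i\<bar>) \<le> sqrt (\<Sum>i\<in>I. (f i)\<^sup>2) * sqrt (\<Sum>i\<in>I. (g i :: real)\<^sup>2)"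
  using L2_set_mult_ineq[of f g I] by (simp add: L2_set_def)

lemma norm_sum_vscale:
  assumes "\<And>i. i \<in> I \<Longrightarrow> h i \<in> ell2 A"
  shows "ell2_norm (\<Sum>i\<in>I. vscale (b i) (h i)) \<le> sqrt (\<Sum>i\<in>I. (cmod (b i))\<^sup>2) * sqrt (\<Sum>i\<in>I. (ell2_norm (h i))\<^sup>2)"
proof -
  have "ell2_norm (\<Sum>i\<in>I. vscale (b i) (h i)) \<le> (\<Sum>i\<in>I. ell2_norm (vscale (b i) (h i)))"
    using assms
  proof (induction I rule: infinite_finite_induct)
    case (insert i I)
    have "ell2_norm (vscale (b i) (h i) + (\<Sum>i\<in>I. vscale (b i) (h i)))
      \<le> ell2_norm (vscale (b i) (h i)) + ell2_norm (\<Sum>i\<in>I. vscale (b i) (h i))"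
      using insert.prems by (intro ell2_norm_triangle[where A = A and B = A] ell2_sum ell2_scale) auto
    also have "\<dots> \<le> ell2_norm (vscale (b i) (h i)) + (\<Sum>i\<in>I. ell2_norm (vscale (b i) (h i)))"
      using insert by (intro add_left_mono) auto
    finally show ?case
      by (simp only: sum.insert[OF insert.hyps])
  qed simp_all
  also have "\<dots> = (\<Sum>i\<in>I. \<bar>cmod (b i)\<bar> * \<bar>ell2_norm (h i)\<bar>)"
    by simp
  finally show ?thesis
    using sum_mult_le_sqrt[of "\<lambda>i. cmod (b i)" "\<lambda>i. ell2_norm (h i)" I] by linarith
qed

text \<open>The operators \<open>adj A (W j)\<close> form the row that is adjoint to the column of
  the \<open>W j\<close>, and a contraction has a contractive adjoint. The norm is tested on the
  image vector itself.\<close>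

lemma adj_sum_contraction:
  assumes W: "\<And>j. j \<in> J \<Longrightarrow> W j \<in> bop A" and k: "\<And>j. j \<in> J \<Longrightarrow> k j \<in> ell2 A"
    and iso: "\<And>f. f \<in> ell2 A \<Longrightarrow> (\<Sum>j\<in>J. (ell2_norm (W j f))\<^sup>2) \<le> (ell2_norm f)\<^sup>2"
  shows "(ell2_norm (\<Sum>j\<in>J. adj A (W j) (k j)))\<^sup>2 \<le> (\<Sum>j\<in>J. (ell2_norm (k j))\<^sup>2)"
proof -
  let ?F = "\<Sum>j\<in>J. adj A (W j) (k j)"
  have F: "?F \<in> ell2 A"
    using W by (intro ell2_sum) (auto intro!: bop_ell2)
  have "complex_of_real ((ell2_norm ?F)\<^sup>2) = (\<Sum>j\<in>J. ip ?F (adj A (W j) (k j)))"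
    unfolding ip_self[OF F, symmetric] by (rule ip_sum_right[OF F, where B = A]) (use W in auto)
  also have "\<dots> = (\<Sum>j\<in>J. ip (W j ?F) (k j))"
    using W k F by (intro sum.cong refl adj_ip_right) auto
  finally have "(ell2_norm ?F)\<^sup>2 = cmod (\<Sum>j\<in>J. ip (W j ?F) (k j))"
    by (metis norm_of_real abs_power2)
  also have "\<dots> \<le> (\<Sum>j\<in>J. cmod (ip (W j ?F) (k j)))"
    by (rule norm_sum)
  also have "\<dots> \<le> (\<Sum>j\<in>J. \<bar>ell2_norm (W j ?F)\<bar> * \<bar>ell2_norm (k j)\<bar>)"
    using W k ip_Cauchy_Schwarz[OF bop_ell2] by (intro sum_mono) fastforce
  also have "\<dots> \<le> sqrt (\<Sum>j\<in>J. (ell2_norm (W j ?F))\<^sup>2) * sqrt (\<Sum>j\<in>J. (ell2_norm (k j))\<^sup>2)"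
    by (rule sum_mult_le_sqrt)
  also have "\<dots> \<le> sqrt ((ell2_norm ?F)\<^sup>2) * sqrt (\<Sum>j\<in>J. (ell2_norm (k j))\<^sup>2)"
    using iso[OF F] by (intro mult_right_mono real_sqrt_le_mono) (auto intro: sum_nonneg)
  finally have "ell2_norm ?F * ell2_norm ?F \<le> sqrt (\<Sum>j\<in>J. (ell2_norm (k j))\<^sup>2) * ell2_norm ?F"
    by (simp add: power2_eq_square mult_ac)
  then have "ell2_norm ?F \<le> sqrt (\<Sum>j\<in>J. (ell2_norm (k j))\<^sup>2)"
    by (rule mult_self_le_cancel) (auto intro: sum_nonneg)
  then have "(ell2_norm ?F)\<^sup>2 \<le> (sqrt (\<Sum>j\<in>J. (ell2_norm (k j))\<^sup>2))\<^sup>2"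
    by (intro power_mono) auto
  then show ?thesis
    by (simp add: sum_nonneg)
qed

text \<open>Nearest-point argument: a minimizing sequence in \<open>M\<close> is Cauchy by the
  parallelogram law, its limit \<open>l\<close> is a nearest point of the closure, so
  \<open>h - l\<close> is orthogonal to \<open>M\<close> and vanishes.\<close>

lemma dense_of_trivial_complement:
  assumes M: "M \<subseteq> ell2 A" "0 \<in> M" "\<And>f g. f \<in> M \<Longrightarrow> g \<in> M \<Longrightarrow> f + g \<in> M" "\<And>c f. f \<in> M \<Longrightarrow> vscale c f \<in> M"
    and triv: "\<And>h. h \<in> ell2 A \<Longrightarrow> (\<And>g. g \<in> M \<Longrightarrow> ip g h = 0) \<Longrightarrow> h = 0"
    and h: "h \<in> ell2 A" and e: "e > 0"
  obtains g where "g \<in> M" "ell2_norm (h - g) \<le> e"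
proof -
  define D where "D = (\<lambda>g. ell2_norm (h - g)) ` M"
  define \<delta> where "\<delta> = Inf D"
  have bdd: "bdd_below D"
    unfolding D_def by (rule bdd_belowI2[where m = 0]) simp
  have \<delta>le: "\<delta> \<le> ell2_norm (h - g)" if "g \<in> M" for g
    unfolding \<delta>_def using that bdd by (intro cInf_lower) (auto simp: D_def)
  have ne: "D \<noteq> {}"
    using M(2) by (auto simp: D_def)
  have \<delta>0: "0 \<le> \<delta>"
    unfolding \<delta>_def using ne by (intro cInf_greatest) (auto simp: D_def)
  have "\<exists>g\<in>M. ell2_norm (h - g) < \<delta> + inverse (real (Suc n))" for n
  proof -
    have "Inf D < \<delta> + inverse (real (Suc n))"
      by (simp add: \<delta>_def)
    from cInf_lessD[OF ne this] show ?thesis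
      by (auto simp: D_def)
  qed
  then obtain G where G: "\<And>n. G n \<in> M" "\<And>n. ell2_norm (h - G n) < \<delta> + inverse (real (Suc n))"
    by metis
  have GA: "G n \<in> ell2 A" for n
    using G(1) M(1) by blast
  have hG: "h - G n \<in> ell2 A" for n
    by (rule ell2_diff[OF h GA])
  have par: "(ell2_norm (x + y))\<^sup>2 + (ell2_norm (x - y))\<^sup>2 = 2 * (ell2_norm x)\<^sup>2 + 2 * (ell2_norm y)\<^sup>2"
    if "x \<in> ell2 A" "y \<in> ell2 A" for x y
  proof -
    have "ip (x + y) (x + y) + ip (x - y) (x - y) = 2 * ip x x + 2 * ip y y"
      using that by (simp add: ip_add_left[where A = A and B = A and B' = A] ip_add_right[where A = A and B = A and B' = A]
          ip_diff_left[where A = A and B = A and B' = A] ip_diff_right[where A = A and B = A and B' = A])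
    then have "complex_of_real ((ell2_norm (x + y))\<^sup>2 + (ell2_norm (x - y))\<^sup>2) = of_real (2 * (ell2_norm x)\<^sup>2 + 2 * (ell2_norm y)\<^sup>2)"
      using that by (simp add: ip_self[where A = A])
    then show ?thesis
      using of_real_eq_iff by blast
  qed
  have close: "(ell2_norm (G m - G n))\<^sup>2 \<le> 2 * (\<delta> + inverse (real (Suc m)))\<^sup>2 + 2 * (\<delta> + inverse (real (Suc n)))\<^sup>2 - 4 * \<delta>\<^sup>2" for m n
  proof -
    \<comment> \<open>The midpoint lies in \<open>M\<close>, so its distance from \<open>h\<close>
      is at least \<open>\<delta>\<close>; this is the lower bound that the parallelogram law
      needs.\<close>
    have "vscale (1/2) (G m + G n) \<in> M"
      using G M by auto
    then have "\<delta> \<le> ell2_norm (h - vscale (1/2) (G m + G n))"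
      by (rule \<delta>le)
    also have "(h - G m) + (h - G n) = vscale 2 (h - vscale (1/2) (G m + G n))"
      by (auto simp: fun_eq_iff pointwise algebra_simps)
    then have "ell2_norm ((h - G m) + (h - G n)) = 2 * ell2_norm (h - vscale (1/2) (G m + G n))"
      by simp
    ultimately have "2 * \<delta> \<le> ell2_norm ((h - G m) + (h - G n))"
      by simp
    then have "(2 * \<delta>)\<^sup>2 \<le> (ell2_norm ((h - G m) + (h - G n)))\<^sup>2"
      using \<delta>0 by (intro power_mono) auto
    moreover have "(h - G m) - (h - G n) = G n - G m"
      by (auto simp: fun_eq_iff pointwise)
    moreover have "(ell2_norm (h - G m))\<^sup>2 \<le> (\<delta> + inverse (real (Suc m)))\<^sup>2" "(ell2_norm (h - G n))\<^sup>2 \<le> (\<delta> + inverse (real (Suc n)))\<^sup>2"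
      using G(2)[of m] G(2)[of n] by (auto intro!: power_mono)
    ultimately show ?thesis
      using par[OF hG hG, of m n] by (simp add: ell2_norm_minus_commute[of "G n"])
  qed
  have lim0: "(\<lambda>n. (\<delta> + inverse (real (Suc n)))\<^sup>2) \<longlonglongrightarrow> (\<delta> + 0)\<^sup>2"
    by (intro tendsto_intros LIMSEQ_inverse_real_of_nat)
  obtain l where l: "l \<in> ell2 A" "(\<lambda>n. ell2_norm (G n - l)) \<longlonglongrightarrow> 0"
  proof (rule ell2_complete[of G A])
    show "G n \<in> ell2 A" for n
      by (rule GA)
    fix e :: real assume e: "e > 0"
    then have "e\<^sup>2 / 4 > 0"
      by simp
    then obtain N where N: "\<And>n. n \<ge> N \<Longrightarrow> \<bar>(\<delta> + inverse (real (Suc n)))\<^sup>2 - \<delta>\<^sup>2\<bar> < e\<^sup>2 / 4"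
      using LIMSEQ_D[OF lim0, of "e\<^sup>2 / 4"] by auto
    have "ell2_norm (G m - G n) \<le> e" if "m \<ge> N" "n \<ge> N" for m n
    proof -
      have "(ell2_norm (G m - G n))\<^sup>2 \<le> e\<^sup>2"
        using close[of m n] N[OF that(1)] N[OF that(2)] by linarith
      then show ?thesis
        using e by (simp add: power2_le_iff_abs_le)
    qed
    then show "\<exists>N. \<forall>m\<ge>N. \<forall>n\<ge>N. ell2_norm (G m - G n) \<le> e"
      by blast
  qed
  have gA: "g \<in> ell2 A" if "g \<in> M" for g
    using that M(1) by blast
  have hl: "h - l \<in> ell2 A"
    using h l by simp
  \<comment> \<open>The limit \<open>l\<close> need not lie in \<open>M\<close> itself, so
    minimality is transported to it from the \<open>G n\<close>.\<close>
  have min: "ell2_norm (h - l) \<le> ell2_norm (h - l - g)" if g: "g \<in> M" for g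
  proof (rule LIMSEQ_le)
    have ub: "\<delta> \<le> ell2_norm (h - l - g) + ell2_norm (G n - l)" for n
    proof -
      have "\<delta> \<le> ell2_norm (h - (g + G n))"
        using G g M by (intro \<delta>le) auto
      also have "h - (g + G n) = (h - l - g) - (G n - l)"
        by (auto simp: fun_eq_iff pointwise)
      also have "ell2_norm \<dots> \<le> ell2_norm (h - l - g) + ell2_norm (G n - l)"
        using h l(1) GA gA[OF g] by (intro ell2_norm_triangle_diff[where A = A and B = A] ell2_diff)
      finally show ?thesis .
    qed
    have lb: "ell2_norm (h - l) \<le> (\<delta> + inverse (real (Suc n))) + ell2_norm (G n - l)" for n
    proof -
      have eq: "(h - G n) + (G n - l) = h - l"
        by (simp add: fun_eq_iff pointwise)
      have "ell2_norm (h - l) \<le> ell2_norm (h - G n) + ell2_norm (G n - l)"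
        using ell2_norm_triangle[OF hG[of n] ell2_diff[OF GA[of n] l(1)]] unfolding eq .
      then show ?thesis
        by (rule order_trans) (use G(2)[of n] in \<open>intro add_right_mono less_imp_le\<close>)
    qed
    have "ell2_norm (h - l) \<le> ell2_norm (h - l - g) + inverse (real (Suc n)) + 2 * ell2_norm (G n - l)" for n
      using lb[of n] ub[of n] by simp
    then show "\<exists>N. \<forall>n\<ge>N. ell2_norm (h - l) \<le> ell2_norm (h - l - g) + inverse (real (Suc n)) + 2 * ell2_norm (G n - l)"
      by blast
    show "(\<lambda>n. ell2_norm (h - l)) \<longlonglongrightarrow> ell2_norm (h - l)"
      by simp
    have "(\<lambda>n. ell2_norm (h - l - g) + inverse (real (Suc n)) + 2 * ell2_norm (G n - l)) \<longlonglongrightarrow> ell2_norm (h - l - g) + 0 + 2 * 0"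
      by (intro tendsto_intros LIMSEQ_inverse_real_of_nat l(2))
    then show "(\<lambda>n. ell2_norm (h - l - g) + inverse (real (Suc n)) + 2 * ell2_norm (G n - l)) \<longlonglongrightarrow> ell2_norm (h - l - g)"
      by simp
  qed
  have "ip g (h - l) = 0" if g: "g \<in> M" for g
  proof -
    note gA = gA[OF g]
    \<comment> \<open>With first coefficient \<open>0\<close> the quadratic inequality forces the
      inner product to vanish.\<close>
    have "(cmod (ip (h - l) g))\<^sup>2 \<le> 0 * (ell2_norm g)\<^sup>2"
    proof (rule quadratic_Cauchy_Schwarz)
      fix c
      have eq: "h - l - vscale (- c) g = (h - l) + vscale c g"
        by (simp add: fun_eq_iff pointwise)
      have "(ell2_norm (h - l))\<^sup>2 \<le> (ell2_norm (h - l - vscale (- c) g))\<^sup>2"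
        using g M(4) by (intro power_mono min) auto
      then show "0 \<le> 0 + 2 * Re (c * ip (h - l) g) + (cmod c)\<^sup>2 * (ell2_norm g)\<^sup>2"
        unfolding eq ell2_norm_add_scale[OF hl gA] by simp
    qed auto
    then show ?thesis
      using ip_cnj[of "h - l" g] by simp
  qed
  then have "h - l = 0"
    using triv[OF hl] by blast
  then have "h = l"
    by simp
  obtain n where "ell2_norm (G n - l) < e"
    using LIMSEQ_D[OF l(2) e] by auto
  then have "ell2_norm (h - G n) \<le> e"
    using \<open>h = l\<close> by (simp add: ell2_norm_minus_commute)
  then show thesis
    using that G(1) by blast
qed

subsection \<open>Dilation by a block unitary\<close>

lemma vscale_add: "vscale c (f + g) = vscale c f + vscale c g"
  by (simp add: fun_eq_iff pointwise distrib_left)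

lemma vscale_vscale: "vscale b (vscale c f) = vscale (b * c) f"
  by (simp add: fun_eq_iff pointwise)

lemma vscale_sum: "vscale c (\<Sum>i\<in>I. f i) = (\<Sum>i\<in>I. vscale c (f i))"
  by (rule ext) (simp add: vscale_apply sum_fun_apply sum_distrib_left)

lemma sum_pairs: "(\<Sum>s\<in>(UNIV :: ('k::finite \<times> 'l::finite) set). F s) = (\<Sum>k\<in>UNIV. \<Sum>l\<in>UNIV. F (k, l))"
  by (simp add: sum.cartesian_product)

text \<open>Common shape of the limit arguments: a cutoff costing \<open>e\<close> is chosen first,
  then the remaining part \<open>g\<close> tends to \<open>0\<close>.\<close>

lemma tendsto_zero_approx:
  assumes "\<And>m. 0 \<le> X m" "\<And>e. e > 0 \<Longrightarrow> \<exists>g. g \<longlonglongrightarrow> 0 \<and> (\<forall>m. X m \<le> e + g m)"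
  shows "X \<longlonglongrightarrow> (0 :: real)"
proof (rule LIMSEQ_I)
  fix r :: real assume r: "r > 0"
  then obtain g where g: "g \<longlonglongrightarrow> 0" "\<And>m. X m \<le> r / 2 + g m"
    using assms(2)[of "r / 2"] by auto
  obtain N where N: "\<And>n. n \<ge> N \<Longrightarrow> \<bar>g n\<bar> < r / 2"
    using LIMSEQ_D[OF g(1), of "r / 2"] r by auto
  have "norm (X n - 0) < r" if "n \<ge> N" for n
    using g(2)[of n] N[OF that] assms(1)[of n] by simp
  then show "\<exists>N. \<forall>n\<ge>N. norm (X n - 0) < r"
    by blast
qed

text \<open>This is the variance identity, read off from the expansion at
  \<open>c = - \<phi> x\<close>; through it captured mass and deviation add up to the second
  moment.\<close>

lemma state_norm_center:
  assumes s: "state A \<phi>" and x: "x \<in> bop A"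
  shows "(state_norm A \<phi> (x - oscale (\<phi> x) (id_op A)))\<^sup>2 = (state_norm A \<phi> x)\<^sup>2 - (cmod (\<phi> x))\<^sup>2"
proof -
  have eq: "x - oscale (\<phi> x) (id_op A) = x + oscale (- \<phi> x) (id_op A)"
    by (simp add: fun_eq_iff pointwise)
  have "\<phi> (adj A (x - oscale (\<phi> x) (id_op A)) \<circ> (x - oscale (\<phi> x) (id_op A))) = \<phi> (adj A x \<circ> x) - \<phi> x * cnj (\<phi> x)"
    unfolding eq state_expand[OF s x bop_id] using x by (simp add: state_id[OF s] state_adj[OF s x])
  then have "complex_of_real ((state_norm A \<phi> (x - oscale (\<phi> x) (id_op A)))\<^sup>2) = of_real ((state_norm A \<phi> x)\<^sup>2 - (cmod (\<phi> x))\<^sup>2)"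
    using x state_norm_power2(1)[OF s x] state_norm_power2(1)[OF s, of "x - oscale (\<phi> x) (id_op A)"]
    by (simp add: complex_norm_square del: of_real_power)
  then show ?thesis
    using of_real_eq_iff by blast
qed

text \<open>
  \<open>c\<close> is a factor of the matrix of a state \<open>\<psi>\<close>.  Then \<open>dil_T U k l x\<close> is a block of \<open>U\<^sup>* (x \<otimes> 1) U\<close>, and
  \<open>dil_P U c y\<close> is the image of \<open>U (y \<otimes> 1) U\<^sup>*\<close> under \<open>id \<otimes> \<psi>\<close>.
\<close>

definition dil_T :: "('k::finite \<Rightarrow> 'k \<Rightarrow> 'a op) \<Rightarrow> 'k \<Rightarrow> 'k \<Rightarrow> 'a op \<Rightarrow> 'a op" where
  "dil_T U k l x = (\<Sum>i\<in>UNIV. adj UNIV (U i k) \<circ> x \<circ> U i l)"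

text \<open>In \<open>s = (k, t)\<close> the first entry is a row of blocks and the second a row of
  \<open>c\<close>. Summing over \<open>t\<close> replaces the weights of \<open>\<psi>\<close> by
  plain sums of squares, because the matrix of \<open>\<psi>\<close> is the Gram matrix of the
  columns of \<open>c\<close>.\<close>

definition dil_R :: "('k::finite \<Rightarrow> 'k \<Rightarrow> 'a op) \<Rightarrow> ('k \<Rightarrow> 'k \<Rightarrow> complex) \<Rightarrow> 'k \<times> 'k \<Rightarrow> 'a op \<Rightarrow> 'a op" where
  "dil_R U c s x = (\<Sum>l\<in>UNIV. oscale (c (snd s) l) (dil_T U (fst s) l x))"

text \<open>These are the Kraus operators of \<open>dil_P\<close>.\<close>

definition dil_W :: "('k::finite \<Rightarrow> 'k \<Rightarrow> 'a op) \<Rightarrow> ('k \<Rightarrow> 'k \<Rightarrow> complex) \<Rightarrow> 'k \<times> 'k \<Rightarrow> 'a op" where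
  "dil_W U c s = (\<Sum>l\<in>UNIV. oscale (c (snd s) l) (adj UNIV (U l (fst s))))"

definition dil_P :: "('k::finite \<Rightarrow> 'k \<Rightarrow> 'a op) \<Rightarrow> ('k \<Rightarrow> 'k \<Rightarrow> complex) \<Rightarrow> 'a op \<Rightarrow> 'a op" where
  "dil_P U c y = (\<Sum>s\<in>UNIV. adj UNIV (dil_W U c s) \<circ> y \<circ> dil_W U c s)"

text \<open>\<open>c_norm\<close> expresses that \<open>\<psi>\<close> has total mass
  \<open>1\<close>, \<open>d\<close> inverts \<open>c\<close>, and \<open>duality\<close> is the
  invariance of the product state in the form in which it is used. The block unitary stays abstract;
  the micromaser enters through a later locale.\<close>

locale dilation =
  fixes U :: "'k::finite \<Rightarrow> 'k \<Rightarrow> 'a op" and c d :: "'k \<Rightarrow> 'k \<Rightarrow> complex" and \<phi> :: "'a op \<Rightarrow> complex"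
  assumes state: "state UNIV \<phi>"
    and U_bop [simp]: "\<And>i k. U i k \<in> bop UNIV"
    and U_iso: "\<And>k l. (\<Sum>i\<in>UNIV. adj UNIV (U i k) \<circ> U i l) = (if k = l then id_op UNIV else 0)"
    and U_coiso: "\<And>i j. (\<Sum>k\<in>UNIV. U i k \<circ> adj UNIV (U j k)) = (if i = j then id_op UNIV else 0)"
    and c_norm: "(\<Sum>t\<in>UNIV. \<Sum>l\<in>UNIV. (cmod (c t l))\<^sup>2) = 1"
    and c_inv: "\<And>l l'. (\<Sum>t\<in>UNIV. d l t * c t l') = (if l = l' then 1 else 0)"
    and duality: "\<And>x y z. x \<in> bop UNIV \<Longrightarrow> y \<in> bop UNIV \<Longrightarrow> z \<in> bop UNIV \<Longrightarrow>
      (\<Sum>s\<in>UNIV. \<phi> (adj UNIV (dil_R U c s x) \<circ> y \<circ> dil_R U c s z)) = \<phi> (adj UNIV x \<circ> dil_P U c y \<circ> z)"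
begin

abbreviation T where "T \<equiv> dil_T U"
abbreviation R where "R \<equiv> dil_R U c"
abbreviation W where "W \<equiv> dil_W U c"
abbreviation P where "P \<equiv> dil_P U c"
abbreviation sn where "sn \<equiv> state_norm UNIV \<phi>"

text \<open>The last letter acts first, as in \<open>J\<^sub>n\<close>, where the coupling to the
  last atom is applied first.\<close>

definition Rw :: "('k \<times> 'k) list \<Rightarrow> 'a op \<Rightarrow> 'a op" where
  "Rw S x = foldr R S x"

lemma Rw_simps [simp]: "Rw [] x = x" "Rw (s # S) x = R s (Rw S x)" "Rw (S @ S') x = Rw S (Rw S' x)"
  by (simp_all add: Rw_def)

lemma T_bop [simp]: "x \<in> bop UNIV \<Longrightarrow> T k l x \<in> bop UNIV"
  unfolding dil_T_def by (intro bop_sum_ops bop_comp adj_bop U_bop)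

lemma R_bop [simp]: "x \<in> bop UNIV \<Longrightarrow> R s x \<in> bop UNIV"
  unfolding dil_R_def by (intro bop_sum_ops bop_oscale T_bop)

lemma W_bop [simp]: "W s \<in> bop UNIV"
  unfolding dil_W_def by (intro bop_sum_ops bop_oscale adj_bop U_bop)

lemma P_bop [simp]: "x \<in> bop UNIV \<Longrightarrow> P x \<in> bop UNIV"
  unfolding dil_P_def by (intro bop_sum_ops bop_comp adj_bop W_bop)

lemma P_pow_bop [simp]: "x \<in> bop UNIV \<Longrightarrow> (P ^^ m) x \<in> bop UNIV"
  by (induction m) auto

lemma Rw_bop [simp]: "x \<in> bop UNIV \<Longrightarrow> Rw S x \<in> bop UNIV"
  by (induction S) auto

lemma adjU_add: "f \<in> ell2 UNIV \<Longrightarrow> g \<in> ell2 UNIV \<Longrightarrow> adj UNIV (U i k) (f + g) = adj UNIV (U i k) f + adj UNIV (U i k) g"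
  by (rule bop_add[OF adj_bop[OF U_bop]])

lemma adjU_scale: "f \<in> ell2 UNIV \<Longrightarrow> adj UNIV (U i k) (vscale b f) = vscale b (adj UNIV (U i k) f)"
  by (rule bop_scale[OF adj_bop[OF U_bop]])

lemma T_plus: "x \<in> bop UNIV \<Longrightarrow> y \<in> bop UNIV \<Longrightarrow> T k l (x + y) = T k l x + T k l y"
  by (rule ext) (simp add: dil_T_def op_sum_apply adjU_add sum.distrib)

lemma T_oscale: "x \<in> bop UNIV \<Longrightarrow> T k l (oscale b x) = oscale b (T k l x)"
  by (rule ext) (simp add: dil_T_def op_sum_apply adjU_scale vscale_sum)

lemma R_plus: "x \<in> bop UNIV \<Longrightarrow> y \<in> bop UNIV \<Longrightarrow> R s (x + y) = R s x + R s y"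
  by (rule ext) (simp add: dil_R_def op_sum_apply T_plus vscale_add sum.distrib)

lemma R_oscale: "x \<in> bop UNIV \<Longrightarrow> R s (oscale b x) = oscale b (R s x)"
  by (rule ext) (simp add: dil_R_def op_sum_apply T_oscale vscale_sum vscale_vscale mult.commute)

lemma Rw_plus: "x \<in> bop UNIV \<Longrightarrow> y \<in> bop UNIV \<Longrightarrow> Rw S (x + y) = Rw S x + Rw S y"
  by (induction S) (simp_all add: R_plus)

lemma Rw_oscale: "x \<in> bop UNIV \<Longrightarrow> Rw S (oscale b x) = oscale b (Rw S x)"
  by (induction S) (simp_all add: R_oscale)

lemma Rw_minus: "x \<in> bop UNIV \<Longrightarrow> y \<in> bop UNIV \<Longrightarrow> Rw S (x - y) = Rw S x - Rw S y"
  unfolding op_diff_eq by (simp add: Rw_plus Rw_oscale)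

lemma Rw_sum:
  assumes "\<And>i. i \<in> I \<Longrightarrow> x i \<in> bop UNIV"
  shows "Rw S (\<Sum>i\<in>I. x i) = (\<Sum>i\<in>I. Rw S (x i))"
proof (rule clinear_sum[where t = oscale and A = UNIV])
  show "clinear_map_on (bop UNIV) oscale oscale (Rw S)"
    by (simp add: clinear_map_on_def Rw_plus Rw_oscale)
qed (use assms in \<open>simp_all add: fun_eq_iff[of "oscale 0 _"]\<close>)

lemma T_id: "T k l (id_op UNIV) = (if k = l then id_op UNIV else 0)"
  unfolding dil_T_def by (simp add: U_iso)

definition eps :: "'k \<times> 'k \<Rightarrow> complex" where
  "eps s = c (snd s) (fst s)"

lemma R_id: "R s (id_op UNIV) = oscale (eps s) (id_op UNIV)"
proof -
  have "R s (id_op UNIV) = (\<Sum>l\<in>UNIV. if l = fst s then oscale (c (snd s) l) (id_op UNIV) else 0)"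
    unfolding dil_R_def T_id by (intro sum.cong) (auto simp: fun_eq_iff[of "oscale _ 0"])
  then show ?thesis
    by (simp add: eps_def)
qed

definition epsw :: "('k \<times> 'k) list \<Rightarrow> complex" where
  "epsw S = prod_list (map eps S)"

lemma Rw_id: "Rw S (id_op UNIV) = oscale (epsw S) (id_op UNIV)"
proof (induction S)
  case (Cons s S)
  have "R s (oscale (epsw S) (id_op UNIV)) = oscale (epsw S) (oscale (eps s) (id_op UNIV))"
    by (simp add: R_oscale R_id)
  also have "\<dots> = oscale (epsw (s # S)) (id_op UNIV)"
    by (rule ext) (simp add: vscale_vscale epsw_def mult.commute)
  finally show ?case
    by (simp only: Rw_simps Cons)
qed (simp add: epsw_def fun_eq_iff[of "oscale 1 _"])

lemma sum_eps: "(\<Sum>s\<in>UNIV. (cmod (eps s))\<^sup>2) = 1"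
  using c_norm unfolding sum_pairs eps_def by (subst sum.swap) simp

lemma sum_epsw: "(\<Sum>S\<in>words n. (cmod (epsw S))\<^sup>2) = 1"
proof (induction n)
  case (Suc n)
  have "(\<Sum>S\<in>words (Suc n). (cmod (epsw S))\<^sup>2) = (\<Sum>s\<in>UNIV. (cmod (eps s))\<^sup>2 * (\<Sum>S\<in>words n. (cmod (epsw S))\<^sup>2))"
    by (simp add: sum_words_Suc epsw_def norm_mult power_mult_distrib sum_distrib_left)
  then show ?case
    by (simp add: Suc sum_eps)
qed (simp add: epsw_def)

section \<open>Isometry of the block unitary and column estimates\<close>

lemma U_coiso_ip:
  assumes "\<And>i. h i \<in> ell2 UNIV" "\<And>i. h' i \<in> ell2 UNIV"
  shows "(\<Sum>k\<in>UNIV. ip (\<Sum>i\<in>UNIV. adj UNIV (U i k) (h i)) (\<Sum>j\<in>UNIV. adj UNIV (U j k) (h' j))) = (\<Sum>i\<in>UNIV. ip (h i) (h' i))"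
proof -
  have bb: "adj UNIV (U i k) f \<in> ell2 UNIV" for i k f
    by simp
  have "(\<Sum>k\<in>UNIV. ip (\<Sum>i\<in>UNIV. adj UNIV (U i k) (h i)) (\<Sum>j\<in>UNIV. adj UNIV (U j k) (h' j)))
      = (\<Sum>k\<in>UNIV. \<Sum>i\<in>UNIV. \<Sum>j\<in>UNIV. ip (h i) ((U i k \<circ> adj UNIV (U j k)) (h' j)))"
    using assms bb
    by (simp add: ip_sum_left[where A = UNIV and B = UNIV] ip_sum_right[where A = UNIV and B = UNIV] adj_ip)
      (rule sum.cong[OF refl], rule sum.swap)
  also have "\<dots> = (\<Sum>i\<in>UNIV. \<Sum>k\<in>UNIV. \<Sum>j\<in>UNIV. ip (h i) ((U i k \<circ> adj UNIV (U j k)) (h' j)))"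
    by (rule sum.swap)
  also have "\<dots> = (\<Sum>i\<in>UNIV. \<Sum>j\<in>UNIV. \<Sum>k\<in>UNIV. ip (h i) ((U i k \<circ> adj UNIV (U j k)) (h' j)))"
    by (intro sum.cong refl sum.swap)
  also have "\<dots> = (\<Sum>i\<in>UNIV. \<Sum>j\<in>UNIV. ip (h i) ((\<Sum>k\<in>UNIV. U i k \<circ> adj UNIV (U j k)) (h' j)))"
    unfolding op_sum_apply
    by (intro sum.cong refl ip_sum_right[symmetric, where A = UNIV and B = UNIV]) (simp_all add: assms)
  also have "\<dots> = (\<Sum>i\<in>UNIV. \<Sum>j\<in>UNIV. if i = j then ip (h i) (h' j) else 0)"
    unfolding U_coiso by (intro sum.cong refl) (simp add: assms)
  finally show ?thesis
    by simp
qed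

lemma norm_sq_via_ip:
  assumes "\<And>i. i \<in> I \<Longrightarrow> f i \<in> ell2 A" "\<And>j. j \<in> J \<Longrightarrow> g j \<in> ell2 A"
    and "(\<Sum>i\<in>I. ip (f i) (f i)) = (\<Sum>j\<in>J. of_real (b j) * ip (g j) (g j))"
  shows "(\<Sum>i\<in>I. (ell2_norm (f i))\<^sup>2) = (\<Sum>j\<in>J. b j * (ell2_norm (g j))\<^sup>2)"
proof -
  have "complex_of_real (\<Sum>i\<in>I. (ell2_norm (f i))\<^sup>2) = (\<Sum>i\<in>I. ip (f i) (f i))"
    using assms(1) by (simp add: ip_self[where A = A])
  moreover have "complex_of_real (\<Sum>j\<in>J. b j * (ell2_norm (g j))\<^sup>2) = (\<Sum>j\<in>J. of_real (b j) * ip (g j) (g j))"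
    using assms(2) by (simp add: ip_self[where A = A])
  ultimately have "complex_of_real (\<Sum>i\<in>I. (ell2_norm (f i))\<^sup>2) = of_real (\<Sum>j\<in>J. b j * (ell2_norm (g j))\<^sup>2)"
    using assms(3) by simp
  then show ?thesis
    using of_real_eq_iff by blast
qed

lemma U_coiso_norm:
  assumes "\<And>i. h i \<in> ell2 UNIV"
  shows "(\<Sum>k\<in>UNIV. (ell2_norm (\<Sum>i\<in>UNIV. adj UNIV (U i k) (h i)))\<^sup>2) = (\<Sum>i\<in>UNIV. (ell2_norm (h i))\<^sup>2)"
  using norm_sq_via_ip[of UNIV "\<lambda>k. \<Sum>i\<in>UNIV. adj UNIV (U i k) (h i)" UNIV UNIV h "\<lambda>_. 1"]
    U_coiso_ip[OF assms assms] assms by simp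

text \<open>The family on the left is the image under \<open>U\<close> of the product of
  \<open>g\<close> with the vector \<open>a\<close>, so this is isometry on product vectors.\<close>

lemma U_iso_norm:
  assumes g: "g \<in> ell2 UNIV"
  shows "(\<Sum>i\<in>UNIV. (ell2_norm (\<Sum>l\<in>UNIV. vscale (a l) (U i l g)))\<^sup>2) = (\<Sum>l\<in>UNIV. (cmod (a l))\<^sup>2) * (ell2_norm g)\<^sup>2"
proof -
  have "(\<Sum>i\<in>UNIV. ip (\<Sum>l\<in>UNIV. vscale (a l) (U i l g)) (\<Sum>l\<in>UNIV. vscale (a l) (U i l g)))
      = (\<Sum>i\<in>UNIV. \<Sum>l\<in>UNIV. \<Sum>l'\<in>UNIV. cnj (a l) * a l' * ip g ((adj UNIV (U i l) \<circ> U i l') g))"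
    using g by (simp add: ip_sum_left[where A = UNIV and B = UNIV] ip_sum_right[where A = UNIV and B = UNIV]
        adj_ip_right sum_distrib_left mult.assoc)
      (rule sum.cong[OF refl], subst sum.swap, simp add: mult.left_commute)
  also have "\<dots> = (\<Sum>l\<in>UNIV. \<Sum>i\<in>UNIV. \<Sum>l'\<in>UNIV. cnj (a l) * a l' * ip g ((adj UNIV (U i l) \<circ> U i l') g))"
    by (rule sum.swap)
  also have "\<dots> = (\<Sum>l\<in>UNIV. \<Sum>l'\<in>UNIV. \<Sum>i\<in>UNIV. cnj (a l) * a l' * ip g ((adj UNIV (U i l) \<circ> U i l') g))"
    by (intro sum.cong refl sum.swap)
  also have "\<dots> = (\<Sum>l\<in>UNIV. \<Sum>l'\<in>UNIV. cnj (a l) * a l' * ip g ((\<Sum>i\<in>UNIV. adj UNIV (U i l) \<circ> U i l') g))"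
    unfolding op_sum_apply sum_distrib_left[symmetric]
    by (intro sum.cong refl arg_cong[where f = "(*) _"] ip_sum_right[symmetric, where A = UNIV and B = UNIV])
      (simp_all add: g)
  also have "\<dots> = (\<Sum>l\<in>UNIV. \<Sum>l'\<in>UNIV. if l = l' then cnj (a l) * a l' * ip g g else 0)"
    unfolding U_iso by (intro sum.cong refl) (simp add: g)
  also have "\<dots> = (\<Sum>l\<in>UNIV. of_real ((cmod (a l))\<^sup>2) * ip g g)"
    by (simp add: complex_norm_square mult.commute del: of_real_power)
  finally have "(\<Sum>i\<in>UNIV. (ell2_norm (\<Sum>l\<in>UNIV. vscale (a l) (U i l g)))\<^sup>2) = (\<Sum>l\<in>UNIV. (cmod (a l))\<^sup>2 * (ell2_norm g)\<^sup>2)"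
    by (intro norm_sq_via_ip[where A = UNIV]) (simp_all add: g)
  then show ?thesis
    by (simp add: sum_distrib_right)
qed

text \<open>Read from the inside: \<open>g\<close> is tensored with the row \<open>snd s\<close> of
  \<open>c\<close>, mapped by \<open>U\<close>, hit by \<open>x\<close> in the first factor, mapped
  back by the adjoint of \<open>U\<close>, and the component \<open>fst s\<close> is taken. The norm
  estimates rest on this order.\<close>

lemma R_apply:
  assumes x: "x \<in> bop UNIV"
  shows "R s x g = (\<Sum>i\<in>UNIV. adj UNIV (U i (fst s)) (x (\<Sum>l\<in>UNIV. vscale (c (snd s) l) (U i l g))))"
proof -
  have "x (\<Sum>l\<in>UNIV. vscale (c (snd s) l) (U i l g)) = (\<Sum>l\<in>UNIV. vscale (c (snd s) l) (x (U i l g)))" for i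
    by (subst bop_sum[OF x]) (simp_all add: bop_scale[OF x])
  moreover have "adj UNIV (U i (fst s)) (\<Sum>l\<in>UNIV. vscale (c (snd s) l) (x (U i l g)))
      = (\<Sum>l\<in>UNIV. vscale (c (snd s) l) (adj UNIV (U i (fst s)) (x (U i l g))))" for i
    by (subst bop_sum[OF adj_bop[OF U_bop]]) (simp_all add: adjU_scale x)
  ultimately have "(\<Sum>i\<in>UNIV. adj UNIV (U i (fst s)) (x (\<Sum>l\<in>UNIV. vscale (c (snd s) l) (U i l g))))
      = (\<Sum>i\<in>UNIV. \<Sum>l\<in>UNIV. vscale (c (snd s) l) (adj UNIV (U i (fst s)) (x (U i l g))))"
    by simp
  also have "\<dots> = (\<Sum>l\<in>UNIV. \<Sum>i\<in>UNIV. vscale (c (snd s) l) (adj UNIV (U i (fst s)) (x (U i l g))))"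
    by (rule sum.swap)
  finally show ?thesis
    by (simp add: dil_R_def dil_T_def op_sum_apply vscale_sum)
qed

text \<open>Both passages through \<open>U\<close> preserve norms and the rows of \<open>c\<close>
  have total squared norm \<open>1\<close>, so nothing is gained beyond the bound of the column
  \<open>x\<close>. A whole family \<open>x\<close> is treated because words are built up letter by
  letter.\<close>

lemma R_column:
  assumes x: "\<And>j. j \<in> J \<Longrightarrow> x j \<in> bop UNIV" and g: "g \<in> ell2 UNIV"
    and C: "\<And>f. f \<in> ell2 UNIV \<Longrightarrow> (\<Sum>j\<in>J. (ell2_norm (x j f))\<^sup>2) \<le> C\<^sup>2 * (ell2_norm f)\<^sup>2"
  shows "(\<Sum>s\<in>UNIV. \<Sum>j\<in>J. (ell2_norm (R s (x j) g))\<^sup>2) \<le> C\<^sup>2 * (ell2_norm g)\<^sup>2"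
proof -
  define v where "v t i = (\<Sum>l\<in>UNIV. vscale (c t l) (U i l g))" for t i
  have v: "v t i \<in> ell2 UNIV" for t i
    by (simp add: v_def)
  have "(\<Sum>s\<in>UNIV. \<Sum>j\<in>J. (ell2_norm (R s (x j) g))\<^sup>2)
      = (\<Sum>t\<in>UNIV. \<Sum>j\<in>J. \<Sum>k\<in>UNIV. (ell2_norm (R (k, t) (x j) g))\<^sup>2)"
    unfolding sum_pairs by (subst sum.swap) (intro sum.cong refl sum.swap)
  also have "\<dots> = (\<Sum>t\<in>UNIV. \<Sum>j\<in>J. \<Sum>i\<in>UNIV. (ell2_norm (x j (v t i)))\<^sup>2)"
  proof (rule sum.cong[OF refl], rule sum.cong[OF refl])
    fix t j assume "j \<in> J"
    show "(\<Sum>k\<in>UNIV. (ell2_norm (R (k, t) (x j) g))\<^sup>2) = (\<Sum>i\<in>UNIV. (ell2_norm (x j (v t i)))\<^sup>2)"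
      using U_coiso_norm[of "\<lambda>i. x j (v t i)"] x[OF \<open>j \<in> J\<close>] by (simp add: R_apply v_def)
  qed
  also have "\<dots> = (\<Sum>t\<in>UNIV. \<Sum>i\<in>UNIV. \<Sum>j\<in>J. (ell2_norm (x j (v t i)))\<^sup>2)"
    by (intro sum.cong refl sum.swap)
  also have "\<dots> \<le> (\<Sum>t\<in>UNIV. \<Sum>i\<in>UNIV. C\<^sup>2 * (ell2_norm (v t i))\<^sup>2)"
    by (intro sum_mono C v)
  also have "\<dots> = C\<^sup>2 * ((\<Sum>t\<in>UNIV. \<Sum>l\<in>UNIV. (cmod (c t l))\<^sup>2) * (ell2_norm g)\<^sup>2)"
    unfolding sum_distrib_left[symmetric] v_def U_iso_norm[OF g] sum_distrib_right[symmetric] ..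
  finally show ?thesis
    by (simp add: c_norm)
qed

lemma Rw_column:
  assumes x: "x \<in> bop UNIV" and C: "bounded_by x C"
  shows "g \<in> ell2 UNIV \<Longrightarrow> (\<Sum>S\<in>words m. (ell2_norm (Rw S x g))\<^sup>2) \<le> C\<^sup>2 * (ell2_norm g)\<^sup>2"
proof (induction m arbitrary: g)
  case 0
  then show ?case
    using bounded_by_power2[OF C] by simp
next
  case (Suc m)
  then show ?case
    unfolding sum_words_Suc using R_column[of "words m" "\<lambda>S. Rw S x" g C] x by simp
qed

text \<open>A single word is one member of the column of all words of its length.\<close>

lemma Rw_bounded_by:
  assumes x: "x \<in> bop UNIV" and C: "bounded_by x C"
  shows "bounded_by (Rw S x) C"
proof (rule bounded_byI)
  show "Rw S x \<in> bop UNIV" "0 \<le> C"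
    using x C by (auto simp: bounded_by_def)
  fix g :: "'a vec" assume g: "g \<in> ell2 UNIV"
  have "(ell2_norm (Rw S x g))\<^sup>2 \<le> (\<Sum>S\<in>words (length S). (ell2_norm (Rw S x g))\<^sup>2)"
    by (rule member_le_sum) (auto simp: words_def[of "length S"] finite_words[unfolded words_def])
  also have "\<dots> \<le> C\<^sup>2 * (ell2_norm g)\<^sup>2"
    by (rule Rw_column[OF x C g])
  finally have "(ell2_norm (Rw S x g))\<^sup>2 \<le> (C * ell2_norm g)\<^sup>2"
    by (simp add: power_mult_distrib)
  then show "ell2_norm (Rw S x g) \<le> C * ell2_norm g"
    by (rule power2_le_imp_le) (use C in \<open>simp add: bounded_by_def\<close>)
qed

text \<open>The first letter of a word is applied last, so \<open>duality\<close> peels it off and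
  moves \<open>y\<close> to \<open>P y\<close>; hence \<open>y\<close> is arbitrary in the
  induction.\<close>

lemma duality_words:
  assumes "x \<in> bop UNIV" "z \<in> bop UNIV"
  shows "y \<in> bop UNIV \<Longrightarrow> (\<Sum>S\<in>words m. \<phi> (adj UNIV (Rw S x) \<circ> y \<circ> Rw S z)) = \<phi> (adj UNIV x \<circ> (P ^^ m) y \<circ> z)"
proof (induction m arbitrary: y)
  case (Suc m)
  have "(\<Sum>S\<in>words (Suc m). \<phi> (adj UNIV (Rw S x) \<circ> y \<circ> Rw S z))
    = (\<Sum>S\<in>words m. \<Sum>s\<in>UNIV. \<phi> (adj UNIV (R s (Rw S x)) \<circ> y \<circ> R s (Rw S z)))"
    unfolding sum_words_Suc by (simp add: sum.swap[of _ "words m"])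
  also have "\<dots> = (\<Sum>S\<in>words m. \<phi> (adj UNIV (Rw S x) \<circ> P y \<circ> Rw S z))"
    using assms Suc.prems by (intro sum.cong refl duality) auto
  also have "\<dots> = \<phi> (adj UNIV x \<circ> (P ^^ m) (P y) \<circ> z)"
    by (rule Suc.IH) (simp add: Suc.prems)
  finally show ?case
    by (simp only: funpow_Suc_right comp_apply[of "P ^^ m" P y])
qed simp

lemma W_apply: "f \<in> ell2 UNIV \<Longrightarrow> W (k, t) f = (\<Sum>l\<in>UNIV. adj UNIV (U l k) (vscale (c t l) f))"
  by (simp add: dil_W_def op_sum_apply adjU_scale)

text \<open>For each row of \<open>c\<close> the family \<open>W (k, t) f\<close> is the adjoint of
  \<open>U\<close> applied to a product vector, and the rows have total squared norm
  \<open>1\<close>. This normalization makes \<open>P\<close> unital and the row of the adjoints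
  contractive.\<close>

lemma W_ip:
  assumes f: "f \<in> ell2 UNIV" and g: "g \<in> ell2 UNIV"
  shows "(\<Sum>s\<in>UNIV. ip (W s f) (W s g)) = ip f g"
proof -
  have "(\<Sum>s\<in>UNIV. ip (W s f) (W s g)) = (\<Sum>t\<in>UNIV. \<Sum>k\<in>UNIV. ip (W (k, t) f) (W (k, t) g))"
    unfolding sum_pairs by (rule sum.swap)
  also have "\<dots> = (\<Sum>t\<in>UNIV. \<Sum>l\<in>UNIV. ip (vscale (c t l) f) (vscale (c t l) g))"
    unfolding W_apply[OF f] W_apply[OF g] by (intro sum.cong refl U_coiso_ip) (simp_all add: f g)
  also have "\<dots> = (\<Sum>t\<in>UNIV. \<Sum>l\<in>UNIV. of_real ((cmod (c t l))\<^sup>2) * ip f g)"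
    by (intro sum.cong refl) (simp add: complex_norm_square mult_ac del: of_real_power)
  also have "\<dots> = of_real (\<Sum>t\<in>UNIV. \<Sum>l\<in>UNIV. (cmod (c t l))\<^sup>2) * ip f g"
    by (simp add: sum_distrib_right)
  finally show ?thesis
    by (simp add: c_norm)
qed

lemma W_norm: "f \<in> ell2 UNIV \<Longrightarrow> (\<Sum>s\<in>UNIV. (ell2_norm (W s f))\<^sup>2) = (ell2_norm f)\<^sup>2"
  using norm_sq_via_ip[of UNIV "\<lambda>s. W s f" UNIV "{()}" "\<lambda>_. f" "\<lambda>_. 1"] W_ip[of f f] by simp

lemma P_id: "P (id_op UNIV) = id_op UNIV"
proof (rule op_eqI[where A = UNIV])
  fix i j :: 'a
  have "P (id_op UNIV) (ket j) i = ip (ket i) (\<Sum>s\<in>UNIV. adj UNIV (W s) (W s (ket j)))"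
    by (simp add: dil_P_def op_sum_apply)
  also have "\<dots> = (\<Sum>s\<in>UNIV. ip (ket i) (adj UNIV (W s) (W s (ket j))))"
    by (rule ip_sum_right[where A = UNIV and B = UNIV]) auto
  also have "\<dots> = (\<Sum>s\<in>UNIV. ip (W s (ket i)) (W s (ket j)))"
    by (intro sum.cong refl adj_ip_right) auto
  also have "\<dots> = ip (ket i) (ket j)"
    by (rule W_ip) auto
  finally show "P (id_op UNIV) (ket j) i = id_op UNIV (ket j) i"
    by (simp only: ip_ket_left id_op_apply[OF ell2_ket[OF UNIV_I]])
qed auto

lemma P_pow_id: "(P ^^ m) (id_op UNIV) = id_op UNIV"
  by (induction m) (simp_all add: P_id)

lemma adj_P: "y \<in> bop UNIV \<Longrightarrow> adj UNIV (P y) = P (adj UNIV y)"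
  unfolding dil_P_def by (simp add: adj_sum adj_comp comp_assoc)

lemma adj_P_pow: "y \<in> bop UNIV \<Longrightarrow> adj UNIV ((P ^^ m) y) = (P ^^ m) (adj UNIV y)"
  by (induction m) (simp_all add: adj_P)

lemma P_norm:
  assumes y: "y \<in> bop UNIV" and f: "f \<in> ell2 UNIV"
  shows "(ell2_norm (P y f))\<^sup>2 \<le> (\<Sum>s\<in>UNIV. (ell2_norm (y (W s f)))\<^sup>2)"
  using adj_sum_contraction[of UNIV W UNIV "\<lambda>s. y (W s f)"] y W_norm
  by (simp add: dil_P_def op_sum_apply)

lemma P_bounded_by:
  assumes y: "y \<in> bop UNIV" and C: "bounded_by y C"
  shows "bounded_by (P y) C"
proof (rule bounded_byI)
  show "P y \<in> bop UNIV" "0 \<le> C"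
    using y C by (auto simp: bounded_by_def)
  fix f :: "'a vec" assume f: "f \<in> ell2 UNIV"
  have "(ell2_norm (P y f))\<^sup>2 \<le> (\<Sum>s\<in>UNIV. C\<^sup>2 * (ell2_norm (W s f))\<^sup>2)"
    by (rule order_trans[OF P_norm[OF y f]]) (intro sum_mono bounded_by_power2 C)
  also have "\<dots> = (C * ell2_norm f)\<^sup>2"
    by (simp add: sum_distrib_left[symmetric] W_norm[OF f] power_mult_distrib)
  finally show "ell2_norm (P y f) \<le> C * ell2_norm f"
    by (rule power2_le_imp_le) (use C in \<open>simp add: bounded_by_def\<close>)
qed

lemma P_pow_bounded_by: "y \<in> bop UNIV \<Longrightarrow> bounded_by y C \<Longrightarrow> bounded_by ((P ^^ m) y) C"
  by (induction m) (simp_all add: P_bounded_by)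

text \<open>Duality with the identity on both sides: \<open>R s\<close> multiplies the identity by
  \<open>eps s\<close>, and these numbers form a unit vector.\<close>

lemma state_P: "y \<in> bop UNIV \<Longrightarrow> \<phi> (P y) = \<phi> y"
proof -
  assume y: "y \<in> bop UNIV"
  have "\<phi> (P y) = (\<Sum>s\<in>UNIV. \<phi> (adj UNIV (R s (id_op UNIV)) \<circ> y \<circ> R s (id_op UNIV)))"
    using duality[of "id_op UNIV" y "id_op UNIV"] y by simp
  also have "\<dots> = (\<Sum>s\<in>UNIV. of_real ((cmod (eps s))\<^sup>2) * \<phi> y)"
  proof (intro sum.cong refl)
    fix s :: "'k \<times> 'k"
    have "adj UNIV (R s (id_op UNIV)) \<circ> y \<circ> R s (id_op UNIV) = oscale (of_real ((cmod (eps s))\<^sup>2)) y"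
      using y unfolding R_id
      by (simp add: adj_oscale oscale_comp comp_oscale[where A = UNIV] complex_norm_square mult.commute del: of_real_power)
        (rule ext, simp add: vscale_vscale mult.commute)
    then show "\<phi> (adj UNIV (R s (id_op UNIV)) \<circ> y \<circ> R s (id_op UNIV)) = of_real ((cmod (eps s))\<^sup>2) * \<phi> y"
      using state_scale[OF state y] by simp
  qed
  also have "\<dots> = of_real (\<Sum>s\<in>UNIV. (cmod (eps s))\<^sup>2) * \<phi> y"
    by (simp add: sum_distrib_right)
  finally show ?thesis
    by (simp add: sum_eps)
qed

text \<open>Kadison--Schwarz: \<open>P_norm\<close> compares \<open>P y\<close> with the column of
  the \<open>y \<circ> W s\<close>, whose total under \<open>\<phi>\<close> is the value at
  \<open>P (adj UNIV y \<circ> y)\<close>, and \<open>\<phi>\<close> is invariant under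
  \<open>P\<close>.\<close>

lemma sn_P:
  assumes y: "y \<in> bop UNIV"
  shows "sn (P y) \<le> sn y"
proof -
  have "(\<Sum>i\<in>{()}. (sn (P y))\<^sup>2) \<le> (\<Sum>s\<in>UNIV. (sn (y \<circ> W s))\<^sup>2)"
    by (rule state_norm_mono[OF state]) (simp_all add: y P_norm)
  also have "complex_of_real (\<Sum>s\<in>UNIV. (sn (y \<circ> W s))\<^sup>2) = \<phi> (P (adj UNIV y \<circ> y))"
    using y unfolding dil_P_def
    by (subst state_sum[OF state]) (simp_all add: state_norm_power2(1)[OF state, symmetric] adj_comp comp_assoc del: of_real_power)
  then have "(\<Sum>s\<in>UNIV. (sn (y \<circ> W s))\<^sup>2) = (sn y)\<^sup>2"
    unfolding state_P[OF bop_comp[OF adj_bop[OF y] y]] state_norm_power2(1)[OF state y] of_real_eq_iff .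
  finally show ?thesis
    by (intro power2_le_imp_le[of "sn (P y)" "sn y"]) (simp_all add: state_norm_ge_0[OF state] y)
qed

lemma sn_P_pow: "y \<in> bop UNIV \<Longrightarrow> sn ((P ^^ m) y) \<le> sn y"
proof (induction m)
  case (Suc m)
  then show ?case
    using sn_P[of "(P ^^ m) y"] by simp
qed simp

lemma sum_sn_Rw:
  assumes "x \<in> bop UNIV"
  shows "(\<Sum>S\<in>words m. (sn (Rw S x))\<^sup>2) = (sn x)\<^sup>2"
proof -
  have "complex_of_real (\<Sum>S\<in>words m. (sn (Rw S x))\<^sup>2) = (\<Sum>S\<in>words m. \<phi> (adj UNIV (Rw S x) \<circ> id_op UNIV \<circ> Rw S x))"
    using assms by (simp add: state_norm_power2(1)[OF state] comp_assoc)
  also have "\<dots> = of_real ((sn x)\<^sup>2)"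
    unfolding duality_words[OF assms assms bop_id] P_pow_id using assms
    by (simp add: state_norm_power2(1)[OF state])
  finally show ?thesis
    using of_real_eq_iff by blast
qed

text \<open>Duality with identities in the first two places. It says that \<open>\<phi> x\<close> is
  the component of the family \<open>\<phi> (Rw S x)\<close> along the unit vector
  \<open>epsw\<close>.\<close>

lemma sum_epsw_Rw:
  assumes "x \<in> bop UNIV"
  shows "(\<Sum>S\<in>words n. cnj (epsw S) * \<phi> (Rw S x)) = \<phi> x"
proof -
  have "(\<Sum>S\<in>words n. cnj (epsw S) * \<phi> (Rw S x)) = (\<Sum>S\<in>words n. \<phi> (adj UNIV (Rw S (id_op UNIV)) \<circ> id_op UNIV \<circ> Rw S x))"
    using assms by (intro sum.cong refl) (simp add: Rw_id adj_oscale oscale_comp comp_assoc state_scale[OF state])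
  then show ?thesis
    unfolding duality_words[OF bop_id assms bop_id] P_pow_id using assms by simp
qed

end

text \<open>Pythagoras: \<open>q\<close> is the coefficient of \<open>v\<close> along the unit
  vector \<open>e\<close>, and the left side measures the orthogonal part.\<close>

lemma sum_center:
  fixes v e :: "'i \<Rightarrow> complex"
  assumes "(\<Sum>i\<in>I. cnj (e i) * v i) = q" "(\<Sum>i\<in>I. (cmod (e i))\<^sup>2) = 1"
  shows "(\<Sum>i\<in>I. (cmod (v i - e i * q))\<^sup>2) = (\<Sum>i\<in>I. (cmod (v i))\<^sup>2) - (cmod q)\<^sup>2"
proof -
  have "complex_of_real (\<Sum>i\<in>I. (cmod (v i - e i * q))\<^sup>2)
     = (\<Sum>i\<in>I. v i * cnj (v i) - cnj q * (cnj (e i) * v i) - q * cnj (cnj (e i) * v i) + (q * cnj q) * (e i * cnj (e i)))"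
    unfolding of_real_sum complex_norm_square by (intro sum.cong refl) (simp add: algebra_simps)
  also have "\<dots> = (\<Sum>i\<in>I. v i * cnj (v i)) - cnj q * q - q * cnj q + (q * cnj q) * (\<Sum>i\<in>I. e i * cnj (e i))"
    unfolding assms(1)[symmetric] by (simp add: sum.distrib sum_subtractf sum_distrib_left cnj_sum)
  also have "(\<Sum>i\<in>I. e i * cnj (e i)) = 1"
    using assms(2) unfolding complex_norm_square[symmetric] of_real_sum[symmetric] by simp
  finally have "complex_of_real (\<Sum>i\<in>I. (cmod (v i - e i * q))\<^sup>2) = of_real ((\<Sum>i\<in>I. (cmod (v i))\<^sup>2) - (cmod q)\<^sup>2)"
    by (simp add: complex_norm_square del: of_real_power)
  then show ?thesis
    using of_real_eq_iff by blast
qed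

lemma square_sum3: "(x + y + z)\<^sup>2 \<le> 3 * (x\<^sup>2 + y\<^sup>2 + (z :: real)\<^sup>2)"
  using sum_squares_bound[of x y] sum_squares_bound[of x z] sum_squares_bound[of y z]
  by (simp add: power2_eq_square algebra_simps)

lemma square_sum2: "(x + y)\<^sup>2 \<le> 2 * (x\<^sup>2 + (y :: real)\<^sup>2)"
  using sum_squares_bound[of x y] by (simp add: power2_sum)

section \<open>Captured mass and deviation\<close>

context dilation
begin

lemma sn_ge_0 [simp]: "x \<in> bop UNIV \<Longrightarrow> 0 \<le> sn x"
  by (rule state_norm_ge_0[OF state])

definition Y :: "'a op \<Rightarrow> ('k \<times> 'k) list \<Rightarrow> 'a op" where
  "Y a S = Rw S a - oscale (\<phi> (Rw S a)) (id_op UNIV)"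

text \<open>In the product state this is the squared norm of \<open>Q\<^sub>m (J\<^sub>m a)\<close>;
  together with \<open>dev a m\<close> it makes up \<open>(sn a)\<^sup>2\<close>.\<close>

definition mass :: "'a op \<Rightarrow> nat \<Rightarrow> real" where
  "mass a m = (\<Sum>S\<in>words m. (cmod (\<phi> (Rw S a)))\<^sup>2)"

definition dev :: "'a op \<Rightarrow> nat \<Rightarrow> real" where
  "dev a m = (\<Sum>S\<in>words m. (sn (Y a S))\<^sup>2)"

lemma Y_bop [simp]: "a \<in> bop UNIV \<Longrightarrow> Y a S \<in> bop UNIV"
  by (simp add: Y_def)

text \<open>Applying \<open>Rw S'\<close> to \<open>Y a S\<close> subtracts from
  \<open>\<phi> (Rw (S' @ S) a)\<close> its component along \<open>epsw\<close>, so
  \<open>sum_center\<close> turns the sum over \<open>S'\<close> into a difference of masses. Hence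
  the mass increases, and its increments measure what \<open>\<phi>\<close> still sees of the
  fluctuations.\<close>

lemma mass_add:
  assumes a: "a \<in> bop UNIV"
  shows "(\<Sum>S\<in>words m. \<Sum>S'\<in>words n. (cmod (\<phi> (Rw S' (Y a S))))\<^sup>2) = mass a (n + m) - mass a m"
proof -
  have "(\<Sum>S'\<in>words n. (cmod (\<phi> (Rw S' (Y a S))))\<^sup>2)
      = (\<Sum>S'\<in>words n. (cmod (\<phi> (Rw (S' @ S) a)))\<^sup>2) - (cmod (\<phi> (Rw S a)))\<^sup>2" for S
  proof -
    have "\<phi> (Rw S' (Y a S)) = \<phi> (Rw (S' @ S) a) - epsw S' * \<phi> (Rw S a)" for S'
    proof -
      have "Rw S' (Y a S) = Rw (S' @ S) a - oscale (\<phi> (Rw S a)) (oscale (epsw S') (id_op UNIV))"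
        using a by (simp add: Y_def Rw_minus Rw_oscale Rw_id)
      then show ?thesis
        using a by (simp add: state_diff[OF state] state_scale[OF state] state_id[OF state] mult.commute)
    qed
    then show ?thesis
      using sum_center[OF sum_epsw_Rw sum_epsw, of "Rw S a" n] a by simp
  qed
  then show ?thesis
    unfolding mass_def sum_words_add sum_subtractf by (simp add: sum_subtractf) (rule sum.swap)
qed

lemma mass_le: "a \<in> bop UNIV \<Longrightarrow> mass a m \<le> (sn a)\<^sup>2"
  unfolding mass_def sum_sn_Rw[symmetric, of a m]
  by (intro sum_mono power_mono state_le_norm[OF state]) auto

lemma mass_mono: "a \<in> bop UNIV \<Longrightarrow> m \<le> m' \<Longrightarrow> mass a m \<le> mass a m'"
proof -
  assume a: "a \<in> bop UNIV" and le: "m \<le> m'"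
  have "0 \<le> mass a ((m' - m) + m) - mass a m"
    unfolding mass_add[OF a, symmetric] by (intro sum_nonneg) auto
  then show ?thesis
    using le by simp
qed

lemma mass_increment:
  assumes a: "a \<in> bop UNIV"
  shows "(\<lambda>m. mass a (n + m) - mass a m) \<longlonglongrightarrow> 0"
proof -
  have inc: "incseq (mass a)"
    using mass_mono[OF a] by (simp add: incseq_def)
  obtain L where L: "mass a \<longlonglongrightarrow> L"
    by (rule incseq_convergent[OF inc]) (use mass_le[OF a] in blast)
  then have "(\<lambda>m. mass a (n + m)) \<longlonglongrightarrow> L"
    using LIMSEQ_ignore_initial_segment[OF L, of n] by (simp add: add.commute)
  then show ?thesis
    using tendsto_diff[OF _ L] by fastforce
qed

text \<open>The operators \<open>Rw S a\<close> and their means each form a column of norm at most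
  \<open>C\<close>, the means because \<open>mass a m \<le> (sn a)\<^sup>2 \<le> C\<^sup>2\<close>;
  the triangle inequality doubles the constant.\<close>

lemma Y_column:
  assumes a: "a \<in> bop UNIV" and C: "bounded_by a C" and g: "g \<in> ell2 UNIV"
  shows "(\<Sum>S\<in>words m. (ell2_norm (Y a S g))\<^sup>2) \<le> (2 * C)\<^sup>2 * (ell2_norm g)\<^sup>2"
proof -
  have "(ell2_norm (Y a S g))\<^sup>2 \<le> 2 * (ell2_norm (Rw S a g))\<^sup>2 + 2 * (cmod (\<phi> (Rw S a)))\<^sup>2 * (ell2_norm g)\<^sup>2" for S
  proof -
    have "ell2_norm (Y a S g) \<le> ell2_norm (Rw S a g) + cmod (\<phi> (Rw S a)) * ell2_norm g"
      using ell2_norm_triangle_diff[of "Rw S a g" UNIV "vscale (\<phi> (Rw S a)) g" UNIV] a g by (simp add: Y_def)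
    then have "(ell2_norm (Y a S g))\<^sup>2 \<le> (ell2_norm (Rw S a g) + cmod (\<phi> (Rw S a)) * ell2_norm g)\<^sup>2"
      by (intro power_mono) auto
    also note square_sum2
    finally show ?thesis
      by (simp add: power_mult_distrib)
  qed
  then have "(\<Sum>S\<in>words m. (ell2_norm (Y a S g))\<^sup>2)
      \<le> (\<Sum>S\<in>words m. 2 * (ell2_norm (Rw S a g))\<^sup>2 + 2 * (cmod (\<phi> (Rw S a)))\<^sup>2 * (ell2_norm g)\<^sup>2)"
    by (intro sum_mono)
  also have "\<dots> = 2 * (\<Sum>S\<in>words m. (ell2_norm (Rw S a g))\<^sup>2) + 2 * mass a m * (ell2_norm g)\<^sup>2"
    by (simp add: sum.distrib sum_distrib_left sum_distrib_right mass_def)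
  also have "\<dots> \<le> 2 * (C\<^sup>2 * (ell2_norm g)\<^sup>2) + 2 * C\<^sup>2 * (ell2_norm g)\<^sup>2"
  proof (intro add_mono mult_left_mono mult_right_mono Rw_column a C g)
    have "(sn a)\<^sup>2 \<le> C\<^sup>2"
      using state_norm_bounded_by[OF state a C] a by (intro power_mono) auto
    then show "mass a m \<le> C\<^sup>2"
      using mass_le[OF a, of m] by linarith
  qed auto
  finally show ?thesis
    by (simp add: power_mult_distrib)
qed

text \<open>A matrix entry of the fluctuations is the same matrix entry of a bounded sequence of
  operators which is asymptotically invisible to \<open>\<phi>\<close>, now and after any number of steps.\<close>

lemma slice_sequence:
  assumes a: "a \<in> bop UNIV"
  obtains X D where "\<And>m. X m \<in> bop UNIV" "\<And>m. bounded_by (X m) D"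
    "\<And>S. (\<lambda>m. \<phi> (Rw S (X m))) \<longlonglongrightarrow> 0"
    "\<And>m. X m (ket j) i = of_real (\<Sum>S\<in>words m. (cmod (Y a S (ket j) i))\<^sup>2)"
proof -
  obtain C where C: "bounded_by a C"
    using bop_bounded_by[OF a] by blast
  then have C0: "0 \<le> C"
    by (simp add: bounded_by_def)
  define b where "b S = cnj (Y a S (ket j) i)" for S
  define X where "X m = (\<Sum>S\<in>words m. oscale (b S) (Y a S))" for m
  have X: "X m \<in> bop UNIV" for m
    unfolding X_def using a by (intro bop_sum_ops bop_oscale Y_bop)
  have b2: "(\<Sum>S\<in>words m. (cmod (b S))\<^sup>2) \<le> (2 * C)\<^sup>2" for m
  proof -
    have "(\<Sum>S\<in>words m. (cmod (b S))\<^sup>2) \<le> (\<Sum>S\<in>words m. (ell2_norm (Y a S (ket j)))\<^sup>2)"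
      unfolding b_def using a by (intro sum_mono power_mono) (auto intro!: cmod_le_ell2_norm[where A = UNIV])
    also have "\<dots> \<le> (2 * C)\<^sup>2"
      using Y_column[OF a C, of "ket j" m] by simp
    finally show ?thesis .
  qed
  have "bounded_by (X m) (2 * C * (2 * C))" for m
  proof (rule bounded_byI[OF X])
    fix g :: "'a vec" assume g: "g \<in> ell2 UNIV"
    have "ell2_norm (X m g) \<le> sqrt (\<Sum>S\<in>words m. (cmod (b S))\<^sup>2) * sqrt (\<Sum>S\<in>words m. (ell2_norm (Y a S g))\<^sup>2)"
      unfolding X_def op_sum_apply oscale_apply using a by (intro norm_sum_vscale[where A = UNIV]) simp
    also have "\<dots> \<le> sqrt ((2 * C)\<^sup>2) * sqrt ((2 * C)\<^sup>2 * (ell2_norm g)\<^sup>2)"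
      using Y_column[OF a C g] b2 by (intro mult_mono real_sqrt_le_mono) (auto intro: sum_nonneg)
    also have "\<dots> = 2 * C * (2 * C) * ell2_norm g"
      using C0 by (simp add: real_sqrt_mult)
    finally show "ell2_norm (X m g) \<le> 2 * C * (2 * C) * ell2_norm g" .
  qed (use C0 in simp)
  moreover have "(\<lambda>m. \<phi> (Rw S (X m))) \<longlonglongrightarrow> 0" for S
  proof (rule Lim_null_comparison)
    define n where "n = length S"
    have S: "S \<in> words n"
      by (simp add: n_def words_def)
    \<comment> \<open>Cauchy--Schwarz over the words of length \<open>m\<close>. The fixed word
      \<open>S\<close> is one summand of the sum over all words of its length, and that full sum is
      an increment of the mass.\<close>
    have "norm (\<phi> (Rw S (X m))) \<le> 2 * C * sqrt (mass a (n + m) - mass a m)" for m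
    proof -
      have "cmod (\<phi> (Rw S (X m))) = cmod (\<Sum>S'\<in>words m. b S' * \<phi> (Rw S (Y a S')))"
        unfolding X_def using a
        by (simp add: Rw_sum state_sum[OF state] Rw_oscale state_scale[OF state])
      also have "\<dots> \<le> (\<Sum>S'\<in>words m. \<bar>cmod (b S')\<bar> * \<bar>cmod (\<phi> (Rw S (Y a S')))\<bar>)"
        by (rule order_trans[OF norm_sum]) (simp add: norm_mult)
      also have "\<dots> \<le> sqrt (\<Sum>S'\<in>words m. (cmod (b S'))\<^sup>2) * sqrt (\<Sum>S'\<in>words m. (cmod (\<phi> (Rw S (Y a S'))))\<^sup>2)"
        by (rule sum_mult_le_sqrt)
      also have "\<dots> \<le> sqrt ((2 * C)\<^sup>2) * sqrt (mass a (n + m) - mass a m)"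
      proof (intro mult_mono real_sqrt_le_mono b2)
        show "(\<Sum>S'\<in>words m. (cmod (\<phi> (Rw S (Y a S'))))\<^sup>2) \<le> mass a (n + m) - mass a m"
          unfolding mass_add[OF a, symmetric]
          by (intro sum_mono member_le_sum[OF S]) auto
      qed (auto intro: sum_nonneg)
      finally show ?thesis
        using C0 by (simp add: real_sqrt_mult)
    qed
    then show "\<forall>\<^sub>F m in sequentially. norm (\<phi> (Rw S (X m))) \<le> 2 * C * sqrt (mass a (n + m) - mass a m)"
      by simp
    have "(\<lambda>m. 2 * C * sqrt (mass a (n + m) - mass a m)) \<longlonglongrightarrow> 2 * C * sqrt 0"
      by (intro tendsto_intros mass_increment a)
    then show "(\<lambda>m. 2 * C * sqrt (mass a (n + m) - mass a m)) \<longlonglongrightarrow> 0"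
      by simp
  qed
  moreover have "X m (ket j) i = of_real (\<Sum>S\<in>words m. (cmod (Y a S (ket j) i))\<^sup>2)" for m
    unfolding X_def op_sum_apply sum_fun_apply
    by (simp add: b_def vscale_apply complex_norm_square mult.commute del: of_real_power)
  ultimately show thesis
    using that X by blast
qed

lemma dev_le: "a \<in> bop UNIV \<Longrightarrow> dev a m \<le> (sn a)\<^sup>2"
  unfolding dev_def sum_sn_Rw[symmetric, of a m] Y_def
  by (intro sum_mono) (simp add: state_norm_center[OF state])

lemma dev_nonneg: "0 \<le> dev a m"
  unfolding dev_def by (intro sum_nonneg) auto

lemma Y_plus: "a \<in> bop UNIV \<Longrightarrow> b \<in> bop UNIV \<Longrightarrow> Y (a + b) S = Y a S + Y b S"
  unfolding Y_def
  by (rule ext) (simp add: Rw_plus state_add[OF state], simp add: fun_eq_iff pointwise algebra_simps)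

text \<open>The square root of \<open>dev\<close> is a seminorm; the crude factor \<open>2\<close>
  suffices for passing to finite sums and small remainders.\<close>

lemma dev_plus:
  assumes a: "a \<in> bop UNIV" and b: "b \<in> bop UNIV"
  shows "dev (a + b) m \<le> 2 * dev a m + 2 * dev b m"
proof -
  have "(sn (Y (a + b) S))\<^sup>2 \<le> 2 * (sn (Y a S))\<^sup>2 + 2 * (sn (Y b S))\<^sup>2" for S
  proof -
    have "(sn (Y (a + b) S))\<^sup>2 \<le> (sn (Y a S) + sn (Y b S))\<^sup>2"
      unfolding Y_plus[OF a b] using a b by (intro power_mono state_norm_triangle[OF state]) auto
    also note square_sum2
    finally show ?thesis
      by simp
  qed
  then have "dev (a + b) m \<le> (\<Sum>S\<in>words m. 2 * (sn (Y a S))\<^sup>2 + 2 * (sn (Y b S))\<^sup>2)"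
    unfolding dev_def by (intro sum_mono)
  then show ?thesis
    by (simp add: dev_def sum.distrib sum_distrib_left)
qed

lemma dev_zero: "dev 0 m = 0"
proof -
  have "(0 :: 'a op) \<circ> (0 :: 'a op) = 0"
    by (rule ext) simp
  then have "sn 0 = 0"
    by (simp only: state_norm_def adj_zero state_zero[OF state]) simp
  then show ?thesis
    using dev_le[of 0 m] dev_nonneg[of 0 m] by simp
qed

lemma dev_sum_tendsto:
  assumes "finite I" "\<And>i. i \<in> I \<Longrightarrow> a i \<in> bop UNIV" "\<And>i. i \<in> I \<Longrightarrow> dev (a i) \<longlonglongrightarrow> 0"
  shows "dev (\<Sum>i\<in>I. a i) \<longlonglongrightarrow> 0"
  using assms
proof (induction I rule: finite_induct)
  case empty
  have "dev 0 = (\<lambda>m. 0)"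
    by (rule ext) (rule dev_zero)
  then show ?case
    by (simp only: sum.empty tendsto_const)
next
  case (insert i I)
  have bop: "a i \<in> bop UNIV" "(\<Sum>i\<in>I. a i) \<in> bop UNIV"
    using insert.prems by auto
  have lim: "(\<lambda>m. 2 * dev (a i) m + 2 * dev (\<Sum>i\<in>I. a i) m) \<longlonglongrightarrow> 2 * 0 + 2 * 0"
    using insert by (intro tendsto_intros) auto
  have "dev (a i + (\<Sum>i\<in>I. a i)) \<longlonglongrightarrow> 0"
  proof (rule tendsto_sandwich[OF _ _ tendsto_const])
    show "\<forall>\<^sub>F m in sequentially. 0 \<le> dev (a i + (\<Sum>i\<in>I. a i)) m"
      by (simp add: dev_nonneg)
    show "\<forall>\<^sub>F m in sequentially. dev (a i + (\<Sum>i\<in>I. a i)) m \<le> 2 * dev (a i) m + 2 * dev (\<Sum>i\<in>I. a i) m"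
      using dev_plus[OF bop] by simp
    show "(\<lambda>m. 2 * dev (a i) m + 2 * dev (\<Sum>i\<in>I. a i) m) \<longlonglongrightarrow> 0"
      using lim by simp
  qed
  then show ?case
    by (simp only: sum.insert[OF insert.hyps])
qed

text \<open>\<open>rho\<close> is the density operator of \<open>\<phi>\<close>, in coordinates.\<close>

definition rho :: "'a vec \<Rightarrow> 'a vec" where
  "rho f = (\<lambda>i. \<phi> (butterfly UNIV f (ket i)))"

text \<open>For a finite truncation \<open>g\<close> of \<open>rho f\<close>, the number
  \<open>\<phi> (butterfly UNIV f g)\<close> equals the squared norm of \<open>g\<close> and is at
  most \<open>ell2_norm f * ell2_norm g\<close>.\<close>

lemma rho_ell2: "f \<in> ell2 UNIV \<Longrightarrow> rho f \<in> ell2 UNIV"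
proof (rule ell2_bounded_sums(1)[where C = "ell2_norm f"])
  assume f: "f \<in> ell2 UNIV"
  fix F :: "'a set" assume F: "finite F"
  define g where "g = trunc F (rho f)"
  have g: "g = (\<Sum>i\<in>F. vscale (rho f i) (ket i))"
    by (simp add: g_def trunc_eq_sum[OF F])
  have gl: "g \<in> ell2 UNIV"
    unfolding g by (intro ell2_sum) simp
  have "butterfly UNIV f g = (\<Sum>i\<in>F. oscale (cnj (rho f i)) (butterfly UNIV f (ket i)))"
    unfolding g
  proof (rule ext)
    fix h :: "'a vec"
    show "butterfly UNIV f (\<Sum>i\<in>F. vscale (rho f i) (ket i)) h
      = (\<Sum>i\<in>F. oscale (cnj (rho f i)) (butterfly UNIV f (ket i))) h"
      by (cases "h \<in> ell2 UNIV")
        (simp_all add: butterfly_def op_sum_apply ip_sum_left[where A = UNIV and B = UNIV] vscale_vscale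
          fun_eq_iff sum_fun_apply sum_distrib_right vscale_apply)
  qed
  then have "\<phi> (butterfly UNIV f g) = (\<Sum>i\<in>F. cnj (rho f i) * rho f i)"
    using f by (simp add: state_sum[OF state] state_scale[OF state]) (simp add: rho_def)
  also have "\<dots> = of_real ((ell2_norm g)\<^sup>2)"
    by (simp add: g_def ell2_norm_trunc_finite[OF F] complex_norm_square mult.commute del: of_real_power)
  finally have "(ell2_norm g)\<^sup>2 = cmod (\<phi> (butterfly UNIV f g))"
    by (metis norm_of_real abs_power2)
  also have "\<dots> \<le> ell2_norm f * ell2_norm g"
    using state_le_norm[OF state, of "butterfly UNIV f g"] state_norm_butterfly[OF state f gl] f gl by simp
  finally have "ell2_norm g \<le> ell2_norm f"
    by (intro mult_self_le_cancel[of "ell2_norm g"]) (simp_all add: power2_eq_square)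
  then have "(ell2_norm g)\<^sup>2 \<le> (ell2_norm f)\<^sup>2"
    by (intro power_mono) auto
  then show "(\<Sum>i\<in>F. (cmod (rho f i))\<^sup>2) \<le> (ell2_norm f)\<^sup>2"
    by (simp add: g_def ell2_norm_trunc_finite[OF F])
qed auto

text \<open>Both sides are bounded and linear in \<open>g\<close>, and they agree on basis vectors
  because \<open>\<phi>\<close> is compatible with adjoints. Functionals of the form
  \<open>ip (rho f)\<close> thus become values of \<open>\<phi>\<close>.\<close>

lemma rho_ip:
  assumes f: "f \<in> ell2 UNIV" and g: "g \<in> ell2 UNIV"
  shows "ip (rho f) g = \<phi> (butterfly UNIV g f)"
proof -
  have "ip (rho f) g - \<phi> (butterfly UNIV g f) = 0"
  proof (rule functional_zero[where A = UNIV and C = "ell2_norm (rho f) + ell2_norm f"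
        and L = "\<lambda>g. ip (rho f) g - \<phi> (butterfly UNIV g f)"])
    fix g :: "'a vec" and b assume "g \<in> ell2 UNIV"
    then show "ip (rho f) (vscale b g) - \<phi> (butterfly UNIV (vscale b g) f) = b * (ip (rho f) g - \<phi> (butterfly UNIV g f))"
      using f by (simp add: butterfly_scale_left state_scale[OF state] right_diff_distrib)
  next
    fix g :: "'a vec" assume g: "g \<in> ell2 UNIV"
    have "cmod (ip (rho f) g) \<le> ell2_norm (rho f) * ell2_norm g"
      by (rule ip_Cauchy_Schwarz[OF rho_ell2[OF f] g])
    moreover have "cmod (\<phi> (butterfly UNIV g f)) \<le> ell2_norm f * ell2_norm g"
      using state_le_norm[OF state butterfly_bop[OF g f]] state_norm_butterfly[OF state g f] by (simp add: mult.commute)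
    ultimately show "cmod (ip (rho f) g - \<phi> (butterfly UNIV g f)) \<le> (ell2_norm (rho f) + ell2_norm f) * ell2_norm g"
      using norm_triangle_ineq4[of "ip (rho f) g" "\<phi> (butterfly UNIV g f)"] by (simp add: distrib_right)
  next
    fix g h :: "'a vec" assume g: "g \<in> ell2 UNIV" and h: "h \<in> ell2 UNIV"
    show "ip (rho f) (g + h) - \<phi> (butterfly UNIV (g + h) f)
        = ip (rho f) g - \<phi> (butterfly UNIV g f) + (ip (rho f) h - \<phi> (butterfly UNIV h f))"
      using f g h ip_add_right[OF rho_ell2[OF f] g h] by (simp add: butterfly_add_left state_add[OF state])
  next
    fix i :: 'a
    have "\<phi> (butterfly UNIV (ket i) f) = cnj (\<phi> (butterfly UNIV f (ket i)))"
      using state_adj[OF state, of "butterfly UNIV f (ket i)"] f by (simp add: adj_butterfly)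
    then show "ip (rho f) (ket i) - \<phi> (butterfly UNIV (ket i) f) = 0"
      by (simp add: rho_def)
  qed (use g in auto)
  then show ?thesis
    by simp
qed

text \<open>A vector \<open>h\<close> orthogonal to the range of \<open>rho\<close> gives
  \<open>\<phi>\<close> the value \<open>0\<close> on the square of \<open>|h><h|\<close>, and
  faithfulness forces \<open>h = 0\<close>.\<close>

lemma rho_dense:
  assumes faithful: "\<And>x. x \<in> bop UNIV \<Longrightarrow> \<phi> (adj UNIV x \<circ> x) = 0 \<Longrightarrow> x = 0"
    and h: "h \<in> ell2 UNIV" and e: "e > 0"
  obtains g where "g \<in> ell2 UNIV" "ell2_norm (h - rho g) \<le> e"
proof -
  have "\<exists>g \<in> rho ` ell2 UNIV. ell2_norm (h - g) \<le> e"
  proof (rule dense_of_trivial_complement[where M = "rho ` ell2 UNIV" and A = UNIV and h = h and e = e])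
    show "rho ` ell2 UNIV \<subseteq> ell2 UNIV"
      using rho_ell2 by auto
    have "rho 0 = 0"
    proof
      fix i :: 'a
      have "butterfly UNIV 0 (ket i) = (0 :: 'a op)"
        by (rule ext) (simp add: butterfly_def)
      then show "rho 0 i = 0 i"
        using state_zero[OF state] by (simp only: rho_def zero_fun_apply)
    qed
    then show "0 \<in> rho ` ell2 UNIV"
      by (metis ell2_zero image_eqI)
    fix f g :: "'a vec" and b assume f: "f \<in> rho ` ell2 UNIV"
    then obtain f' where f': "f = rho f'" "f' \<in> ell2 UNIV"
      by blast
    have "vscale b f = rho (vscale b f')"
      using f' by (simp add: fun_eq_iff pointwise rho_def butterfly_scale_left state_scale[OF state])
    then show "vscale b f \<in> rho ` ell2 UNIV"
      using f' by (metis ell2_scale image_eqI)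
    assume "g \<in> rho ` ell2 UNIV"
    then obtain g' where g': "g = rho g'" "g' \<in> ell2 UNIV"
      by blast
    have "f + g = rho (f' + g')"
      using f' g' by (simp add: fun_eq_iff pointwise rho_def butterfly_add_left state_add[OF state])
    then show "f + g \<in> rho ` ell2 UNIV"
      using f' g' by (metis ell2_add image_eqI)
  next
    fix h :: "'a vec" assume h: "h \<in> ell2 UNIV" and orth: "\<And>g. g \<in> rho ` ell2 UNIV \<Longrightarrow> ip g h = 0"
    show "h = 0"
    proof (rule ccontr)
      assume "h \<noteq> 0"
      then have n: "ell2_norm h \<noteq> 0"
        using ell2_norm_eq_0[OF h] by blast
      have "\<phi> (adj UNIV (butterfly UNIV h h) \<circ> butterfly UNIV h h) = ip h h * ip (rho h) h"
        using h by (simp add: adj_butterfly butterfly_comp_butterfly state_scale[OF state] rho_ip)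
      also have "ip (rho h) h = 0"
        using orth h by blast
      finally have "butterfly UNIV h h = 0"
        by (intro faithful butterfly_bop h) (simp only: mult_zero_right)
      then have "vscale (ip h h) h = 0"
        using h by (metis butterfly_apply op_apply(3))
      then have "ell2_norm (vscale (ip h h) h) = 0"
        by simp
      then show False
        using n ip_self[OF h] by (simp del: of_real_power)
    qed
  next
    fix g assume "g \<in> rho ` ell2 UNIV" "ell2_norm (h - g) \<le> e"
    then show ?thesis
      by blast
  qed (use h e in auto)
  then show thesis
    using that by blast
qed

text \<open>Tightness: the dual evolution leaks no mass to infinity, because vector functionals are
  approximated in norm by functionals \<open>x \<mapsto> \<phi> (x b)\<close>.\<close>

lemma tight:
  assumes faithful: "\<And>x. x \<in> bop UNIV \<Longrightarrow> \<phi> (adj UNIV x \<circ> x) = 0 \<Longrightarrow> x = 0"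
    and h: "h \<in> ell2 UNIV" and e: "e > 0"
  obtains K where "0 \<le> K" "\<And>y m. y \<in> bop UNIV \<Longrightarrow> adj UNIV y = y \<Longrightarrow> bounded_by y 1 \<Longrightarrow>
    cmod (ip h ((P ^^ m) y h)) \<le> e + K * sn y"
proof -
  \<comment> \<open>The denominator absorbs the norm of the image of \<open>h\<close> below and
    stays positive for \<open>h = 0\<close>.\<close>
  have "e / (ell2_norm h + 1) > 0"
    using e by (simp add: add_nonneg_pos)
  then obtain g where g: "g \<in> ell2 UNIV" "ell2_norm (h - rho g) \<le> e / (ell2_norm h + 1)"
    using rho_dense[OF faithful h] by metis
  have "cmod (ip h ((P ^^ m) y h)) \<le> e + (ell2_norm h * ell2_norm g) * sn y"
    if y: "y \<in> bop UNIV" "adj UNIV y = y" "bounded_by y 1" for y m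
  proof -
    let ?y = "(P ^^ m) y"
    have yb: "?y \<in> bop UNIV" "adj UNIV ?y = ?y" "bounded_by ?y 1"
      using y by (simp_all add: adj_P_pow P_pow_bounded_by)
    have yh: "?y h \<in> ell2 UNIV"
      using yb(1) by simp
    have "ip h (?y h) = ip (h - rho g) (?y h) + ip (rho g) (?y h)"
      using ip_diff_left[OF yh h rho_ell2[OF g(1)]] by simp
    then have "cmod (ip h (?y h)) \<le> cmod (ip (h - rho g) (?y h)) + cmod (ip (rho g) (?y h))"
      by (simp add: norm_triangle_ineq)
    also have "cmod (ip (h - rho g) (?y h)) \<le> e"
    proof -
      have "cmod (ip (h - rho g) (?y h)) \<le> ell2_norm (h - rho g) * ell2_norm (?y h)"
        using h rho_ell2[OF g(1)] yh by (intro ip_Cauchy_Schwarz[where A = UNIV and B = UNIV] ell2_diff)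
      also have "\<dots> \<le> e / (ell2_norm h + 1) * (ell2_norm h + 1)"
      proof (intro mult_mono g(2))
        have "ell2_norm (?y h) \<le> 1 * ell2_norm h"
          using yb(3) unfolding bounded_by_def by blast
        then show "ell2_norm (?y h) \<le> ell2_norm h + 1"
          by simp
      qed (use e in auto)
      also have "\<dots> = e"
        by (simp add: add_nonneg_eq_0_iff)
      finally show ?thesis .
    qed
    also have "cmod (ip (rho g) (?y h)) \<le> (ell2_norm h * ell2_norm g) * sn y"
    proof -
      \<comment> \<open>Since \<open>?y\<close> is self-adjoint, it can be put into the first place
        of the Cauchy--Schwarz inequality for \<open>\<phi>\<close>, where
        \<open>sn ?y \<le> sn y\<close> makes the bound uniform in \<open>m\<close>.\<close>
      have "cmod (ip (rho g) (?y h)) = cmod (\<phi> (adj UNIV ?y \<circ> butterfly UNIV h g))"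
        unfolding yb(2) comp_butterfly[OF yb(1) h] rho_ip[OF g(1) yh] ..
      also have "\<dots> \<le> sn ?y * sn (butterfly UNIV h g)"
        by (rule state_Cauchy_Schwarz[OF state yb(1) butterfly_bop[OF h g(1)]])
      also have "\<dots> \<le> sn y * (ell2_norm h * ell2_norm g)"
        by (rule mult_mono[OF sn_P_pow[OF y(1)] state_norm_butterfly[OF state h g(1)]])
          (simp_all add: y(1) h g(1))
      finally show ?thesis
        by (simp add: mult_ac)
    qed
    finally show ?thesis
      by simp
  qed
  then show thesis
    using that[of "ell2_norm h * ell2_norm g"] by simp
qed

end


section \<open>From matrix entries to norm convergence\<close>

lemma state_norm_sum:
  assumes s: "state A \<phi>" and "\<And>i. i \<in> I \<Longrightarrow> x i \<in> bop A"
  shows "state_norm A \<phi> (\<Sum>i\<in>I. x i) \<le> (\<Sum>i\<in>I. state_norm A \<phi> (x i))"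
  using assms(2)
proof (induction I rule: infinite_finite_induct)
  case (insert i I)
  have "state_norm A \<phi> (x i + (\<Sum>i\<in>I. x i)) \<le> state_norm A \<phi> (x i) + state_norm A \<phi> (\<Sum>i\<in>I. x i)"
    using insert.prems by (intro state_norm_triangle[OF s]) auto
  also have "\<dots> \<le> state_norm A \<phi> (x i) + (\<Sum>i\<in>I. state_norm A \<phi> (x i))"
    using insert by (intro add_left_mono) auto
  finally show ?case
    by (simp only: sum.insert[OF insert.hyps])
next
  have "(0 :: 'a op) \<circ> (0 :: 'a op) = 0"
    by (rule ext) simp
  then have "state_norm A \<phi> 0 = 0"
    by (simp only: state_norm_def adj_zero state_zero[OF s]) simp
  then show "state_norm A \<phi> (\<Sum>i\<in>{}. x i) \<le> (\<Sum>i\<in>{}. state_norm A \<phi> (x i))"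
    "infinite I \<Longrightarrow> state_norm A \<phi> (\<Sum>i\<in>I. x i) \<le> (\<Sum>i\<in>I. state_norm A \<phi> (x i))" for I
    by (simp_all only: sum.empty sum.infinite order_refl not_False_eq_True)
qed

lemma butterfly_ket: "butterfly UNIV (ket i) (ket j) (ket k) l = (if k = j \<and> l = i then 1 else 0)"
  by (simp add: butterfly_apply vscale_apply) (auto simp: ket_def)

lemma proj_comp_proj:
  assumes y: "y \<in> bop UNIV" and F: "finite F"
  shows "proj F \<circ> y \<circ> proj F = (\<Sum>(i, j)\<in>F \<times> F. oscale (y (ket j) i) (butterfly UNIV (ket i) (ket j)))"
proof (rule op_eqI[where A = UNIV])
  fix i j :: 'a
  have "(\<Sum>(i, j)\<in>F \<times> F. oscale (y (ket j) i) (butterfly UNIV (ket i) (ket j))) (ket j) i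
    = (\<Sum>(i', j')\<in>F \<times> F. if i' = i \<and> j' = j then y (ket j) i else 0)"
    unfolding op_sum_apply sum_fun_apply
    by (intro sum.cong refl) (auto simp: vscale_apply butterfly_ket)
  also have "\<dots> = (if i \<in> F \<and> j \<in> F then y (ket j) i else 0)"
  proof -
    have "(\<Sum>(i', j')\<in>F \<times> F. if i' = i \<and> j' = j then y (ket j) i else 0)
      = (\<Sum>q\<in>F \<times> F. if q = (i, j) then y (ket j) i else 0)"
      by (rule sum.cong[OF refl]) (simp add: case_prod_unfold prod_eq_iff)
    also have "\<dots> = (if (i, j) \<in> F \<times> F then y (ket j) i else 0)"
      by (rule sum.delta) (simp add: F)
    finally show ?thesis
      by simp
  qed
  also have "\<dots> = (proj F \<circ> y \<circ> proj F) (ket j) i"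
  proof -
    have "trunc F (ket j) = (if j \<in> F then ket j else 0)"
      by (auto simp: fun_eq_iff trunc_apply ket_def pointwise)
    then show ?thesis
      using y by (simp add: proj_apply trunc_apply bop_0[OF y] pointwise)
  qed
  finally show "(proj F \<circ> y \<circ> proj F) (ket j) i
    = (\<Sum>(i, j)\<in>F \<times> F. oscale (y (ket j) i) (butterfly UNIV (ket i) (ket j))) (ket j) i" ..
qed (use y in \<open>auto intro!: bop_sum_ops\<close>)

text \<open>\<open>observable\<close> is the one place where a particular coupling has to be
  studied; the locale deduces convergence of \<open>dev\<close> from it together with faithfulness
  and normality.\<close>

locale observable_dilation = dilation U c d \<phi>
  for U :: "'k::finite \<Rightarrow> 'k \<Rightarrow> nat op" and c d \<phi> +
  assumes normal: "normal_state UNIV \<phi>"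
    and faithful: "\<And>x. x \<in> bop UNIV \<Longrightarrow> \<phi> (adj UNIV x \<circ> x) = 0 \<Longrightarrow> x = 0"
    and observable: "\<And>X D i j. (\<And>m. X m \<in> bop UNIV) \<Longrightarrow> (\<And>m. bounded_by (X m) D) \<Longrightarrow>
      (\<And>S. (\<lambda>m. \<phi> (Rw S (X m))) \<longlonglongrightarrow> 0) \<Longrightarrow> (\<lambda>m. X m (ket j) i) \<longlonglongrightarrow> 0"
begin

lemma entries_tendsto:
  assumes a: "a \<in> bop UNIV"
  shows "(\<lambda>m. \<Sum>S\<in>words m. (cmod (Y a S (ket j) i))\<^sup>2) \<longlonglongrightarrow> 0"
proof -
  obtain X D where X: "\<And>m. X m \<in> bop UNIV" "\<And>m. bounded_by (X m) D"
    "\<And>S. (\<lambda>m. \<phi> (Rw S (X m))) \<longlonglongrightarrow> 0"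
    "\<And>m. X m (ket j) i = of_real (\<Sum>S\<in>words m. (cmod (Y a S (ket j) i))\<^sup>2)"
    using slice_sequence[OF a, of j i] by blast
  have "(\<lambda>m. X m (ket j) i) \<longlonglongrightarrow> 0"
    by (rule observable[OF X(1-3)])
  then have "(\<lambda>m. complex_of_real (\<Sum>S\<in>words m. (cmod (Y a S (ket j) i))\<^sup>2)) \<longlonglongrightarrow> of_real 0"
    unfolding X(4) of_real_0 .
  then show ?thesis
    by (simp only: tendsto_of_real_iff)
qed

text \<open>Duality replaces the projection by its image under \<open>P ^^ m\<close>, and for a
  rank-one operator the result is a multiple of the form of that image at \<open>h\<close>. This is
  the quantity that \<open>tight\<close> controls uniformly in \<open>m\<close>.\<close>

lemma sum_sn_coproj_comp:
  assumes h: "h \<in> ell2 UNIV" and f: "f \<in> ell2 UNIV"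
  shows "(\<Sum>S\<in>words m. (sn (coproj F \<circ> Rw S (butterfly UNIV h f)))\<^sup>2)
    \<le> cmod (ip h ((P ^^ m) (coproj F) h)) * (ell2_norm f)\<^sup>2"
proof -
  let ?a = "butterfly UNIV h f"
  have a: "?a \<in> bop UNIV"
    by (rule butterfly_bop[OF h f])
  have qq: "adj UNIV (coproj F) \<circ> coproj F = coproj F"
    by (simp add: coproj_def adj_proj proj_idem)
  have "complex_of_real (\<Sum>S\<in>words m. (sn (coproj F \<circ> Rw S ?a))\<^sup>2)
      = (\<Sum>S\<in>words m. \<phi> (adj UNIV (Rw S ?a) \<circ> coproj F \<circ> Rw S ?a))"
    unfolding of_real_sum
  proof (intro sum.cong refl)
    fix S
    have "adj UNIV (coproj F \<circ> Rw S ?a) \<circ> (coproj F \<circ> Rw S ?a)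
        = adj UNIV (Rw S ?a) \<circ> (adj UNIV (coproj F) \<circ> coproj F) \<circ> Rw S ?a"
      using a by (simp add: adj_comp comp_assoc)
    then show "complex_of_real ((sn (coproj F \<circ> Rw S ?a))\<^sup>2) = \<phi> (adj UNIV (Rw S ?a) \<circ> coproj F \<circ> Rw S ?a)"
      unfolding qq using a by (simp only: state_norm_power2(1)[OF state, symmetric] bop_comp coproj_bop Rw_bop)
  qed
  also have "\<dots> = \<phi> (adj UNIV ?a \<circ> (P ^^ m) (coproj F) \<circ> ?a)"
    by (rule duality_words[OF a a coproj_bop])
  also have "adj UNIV ?a \<circ> (P ^^ m) (coproj F) \<circ> ?a = oscale (ip h ((P ^^ m) (coproj F) h)) (butterfly UNIV f f)"
    unfolding adj_butterfly[OF h f] comp_assoc comp_butterfly[OF P_pow_bop[OF coproj_bop] h]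
    by (rule butterfly_comp_butterfly[OF f]) simp
  finally have eq: "complex_of_real (\<Sum>S\<in>words m. (sn (coproj F \<circ> Rw S ?a))\<^sup>2)
      = ip h ((P ^^ m) (coproj F) h) * \<phi> (butterfly UNIV f f)"
    using f by (simp only: state_scale[OF state] butterfly_bop)
  have "(\<Sum>S\<in>words m. (sn (coproj F \<circ> Rw S ?a))\<^sup>2) \<le> cmod (complex_of_real (\<Sum>S\<in>words m. (sn (coproj F \<circ> Rw S ?a))\<^sup>2))"
    by (simp only: norm_of_real abs_ge_self)
  also have "\<dots> \<le> cmod (ip h ((P ^^ m) (coproj F) h)) * (ell2_norm f)\<^sup>2"
    unfolding eq norm_mult
  proof (rule mult_left_mono)
    show "cmod (\<phi> (butterfly UNIV f f)) \<le> (ell2_norm f)\<^sup>2"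
      using state_le_norm[OF state butterfly_bop[OF f f]] state_norm_butterfly[OF state f f]
      unfolding power2_eq_square by (rule order_trans)
  qed simp
  finally show ?thesis .
qed

text \<open>Split \<open>Y = q Y + p Y q + p Y p\<close> with \<open>p\<close> the projection onto
  the levels below \<open>N\<close>. Tightness controls the first term, the column bound and
  normality the second, both uniformly in \<open>m\<close>; the third involves finitely many matrix
  entries, which tend to \<open>0\<close>.\<close>

lemma dev_butterfly_tendsto:
  assumes h: "h \<in> ell2 UNIV" and f: "f \<in> ell2 UNIV"
  shows "dev (butterfly UNIV h f) \<longlonglongrightarrow> 0"
proof -
  let ?a = "butterfly UNIV h f"
  define q p where "q N = coproj {..<N}" and "p N = proj {..<N}" for N :: nat
  have a: "?a \<in> bop UNIV"
    by (rule butterfly_bop[OF h f])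
  have q: "q N \<in> bop UNIV" and p: "p N \<in> bop UNIV" and pq: "p N + q N = id_op UNIV"
    and p1: "bounded_by (p N) 1" and q1: "bounded_by (q N) 1" and qadj: "adj UNIV (q N) = q N" for N
    unfolding q_def p_def
    by (rule coproj_bop proj_bop proj_coproj proj_bounded_by | simp only: coproj_def proj_bounded_by adj_proj)+
  obtain C where C: "bounded_by ?a C"
    using bop_bounded_by[OF a] by blast
  then have C0: "0 \<le> C"
    by (simp add: bounded_by_def)
  have split: "(sn (Y ?a S))\<^sup>2 \<le> 3 * ((sn (q N \<circ> Y ?a S))\<^sup>2 + (sn (p N \<circ> Y ?a S \<circ> q N))\<^sup>2 + (sn (p N \<circ> Y ?a S \<circ> p N))\<^sup>2)" for S N
  proof -
    let ?Y = "Y ?a S"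
    have Y: "?Y \<in> bop UNIV"
      using a by simp
    have "?Y = (p N + q N) \<circ> ?Y"
      unfolding pq by (rule id_op_comp[OF Y, symmetric])
    also have "\<dots> = (q N \<circ> ?Y) + (p N \<circ> ?Y \<circ> (q N + p N))"
    proof -
      have qp: "q N + p N = id_op UNIV"
        using pq[of N] by (simp only: add.commute)
      show ?thesis
        unfolding qp comp_id_op[OF bop_comp[OF p Y]] plus_comp by (rule add.commute)
    qed
    also have "p N \<circ> ?Y \<circ> (q N + p N) = (p N \<circ> ?Y \<circ> q N) + (p N \<circ> ?Y \<circ> p N)"
      by (rule comp_plus[where A = UNIV]) (use p q Y in auto)
    finally have eq: "?Y = (q N \<circ> ?Y) + ((p N \<circ> ?Y \<circ> q N) + (p N \<circ> ?Y \<circ> p N))" .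
    have "sn ?Y \<le> sn (q N \<circ> ?Y) + (sn (p N \<circ> ?Y \<circ> q N) + sn (p N \<circ> ?Y \<circ> p N))"
      by (subst eq, rule order_trans[OF state_norm_triangle[OF state] add_left_mono[OF state_norm_triangle[OF state]]])
        (use p q Y in auto)
    then have "(sn ?Y)\<^sup>2 \<le> (sn (q N \<circ> ?Y) + sn (p N \<circ> ?Y \<circ> q N) + sn (p N \<circ> ?Y \<circ> p N))\<^sup>2"
      using Y by (intro power_mono) auto
    also note square_sum3
    finally show ?thesis .
  qed
  have t1: "(\<Sum>S\<in>words m. (sn (q N \<circ> Y ?a S))\<^sup>2)
      \<le> 2 * (cmod (ip h ((P ^^ m) (q N) h)) * (ell2_norm f)\<^sup>2) + 2 * (sn ?a)\<^sup>2 * (sn (q N))\<^sup>2" for N m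
  proof -
    have "(sn (q N \<circ> Y ?a S))\<^sup>2 \<le> 2 * (sn (q N \<circ> Rw S ?a))\<^sup>2 + 2 * ((cmod (\<phi> (Rw S ?a)))\<^sup>2 * (sn (q N))\<^sup>2)" for S
    proof -
      have "q N \<circ> Y ?a S = (q N \<circ> Rw S ?a) - oscale (\<phi> (Rw S ?a)) (q N)"
        unfolding Y_def using a q by (simp add: comp_minus[where A = UNIV] comp_oscale[where A = UNIV])
      then have "sn (q N \<circ> Y ?a S) \<le> sn (q N \<circ> Rw S ?a) + cmod (\<phi> (Rw S ?a)) * sn (q N)"
        using state_norm_diff[OF state, of "q N \<circ> Rw S ?a" "oscale (\<phi> (Rw S ?a)) (q N)"] a q
        by (simp add: state_norm_oscale[OF state])
      then have "(sn (q N \<circ> Y ?a S))\<^sup>2 \<le> (sn (q N \<circ> Rw S ?a) + cmod (\<phi> (Rw S ?a)) * sn (q N))\<^sup>2"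
        using a q by (intro power_mono) auto
      also note square_sum2
      finally show ?thesis
        by (simp add: power_mult_distrib)
    qed
    then have "(\<Sum>S\<in>words m. (sn (q N \<circ> Y ?a S))\<^sup>2)
        \<le> (\<Sum>S\<in>words m. 2 * (sn (q N \<circ> Rw S ?a))\<^sup>2 + 2 * ((cmod (\<phi> (Rw S ?a)))\<^sup>2 * (sn (q N))\<^sup>2))"
      by (intro sum_mono)
    also have "\<dots> = 2 * (\<Sum>S\<in>words m. (sn (q N \<circ> Rw S ?a))\<^sup>2) + 2 * (mass ?a m * (sn (q N))\<^sup>2)"
      by (simp add: sum.distrib sum_distrib_left sum_distrib_right mass_def)
    also have "\<dots> \<le> 2 * (cmod (ip h ((P ^^ m) (q N) h)) * (ell2_norm f)\<^sup>2) + 2 * ((sn ?a)\<^sup>2 * (sn (q N))\<^sup>2)"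
      unfolding q_def by (intro add_mono mult_left_mono sum_sn_coproj_comp[OF h f] mult_right_mono mass_le a) auto
    finally show ?thesis
      by (simp add: mult.assoc)
  qed
  have t2: "(\<Sum>S\<in>words m. (sn (p N \<circ> Y ?a S \<circ> q N))\<^sup>2) \<le> (2 * C)\<^sup>2 * (sn (q N))\<^sup>2" for N m
  proof -
    have "(\<Sum>S\<in>words m. (sn (p N \<circ> Y ?a S \<circ> q N))\<^sup>2) \<le> (\<Sum>i\<in>{()}. (sn (oscale (of_real (2 * C)) (q N)))\<^sup>2)"
    proof (rule state_norm_mono[OF state])
      fix g :: "nat vec"
      have "(\<Sum>S\<in>words m. (ell2_norm ((p N \<circ> Y ?a S \<circ> q N) g))\<^sup>2) \<le> (\<Sum>S\<in>words m. (ell2_norm (Y ?a S (q N g)))\<^sup>2)"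
        using p1[of N] by (intro sum_mono power_mono) (auto simp: bounded_by_def)
      also have "\<dots> \<le> (2 * C)\<^sup>2 * (ell2_norm (q N g))\<^sup>2"
        by (rule Y_column[OF a C]) (use q in simp)
      also have "\<dots> = (\<Sum>i\<in>{()}. (ell2_norm (oscale (of_real (2 * C)) (q N) g))\<^sup>2)"
        using C0 by (simp add: power_mult_distrib)
      finally show "(\<Sum>S\<in>words m. (ell2_norm ((p N \<circ> Y ?a S \<circ> q N) g))\<^sup>2) \<le> (\<Sum>i\<in>{()}. (ell2_norm (oscale (of_real (2 * C)) (q N) g))\<^sup>2)" .
    qed (use a p q in auto)
    also have "\<dots> = (2 * C)\<^sup>2 * (sn (q N))\<^sup>2"
      using C0 q by (simp add: state_norm_oscale[OF state] power_mult_distrib)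
    finally show ?thesis .
  qed
  define E where "E N m = (\<Sum>(i, j)\<in>{..<N} \<times> {..<N}. \<Sum>S\<in>words m. (cmod (Y ?a S (ket j) i))\<^sup>2)" for N m
  \<comment> \<open>The square of a sum of \<open>N * N\<close> terms costs a factor
    \<open>N * N\<close>, which is harmless because \<open>N\<close> is fixed before
    \<open>m\<close> grows.\<close>
  have t3: "(\<Sum>S\<in>words m. (sn (p N \<circ> Y ?a S \<circ> p N))\<^sup>2) \<le> real (N * N) * E N m" for N m
  proof -
    have "(sn (p N \<circ> Y ?a S \<circ> p N))\<^sup>2 \<le> (\<Sum>(i, j)\<in>{..<N} \<times> {..<N}. (cmod (Y ?a S (ket j) i))\<^sup>2) * real (N * N)" for S
    proof -
      have "p N \<circ> Y ?a S \<circ> p N = (\<Sum>z\<in>{..<N} \<times> {..<N}. oscale (Y ?a S (ket (snd z)) (fst z)) (butterfly UNIV (ket (fst z)) (ket (snd z))))"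
        unfolding p_def using a by (subst proj_comp_proj) (auto simp: case_prod_unfold)
      then have "sn (p N \<circ> Y ?a S \<circ> p N) = sn (\<Sum>z\<in>{..<N} \<times> {..<N}. oscale (Y ?a S (ket (snd z)) (fst z)) (butterfly UNIV (ket (fst z)) (ket (snd z))))"
        by (rule arg_cong)
      also have "\<dots> \<le> (\<Sum>z\<in>{..<N} \<times> {..<N}. sn (oscale (Y ?a S (ket (snd z)) (fst z)) (butterfly UNIV (ket (fst z)) (ket (snd z)))))"
        by (rule state_norm_sum[OF state]) auto
      also have "\<dots> \<le> (\<Sum>z\<in>{..<N} \<times> {..<N}. cmod (Y ?a S (ket (snd z)) (fst z)))"
      proof (rule sum_mono)
        fix z :: "nat \<times> nat"
        have "sn (butterfly UNIV (ket (fst z)) (ket (snd z))) \<le> 1"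
          using state_norm_butterfly[OF state, of "ket (fst z)" "ket (snd z)"] by simp
        then show "sn (oscale (Y ?a S (ket (snd z)) (fst z)) (butterfly UNIV (ket (fst z)) (ket (snd z)))) \<le> cmod (Y ?a S (ket (snd z)) (fst z))"
          by (simp add: state_norm_oscale[OF state] mult_left_le)
      qed
      finally have "(sn (p N \<circ> Y ?a S \<circ> p N))\<^sup>2 \<le> (\<Sum>z\<in>{..<N} \<times> {..<N}. cmod (Y ?a S (ket (snd z)) (fst z)))\<^sup>2"
        using a p by (intro power_mono) auto
      also have "\<dots> \<le> (\<Sum>z\<in>{..<N} \<times> {..<N}. (cmod (Y ?a S (ket (snd z)) (fst z)))\<^sup>2) * real (card ({..<N} \<times> {..<N}))"
        using sum_squared_le_sum_of_squares by blast
      finally show ?thesis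
        by (simp add: case_prod_unfold)
    qed
    then have "(\<Sum>S\<in>words m. (sn (p N \<circ> Y ?a S \<circ> p N))\<^sup>2)
      \<le> (\<Sum>S\<in>words m. (\<Sum>(i, j)\<in>{..<N} \<times> {..<N}. (cmod (Y ?a S (ket j) i))\<^sup>2) * real (N * N))"
      by (intro sum_mono)
    also have "\<dots> = real (N * N) * E N m"
      unfolding E_def case_prod_unfold sum_distrib_right[symmetric]
      by (subst sum.swap) (simp add: mult.commute)
    finally show ?thesis .
  qed
  have E: "E N \<longlonglongrightarrow> 0" for N
  proof -
    have "(\<lambda>m. E N m) \<longlonglongrightarrow> (\<Sum>z\<in>{..<N} \<times> {..<N}. 0)"
      unfolding E_def case_prod_unfold by (intro tendsto_sum entries_tendsto a)
    then show ?thesis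
      by simp
  qed
  show ?thesis
  proof (rule tendsto_zero_approx[OF dev_nonneg])
    fix r :: real assume r: "r > 0"
    \<comment> \<open>\<open>e\<close> is chosen so that \<open>6 * e * b = r\<close>: the factor is
      \<open>3\<close> from the split times \<open>2\<close> from centering, and \<open>b\<close>
      exceeds \<open>(ell2_norm f)\<^sup>2\<close> and cannot vanish.\<close>
    define b where "b = (ell2_norm f)\<^sup>2 + 1"
    define e where "e = r / (6 * b)"
    have fp: "b > 0"
      by (simp add: b_def add_nonneg_pos)
    have e: "e > 0"
      using r fp by (simp add: e_def)
    obtain K where K: "0 \<le> K" "\<And>y m. y \<in> bop UNIV \<Longrightarrow> adj UNIV y = y \<Longrightarrow> bounded_by y 1 \<Longrightarrow>
      cmod (ip h ((P ^^ m) y h)) \<le> e + K * sn y"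
      using tight[OF faithful h e] by blast
    define B where "B N = 3 * (2 * ((e + K * sn (q N)) * (ell2_norm f)\<^sup>2) + 2 * (sn ?a)\<^sup>2 * (sn (q N))\<^sup>2 + (2 * C)\<^sup>2 * (sn (q N))\<^sup>2)" for N
    have "B \<longlonglongrightarrow> 3 * (2 * ((e + K * 0) * (ell2_norm f)\<^sup>2) + 2 * (sn ?a)\<^sup>2 * 0\<^sup>2 + (2 * C)\<^sup>2 * 0\<^sup>2)"
      unfolding B_def q_def by (intro tendsto_intros normal_state_coproj normal)
    moreover have "3 * (2 * ((e + K * 0) * (ell2_norm f)\<^sup>2) + 2 * (sn ?a)\<^sup>2 * 0\<^sup>2 + (2 * C)\<^sup>2 * 0\<^sup>2) < r"
    proof -
      have "6 * e * (ell2_norm f)\<^sup>2 < 6 * e * b"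
        using e by (simp add: b_def)
      also have "\<dots> = r"
        using fp by (simp add: e_def)
      finally show ?thesis
        by simp
    qed
    ultimately have "\<forall>\<^sub>F N in sequentially. B N < r"
      by (rule order_tendstoD(2))
    then obtain N where N: "B N < r"
      by (auto simp: eventually_sequentially)
    have "dev ?a m \<le> r + 3 * (real (N * N) * E N m)" for m
    proof -
      have "dev ?a m \<le> (\<Sum>S\<in>words m. 3 * ((sn (q N \<circ> Y ?a S))\<^sup>2 + (sn (p N \<circ> Y ?a S \<circ> q N))\<^sup>2 + (sn (p N \<circ> Y ?a S \<circ> p N))\<^sup>2))"
        unfolding dev_def by (intro sum_mono split)
      also have "\<dots> = 3 * ((\<Sum>S\<in>words m. (sn (q N \<circ> Y ?a S))\<^sup>2) + (\<Sum>S\<in>words m. (sn (p N \<circ> Y ?a S \<circ> q N))\<^sup>2) + (\<Sum>S\<in>words m. (sn (p N \<circ> Y ?a S \<circ> p N))\<^sup>2))"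
        by (simp add: sum_distrib_left[symmetric] sum.distrib)
      also have "\<dots> \<le> B N + 3 * (real (N * N) * E N m)"
      proof -
        have "cmod (ip h ((P ^^ m) (q N) h)) * (ell2_norm f)\<^sup>2 \<le> (e + K * sn (q N)) * (ell2_norm f)\<^sup>2"
          using K(2)[OF q qadj q1] by (intro mult_right_mono) auto
        moreover have "3 * (s1 + s2 + s3) \<le> 3 * (2 * y + z + w) + 3 * v"
          if "x \<le> y" "s1 \<le> 2 * x + z" "s2 \<le> w" "s3 \<le> v" for s1 s2 s3 x y z w v :: real
          using that by simp
        ultimately show ?thesis
          using t1 t2 t3 unfolding B_def by blast
      qed
      finally show ?thesis
        using N by simp
    qed
    moreover have "(\<lambda>m. 3 * (real (N * N) * E N m)) \<longlonglongrightarrow> 3 * (real (N * N) * 0)"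
      by (intro tendsto_intros E)
    ultimately show "\<exists>g. g \<longlonglongrightarrow> 0 \<and> (\<forall>m. dev ?a m \<le> r + g m)"
      by (intro exI[of _ "\<lambda>m. 3 * (real (N * N) * E N m)"]) simp
  qed
qed

text \<open>Right multiplication by the projection onto the levels below \<open>N\<close> turns
  \<open>a\<close> into a finite sum of rank-one operators. The remainder has deviation at most its
  second moment, which is small by normality.\<close>

theorem dev_tendsto:
  assumes a: "a \<in> bop UNIV"
  shows "dev a \<longlonglongrightarrow> 0"
proof (rule tendsto_zero_approx[OF dev_nonneg])
  fix r :: real assume r: "r > 0"
  obtain C where C: "bounded_by a C"
    using bop_bounded_by[OF a] by blast
  then have C0: "0 \<le> C"
    by (simp add: bounded_by_def)
  have "(\<lambda>N. 2 * (C * sn (coproj {..<N}))\<^sup>2) \<longlonglongrightarrow> 2 * (C * 0)\<^sup>2"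
    by (intro tendsto_intros normal_state_coproj normal)
  then have "\<forall>\<^sub>F N in sequentially. 2 * (C * sn (coproj {..<N}))\<^sup>2 < r"
    by (rule order_tendstoD(2)) (use r in simp)
  then obtain N where N: "2 * (C * sn (coproj {..<N}))\<^sup>2 < r"
    by (auto simp: eventually_sequentially)
  let ?p = "proj {..<N}" and ?q = "coproj {..<N}"
  have "dev (\<Sum>j<N. butterfly UNIV (a (ket j)) (ket j)) \<longlonglongrightarrow> 0"
    using a by (intro dev_sum_tendsto dev_butterfly_tendsto butterfly_bop) auto
  moreover have "a \<circ> ?p = (\<Sum>j<N. butterfly UNIV (a (ket j)) (ket j))"
    using a by (simp add: proj_eq_butterfly_sum comp_sum[where A = UNIV] comp_butterfly)
  ultimately have lim: "dev (a \<circ> ?p) \<longlonglongrightarrow> 0"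
    by simp
  have eq: "a = (a \<circ> ?p) + (a \<circ> ?q)"
    using comp_plus[OF a proj_bop coproj_bop, of "{..<N}" "{..<N}"] a by (simp only: proj_coproj comp_id_op)
  have "dev a m \<le> r + 2 * dev (a \<circ> ?p) m" for m
  proof -
    have "dev ((a \<circ> ?p) + (a \<circ> ?q)) m \<le> 2 * dev (a \<circ> ?p) m + 2 * dev (a \<circ> ?q) m"
      using a by (intro dev_plus) auto
    moreover have "dev (a \<circ> ?q) m \<le> (C * sn ?q)\<^sup>2"
    proof (rule order_trans[OF dev_le])
      show "(sn (a \<circ> ?q))\<^sup>2 \<le> (C * sn ?q)\<^sup>2"
        using a by (intro power_mono state_norm_comp_le[OF state _ _ C]) auto
    qed (use a in simp)
    ultimately show ?thesis
      using N unfolding eq[symmetric] by linarith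
  qed
  moreover have "(\<lambda>m. 2 * dev (a \<circ> ?p) m) \<longlonglongrightarrow> 2 * 0"
    by (intro tendsto_intros lim)
  ultimately show "\<exists>g. g \<longlonglongrightarrow> 0 \<and> (\<forall>m. dev a m \<le> r + g m)"
    by (intro exI[of _ "\<lambda>m. 2 * dev (a \<circ> ?p) m"]) simp
qed

end

subsection \<open>Observability of the micromaser\<close>

lemma ket_apply: "ket i j = (if j = i then 1 else 0)"
  by (simp add: ket_def)

lemma sum_UNIV_2: "(\<Sum>i\<in>UNIV. f i) = f 0 + f (1 :: 2)"
proof -
  have "(2 :: 2) = 0"
    by simp
  then have U: "(UNIV :: 2 set) = {0, 1}"
    using UNIV_2 by auto
  show ?thesis
    unfolding U by simp
qed

text \<open>Write \<open>x\<close> as \<open>p x p + p x q + q x\<close>, where \<open>p x p\<close>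
  is \<open>x (ket i) i\<close> times \<open>p\<close>. Replacing \<open>\<omega> p\<close> by
  \<open>1\<close> and dropping the two terms with \<open>q\<close> each cost at most
  \<open>C\<close> times the state norm of \<open>q\<close>, whence the factor
  \<open>3\<close>.\<close>

lemma state_near_vacuum:
  assumes s: "state UNIV \<omega>" and x: "x \<in> bop UNIV" and C: "bounded_by x C"
  shows "cmod (\<omega> x - x (ket i) i) \<le> 3 * C * state_norm UNIV \<omega> (coproj {i})"
proof -
  let ?p = "proj {i}" and ?q = "coproj {i}"
  let ?s = "state_norm UNIV \<omega> ?q"
  have C0: "0 \<le> C"
    using C by (simp add: bounded_by_def)
  have pq: "?p + ?q = id_op UNIV"
    by (rule proj_coproj)
  have "x = (?p + ?q) \<circ> x"
    unfolding pq by (rule id_op_comp[OF x, symmetric])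
  also have "\<dots> = (?p \<circ> x) + (?q \<circ> x)"
    by (rule plus_comp)
  also have "?p \<circ> x = (?p \<circ> x \<circ> ?p) + (?p \<circ> x \<circ> ?q)"
  proof -
    have "?p \<circ> x = ?p \<circ> x \<circ> (?p + ?q)"
      unfolding pq comp_id_op[OF bop_comp[OF proj_bop x]] ..
    then show ?thesis
      using comp_plus[OF bop_comp[OF proj_bop x] proj_bop coproj_bop, of "{i}" "{i}" "{i}"] by (rule trans)
  qed
  also have "?p \<circ> x \<circ> ?p = oscale (x (ket i) i) ?p"
    using proj_comp_proj[OF x, of "{i}"] proj_eq_butterfly_sum[of "{i}"] by simp
  finally have eq: "x = oscale (x (ket i) i) ?p + (?p \<circ> x \<circ> ?q) + (?q \<circ> x)" .
  have "\<omega> x = x (ket i) i * \<omega> ?p + \<omega> (?p \<circ> x \<circ> ?q) + \<omega> (?q \<circ> x)"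
    by (subst eq, subst state_add[OF s], use x in simp, use x in simp, subst state_add[OF s])
      (use x in \<open>simp_all add: state_scale[OF s]\<close>)
  moreover have "\<omega> ?p + \<omega> ?q = 1"
    using state_add[OF s proj_bop coproj_bop, of "{i}" "{i}"] by (simp only: pq state_id[OF s])
  then have "\<omega> ?p = 1 - \<omega> ?q"
    by (simp only: eq_diff_eq)
  ultimately have "\<omega> x - x (ket i) i = - (x (ket i) i * \<omega> ?q) + \<omega> (?p \<circ> x \<circ> ?q) + \<omega> (?q \<circ> x)"
    by (simp add: right_diff_distrib)
  then have "cmod (\<omega> x - x (ket i) i) \<le> cmod (x (ket i) i * \<omega> ?q) + cmod (\<omega> (?p \<circ> x \<circ> ?q)) + cmod (\<omega> (?q \<circ> x))"
    by (simp only:) (intro order_trans[OF norm_triangle_ineq] add_mono order_refl, simp only: norm_minus_cancel order_refl)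
  moreover have "cmod (x (ket i) i * \<omega> ?q) \<le> C * ?s"
  proof -
    have "cmod (x (ket i) i) \<le> C"
      using cmod_le_ell2_norm[OF bop_ell2[OF x], of "ket i" i] C unfolding bounded_by_def
      by (metis ell2_norm_ket mult.right_neutral order_trans)
    moreover have "cmod (\<omega> ?q) \<le> ?s"
      by (rule state_le_norm[OF s coproj_bop])
    ultimately show ?thesis
      unfolding norm_mult by (intro mult_mono) (auto simp: C0)
  qed
  moreover have "cmod (\<omega> (?p \<circ> x \<circ> ?q)) \<le> C * ?s"
  proof -
    have "cmod (\<omega> (adj UNIV (adj UNIV x \<circ> ?p) \<circ> ?q)) \<le> state_norm UNIV \<omega> (adj UNIV x \<circ> ?p) * ?s"
      by (rule state_Cauchy_Schwarz[OF s]) (use x in auto)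
    also have "\<dots> \<le> C * ?s"
    proof (rule mult_right_mono)
      have "bounded_by (adj UNIV x) C"
        using C x by (intro bounded_byI[where A = UNIV] adj_bound) (auto simp: bounded_by_def)
      then have "state_norm UNIV \<omega> (adj UNIV x \<circ> ?p) \<le> C * state_norm UNIV \<omega> ?p"
        using x by (intro state_norm_comp_le[OF s]) auto
      also have "\<dots> \<le> C * 1"
        using state_norm_bounded_by[OF s proj_bop proj_bounded_by] C0 by (intro mult_left_mono)
      finally show "state_norm UNIV \<omega> (adj UNIV x \<circ> ?p) \<le> C"
        by simp
    qed (simp add: state_norm_ge_0[OF s])
    also have "adj UNIV (adj UNIV x \<circ> ?p) = ?p \<circ> x"
      using x by (simp add: adj_comp adj_proj)
    finally show ?thesis .
  qed
  moreover have "cmod (\<omega> (?q \<circ> x)) \<le> C * ?s"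
  proof -
    have "cmod (\<omega> (adj UNIV ?q \<circ> x)) \<le> ?s * state_norm UNIV \<omega> x"
      by (rule state_Cauchy_Schwarz[OF s coproj_bop x])
    also have "\<dots> \<le> ?s * C"
      using state_norm_bounded_by[OF s x C] by (intro mult_left_mono) (simp_all add: state_norm_ge_0[OF s])
    also have "adj UNIV ?q = ?q"
      by (simp add: coproj_def adj_proj)
    finally show ?thesis
      by (simp only: mult.commute)
  qed
  ultimately show ?thesis
    by linarith
qed

section \<open>Functionals blind to the fluctuations\<close>

context dilation
begin

lemma T_apply_ip:
  assumes x: "x \<in> bop UNIV" and f: "f \<in> ell2 UNIV" and g: "g \<in> ell2 UNIV"
  shows "ip f (T k l x g) = (\<Sum>i\<in>UNIV. ip (U i k f) (x (U i l g)))"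
proof -
  have "ip f (T k l x g) = (\<Sum>i\<in>UNIV. ip f (adj UNIV (U i k) (x (U i l g))))"
    unfolding dil_T_def op_sum_apply comp_apply
    by (rule ip_sum_right[OF f, where B = UNIV]) simp
  also have "\<dots> = (\<Sum>i\<in>UNIV. ip (U i k f) (x (U i l g)))"
    by (intro sum.cong refl adj_ip_right) (use x f in auto)
  finally show ?thesis .
qed

text \<open>The matrix \<open>d\<close> inverts \<open>c\<close>, so the mixture over
  \<open>l\<close> in \<open>R\<close> can be undone.\<close>

lemma T_eq_R:
  assumes x: "x \<in> bop UNIV"
  shows "T k l x = (\<Sum>t\<in>UNIV. oscale (d l t) (R (k, t) x))"
proof (rule ext)
  fix f
  have "(\<Sum>t\<in>UNIV. oscale (d l t) (R (k, t) x)) f = (\<Sum>t\<in>UNIV. \<Sum>l'\<in>UNIV. vscale (d l t * c t l') (T k l' x f))"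
    by (simp add: dil_R_def op_sum_apply vscale_sum vscale_vscale)
  also have "\<dots> = (\<Sum>l'\<in>UNIV. \<Sum>t\<in>UNIV. vscale (d l t * c t l') (T k l' x f))"
    by (rule sum.swap)
  also have "\<dots> = (\<Sum>l'\<in>UNIV. vscale (\<Sum>t\<in>UNIV. d l t * c t l') (T k l' x f))"
    by (intro sum.cong refl) (simp add: fun_eq_iff sum_fun_apply vscale_apply sum_distrib_right)
  also have "\<dots> = (\<Sum>l'\<in>UNIV. if l = l' then T k l' x f else 0)"
    unfolding c_inv by (intro sum.cong refl) auto
  finally show "T k l x f = (\<Sum>t\<in>UNIV. oscale (d l t) (R (k, t) x)) f"
    by simp
qed

text \<open>All words are demanded, not just the empty one: precomposing \<open>\<omega>\<close>
  with \<open>T k l\<close> prepends letters to \<open>S\<close>, so the property is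
  inherited.\<close>

definition blind :: "(nat \<Rightarrow> 'a op) \<Rightarrow> ('a op \<Rightarrow> complex) \<Rightarrow> bool" where
  "blind X \<omega> \<longleftrightarrow> clinear_map_on (bop UNIV) oscale (*) \<omega> \<and> (\<forall>S. (\<lambda>m. \<omega> (Rw S (X m))) \<longlonglongrightarrow> 0)"

lemma blind_cong:
  assumes X: "\<And>m. X m \<in> bop UNIV" and eq: "\<And>x. x \<in> bop UNIV \<Longrightarrow> \<omega> x = \<omega>' x" and "blind X \<omega>"
  shows "blind X \<omega>'"
  using assms(3) eq X by (simp add: blind_def clinear_map_on_def)

lemma blind_scale: "blind X \<omega> \<Longrightarrow> blind X (\<lambda>x. b * \<omega> x)"
  unfolding blind_def clinear_map_on_def by (auto simp: algebra_simps intro: tendsto_mult_right_zero)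

lemma blind_diff: "blind X \<omega> \<Longrightarrow> blind X \<omega>' \<Longrightarrow> blind X (\<lambda>x. \<omega> x - \<omega>' x)"
  unfolding blind_def clinear_map_on_def by (auto simp: algebra_simps intro: tendsto_diff[of _ 0 _ _ 0, simplified])

lemma blind_T:
  assumes X: "\<And>m. X m \<in> bop UNIV" and b: "blind X \<omega>"
  shows "blind X (\<lambda>x. \<omega> (T k l x))"
  unfolding blind_def
proof (intro conjI allI)
  have lin: "clinear_map_on (bop UNIV) oscale (*) \<omega>"
    using b by (simp add: blind_def)
  then show "clinear_map_on (bop UNIV) oscale (*) (\<lambda>x. \<omega> (T k l x))"
    by (simp add: clinear_map_on_def T_plus T_oscale)
  fix S
  have "\<omega> (T k l (Rw S (X m))) = (\<Sum>t\<in>UNIV. d l t * \<omega> (Rw ((k, t) # S) (X m)))" for m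
  proof -
    have "\<omega> (T k l (Rw S (X m))) = (\<Sum>t\<in>UNIV. \<omega> (oscale (d l t) (R (k, t) (Rw S (X m)))))"
      unfolding T_eq_R[OF Rw_bop[OF X]]
      by (rule clinear_sum[OF lin]) (use X in auto)
    then show ?thesis
      using lin X by (simp add: clinear_map_on_def)
  qed
  moreover have "(\<lambda>m. \<Sum>t\<in>UNIV. d l t * \<omega> (Rw ((k, t) # S) (X m))) \<longlonglongrightarrow> (\<Sum>t\<in>UNIV. d l t * 0)"
    using b unfolding blind_def by (intro tendsto_intros) blast
  ultimately show "(\<lambda>m. \<omega> (T k l (Rw S (X m)))) \<longlonglongrightarrow> 0"
    by simp
qed

lemma state_T:
  assumes s: "state UNIV \<omega>"
  shows "state UNIV (\<lambda>x. \<omega> (T k k x))"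
  unfolding state_def
proof (intro conjI allI impI)
  show "clinear_map_on (bop UNIV) oscale (*) (\<lambda>x. \<omega> (T k k x))"
    by (simp add: clinear_map_on_def T_plus T_oscale state_add[OF s] state_scale[OF s])
  show "\<omega> (T k k (id_op UNIV)) = 1"
    by (simp add: T_id state_id[OF s])
  fix x :: "'a op" assume x: "pos_op UNIV x"
  have "pos_op UNIV (T k k x)"
    unfolding pos_op_def
  proof (intro conjI ballI)
    fix f :: "'a vec" assume f: "f \<in> ell2 UNIV"
    have "ip (U i k f) (x (U i k f)) \<in> \<real>\<^sub>\<ge>\<^sub>0" for i
      using x by (simp add: pos_op_def)
    then show "ip f (T k k x f) \<in> \<real>\<^sub>\<ge>\<^sub>0"
      using T_apply_ip[OF _ f f] x
      by (auto simp: pos_op_def complex_nonneg_Reals_iff intro!: sum_nonneg)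
  qed (use x in \<open>simp add: pos_op_def\<close>)
  then show "\<omega> (T k k x) \<in> \<real>\<^sub>\<ge>\<^sub>0"
    by (rule state_pos[OF s])
qed

lemma state_T_pow: "state UNIV (\<lambda>x. \<phi> ((T k k ^^ m) x))"
proof (induction m)
  case (Suc m)
  have "(\<lambda>x. \<phi> ((T k k ^^ Suc m) x)) = (\<lambda>x. \<phi> ((T k k ^^ m) (T k k x)))"
    by (simp add: funpow_Suc_right del: funpow.simps)
  then show ?case
    using state_T[OF Suc, of k] by simp
qed (simp add: state)

lemma blind_T_pow:
  assumes X: "\<And>m. X m \<in> bop UNIV" and b: "blind X \<phi>"
  shows "blind X (\<lambda>x. \<phi> ((T k l ^^ m) x))"
proof (induction m)
  case (Suc m)
  have "(\<lambda>x. \<phi> ((T k l ^^ Suc m) x)) = (\<lambda>x. \<phi> ((T k l ^^ m) (T k l x)))"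
    by (simp add: funpow_Suc_right del: funpow.simps)
  then show ?case
    using blind_T[OF X Suc, of k l] by simp
qed (simp add: b)

end

text \<open>\<open>U i k\<close> is the block of \<open>u\<close> from atom state \<open>k\<close>
  to atom state \<open>i\<close>. In \<open>U01\<close> the atom gives its quantum to the ladder, in
  \<open>U10\<close> it takes one up; the index on a coefficient is the total number of
  quanta.\<close>

locale micromaser_dilation = dilation U c d \<phi>
  for U :: "2 \<Rightarrow> 2 \<Rightarrow> nat op" and c d \<phi> +
  fixes \<alpha> \<alpha>p \<beta> \<beta>p :: "nat \<Rightarrow> complex"
  assumes normal: "normal_state UNIV \<phi>"
    and U00: "\<And>n. U 0 0 (ket n) = vscale (\<alpha> n) (ket n)"
    and U10_0: "U 1 0 (ket 0) = 0"
    and U10: "\<And>n. U 1 0 (ket (Suc n)) = vscale (\<beta>p (Suc n)) (ket n)"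
    and U01: "\<And>n. U 0 1 (ket n) = vscale (\<beta> (Suc n)) (ket (Suc n))"
    and U11: "\<And>n. U 1 1 (ket n) = vscale (\<alpha>p (Suc n)) (ket n)"
    and \<alpha>0: "cmod (\<alpha> 0) = 1"
    and \<beta>: "\<And>n. \<beta> (Suc n) \<noteq> 0"
begin

lemma \<alpha>0_nz: "\<alpha> 0 \<noteq> 0"
  using \<alpha>0 by auto

lemma T_entry:
  assumes x: "x \<in> bop UNIV"
  shows "T k l x (ket j) i = ip (U 0 k (ket i)) (x (U 0 l (ket j))) + ip (U 1 k (ket i)) (x (U 1 l (ket j)))"
  using T_apply_ip[OF x, of "ket i" "ket j" k l] by (simp add: sum_UNIV_2)

lemma \<alpha>\<beta>p: "(cmod (\<alpha> (Suc n)))\<^sup>2 + (cmod (\<beta>p (Suc n)))\<^sup>2 = 1"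
proof -
  have "T 0 0 (id_op UNIV) (ket (Suc n)) (Suc n) = of_real ((cmod (\<alpha> (Suc n)))\<^sup>2 + (cmod (\<beta>p (Suc n)))\<^sup>2)"
    unfolding T_entry[OF bop_id]
    by (simp add: U00 U10 vscale_apply complex_norm_square mult.commute ket_apply del: of_real_power)
  moreover have "T 0 0 (id_op UNIV) (ket (Suc n)) (Suc n) = 1"
    unfolding T_id by (simp add: ket_apply)
  ultimately show ?thesis
    by (metis of_real_eq_1_iff)
qed

text \<open>The columns of a unitary two-by-two block are orthogonal, so \<open>\<beta>p = 0\<close>
  and \<open>\<beta> \<noteq> 0\<close> force \<open>\<alpha> = 0\<close>, against the norm of the
  column. Descent under ground-state atoms is governed by \<open>\<beta>p\<close>, while the
  hypothesis concerns \<open>\<beta>\<close>.\<close>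

lemma \<beta>p: "\<beta>p (Suc n) \<noteq> 0"
proof
  assume 0: "\<beta>p (Suc n) = 0"
  have "T 0 1 (id_op UNIV) (ket n) (Suc n) = cnj (\<alpha> (Suc n)) * \<beta> (Suc n)"
    unfolding T_entry[OF bop_id] by (simp add: U00 U10 U01 U11 0 vscale_apply ket_apply pointwise)
  moreover have "T 0 1 (id_op UNIV) (ket n) (Suc n) = 0"
    unfolding T_id by (simp add: pointwise)
  ultimately have "\<alpha> (Suc n) = 0"
    using \<beta>[of n] by simp
  then show False
    using \<alpha>\<beta>p[of n] 0 by simp
qed

lemma proj_ket: "proj F (ket j) = (if j \<in> F then ket j else 0)"
  by (auto simp: fun_eq_iff proj_apply trunc_apply ket_apply pointwise)

text \<open>Ground-state atoms only take energy out, so the probability of at most \<open>N\<close> quanta increases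
  by the amount flowing down from level \<open>N + 1\<close>.\<close>

lemma T_proj:
  "T 0 0 (proj {..<Suc N}) = proj {..<Suc N} + oscale (of_real ((cmod (\<beta>p (Suc N)))\<^sup>2)) (butterfly UNIV (ket (Suc N)) (ket (Suc N)))"
proof (rule op_eqI[where A = UNIV])
  fix i j :: nat
  have m: "cnj z * z = of_real ((cmod z)\<^sup>2)" for z
    by (simp only: complex_norm_square mult.commute)
  have s: "cnj (\<alpha> (Suc n)) * \<alpha> (Suc n) + cnj (\<beta>p (Suc n)) * \<beta>p (Suc n) = 1" for n
    unfolding m of_real_add[symmetric] \<alpha>\<beta>p by simp
  have a0: "cnj (\<alpha> 0) * \<alpha> 0 = 1"
    unfolding m \<alpha>0 by simp
  have p: "proj F (ket j) i = (if i = j \<and> j \<in> F then 1 else 0)" for F and i j :: nat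
    by (simp add: proj_ket ket_apply pointwise)
  have e0: "ip (U 0 0 (ket i)) (proj F (U 0 0 (ket j))) = (if i = j \<and> j \<in> F then cnj (\<alpha> i) * \<alpha> j else 0)" for F
    by (simp add: U00 bop_scale[OF proj_bop] p)
  have e1: "ip (U 1 0 (ket (Suc n))) (proj F (U 1 0 (ket (Suc k)))) = (if n = k \<and> k \<in> F then cnj (\<beta>p (Suc n)) * \<beta>p (Suc k) else 0)" for F n k
    by (simp add: U10 bop_scale[OF proj_bop] p)
  have r: "(proj {..<Suc N} + oscale (of_real ((cmod (\<beta>p (Suc N)))\<^sup>2)) (butterfly UNIV (ket (Suc N)) (ket (Suc N)))) (ket j) i
    = (if i = j \<and> j < Suc N then 1 else 0) + (if j = Suc N \<and> i = Suc N then cnj (\<beta>p (Suc N)) * \<beta>p (Suc N) else 0)"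
    by (simp add: pointwise p butterfly_ket m del: of_real_power)
  show "T 0 0 (proj {..<Suc N}) (ket j) i
    = (proj {..<Suc N} + oscale (of_real ((cmod (\<beta>p (Suc N)))\<^sup>2)) (butterfly UNIV (ket (Suc N)) (ket (Suc N)))) (ket j) i"
    unfolding r T_entry[OF proj_bop] e0
  proof (cases j; cases i)
    \<comment> \<open>For equal levels: at \<open>n < N\<close> the two contributions add up to
      \<open>1\<close>, at \<open>n = N\<close> only the descent from level \<open>Suc N\<close>
      remains, and above there is nothing.\<close>
    fix n k assume ji: "j = Suc n" "i = Suc k"
    show "(if i = j \<and> j \<in> {..<Suc N} then cnj (\<alpha> i) * \<alpha> j else 0) + ip (U 1 0 (ket i)) (proj {..<Suc N} (U 1 0 (ket j)))
      = (if i = j \<and> j < Suc N then 1 else 0) + (if j = Suc N \<and> i = Suc N then cnj (\<beta>p (Suc N)) * \<beta>p (Suc N) else 0)"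
      unfolding ji e1 using s[of n] by (cases "k = n"; cases "n < N"; cases "n = N") simp_all
  qed (simp_all add: U10_0 a0 bop_0[OF proj_bop])
qed auto

text \<open>
  \<open>pop m N\<close> and \<open>cum m N\<close> are the probabilities of exactly \<open>N\<close> and at most \<open>N\<close> quanta after \<open>m\<close>
  atoms in the ground state.
\<close>

definition pop :: "nat \<Rightarrow> nat \<Rightarrow> real" where
  "pop m N = Re (\<phi> ((T 0 0 ^^ m) (butterfly UNIV (ket N) (ket N))))"

definition cum :: "nat \<Rightarrow> nat \<Rightarrow> real" where
  "cum m N = Re (\<phi> ((T 0 0 ^^ m) (proj {..<Suc N})))"

lemma cum_Suc: "cum (Suc m) N = cum m N + (cmod (\<beta>p (Suc N)))\<^sup>2 * pop m (Suc N)"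
proof -
  note s = state_T_pow[where k = 0 and m = m]
  have "\<phi> ((T 0 0 ^^ Suc m) (proj {..<Suc N})) = \<phi> ((T 0 0 ^^ m) (T 0 0 (proj {..<Suc N})))"
    by (simp add: funpow_Suc_right del: funpow.simps)
  also have "\<dots> = \<phi> ((T 0 0 ^^ m) (proj {..<Suc N}))
     + of_real ((cmod (\<beta>p (Suc N)))\<^sup>2) * \<phi> ((T 0 0 ^^ m) (butterfly UNIV (ket (Suc N)) (ket (Suc N))))"
    unfolding T_proj using state_add[OF s] state_scale[OF s] by simp
  finally show ?thesis
    by (simp add: cum_def pop_def del: of_real_power)
qed

lemma butterfly_ket_eq_proj: "butterfly UNIV (ket N) (ket N) = proj {N}"
  using proj_eq_butterfly_sum[of "{N}"] by simp

lemma pop_nonneg: "0 \<le> pop m N"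
  unfolding pop_def butterfly_ket_eq_proj
  using state_pos[OF state_T_pow[where k = 0 and m = m] pos_op_proj, of "{N}"] by (simp add: complex_nonneg_Reals_iff)

lemma cum_le_1: "cum m N \<le> 1"
  unfolding cum_def
  using complex_Re_le_cmod state_bounded_by[OF state_T_pow[where k = 0 and m = m] proj_bop proj_bounded_by, of "{..<Suc N}"]
  by (rule order_trans)

lemma cum_eq_sum: "cum m N = (\<Sum>i<Suc N. pop m i)"
proof -
  have "\<phi> ((T 0 0 ^^ m) (proj {..<Suc N})) = (\<Sum>i<Suc N. \<phi> ((T 0 0 ^^ m) (butterfly UNIV (ket i) (ket i))))"
    unfolding proj_eq_butterfly_sum[OF finite_lessThan] by (rule state_sum[OF state_T_pow]) simp
  then show ?thesis
    by (simp only: cum_def pop_def Re_sum)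
qed

text \<open>\<open>cum m N\<close> increases in \<open>m\<close> and stays below \<open>1\<close>,
  so its increments vanish; each of them is \<open>pop m (Suc N)\<close> times the nonzero number
  \<open>(cmod (\<beta>p (Suc N)))\<^sup>2\<close>.\<close>

lemma pop_tendsto: "(\<lambda>m. pop m (Suc N)) \<longlonglongrightarrow> 0"
proof -
  have inc: "incseq (\<lambda>m. cum m N)"
    by (rule incseq_SucI) (simp add: cum_Suc pop_nonneg)
  obtain L where L: "(\<lambda>m. cum m N) \<longlonglongrightarrow> L"
    by (rule incseq_convergent[OF inc]) (use cum_le_1 in blast)
  have "(\<lambda>m. cum (Suc m) N - cum m N) \<longlonglongrightarrow> L - L"
    by (intro tendsto_diff LIMSEQ_Suc L)
  then have "(\<lambda>m. (cmod (\<beta>p (Suc N)))\<^sup>2 * pop m (Suc N)) \<longlonglongrightarrow> 0"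
    by (simp add: cum_Suc)
  then have "(\<lambda>m. inverse ((cmod (\<beta>p (Suc N)))\<^sup>2) * ((cmod (\<beta>p (Suc N)))\<^sup>2 * pop m (Suc N))) \<longlonglongrightarrow> 0"
    by (rule tendsto_mult_right_zero)
  then show ?thesis
    using \<beta>p[of N] by simp
qed

text \<open>Normality puts all but \<open>e\<close> of the weight on the levels up to
  \<open>N\<close> at the start, monotonicity of \<open>cum\<close> keeps it there, and the levels
  from \<open>1\<close> to \<open>N\<close> empty by \<open>pop_tendsto\<close>; what is left sits
  at level \<open>0\<close>.\<close>

lemma vacuum_tendsto: "(\<lambda>m. 1 - pop m 0) \<longlonglongrightarrow> 0"
proof (rule tendsto_zero_approx)
  show "0 \<le> 1 - pop m 0" for m
    using cum_le_1[of m 0] by (simp add: cum_eq_sum)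
  fix e :: real assume e: "e > 0"
  have "(\<lambda>N. (sn (coproj {..<N}))\<^sup>2) \<longlonglongrightarrow> 0\<^sup>2"
    by (intro tendsto_intros normal_state_coproj normal)
  then have "(\<lambda>N. (sn (coproj {..<Suc N}))\<^sup>2) \<longlonglongrightarrow> 0"
    using LIMSEQ_Suc by fastforce
  then have "\<forall>\<^sub>F N in sequentially. (sn (coproj {..<Suc N}))\<^sup>2 < e"
    by (rule order_tendstoD(2)) (rule e)
  then obtain N where N: "(sn (coproj {..<Suc N}))\<^sup>2 < e"
    by (auto simp: eventually_sequentially)
  have "1 - e \<le> cum 0 N"
  proof -
    have "\<phi> (proj {..<Suc N}) + \<phi> (coproj {..<Suc N}) = 1"
      using state_add[OF state proj_bop coproj_bop, of "{..<Suc N}" "{..<Suc N}"]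
      by (simp only: proj_coproj state_id[OF state])
    then have "cum 0 N + Re (\<phi> (coproj {..<Suc N})) = 1"
      unfolding cum_def by (metis funpow_0 one_complex.sel(1) plus_complex.sel(1))
    then show ?thesis
      using N state_norm_proj[OF state, of "- {..<Suc N}"] unfolding coproj_def by linarith
  qed
  moreover have "cum 0 N \<le> cum m N" for m
    by (induction m) (simp_all add: cum_Suc pop_nonneg add_increasing2)
  ultimately have "1 - e \<le> cum m N" for m
    using order_trans by blast
  then have "1 - pop m 0 \<le> e + (\<Sum>i<N. pop m (Suc i))" for m
    unfolding cum_eq_sum sum.lessThan_Suc_shift by (simp add: algebra_simps)
  moreover have "(\<lambda>m. \<Sum>i<N. pop m (Suc i)) \<longlonglongrightarrow> (\<Sum>i<N. 0)"
    by (intro tendsto_sum pop_tendsto)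
  ultimately show "\<exists>g. g \<longlonglongrightarrow> 0 \<and> (\<forall>m. 1 - pop m 0 \<le> e + g m)"
    by (intro exI[of _ "\<lambda>m. \<Sum>i<N. pop m (Suc i)"]) simp
qed

text \<open>On operators bounded by \<open>D\<close>, the state \<open>\<phi>\<close> composed with
  \<open>T 0 0 ^^ M\<close> is uniformly close to the vacuum functional by
  \<open>state_near_vacuum\<close>. The number \<open>M\<close> is fixed before \<open>m\<close>
  goes to infinity, and each such state is blind.\<close>

lemma blind_vacuum:
  assumes X: "\<And>m. X m \<in> bop UNIV" and D: "\<And>m. bounded_by (X m) D" and b: "blind X \<phi>"
  shows "blind X (\<lambda>x. x (ket 0) 0)"
  unfolding blind_def
proof (intro conjI allI)
  show "clinear_map_on (bop UNIV) oscale (*) (\<lambda>x :: nat op. x (ket 0) 0)"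
    by (simp add: clinear_map_on_def pointwise)
  fix S
  have D0: "0 \<le> D"
    using D[of 0] by (simp add: bounded_by_def)
  define s where "s m = state_norm UNIV (\<lambda>x. \<phi> ((T 0 0 ^^ m) x)) (coproj {0})" for m
  have s2: "(s m)\<^sup>2 = 1 - pop m 0" for m
  proof -
    note st = state_T_pow[where k = 0 and m = m]
    have "\<phi> ((T 0 0 ^^ m) (proj {0})) + \<phi> ((T 0 0 ^^ m) (coproj {0})) = 1"
      using state_add[OF st proj_bop coproj_bop, of "{0}" "{0}"] state_id[OF st] by (simp only: proj_coproj)
    then have "pop m 0 + Re (\<phi> ((T 0 0 ^^ m) (coproj {0}))) = 1"
      unfolding pop_def butterfly_ket_eq_proj by (metis one_complex.sel(1) plus_complex.sel(1))
    then show ?thesis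
      using state_norm_proj[OF st, of "- {0}"] unfolding s_def coproj_def by linarith
  qed
  have "(\<lambda>m. sqrt ((s m)\<^sup>2)) \<longlonglongrightarrow> sqrt 0"
    unfolding s2 by (intro tendsto_real_sqrt vacuum_tendsto)
  moreover have "0 \<le> s m" for m
    unfolding s_def by (rule state_norm_ge_0[OF state_T_pow coproj_bop])
  ultimately have s: "s \<longlonglongrightarrow> 0"
    by simp
  have "(\<lambda>m. cmod (Rw S (X m) (ket 0) 0)) \<longlonglongrightarrow> 0"
  proof (rule tendsto_zero_approx)
    fix e :: real assume e: "e > 0"
    have "(\<lambda>m. 3 * D * s m) \<longlonglongrightarrow> 3 * D * 0"
      by (intro tendsto_intros s)
    then have "\<forall>\<^sub>F m in sequentially. 3 * D * s m < e"
      by (rule order_tendstoD(2)) (use e in simp)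
    then obtain M where M: "3 * D * s M < e"
      by (auto simp: eventually_sequentially)
    have "cmod (Rw S (X m) (ket 0) 0) \<le> e + cmod (\<phi> ((T 0 0 ^^ M) (Rw S (X m))))" for m
    proof -
      have "cmod (\<phi> ((T 0 0 ^^ M) (Rw S (X m))) - Rw S (X m) (ket 0) 0) \<le> 3 * D * s M"
        unfolding s_def using X D by (intro state_near_vacuum[OF state_T_pow] Rw_bounded_by) auto
      then show ?thesis
        using M norm_triangle_ineq3[of "\<phi> ((T 0 0 ^^ M) (Rw S (X m)))" "Rw S (X m) (ket 0) 0"] by linarith
    qed
    moreover have "(\<lambda>m. cmod (\<phi> ((T 0 0 ^^ M) (Rw S (X m))))) \<longlonglongrightarrow> 0"
      using blind_T_pow[OF X b, where k = 0 and l = 0 and m = M] unfolding blind_def by (simp add: tendsto_norm_zero)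
    ultimately show "\<exists>g. g \<longlonglongrightarrow> 0 \<and> (\<forall>m. cmod (Rw S (X m) (ket 0) 0) \<le> e + g m)"
      by blast
  qed simp
  then show "(\<lambda>m. Rw S (X m) (ket 0) 0) \<longlonglongrightarrow> 0"
    by (rule tendsto_norm_zero_cancel)
qed

text \<open>\<open>T 0 1\<close> raises the column index in row \<open>0\<close>,
  \<open>T 1 0\<close> raises the row index in column \<open>0\<close>, and \<open>T 1 1\<close>
  raises both up to a multiple of the old entry, which is subtracted. The divisors are products of
  values of \<open>\<beta>\<close> and \<open>\<alpha> 0\<close> or their conjugates, hence
  nonzero.\<close>

lemma blind_entries:
  assumes X: "\<And>m. X m \<in> bop UNIV" and D: "\<And>m. bounded_by (X m) D" and b: "blind X \<phi>"
  shows "blind X (\<lambda>x. x (ket j) i)"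
proof (induction i arbitrary: j)
  case 0
  show ?case
  proof (induction j)
    case 0
    show ?case
      by (rule blind_vacuum[OF X D b])
  next
    case (Suc j)
    \<comment> \<open>\<open>U 1 0 (ket 0) = 0\<close>: with one index at the vacuum a single term
      of \<open>T\<close> survives.\<close>
    have "blind X (\<lambda>x. inverse (cnj (\<alpha> 0) * \<beta> (Suc j)) * T 0 1 x (ket j) 0)"
      by (intro blind_scale blind_T[OF X Suc])
    then show ?case
    proof (rule blind_cong[OF X, rotated])
      fix x :: "nat op" assume x: "x \<in> bop UNIV"
      show "inverse (cnj (\<alpha> 0) * \<beta> (Suc j)) * T 0 1 x (ket j) 0 = x (ket (Suc j)) 0"
        unfolding T_entry[OF x] using \<beta>[of j] \<alpha>0_nz
        by (simp add: U00 U01 U10_0 bop_scale[OF x] vscale_apply) (simp add: field_simps)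
    qed
  qed
next
  case (Suc i)
  show ?case
  proof (cases j)
    case 0
    have "blind X (\<lambda>x. inverse (cnj (\<beta> (Suc i)) * \<alpha> 0) * T 1 0 x (ket 0) i)"
      by (intro blind_scale blind_T[OF X Suc])
    then show ?thesis
    proof (rule blind_cong[OF X, rotated])
      fix x :: "nat op" assume x: "x \<in> bop UNIV"
      show "inverse (cnj (\<beta> (Suc i)) * \<alpha> 0) * T 1 0 x (ket 0) i = x (ket j) (Suc i)"
        unfolding T_entry[OF x] using \<beta>[of i] \<alpha>0_nz 0
        by (simp add: U00 U01 U10_0 bop_scale[OF x] bop_0[OF x] vscale_apply) (simp add: field_simps)
    qed
  next
    case (Suc j')
    have "blind X (\<lambda>x. inverse (cnj (\<beta> (Suc i)) * \<beta> (Suc j')) * (T 1 1 x (ket j') i - (cnj (\<alpha>p (Suc i)) * \<alpha>p (Suc j')) * x (ket j') i))"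
      by (intro blind_scale blind_diff blind_T[OF X Suc.IH] Suc.IH)
    then show ?thesis
    proof (rule blind_cong[OF X, rotated])
      fix x :: "nat op" assume x: "x \<in> bop UNIV"
      show "inverse (cnj (\<beta> (Suc i)) * \<beta> (Suc j')) * (T 1 1 x (ket j') i - (cnj (\<alpha>p (Suc i)) * \<alpha>p (Suc j')) * x (ket j') i) = x (ket j) (Suc i)"
        unfolding T_entry[OF x] using \<beta>[of i] \<beta>[of j'] Suc
        by (simp add: U11 U01 bop_scale[OF x] vscale_apply mult.assoc) (simp add: field_simps)
    qed
  qed
qed

lemma observable_dilation:
  assumes "\<And>x. x \<in> bop UNIV \<Longrightarrow> \<phi> (adj UNIV x \<circ> x) = 0 \<Longrightarrow> x = 0"
  shows "observable_dilation U c d \<phi>"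
proof (unfold_locales)
  fix X :: "nat \<Rightarrow> nat op" and D i j
  assume X: "\<And>m. X m \<in> bop UNIV" and D: "\<And>m. bounded_by (X m) D" and "\<And>S. (\<lambda>m. \<phi> (Rw S (X m))) \<longlonglongrightarrow> 0"
  then have "blind X \<phi>"
    using state by (simp add: blind_def state_def)
  then have "(\<lambda>m. Rw [] (X m) (ket j) i) \<longlonglongrightarrow> 0"
    using blind_entries[where X = X and D = D, OF X D] unfolding blind_def by blast
  then show "(\<lambda>m. X m (ket j) i) \<longlonglongrightarrow> 0"
    by simp
qed (use normal assms in auto)

end

subsection \<open>Block matrices\<close>

lemma ip_tensor_ket: "ip (tensor_vec f (ket k)) F = ip f (\<lambda>a. F (a, k))"
proof -
  have "ip (tensor_vec f (ket k)) F = (\<Sum>\<^sub>\<infinity>z\<in>(\<lambda>a. (a, k)) ` UNIV. cnj (tensor_vec f (ket k) z) * F z)"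
    unfolding ip_def by (rule infsum_cong_neutral) (auto simp: tensor_vec_def ket_apply)
  also have "\<dots> = (\<Sum>\<^sub>\<infinity>a. cnj (tensor_vec f (ket k) (a, k)) * F (a, k))"
    by (subst infsum_reindex) (auto simp: inj_on_def comp_def)
  finally show ?thesis
    by (simp add: ip_def tensor_vec_def ket_apply)
qed

definition slice :: "('a \<times> 'b) vec \<Rightarrow> 'b \<Rightarrow> 'a vec" where
  "slice F k = (\<lambda>a. F (a, k))"

lemma slice_ell2 [simp]:
  assumes "F \<in> ell2 A"
  shows "slice F k \<in> ell2 UNIV"
proof (rule ell2_bounded_sums(1)[where C = "ell2_norm F"])
  fix G :: "'a set" assume "finite G"
  have "(\<Sum>a\<in>G. (cmod (slice F k a))\<^sup>2) = (\<Sum>z\<in>(\<lambda>a. (a, k)) ` G. (cmod (F z))\<^sup>2)"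
    by (subst sum.reindex) (auto simp: inj_on_def slice_def)
  also have "\<dots> \<le> (ell2_norm F)\<^sup>2"
    using \<open>finite G\<close> by (intro sum_le_ell2_norm[OF assms]) auto
  finally show "(\<Sum>a\<in>G. (cmod (slice F k a))\<^sup>2) \<le> (ell2_norm F)\<^sup>2" .
qed auto

lemma slice_plus: "slice (F + G) k = slice F k + slice G k"
  by (simp add: slice_def fun_eq_iff pointwise)

lemma slice_vscale: "slice (vscale c F) k = vscale c (slice F k)"
  by (simp add: slice_def fun_eq_iff pointwise)

lemma slice_zero: "slice 0 k = 0"
  by (simp add: slice_def fun_eq_iff pointwise)

lemma slice_sum: "slice (\<Sum>i\<in>I. F i) k = (\<Sum>i\<in>I. slice (F i) k)"
  by (simp add: slice_def fun_eq_iff sum_fun_apply)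

lemma slice_tensor_ket: "slice (tensor_vec f (ket l)) k = (if k = l then f else 0)"
  by (auto simp: slice_def tensor_vec_def ket_apply fun_eq_iff pointwise)

lemma slice_outside: "F \<in> ell2 (UNIV \<times> B) \<Longrightarrow> k \<notin> B \<Longrightarrow> slice F k = 0"
  by (auto simp: slice_def fun_eq_iff pointwise ell2_outside[where A = "UNIV \<times> B"])

lemma tensor_ket_ell2 [simp]: "f \<in> ell2 UNIV \<Longrightarrow> k \<in> B \<Longrightarrow> tensor_vec f (ket k) \<in> ell2 (UNIV \<times> B)"
  by (rule tensor_vec_ell2) auto

lemma tensor_ket_plus: "tensor_vec (f + g) (ket k) = tensor_vec f (ket k) + tensor_vec g (ket k)"
  by (auto simp: tensor_vec_def fun_eq_iff pointwise distrib_right)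

lemma tensor_ket_vscale: "tensor_vec (vscale c f) (ket k) = vscale c (tensor_vec f (ket k))"
  by (auto simp: tensor_vec_def fun_eq_iff pointwise)

lemma tensor_ket_ket: "tensor_vec (ket a) (ket k) = ket (a, k)"
  by (auto simp: tensor_vec_def fun_eq_iff ket_apply)

lemma slice_expand:
  assumes "F \<in> ell2 (UNIV \<times> B)" "finite B"
  shows "F = (\<Sum>k\<in>B. tensor_vec (slice F k) (ket k))"
proof
  fix z
  show "F z = (\<Sum>k\<in>B. tensor_vec (slice F k) (ket k)) z"
  proof (cases z)
    case (Pair a b)
    have "(\<Sum>k\<in>B. tensor_vec (slice F k) (ket k)) z = (\<Sum>k\<in>B. if k = b then F (a, b) else 0)"
      unfolding sum_fun_apply by (intro sum.cong refl) (auto simp: tensor_vec_def slice_def ket_apply Pair)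
    then show ?thesis
      using assms Pair by (auto simp: ell2_outside[OF assms(1)])
  qed
qed

lemma norm_slices:
  assumes F: "F \<in> ell2 (UNIV \<times> B)" and B: "finite B"
  shows "(\<Sum>k\<in>B. (ell2_norm (slice F k))\<^sup>2) = (ell2_norm F)\<^sup>2"
proof -
  have "complex_of_real (\<Sum>k\<in>B. (ell2_norm (slice F k))\<^sup>2) = (\<Sum>k\<in>B. ip (slice F k) (slice F k))"
    using F by (simp add: ip_self[where A = UNIV])
  also have "\<dots> = (\<Sum>k\<in>B. ip (tensor_vec (slice F k) (ket k)) F)"
    unfolding ip_tensor_ket by (simp add: slice_def)
  also have "\<dots> = ip (\<Sum>k\<in>B. tensor_vec (slice F k) (ket k)) F"
    by (rule ip_sum_left[OF F, where B = "UNIV \<times> B", symmetric]) (use F in auto)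
  also have "\<dots> = of_real ((ell2_norm F)\<^sup>2)"
    unfolding slice_expand[OF F B, symmetric] by (rule ip_self[OF F])
  finally show ?thesis
    using of_real_eq_iff by blast
qed

lemma norm_tensor_ket: "f \<in> ell2 UNIV \<Longrightarrow> ell2_norm (tensor_vec f (ket k)) = ell2_norm f"
  using norm_slices[of "tensor_vec f (ket k)" "{k}"] by (simp add: slice_tensor_ket)

lemma norm_slice_le: "F \<in> ell2 (UNIV \<times> B) \<Longrightarrow> finite B \<Longrightarrow> ell2_norm (slice F k) \<le> ell2_norm F"
proof -
  assume F: "F \<in> ell2 (UNIV \<times> B)" and B: "finite B"
  show ?thesis
  proof (cases "k \<in> B")
    case True
    have "(ell2_norm (slice F k))\<^sup>2 \<le> (ell2_norm F)\<^sup>2"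
      unfolding norm_slices[OF F B, symmetric] by (rule member_le_sum[OF True]) (auto simp: B)
    then show ?thesis
      by (rule power2_le_imp_le) simp
  qed (simp add: slice_outside[OF F])
qed

text \<open>The partial matrix element \<open>(1 \<otimes> <k|) z (1 \<otimes> |l>)\<close>.\<close>

definition blk :: "('a \<times> 'b) op \<Rightarrow> 'b \<Rightarrow> 'b \<Rightarrow> 'a op" where
  "blk z k l = (\<lambda>f. if f \<in> ell2 UNIV then slice (z (tensor_vec f (ket l))) k else 0)"

lemma blk_apply: "f \<in> ell2 UNIV \<Longrightarrow> blk z k l f = slice (z (tensor_vec f (ket l))) k"
  by (simp add: blk_def)

lemma blk_entry: "blk z k l (ket a') a = z (ket (a', l)) (a, k)"
  by (simp add: blk_apply tensor_ket_ket) (simp add: slice_def)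

lemma blk_bop [simp]:
  assumes z: "z \<in> bop (UNIV \<times> B)" and l: "l \<in> B" and B: "finite B"
  shows "blk z k l \<in> bop UNIV"
proof -
  obtain C where C: "0 \<le> C" "\<And>F. ell2_norm (z F) \<le> C * ell2_norm F"
    using bop_bound[OF z] by blast
  show ?thesis
  proof (rule bopI[where C = C])
    fix f :: "'a vec" assume f: "f \<in> ell2 UNIV"
    have "ell2_norm (slice (z (tensor_vec f (ket l))) k) \<le> ell2_norm (z (tensor_vec f (ket l)))"
      by (rule norm_slice_le[OF bop_ell2[OF z] B])
    also have "\<dots> \<le> C * ell2_norm f"
      using C(2)[of "tensor_vec f (ket l)"] f by (simp add: norm_tensor_ket)
    finally show "ell2_norm (blk z k l f) \<le> C * ell2_norm f"
      using f by (simp add: blk_apply)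
    show "blk z k l f \<in> ell2 UNIV"
      using f by (simp add: blk_apply slice_ell2[OF bop_ell2[OF z]])
    fix c
    show "blk z k l (vscale c f) = vscale c (blk z k l f)"
      using f l by (simp add: blk_apply tensor_ket_vscale bop_scale[OF z] slice_vscale)
  next
    fix f g :: "'a vec" assume f: "f \<in> ell2 UNIV" and g: "g \<in> ell2 UNIV"
    show "blk z k l (f + g) = blk z k l f + blk z k l g"
      using f g l by (simp add: blk_apply tensor_ket_plus bop_add[OF z] slice_plus)
  qed (simp add: blk_def)
qed

lemma blk_eqI:
  fixes z z' :: "('a \<times> 'b) op"
  assumes "z \<in> bop (UNIV \<times> B)" "z' \<in> bop (UNIV \<times> B)" "\<And>k l. k \<in> B \<Longrightarrow> l \<in> B \<Longrightarrow> blk z k l = blk z' k l"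
  shows "z = z'"
proof (rule op_eqI[OF assms(1,2)])
  fix p q :: "'a \<times> 'b" assume "p \<in> UNIV \<times> B" "q \<in> UNIV \<times> B"
  then obtain a k a' l where pq: "p = (a, k)" "q = (a', l)" "k \<in> B" "l \<in> B"
    by auto
  show "z (ket q) p = z' (ket q) p"
    unfolding pq(1,2) blk_entry[symmetric] using assms(3)[OF pq(3,4)] by simp
qed

lemma blk_plus: "blk (z + z') k l = blk z k l + blk z' k l"
  by (rule ext) (simp add: blk_def slice_plus)

lemma blk_oscale: "blk (oscale c z) k l = oscale c (blk z k l)"
  by (rule ext) (simp add: blk_def slice_vscale)

lemma blk_minus: "blk (z - z') k l = blk z k l - blk z' k l"
  unfolding op_diff_eq by (simp only: blk_plus blk_oscale)

lemma blk_zero: "blk 0 k l = 0"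
  by (rule ext) (simp add: blk_def slice_zero)

lemma blk_sum: "blk (\<Sum>i\<in>I. z i) k l = (\<Sum>i\<in>I. blk (z i) k l)"
  by (rule ext) (simp add: blk_def op_sum_apply slice_sum)

lemma blk_comp:
  fixes z z' :: "('a \<times> 'b) op"
  assumes z: "z \<in> bop (UNIV \<times> B)" and z': "z' \<in> bop (UNIV \<times> B)" and B: "finite B" and l: "l \<in> B"
  shows "blk (z \<circ> z') k l = (\<Sum>m\<in>B. blk z k m \<circ> blk z' m l)"
proof
  fix f :: "'a vec"
  show "blk (z \<circ> z') k l f = (\<Sum>m\<in>B. blk z k m \<circ> blk z' m l) f"
  proof (cases "f \<in> ell2 UNIV")
    case True
    let ?F = "z' (tensor_vec f (ket l))"
    have F: "?F \<in> ell2 (UNIV \<times> B)"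
      by (rule bop_ell2[OF z'])
    have "z ?F = z (\<Sum>m\<in>B. tensor_vec (slice ?F m) (ket m))"
      by (rule arg_cong[OF slice_expand[OF F B]])
    also have "\<dots> = (\<Sum>m\<in>B. z (tensor_vec (slice ?F m) (ket m)))"
      by (rule bop_sum[OF z]) (simp add: slice_ell2[OF F])
    finally show ?thesis
      using True by (simp add: blk_apply op_sum_apply slice_ell2[OF F] slice_sum)
  next
    case False
    have "blk z k m 0 = 0" if "m \<in> B" for m
      by (rule bop_0[OF blk_bop[OF z that B]])
    moreover have "blk w k' l f = 0" for w :: "('a \<times> 'b) op" and k'
      using False by (simp add: blk_def)
    ultimately show ?thesis
      by (simp add: op_sum_apply)
  qed
qed

lemma blk_adj:
  assumes z: "z \<in> bop (UNIV \<times> B)" and B: "finite B" and k: "k \<in> B" and l: "l \<in> B"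
  shows "blk (adj (UNIV \<times> B) z) k l = adj UNIV (blk z l k)"
proof (rule adj_eqI[symmetric])
  show "blk (adj (UNIV \<times> B) z) k l \<in> bop UNIV"
    by (rule blk_bop[OF adj_bop[OF z] l B])
  fix f g :: "'a vec" assume f: "f \<in> ell2 UNIV" and g: "g \<in> ell2 UNIV"
  have "ip f (blk z l k g) = ip (tensor_vec f (ket l)) (z (tensor_vec g (ket k)))"
    using g by (simp add: blk_apply ip_tensor_ket slice_def)
  also have "\<dots> = ip (adj (UNIV \<times> B) z (tensor_vec f (ket l))) (tensor_vec g (ket k))"
    using f g k l by (intro adj_ip[OF z, symmetric]) auto
  also have "\<dots> = cnj (ip (tensor_vec g (ket k)) (adj (UNIV \<times> B) z (tensor_vec f (ket l))))"
    by (simp add: ip_cnj)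
  also have "\<dots> = ip (blk (adj (UNIV \<times> B) z) k l f) g"
    unfolding ip_tensor_ket using f by (simp add: ip_cnj blk_apply slice_def)
  finally show "ip f (blk z l k g) = ip (blk (adj (UNIV \<times> B) z) k l f) g" .
qed

lemma blk_id: "l \<in> B \<Longrightarrow> blk (id_op (UNIV \<times> B)) k l = (if k = l then id_op UNIV else 0)"
  by (rule ext) (auto simp: blk_def id_op_def slice_tensor_ket)

definition mat_op :: "'b set \<Rightarrow> ('b \<Rightarrow> 'b \<Rightarrow> 'a op) \<Rightarrow> ('a \<times> 'b) op" where
  "mat_op B x = (\<lambda>F. if F \<in> ell2 (UNIV \<times> B) then \<Sum>k\<in>B. tensor_vec (\<Sum>l\<in>B. x k l (slice F l)) (ket k) else 0)"

lemma embed_slice_bop: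
  assumes x: "x \<in> bop UNIV" and k: "k \<in> B" and B: "finite B"
  shows "(\<lambda>F. if F \<in> ell2 (UNIV \<times> B) then tensor_vec (x (slice F l)) (ket k) else 0) \<in> bop (UNIV \<times> B)"
proof -
  obtain C where C: "0 \<le> C" "\<And>f. ell2_norm (x f) \<le> C * ell2_norm f"
    using bop_bound[OF x] by blast
  show ?thesis
  proof (rule bopI[where C = C])
    fix F :: "('a \<times> 'b) vec" assume F: "F \<in> ell2 (UNIV \<times> B)"
    then show "(if F \<in> ell2 (UNIV \<times> B) then tensor_vec (x (slice F l)) (ket k) else 0) \<in> ell2 (UNIV \<times> B)"
      using x k by simp
    have "ell2_norm (x (slice F l)) \<le> C * ell2_norm F"
      using C(2)[of "slice F l"] mult_left_mono[OF norm_slice_le[OF F B, of l] C(1)] by linarith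
    then show "ell2_norm (if F \<in> ell2 (UNIV \<times> B) then tensor_vec (x (slice F l)) (ket k) else 0) \<le> C * ell2_norm F"
      using F x by (simp add: norm_tensor_ket)
  qed (use x in \<open>simp_all add: slice_plus slice_vscale bop_add[OF x] bop_scale[OF x] tensor_ket_plus tensor_ket_vscale\<close>)
qed

lemma mat_op_eq_sum:
  fixes x :: "'b \<Rightarrow> 'b \<Rightarrow> 'a op"
  assumes "\<And>k l. k \<in> B \<Longrightarrow> l \<in> B \<Longrightarrow> x k l \<in> bop UNIV"
  shows "mat_op B x = (\<Sum>k\<in>B. \<Sum>l\<in>B. (\<lambda>F. if F \<in> ell2 (UNIV \<times> B) then tensor_vec (x k l (slice F l)) (ket k) else 0))"
proof (rule ext)
  fix F :: "('a \<times> 'b) vec"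
  have t: "tensor_vec (\<Sum>l\<in>I. g l) (ket k) = (\<Sum>l\<in>I. tensor_vec (g l) (ket k))" for g :: "'b \<Rightarrow> 'a vec" and I k
    by (auto simp: tensor_vec_def fun_eq_iff sum_fun_apply sum_distrib_right)
  show "mat_op B x F = (\<Sum>k\<in>B. \<Sum>l\<in>B. (\<lambda>F. if F \<in> ell2 (UNIV \<times> B) then tensor_vec (x k l (slice F l)) (ket k) else 0)) F"
    by (simp add: mat_op_def op_sum_apply t)
qed

lemma mat_op_bop:
  assumes "\<And>k l. k \<in> B \<Longrightarrow> l \<in> B \<Longrightarrow> x k l \<in> bop UNIV" "finite B"
  shows "mat_op B x \<in> bop (UNIV \<times> B)"
proof -
  have "(\<Sum>k\<in>B. \<Sum>l\<in>B. (\<lambda>F. if F \<in> ell2 (UNIV \<times> B) then tensor_vec (x k l (slice F l)) (ket k) else 0)) \<in> bop (UNIV \<times> B)"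
    using assms by (intro bop_sum_ops embed_slice_bop)
  then show ?thesis
    using mat_op_eq_sum[of B x, OF assms(1)] by simp
qed

lemma blk_mat_op:
  fixes x :: "'b \<Rightarrow> 'b \<Rightarrow> 'a op"
  assumes x: "\<And>k l. k \<in> B \<Longrightarrow> l \<in> B \<Longrightarrow> x k l \<in> bop UNIV" and B: "finite B" and k: "k \<in> B" and l: "l \<in> B"
  shows "blk (mat_op B x) k l = x k l"
proof
  fix f :: "'a vec"
  show "blk (mat_op B x) k l f = x k l f"
  proof (cases "f \<in> ell2 UNIV")
    case True
    have "slice (mat_op B x (tensor_vec f (ket l))) k
        = (\<Sum>k'\<in>B. if k = k' then \<Sum>l'\<in>B. x k' l' (if l' = l then f else 0) else 0)"
      using True l by (simp add: mat_op_def slice_sum slice_tensor_ket)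
    also have "\<dots> = (\<Sum>l'\<in>B. x k l' (if l' = l then f else 0))"
      using k B by simp
    also have "\<dots> = (\<Sum>l'\<in>B. if l' = l then x k l f else 0)"
      using x[OF k] bop_0 by (intro sum.cong refl) auto
    finally show ?thesis
      using True l B by (simp add: blk_apply)
  qed (simp add: blk_def bop_outside[OF x[OF k l]])
qed

text \<open>For finite \<open>B\<close> the tensor product is the Kronecker matrix. Once this is
  known, identities between tensor products can be checked block by block.\<close>

lemma tensor_op_eq_mat_op:
  assumes x: "x \<in> bop UNIV" and y: "y \<in> bop B" and B: "finite B"
  shows "tensor_op UNIV B x y = mat_op B (\<lambda>k l. oscale (y (ket l) k) x)"
proof (rule ext)
  fix F :: "('a \<times> 'b) vec"
  show "tensor_op UNIV B x y F = mat_op B (\<lambda>k l. oscale (y (ket l) k) x) F"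
  proof (cases "F \<in> ell2 (UNIV \<times> B)")
    case True
    have "y (\<lambda>b'. x (slice F b') a) b = (\<Sum>k\<in>B. tensor_vec (\<Sum>l\<in>B. vscale (y (ket l) k) (x (slice F l))) (ket k)) (a, b)" for a b
    proof -
      \<comment> \<open>Slices outside \<open>B\<close> vanish and \<open>x 0 = 0\<close>, so
        \<open>g\<close> is supported on the finite set \<open>B\<close> and \<open>y g\<close> is a
        finite sum.\<close>
      define g where "g = (\<lambda>b'. x (slice F b') a)"
      have "g = trunc B g"
        by (auto simp: fun_eq_iff g_def trunc_apply slice_outside[OF True] bop_0[OF x] pointwise)
      then have "y g = (\<Sum>l\<in>B. vscale (g l) (y (ket l)))"
        using trunc_ip_expand[OF y B order_refl, of g] by simp
      then have "y g b = (\<Sum>l\<in>B. g l * y (ket l) b)"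
        by (simp add: sum_fun_apply vscale_apply)
      moreover have "(\<Sum>k\<in>B. tensor_vec (\<Sum>l\<in>B. vscale (y (ket l) k) (x (slice F l))) (ket k)) (a, b)
          = (\<Sum>k\<in>B. if k = b then \<Sum>l\<in>B. y (ket l) b * g l else 0)"
        unfolding sum_fun_apply[of _ B "(a, b)"]
        by (intro sum.cong refl) (auto simp: tensor_vec_def ket_apply sum_fun_apply vscale_apply g_def)
      moreover have "y (ket l) b = 0" if "b \<notin> B" for l
        by (rule ell2_outside[OF bop_ell2[OF y] that])
      ultimately show ?thesis
        using B by (auto simp: g_def mult.commute)
    qed
    then show ?thesis
      using True by (simp add: tensor_op_def mat_op_def fun_eq_iff[where 'a = "'a \<times> 'b"] slice_def)
  qed (simp add: tensor_op_def mat_op_def)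
qed

lemma tensor_op_bop [simp]:
  assumes "x \<in> bop UNIV" "y \<in> bop B" "finite B"
  shows "tensor_op UNIV B x y \<in> bop (UNIV \<times> B)"
  unfolding tensor_op_eq_mat_op[OF assms] using assms by (intro mat_op_bop) auto

lemma blk_tensor_op:
  assumes "x \<in> bop UNIV" "y \<in> bop B" "finite B" "k \<in> B" "l \<in> B"
  shows "blk (tensor_op UNIV B x y) k l = oscale (y (ket l) k) x"
  unfolding tensor_op_eq_mat_op[OF assms(1-3)] using assms by (subst blk_mat_op) auto

definition munit :: "'b set \<Rightarrow> 'b \<Rightarrow> 'b \<Rightarrow> 'b op" where
  "munit B k l = butterfly B (ket k) (ket l)"

lemma munit_bop [simp]: "k \<in> B \<Longrightarrow> l \<in> B \<Longrightarrow> munit B k l \<in> bop B"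
  by (simp add: munit_def)

lemma munit_ket: "l' \<in> B \<Longrightarrow> munit B k l (ket l') k' = (if k' = k \<and> l' = l then 1 else 0)"
  by (simp add: munit_def butterfly_apply vscale_apply) (auto simp: ket_apply)

lemma munit_expand:
  assumes y: "y \<in> bop B" and B: "finite B"
  shows "y = (\<Sum>k\<in>B. \<Sum>l\<in>B. oscale (y (ket l) k) (munit B k l))"
proof (rule op_eqI[OF y])
  show "(\<Sum>k\<in>B. \<Sum>l\<in>B. oscale (y (ket l) k) (munit B k l)) \<in> bop B"
    by (intro bop_sum_ops bop_oscale munit_bop)
  fix i j assume i: "i \<in> B" and j: "j \<in> B"
  have "(\<Sum>k\<in>B. \<Sum>l\<in>B. oscale (y (ket l) k) (munit B k l)) (ket j) i = (\<Sum>k\<in>B. \<Sum>l\<in>B. if k = i then (if l = j then y (ket j) i else 0) else 0)"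
    unfolding op_sum_apply sum_fun_apply using j
    by (intro sum.cong refl) (auto simp: vscale_apply munit_ket)
  also have "\<dots> = (\<Sum>k\<in>B. if k = i then y (ket j) i else 0)"
    using B j by (intro sum.cong refl) auto
  finally show "y (ket j) i = (\<Sum>k\<in>B. \<Sum>l\<in>B. oscale (y (ket l) k) (munit B k l)) (ket j) i"
    using B i by simp
qed

lemma blk_tensor_munit:
  assumes "x \<in> bop UNIV" "finite B" "k \<in> B" "l \<in> B" "k' \<in> B" "l' \<in> B"
  shows "blk (tensor_op UNIV B x (munit B k l)) k' l' = (if k' = k \<and> l' = l then x else 0)"
  unfolding blk_tensor_op[OF assms(1) munit_bop[OF assms(3,4)] assms(2,5,6)] munit_ket[OF assms(6)]
  by (auto simp: fun_eq_iff[of "oscale _ _"])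

text \<open>Matrix units reduce every operator to elementary tensors, so a linear map is fixed by
  its values on these when the second factor is finite.\<close>

lemma tensor_expand:
  assumes z: "z \<in> bop (UNIV \<times> B)" and B: "finite B"
  shows "z = (\<Sum>k\<in>B. \<Sum>l\<in>B. tensor_op UNIV B (blk z k l) (munit B k l))"
proof (rule blk_eqI[OF z])
  show "(\<Sum>k\<in>B. \<Sum>l\<in>B. tensor_op UNIV B (blk z k l) (munit B k l)) \<in> bop (UNIV \<times> B)"
    using z B by (intro bop_sum_ops tensor_op_bop munit_bop blk_bop)
  fix i j assume i: "i \<in> B" and j: "j \<in> B"
  have "blk (\<Sum>k\<in>B. \<Sum>l\<in>B. tensor_op UNIV B (blk z k l) (munit B k l)) i j
      = (\<Sum>k\<in>B. \<Sum>l\<in>B. if k = i then (if l = j then blk z i j else 0) else 0)"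
    unfolding blk_sum using z B i j
    by (intro sum.cong refl) (auto simp: blk_tensor_munit)
  also have "\<dots> = (\<Sum>k\<in>B. if k = i then blk z i j else 0)"
    using B j by (intro sum.cong refl) auto
  also have "\<dots> = blk z i j"
    using B i by simp
  finally show "blk z i j = blk (\<Sum>k\<in>B. \<Sum>l\<in>B. tensor_op UNIV B (blk z k l) (munit B k l)) i j" ..
qed

subsection \<open>Maps determined by elementary tensors\<close>

lemma pull_ell2:
  assumes f: "f \<in> ell2 (g ` B)" and inj: "inj_on g B"
  shows "(\<lambda>i. if i \<in> B then f (g i) else 0) \<in> ell2 B"
    and "ell2_norm (\<lambda>i. if i \<in> B then f (g i) else 0) \<le> ell2_norm f"
proof -
  have "(\<Sum>i\<in>F. (cmod (if i \<in> B then f (g i) else 0))\<^sup>2) \<le> (ell2_norm f)\<^sup>2" if "finite F" for F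
  proof -
    have "(\<Sum>i\<in>F. (cmod (if i \<in> B then f (g i) else 0))\<^sup>2) = (\<Sum>i\<in>F \<inter> B. (cmod (f (g i)))\<^sup>2)"
      using that by (intro sum.mono_neutral_cong_right) auto
    also have "\<dots> = (\<Sum>j\<in>g ` (F \<inter> B). (cmod (f j))\<^sup>2)"
      by (subst sum.reindex) (auto intro: inj_on_subset[OF inj])
    also have "\<dots> \<le> (ell2_norm f)\<^sup>2"
      using that by (intro sum_le_ell2_norm[OF f]) auto
    finally show ?thesis .
  qed
  then show "(\<lambda>i. if i \<in> B then f (g i) else 0) \<in> ell2 B"
    "ell2_norm (\<lambda>i. if i \<in> B then f (g i) else 0) \<le> ell2_norm f"
    using ell2_bounded_sums[of "\<lambda>i. if i \<in> B then f (g i) else 0" "ell2_norm f" B] by simp_all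
qed

lemma push_ell2:
  assumes h: "h \<in> ell2 B"
  shows "(\<lambda>j. if j \<in> g ` B then h (inv_into B g j) else 0) \<in> ell2 (g ` B)"
    and "ell2_norm (\<lambda>j. if j \<in> g ` B then h (inv_into B g j) else 0) \<le> ell2_norm h"
proof -
  have "(\<Sum>j\<in>F. (cmod (if j \<in> g ` B then h (inv_into B g j) else 0))\<^sup>2) \<le> (ell2_norm h)\<^sup>2" if "finite F" for F
  proof -
    have "(\<Sum>j\<in>F. (cmod (if j \<in> g ` B then h (inv_into B g j) else 0))\<^sup>2) = (\<Sum>j\<in>F \<inter> g ` B. (cmod (h (inv_into B g j)))\<^sup>2)"
      using that by (intro sum.mono_neutral_cong_right) auto
    also have "\<dots> = (\<Sum>i\<in>inv_into B g ` (F \<inter> g ` B). (cmod (h i))\<^sup>2)"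
      by (subst sum.reindex) (auto intro: inj_on_subset[OF inj_on_inv_into[of "g ` B"]])
    also have "\<dots> \<le> (ell2_norm h)\<^sup>2"
      using that by (intro sum_le_ell2_norm[OF h]) auto
    finally show ?thesis .
  qed
  then show "(\<lambda>j. if j \<in> g ` B then h (inv_into B g j) else 0) \<in> ell2 (g ` B)"
    "ell2_norm (\<lambda>j. if j \<in> g ` B then h (inv_into B g j) else 0) \<le> ell2_norm h"
    using ell2_bounded_sums[of "\<lambda>j. if j \<in> g ` B then h (inv_into B g j) else 0" "ell2_norm h" "g ` B"] by simp_all
qed

lemma reindex_op_bop:
  assumes T: "T \<in> bop B" and inj: "inj_on g B"
  shows "reindex_op g B T \<in> bop (g ` B)"
proof -
  obtain C where C: "0 \<le> C" "\<And>f. ell2_norm (T f) \<le> C * ell2_norm f"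
    using bop_bound[OF T] by blast
  define p where "p f = (\<lambda>i. if i \<in> B then f (g i) else (0 :: complex))" for f
  have p: "p f \<in> ell2 B" "ell2_norm (p f) \<le> ell2_norm f" if "f \<in> ell2 (g ` B)" for f
    using pull_ell2[OF that inj] by (simp_all add: p_def)
  have R: "reindex_op g B T f = (\<lambda>j. if j \<in> g ` B then T (p f) (inv_into B g j) else 0)" if "f \<in> ell2 (g ` B)" for f
    using that unfolding reindex_op_def p_def by simp
  have pp: "p (f + f') = p f + p f'" "p (vscale c f) = vscale c (p f)" for f f' c
    by (simp_all add: p_def fun_eq_iff pointwise)
  show ?thesis
  proof (rule bopI[where C = C])
    fix f assume f: "f \<in> ell2 (g ` B)"
    show "reindex_op g B T f \<in> ell2 (g ` B)"
      unfolding R[OF f] by (rule push_ell2(1)[OF bop_ell2[OF T]])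
    have "ell2_norm (reindex_op g B T f) \<le> ell2_norm (T (p f))"
      unfolding R[OF f] by (rule push_ell2(2)[OF bop_ell2[OF T]])
    also have "\<dots> \<le> C * ell2_norm f"
      using C(2)[of "p f"] mult_left_mono[OF p(2)[OF f] C(1)] by linarith
    finally show "ell2_norm (reindex_op g B T f) \<le> C * ell2_norm f" .
    fix c
    show "reindex_op g B T (vscale c f) = vscale c (reindex_op g B T f)"
      unfolding R[OF f] R[OF ell2_scale[OF f]] pp bop_scale[OF T p(1)[OF f]] by (auto simp: fun_eq_iff pointwise)
  next
    fix f f' assume f: "f \<in> ell2 (g ` B)" and f': "f' \<in> ell2 (g ` B)"
    show "reindex_op g B T (f + f') = reindex_op g B T f + reindex_op g B T f'"
      unfolding R[OF f] R[OF f'] R[OF ell2_add[OF f f']] pp bop_add[OF T p(1)[OF f] p(1)[OF f']]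
      by (auto simp: fun_eq_iff pointwise)
  qed (simp add: reindex_op_def)
qed

lemma reindex_op_entry:
  assumes inj: "inj_on g B" and i: "i \<in> B" and j: "j \<in> B"
  shows "reindex_op g B T (ket (g j)) (g i) = T (ket j) i"
proof -
  have "(\<lambda>i. if i \<in> B then ket (g j) (g i) else 0) = ket j"
    using j inj_onD[OF inj _ _ j] by (auto simp: fun_eq_iff ket_apply)
  moreover have "ket (g j) \<in> ell2 (g ` B)"
    using j by simp
  ultimately show ?thesis
    using i inj by (simp add: reindex_op_def)
qed

text \<open>Pattern for the linear maps defined by \<open>THE\<close>: an explicit linear map
  \<open>L0\<close> has the defining property and any other such map agrees with it on
  \<open>V\<close>; extensionality removes the freedom outside \<open>V\<close>.\<close>

lemma the_linear:
  assumes lin: "clinear_map_on V s t L0"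
    and closed: "\<And>x y. x \<in> V \<Longrightarrow> y \<in> V \<Longrightarrow> x + y \<in> V" "\<And>c x. x \<in> V \<Longrightarrow> s c x \<in> V"
    and Q: "Q (restrict L0 V)"
    and uniq: "\<And>L z. clinear_map_on V s t L \<Longrightarrow> Q L \<Longrightarrow> z \<in> V \<Longrightarrow> L z = L0 z"
  shows "(THE L. L \<in> extensional V \<and> clinear_map_on V s t L \<and> Q L) = restrict L0 V"
proof (rule the_equality)
  show "restrict L0 V \<in> extensional V \<and> clinear_map_on V s t (restrict L0 V) \<and> Q (restrict L0 V)"
    using lin closed Q by (simp add: clinear_map_on_def)
  fix L assume L: "L \<in> extensional V \<and> clinear_map_on V s t L \<and> Q L"
  show "L = restrict L0 V"
  proof (rule extensionalityI)
    fix z assume "z \<in> V"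
    then show "L z = restrict L0 V z"
      using uniq L by simp
  qed (use L in auto)
qed

lemma linear_tensor_expand:
  fixes L :: "('a \<times> 'b) op \<Rightarrow> 'w::ab_group_add"
  assumes lin: "clinear_map_on (bop (UNIV \<times> B)) oscale t L" and t0: "t 0 (L 0) = 0"
    and z: "z \<in> bop (UNIV \<times> B)" and B: "finite B"
  shows "L z = (\<Sum>k\<in>B. \<Sum>l\<in>B. L (tensor_op UNIV B (blk z k l) (munit B k l)))"
proof -
  have e: "tensor_op UNIV B (blk z k l) (munit B k l) \<in> bop (UNIV \<times> B)" if "k \<in> B" "l \<in> B" for k l
    using that z B by (intro tensor_op_bop blk_bop[of z B] munit_bop)
  have "L z = L (\<Sum>k\<in>B. \<Sum>l\<in>B. tensor_op UNIV B (blk z k l) (munit B k l))"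
    by (rule arg_cong[OF tensor_expand[OF z B]])
  also have "\<dots> = (\<Sum>k\<in>B. L (\<Sum>l\<in>B. tensor_op UNIV B (blk z k l) (munit B k l)))"
    using e by (intro clinear_sum[OF lin t0] bop_sum_ops)
  also have "\<dots> = (\<Sum>k\<in>B. \<Sum>l\<in>B. L (tensor_op UNIV B (blk z k l) (munit B k l)))"
    using e by (intro sum.cong refl clinear_sum[OF lin t0])
  finally show ?thesis .
qed

lemma linear_munit_expand:
  assumes lin: "clinear_map_on (bop B) oscale (*) \<psi>" and y: "y \<in> bop B" and B: "finite B"
  shows "\<psi> y = (\<Sum>k\<in>B. \<Sum>l\<in>B. y (ket l) k * \<psi> (munit B k l))"
proof -
  have "\<psi> y = \<psi> (\<Sum>k\<in>B. \<Sum>l\<in>B. oscale (y (ket l) k) (munit B k l))"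
    by (rule arg_cong[OF munit_expand[OF y B]])
  also have "\<dots> = (\<Sum>k\<in>B. \<psi> (\<Sum>l\<in>B. oscale (y (ket l) k) (munit B k l)))"
    by (rule clinear_sum[OF lin]) (simp, intro bop_sum_ops bop_oscale munit_bop)
  also have "\<dots> = (\<Sum>k\<in>B. \<Sum>l\<in>B. \<psi> (oscale (y (ket l) k) (munit B k l)))"
    by (intro sum.cong refl clinear_sum[OF lin]) (simp_all)
  also have "\<dots> = (\<Sum>k\<in>B. \<Sum>l\<in>B. y (ket l) k * \<psi> (munit B k l))"
    using lin by (intro sum.cong refl) (simp add: clinear_map_on_def)
  finally show ?thesis .
qed

lemma product_functional_eq:
  assumes \<phi>: "clinear_map_on (bop UNIV) oscale (*) \<phi>" and \<psi>: "clinear_map_on (bop B) oscale (*) \<psi>" and B: "finite B"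
  shows "product_functional UNIV B \<phi> \<psi> = (\<lambda>z\<in>bop (UNIV \<times> B). \<Sum>k\<in>B. \<Sum>l\<in>B. \<phi> (blk z k l) * \<psi> (munit B k l))"
  unfolding product_functional_def
proof (rule the_linear)
  have add: "\<phi> (x + y) = \<phi> x + \<phi> y" if "x \<in> bop UNIV" "y \<in> bop UNIV" for x y
    using \<phi> that by (simp add: clinear_map_on_def)
  have scale: "\<phi> (oscale c x) = c * \<phi> x" if "x \<in> bop UNIV" for x c
    using \<phi> that by (simp add: clinear_map_on_def)
  show "clinear_map_on (bop (UNIV \<times> B)) oscale (*) (\<lambda>z. \<Sum>k\<in>B. \<Sum>l\<in>B. \<phi> (blk z k l) * \<psi> (munit B k l))"
    unfolding clinear_map_on_def
  proof (intro conjI ballI allI)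
    fix x y :: "('a \<times> 'b) op" assume x: "x \<in> bop (UNIV \<times> B)" and y: "y \<in> bop (UNIV \<times> B)"
    show "(\<Sum>k\<in>B. \<Sum>l\<in>B. \<phi> (blk (x + y) k l) * \<psi> (munit B k l))
      = (\<Sum>k\<in>B. \<Sum>l\<in>B. \<phi> (blk x k l) * \<psi> (munit B k l)) + (\<Sum>k\<in>B. \<Sum>l\<in>B. \<phi> (blk y k l) * \<psi> (munit B k l))"
      unfolding sum.distrib[symmetric] blk_plus
      by (intro sum.cong refl) (simp add: add blk_bop[OF x _ B] blk_bop[OF y _ B] distrib_right)
  next
    fix c and x :: "('a \<times> 'b) op" assume x: "x \<in> bop (UNIV \<times> B)"
    show "(\<Sum>k\<in>B. \<Sum>l\<in>B. \<phi> (blk (oscale c x) k l) * \<psi> (munit B k l))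
      = c * (\<Sum>k\<in>B. \<Sum>l\<in>B. \<phi> (blk x k l) * \<psi> (munit B k l))"
      unfolding sum_distrib_left blk_oscale
      by (intro sum.cong refl) (simp add: scale blk_bop[OF x _ B])
  qed
  show "\<forall>x\<in>bop UNIV. \<forall>y\<in>bop B. (\<lambda>z\<in>bop (UNIV \<times> B). \<Sum>k\<in>B. \<Sum>l\<in>B. \<phi> (blk z k l) * \<psi> (munit B k l)) (tensor_op UNIV B x y) = \<phi> x * \<psi> y"
  proof (intro ballI)
    fix x :: "'a op" and y :: "'b op" assume x: "x \<in> bop UNIV" and y: "y \<in> bop B"
    have "(\<Sum>k\<in>B. \<Sum>l\<in>B. \<phi> (blk (tensor_op UNIV B x y) k l) * \<psi> (munit B k l))
        = \<phi> x * (\<Sum>k\<in>B. \<Sum>l\<in>B. y (ket l) k * \<psi> (munit B k l))"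
      unfolding sum_distrib_left by (intro sum.cong refl) (simp add: blk_tensor_op x y B scale)
    then show "(\<lambda>z\<in>bop (UNIV \<times> B). \<Sum>k\<in>B. \<Sum>l\<in>B. \<phi> (blk z k l) * \<psi> (munit B k l)) (tensor_op UNIV B x y) = \<phi> x * \<psi> y"
      using x y B linear_munit_expand[OF \<psi> y B] by simp
  qed
  fix L and z :: "('a \<times> 'b) op"
  assume L: "clinear_map_on (bop (UNIV \<times> B)) oscale (*) L"
    and Q: "\<forall>x\<in>bop UNIV. \<forall>y\<in>bop B. L (tensor_op UNIV B x y) = \<phi> x * \<psi> y" and z: "z \<in> bop (UNIV \<times> B)"
  have "L z = (\<Sum>k\<in>B. \<Sum>l\<in>B. L (tensor_op UNIV B (blk z k l) (munit B k l)))"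
    by (rule linear_tensor_expand[OF L _ z B]) simp
  also have "\<dots> = (\<Sum>k\<in>B. \<Sum>l\<in>B. \<phi> (blk z k l) * \<psi> (munit B k l))"
    using Q by (intro sum.cong refl) (simp add: blk_bop[OF z _ B])
  finally show "L z = (\<Sum>k\<in>B. \<Sum>l\<in>B. \<phi> (blk z k l) * \<psi> (munit B k l))" .
qed auto

text \<open>Blockwise the conditional expectation replaces an operator \<open>x\<close> by the
  scalar \<open>\<phi> x\<close>. This satisfies the defining equation on elementary tensors, and
  they span.\<close>

lemma Qn_eq:
  fixes \<phi> :: "'a op \<Rightarrow> complex"
  assumes \<phi>: "clinear_map_on (bop UNIV) oscale (*) \<phi>"
  shows "Qn \<phi> n = (\<lambda>z\<in>bop (UNIV \<times> words n). mat_op (words n) (\<lambda>K L. oscale (\<phi> (blk z K L)) (id_op UNIV)) :: ('a \<times> 'k::finite list) op)"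
proof -
  let ?B = "words n :: 'k list set"
  let ?L = "\<lambda>z :: ('a \<times> 'k list) op. mat_op ?B (\<lambda>K L. oscale (\<phi> (blk z K L)) (id_op UNIV) :: 'a op)"
  have B: "finite ?B"
    by simp
  have L_bop: "?L z \<in> bop (UNIV \<times> ?B)" for z
    by (intro mat_op_bop B bop_oscale bop_id)
  have blkL: "blk (?L z) K L = oscale (\<phi> (blk z K L)) (id_op UNIV)" if "K \<in> ?B" "L \<in> ?B" for z K L
    using that by (intro blk_mat_op B bop_oscale bop_id)
  have add: "\<phi> (x + y) = \<phi> x + \<phi> y" if "x \<in> bop UNIV" "y \<in> bop UNIV" for x y
    using \<phi> that by (simp add: clinear_map_on_def)
  have scale: "\<phi> (oscale c x) = c * \<phi> x" if "x \<in> bop UNIV" for x c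
    using \<phi> that by (simp add: clinear_map_on_def)
  have tQ: "?L (tensor_op UNIV ?B a c) = oscale (\<phi> a) (tensor_op UNIV ?B (id_op UNIV) c)" if a: "a \<in> bop UNIV" and c: "c \<in> bop ?B" for a c
  proof (rule blk_eqI[OF L_bop])
    fix K L assume K: "K \<in> ?B" and L: "L \<in> ?B"
    show "blk (?L (tensor_op UNIV ?B a c)) K L = blk (oscale (\<phi> a) (tensor_op UNIV ?B (id_op UNIV) c)) K L"
      unfolding blkL[OF K L] blk_oscale blk_tensor_op[OF a c B K L] blk_tensor_op[OF bop_id c B K L]
      by (rule ext) (simp add: scale a vscale_vscale mult.commute)
  qed (use c in simp)
  show ?thesis
    unfolding Qn_def
  proof (rule the_linear)
    show "clinear_map_on (bop (UNIV \<times> ?B)) oscale oscale ?L"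
      unfolding clinear_map_on_def
    proof (intro conjI ballI allI)
      fix x y :: "('a \<times> 'k list) op" assume x: "x \<in> bop (UNIV \<times> ?B)" and y: "y \<in> bop (UNIV \<times> ?B)"
      show "?L (x + y) = ?L x + ?L y"
      proof (rule blk_eqI[OF L_bop bop_plus[OF L_bop L_bop]])
        fix K L assume K: "K \<in> ?B" and L: "L \<in> ?B"
        show "blk (?L (x + y)) K L = blk (?L x + ?L y) K L"
        proof -
          have "blk (?L (x + y)) K L = oscale (\<phi> (blk x K L) + \<phi> (blk y K L)) (id_op UNIV)"
            by (rule trans[OF blkL[OF K L]]) (simp only: blk_plus add[OF blk_bop[OF x L B] blk_bop[OF y L B]])
          also have "\<dots> = oscale (\<phi> (blk x K L)) (id_op UNIV) + oscale (\<phi> (blk y K L)) (id_op UNIV)"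
            by (simp add: fun_eq_iff pointwise distrib_right)
          also have "\<dots> = blk (?L x + ?L y) K L"
            by (simp only: blk_plus[of "?L x" "?L y"] blkL[OF K L])
          finally show ?thesis .
        qed
      qed
    next
      fix c and x :: "('a \<times> 'k list) op" assume x: "x \<in> bop (UNIV \<times> ?B)"
      show "?L (oscale c x) = oscale c (?L x)"
      proof (rule blk_eqI[OF L_bop bop_oscale[OF L_bop]])
        fix K L assume K: "K \<in> ?B" and L: "L \<in> ?B"
        show "blk (?L (oscale c x)) K L = blk (oscale c (?L x)) K L"
        proof -
          have "blk (?L (oscale c x)) K L = oscale (c * \<phi> (blk x K L)) (id_op UNIV)"
            by (rule trans[OF blkL[OF K L]]) (simp only: blk_oscale scale[OF blk_bop[OF x L B]])
          also have "\<dots> = oscale c (oscale (\<phi> (blk x K L)) (id_op UNIV))"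
            by (rule ext) (simp add: vscale_vscale)
          also have "\<dots> = blk (oscale c (?L x)) K L"
            by (simp only: blk_oscale[of c "?L x"] blkL[OF K L])
          finally show ?thesis .
        qed
      qed
    qed
    show "\<forall>a\<in>bop UNIV. \<forall>c\<in>bop ?B. restrict ?L (bop (UNIV \<times> ?B)) (tensor_op UNIV ?B a c) = oscale (\<phi> a) (tensor_op UNIV ?B (id_op UNIV) c)"
      using tQ by simp
    fix L :: "('a \<times> 'k list) op \<Rightarrow> ('a \<times> 'k list) op" and z :: "('a \<times> 'k list) op"
    assume L: "clinear_map_on (bop (UNIV \<times> ?B)) oscale oscale L"
      and Q: "\<forall>a\<in>bop UNIV. \<forall>c\<in>bop ?B. L (tensor_op UNIV ?B a c) = oscale (\<phi> a) (tensor_op UNIV ?B (id_op UNIV) c)" and z: "z \<in> bop (UNIV \<times> ?B)"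
    have "L z = (\<Sum>k\<in>?B. \<Sum>l\<in>?B. L (tensor_op UNIV ?B (blk z k l) (munit ?B k l)))"
      by (rule linear_tensor_expand[OF L _ z B]) (rule ext, simp)
    also have "\<dots> = (\<Sum>k\<in>?B. \<Sum>l\<in>?B. oscale (\<phi> (blk z k l)) (tensor_op UNIV ?B (id_op UNIV :: 'a op) (munit ?B k l)))"
      using Q by (intro sum.cong refl) (simp add: blk_bop[OF z _ B])
    also have "\<dots> = ?L z"
    proof (rule blk_eqI)
      show "(\<Sum>k\<in>?B. \<Sum>l\<in>?B. oscale (\<phi> (blk z k l)) (tensor_op UNIV ?B (id_op UNIV :: 'a op) (munit ?B k l))) \<in> bop (UNIV \<times> ?B)"
        by (intro bop_sum_ops bop_oscale tensor_op_bop bop_id munit_bop B)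
      fix i j assume i: "i \<in> ?B" and j: "j \<in> ?B"
      have "blk (\<Sum>k\<in>?B. \<Sum>l\<in>?B. oscale (\<phi> (blk z k l)) (tensor_op UNIV ?B (id_op UNIV :: 'a op) (munit ?B k l))) i j
        = (\<Sum>k\<in>?B. \<Sum>l\<in>?B. if k = i then (if l = j then oscale (\<phi> (blk z i j)) (id_op UNIV :: 'a op) else 0) else 0)"
        unfolding blk_sum blk_oscale using i j
        by (intro sum.cong refl) (auto simp: blk_tensor_munit fun_eq_iff[of "oscale _ 0"])
      also have "\<dots> = (\<Sum>k\<in>?B. if k = i then oscale (\<phi> (blk z i j)) (id_op UNIV :: 'a op) else 0)"
        using B j by (intro sum.cong refl) auto
      finally show "blk (\<Sum>k\<in>?B. \<Sum>l\<in>?B. oscale (\<phi> (blk z k l)) (tensor_op UNIV ?B (id_op UNIV :: 'a op) (munit ?B k l))) i j = blk (?L z) i j"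
        unfolding blkL[OF i j] using B i by simp
    qed (rule L_bop)
    finally show "L z = ?L z" .
  qed auto
qed

section \<open>The product state on words\<close>

lemma image_Cons_words: "(\<lambda>(k, w). k # w) ` (UNIV \<times> words n) = words (Suc n)"
  by (auto simp: words_def image_iff length_Suc_conv)

lemma tensor_list_bop: "set cs \<subseteq> bop UNIV \<Longrightarrow> tensor_list cs \<in> bop (words (length cs) :: 'k::finite list set)"
proof (induction cs)
  case (Cons c cs)
  have "reindex_op (\<lambda>(k, w). k # w) (UNIV \<times> words (length cs)) (tensor_op UNIV (words (length cs)) c (tensor_list cs))
      \<in> bop ((\<lambda>(k, w). k # w) ` (UNIV \<times> words (length cs)))"
    using Cons by (intro reindex_op_bop tensor_op_bop) (auto simp: inj_on_def)
  then show ?case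
    by (simp add: image_Cons_words)
qed simp

lemma tensor_list_Cons_entry:
  assumes "c \<in> bop UNIV" "set cs \<subseteq> bop UNIV" "K \<in> words (length cs)" "L \<in> words (length cs)"
  shows "tensor_list (c # cs) (ket (l # L)) (k # K) = c (ket l) k * tensor_list cs (ket L) (K :: 'k::finite list)"
proof -
  let ?t = "tensor_op UNIV (words (length cs)) c (tensor_list cs)"
  have "tensor_list (c # cs) (ket (l # L)) (k # K) = ?t (ket (l, L)) (k, K)"
    using reindex_op_entry[of "\<lambda>(k, w). k # w" "UNIV \<times> words (length cs)" "(k, K)" "(l, L)" ?t] assms
    by (simp add: inj_on_def)
  also have "\<dots> = blk ?t K L (ket l) k"
    by (simp add: blk_entry)
  also have "\<dots> = c (ket l) k * tensor_list cs (ket L) K"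
    using assms by (subst blk_tensor_op) (simp_all add: tensor_list_bop vscale_apply)
  finally show ?thesis .
qed

text \<open>This is the value of the product state at a matrix unit of words. The catch-all equation
  supplies the empty product; the function is meant for words of equal length.\<close>

fun word_weight :: "('k op \<Rightarrow> complex) \<Rightarrow> 'k list \<Rightarrow> 'k list \<Rightarrow> complex" where
  "word_weight \<psi> (k # K) (l # L) = \<psi> (munit UNIV k l) * word_weight \<psi> K L"
| "word_weight \<psi> _ _ = 1"

text \<open>Matrix units of words factor into letters, so the values on elementary tensors determine
  a functional on the whole matrix algebra.\<close>

lemma munit_words:
  fixes K L :: "'k::finite list"
  shows "length K = n \<Longrightarrow> length L = n \<Longrightarrow> munit (words n) K L = tensor_list (map2 (munit UNIV) K L)"
proof (induction n arbitrary: K L)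
  case 0
  have "id_op (words 0) (ket ([] :: 'k list)) = ket []"
    by (rule id_op_apply) simp
  with 0 show ?case
    by (intro op_eqI[where A = "words 0"]) (auto simp: munit_ket ket_apply[of "[]" "[]"])
next
  case (Suc n)
  obtain k K' l L' where KL: "K = k # K'" "L = l # L'" "length K' = n" "length L' = n"
    using Suc.prems by (metis length_Suc_conv)
  have m: "set (map2 (munit UNIV) K L) \<subseteq> bop UNIV" for K L :: "'k list"
    by auto
  show ?case
  proof (rule op_eqI[where A = "words (Suc n)"])
    show "munit (words (Suc n)) K L \<in> bop (words (Suc n))"
      using Suc.prems by (intro munit_bop) (auto simp: words_def)
    show "tensor_list (map2 (munit UNIV) K L) \<in> bop (words (Suc n))"
      using tensor_list_bop[OF m, of K L] Suc.prems by simp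
    fix I J :: "'k list" assume "I \<in> words (Suc n)" "J \<in> words (Suc n)"
    then obtain i I' j J' where IJ: "I = i # I'" "J = j # J'" "I' \<in> words n" "J' \<in> words n"
      by (auto simp: words_def length_Suc_conv)
    have "tensor_list (map2 (munit UNIV) K L) (ket J) I = munit UNIV k l (ket j) i * tensor_list (map2 (munit UNIV) K' L') (ket J') I'"
      unfolding KL(1,2) IJ(1,2) list.map zip_Cons_Cons prod.case
      by (rule tensor_list_Cons_entry) (use m KL IJ in auto)
    also have "\<dots> = munit (words (Suc n)) K L (ket J) I"
      unfolding Suc.IH[OF KL(3,4), symmetric]
      using KL IJ \<open>J \<in> words (Suc n)\<close> by (simp add: munit_ket)
    finally show "munit (words (Suc n)) K L (ket J) I = tensor_list (map2 (munit UNIV) K L) (ket J) I" ..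
  qed
qed

lemma prod_list_word_weight:
  "length K = length L \<Longrightarrow> prod_list (map \<psi> (map2 (munit UNIV) K L)) = word_weight \<psi> K L"
  by (induction K L rule: list_induct2) auto

lemma power_functional_eq:
  fixes \<psi> :: "'k::finite op \<Rightarrow> complex"
  assumes \<psi>: "clinear_map_on (bop UNIV) oscale (*) \<psi>"
  shows "power_functional n \<psi> = (\<lambda>c\<in>bop (words n). \<Sum>K\<in>words n. \<Sum>L\<in>words n. c (ket L) K * word_weight \<psi> K L)"
  unfolding power_functional_def
proof (rule the_linear)
  let ?L = "\<lambda>c :: 'k list op. \<Sum>K\<in>words n. \<Sum>L\<in>words n. c (ket L) K * word_weight \<psi> K L"
  show "clinear_map_on (bop (words n)) oscale (*) ?L"
    by (simp add: clinear_map_on_def pointwise distrib_right sum.distrib sum_distrib_left mult.assoc)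
  have "(\<Sum>K\<in>words (length cs). \<Sum>L\<in>words (length cs). tensor_list cs (ket L) K * word_weight \<psi> K L) = prod_list (map \<psi> cs)"
    if "set cs \<subseteq> bop UNIV" for cs :: "'k op list"
    using that
  proof (induction cs)
    case Nil
    have "id_op (words 0) (ket ([] :: 'k list)) = ket []"
      by (rule id_op_apply) simp
    then show ?case
      by (simp add: ket_apply[of "[]" "[]"])
  next
    case (Cons c cs)
    let ?w = "words (length cs) :: 'k list set"
    have "(\<Sum>K\<in>words (length (c # cs)). \<Sum>L\<in>words (length (c # cs)). tensor_list (c # cs) (ket L) K * word_weight \<psi> K L)
      = (\<Sum>k\<in>UNIV. \<Sum>K\<in>?w. \<Sum>l\<in>UNIV. \<Sum>L\<in>?w. (c (ket l) k * \<psi> (munit UNIV k l)) * (tensor_list cs (ket L) K * word_weight \<psi> K L))"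
      unfolding list.size add_Suc_right add_0_right sum_words_Suc
    proof (intro sum.cong refl)
      fix k l and K L :: "'k list" assume "K \<in> ?w" "L \<in> ?w"
      then have "tensor_list (c # cs) (ket (l # L)) (k # K) = c (ket l) k * tensor_list cs (ket L) K"
        using Cons.prems by (intro tensor_list_Cons_entry) auto
      then show "tensor_list (c # cs) (ket (l # L)) (k # K) * word_weight \<psi> (k # K) (l # L)
        = c (ket l) k * \<psi> (munit UNIV k l) * (tensor_list cs (ket L) K * word_weight \<psi> K L)"
        by (simp only: word_weight.simps mult_ac)
    qed
    also have "\<dots> = (\<Sum>k\<in>UNIV. \<Sum>l\<in>UNIV. \<Sum>K\<in>?w. \<Sum>L\<in>?w. (c (ket l) k * \<psi> (munit UNIV k l)) * (tensor_list cs (ket L) K * word_weight \<psi> K L))"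
      by (intro sum.cong refl sum.swap)
    also have "\<dots> = (\<Sum>k\<in>UNIV. \<Sum>l\<in>UNIV. c (ket l) k * \<psi> (munit UNIV k l)) * (\<Sum>K\<in>?w. \<Sum>L\<in>?w. tensor_list cs (ket L) K * word_weight \<psi> K L)"
      by (simp add: sum_distrib_left[symmetric] sum_distrib_right)
    also have "\<dots> = \<psi> c * prod_list (map \<psi> cs)"
      using Cons linear_munit_expand[OF \<psi>, of c] by simp
    finally show ?case
      by simp
  qed
  then show "\<forall>cs. length cs = n \<and> set cs \<subseteq> bop UNIV \<longrightarrow> restrict ?L (bop (words n)) (tensor_list cs) = prod_list (map \<psi> cs)"
    using tensor_list_bop by auto
  fix L and c :: "'k list op"
  assume L: "clinear_map_on (bop (words n)) oscale (*) L"
    and Q: "\<forall>cs. length cs = n \<and> set cs \<subseteq> bop UNIV \<longrightarrow> L (tensor_list cs) = prod_list (map \<psi> cs)" and c: "c \<in> bop (words n)"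
  have "L (munit (words n) K M) = word_weight \<psi> K M" if "K \<in> words n" "M \<in> words n" for K M
  proof -
    have "L (munit (words n) K M) = L (tensor_list (map2 (munit UNIV) K M))"
      using that by (subst munit_words) (auto simp: words_def)
    also have "\<dots> = prod_list (map \<psi> (map2 (munit UNIV) K M))"
      using that by (intro Q[rule_format]) (auto simp: words_def)
    also have "\<dots> = word_weight \<psi> K M"
      using that by (intro prod_list_word_weight) (simp add: words_def)
    finally show ?thesis .
  qed
  then show "L c = ?L c"
    unfolding linear_munit_expand[OF L c finite_words] by (intro sum.cong refl) simp
qed auto

lemma product_power_functional:
  fixes \<psi> :: "'k::finite op \<Rightarrow> complex" and \<phi> :: "'a op \<Rightarrow> complex"
  assumes \<phi>: "clinear_map_on (bop UNIV) oscale (*) \<phi>" and \<psi>: "clinear_map_on (bop UNIV) oscale (*) \<psi>"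
    and z: "z \<in> bop (UNIV \<times> words n)"
  shows "product_functional UNIV (words n) \<phi> (power_functional n \<psi>) z
    = (\<Sum>K\<in>words n. \<Sum>L\<in>words n. \<phi> (blk z K L) * word_weight \<psi> K L)"
proof -
  have lin: "clinear_map_on (bop (words n)) oscale (*) (power_functional n \<psi>)"
    unfolding power_functional_eq[OF \<psi>]
    by (simp add: clinear_map_on_def pointwise distrib_right sum.distrib sum_distrib_left mult.assoc)
  have "power_functional n \<psi> (munit (words n) K L) = word_weight \<psi> K L" if "K \<in> words n" "L \<in> words n" for K L
  proof -
    have "power_functional n \<psi> (munit (words n) K L) = (\<Sum>K'\<in>words n. \<Sum>L'\<in>words n. munit (words n) K L (ket L') K' * word_weight \<psi> K' L')"
      using that by (simp add: power_functional_eq[OF \<psi>])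
    also have "\<dots> = (\<Sum>K'\<in>words n. \<Sum>L'\<in>words n. if K' = K then (if L' = L then word_weight \<psi> K L else 0) else 0)"
      by (intro sum.cong refl) (auto simp: munit_ket)
    also have "\<dots> = (\<Sum>K'\<in>words n. if K' = K then word_weight \<psi> K L else 0)"
      using that by (intro sum.cong refl) auto
    finally show ?thesis
      using that by simp
  qed
  then show ?thesis
    unfolding product_functional_eq[OF \<phi> lin finite_words] using z by simp
qed

lemma blk_bop_UNIV: "z \<in> bop UNIV \<Longrightarrow> blk z k (l :: 'k::finite) \<in> bop UNIV"
  using blk_bop[of z UNIV l k] by simp

lemma tensor_op_bop_UNIV: "x \<in> bop UNIV \<Longrightarrow> y \<in> bop UNIV \<Longrightarrow> tensor_op UNIV UNIV x (y :: 'k::finite op) \<in> bop UNIV"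
  using tensor_op_bop[of x y UNIV] by simp

lemma tensor_op_plus_left:
  fixes x y :: "'a op"
  assumes "x \<in> bop UNIV" "y \<in> bop UNIV" "c \<in> bop B" "finite B"
  shows "tensor_op UNIV B (x + y) c = tensor_op UNIV B x c + tensor_op UNIV B y c"
proof (rule blk_eqI)
  fix k l assume "k \<in> B" "l \<in> B"
  then show "blk (tensor_op UNIV B (x + y) c) k l = blk (tensor_op UNIV B x c + tensor_op UNIV B y c) k l"
    using assms by (simp add: blk_plus blk_tensor_op) (rule ext, simp add: vscale_add)
qed (use assms in auto)

lemma tensor_op_oscale_left:
  fixes x :: "'a op"
  assumes "x \<in> bop UNIV" "c \<in> bop B" "finite B"
  shows "tensor_op UNIV B (oscale b x) c = oscale b (tensor_op UNIV B x c)"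
proof (rule blk_eqI)
  fix k l assume "k \<in> B" "l \<in> B"
  then show "blk (tensor_op UNIV B (oscale b x) c) k l = blk (oscale b (tensor_op UNIV B x c)) k l"
    using assms by (simp add: blk_oscale blk_tensor_op) (rule ext, simp add: vscale_vscale mult.commute)
qed (use assms in auto)

section \<open>The coupling in a single slot\<close>

definition omit :: "nat \<Rightarrow> 'k list \<Rightarrow> 'k list" where
  "omit j K = take j K @ drop (Suc j) K"

lemma insert_omit: "j < length K \<Longrightarrow> take j (omit j K) @ K ! j # drop j (omit j K) = K"
  by (simp add: omit_def id_take_nth_drop[symmetric])

lemma omit_words: "K \<in> words n \<Longrightarrow> j < n \<Longrightarrow> omit j K \<in> words (n - 1)"
  by (auto simp: omit_def words_def)

lemma omit_update: "omit j (K[j := k]) = omit j K"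
  by (simp add: omit_def)

lemma update_words: "K \<in> words n \<Longrightarrow> K[j := k] \<in> words n"
  by (simp add: words_def)

lemma omit_eq_iff: "K \<in> words n \<Longrightarrow> L \<in> words n \<Longrightarrow> j < n \<Longrightarrow> K = L \<longleftrightarrow> omit j K = omit j L \<and> K ! j = L ! j"
  unfolding words_def mem_Collect_eq by (metis insert_omit)

context
  fixes n j :: nat
  assumes jn: "j < n"
begin

text \<open>The reindexing map of \<open>place\<close>: the letter \<open>k\<close> is inserted at
  position \<open>j\<close>. Its inverse takes \<open>K\<close> apart into the letter
  \<open>K ! j\<close> and the word \<open>omit j K\<close>.\<close>

definition ins :: "('a \<times> 'k) \<times> 'k list \<Rightarrow> 'a \<times> 'k list" where
  "ins = (\<lambda>((a, k), w). (a, take j w @ k # drop j w))"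

lemma inj_ins: "inj_on ins (UNIV \<times> words (n - 1))"
proof (rule inj_onI)
  fix p q :: "('a \<times> 'k) \<times> 'k list" assume pq: "p \<in> UNIV \<times> words (n - 1)" "q \<in> UNIV \<times> words (n - 1)" "ins p = ins q"
  obtain a k w where p: "p = ((a, k), w)"
    by (metis surj_pair)
  obtain a' k' w' where q: "q = ((a', k'), w')"
    by (metis surj_pair)
  have len: "length (take j w) = length (take j w')" "length w = n - 1" "length w' = n - 1"
    using pq p q by (auto simp: words_def)
  have "a = a'" "take j w @ k # drop j w = take j w' @ k' # drop j w'"
    using pq(3) p q by (auto simp: ins_def)
  moreover from this(2) have "take j w = take j w'" "k = k'" "drop j w = drop j w'"
    using len(1) append_eq_append_conv by auto
  moreover from this have "w = w'"
    using append_take_drop_id[of j w] append_take_drop_id[of j w'] by metis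
  ultimately show "p = q"
    using p q by blast
qed

lemma ins_omit: "K \<in> words n \<Longrightarrow> ins ((a, K ! j), omit j K) = (a, K)"
  using insert_omit[of j K] jn by (simp add: ins_def words_def)

lemma image_ins: "(ins :: ('a \<times> 'k) \<times> 'k list \<Rightarrow> 'a \<times> 'k list) ` (UNIV \<times> words (n - 1)) = UNIV \<times> words n"
proof
  show "(ins :: ('a \<times> 'k) \<times> 'k list \<Rightarrow> 'a \<times> 'k list) ` (UNIV \<times> words (n - 1)) \<subseteq> UNIV \<times> words n"
    using jn by (auto simp: ins_def words_def)
  show "UNIV \<times> words n \<subseteq> (ins :: ('a \<times> 'k) \<times> 'k list \<Rightarrow> 'a \<times> 'k list) ` (UNIV \<times> words (n - 1))"
  proof
    fix z :: "'a \<times> 'k list" assume "z \<in> UNIV \<times> words n"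
    then obtain a K where z: "z = (a, K)" "K \<in> words n"
      by auto
    then have "ins ((a, K ! j), omit j K) = z"
      using ins_omit by simp
    then show "z \<in> ins ` (UNIV \<times> words (n - 1))"
      using omit_words[OF z(2) jn] by (intro image_eqI[of _ _ "((a, K ! j), omit j K)"]) auto
  qed
qed

lemma place_eq: "place n j z c = reindex_op ins (UNIV \<times> words (n - 1)) (tensor_op UNIV (words (n - 1)) z c)"
  by (simp add: place_def ins_def)

lemma place_bop:
  assumes "z \<in> bop UNIV" "c \<in> bop (words (n - 1) :: 'k::finite list set)"
  shows "place n j z c \<in> bop (UNIV \<times> words n)"
  unfolding place_eq image_ins[symmetric]
  by (intro reindex_op_bop tensor_op_bop inj_ins) (use assms in auto)

lemma place_blk:
  fixes z :: "('a \<times> 'k::finite) op"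
  assumes z: "z \<in> bop UNIV" and c: "c \<in> bop (words (n - 1))" and K: "K \<in> words n" and L: "L \<in> words n"
  shows "blk (place n j z c) K L = oscale (c (ket (omit j L)) (omit j K)) (blk z (K ! j) (L ! j))"
proof (rule op_eqI[where A = UNIV])
  show "blk (place n j z c) K L \<in> bop UNIV"
    by (rule blk_bop[OF place_bop[OF z c] L]) simp
  show "oscale (c (ket (omit j L)) (omit j K)) (blk z (K ! j) (L ! j)) \<in> bop UNIV"
    by (intro bop_oscale blk_bop_UNIV z)
  fix a a' :: 'a
  let ?t = "tensor_op UNIV (words (n - 1)) z c"
  have "blk (place n j z c) K L (ket a') a = reindex_op ins (UNIV \<times> words (n - 1)) ?t (ket (ins ((a', L ! j), omit j L))) (ins ((a, K ! j), omit j K))"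
    unfolding blk_entry place_eq ins_omit[OF K] ins_omit[OF L] ..
  also have "\<dots> = ?t (ket ((a', L ! j), omit j L)) ((a, K ! j), omit j K)"
    by (rule reindex_op_entry[OF inj_ins]) (use omit_words[OF K jn] omit_words[OF L jn] in auto)
  also have "\<dots> = blk ?t (omit j K) (omit j L) (ket (a', L ! j)) (a, K ! j)"
    by (simp only: blk_entry)
  also have "\<dots> = oscale (c (ket (omit j L)) (omit j K)) z (ket (a', L ! j)) (a, K ! j)"
    by (subst blk_tensor_op[OF z c finite_words omit_words[OF K jn] omit_words[OF L jn]]) (rule refl)
  also have "\<dots> = oscale (c (ket (omit j L)) (omit j K)) (blk z (K ! j) (L ! j)) (ket a') a"
    by (simp add: vscale_apply blk_entry)
  finally show "blk (place n j z c) K L (ket a') a = oscale (c (ket (omit j L)) (omit j K)) (blk z (K ! j) (L ! j)) (ket a') a" .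
qed

text \<open>A matrix unit of words splits off its letter at position \<open>j\<close>. Hence placed
  operators span, which is the uniqueness half for \<open>slot_map\<close>.\<close>

lemma tensor_munit_eq_place:
  fixes x :: "'a op" and K L :: "'k::finite list"
  assumes x: "x \<in> bop UNIV" and K: "K \<in> words n" and L: "L \<in> words n"
  shows "tensor_op UNIV (words n) x (munit (words n) K L)
    = place n j (tensor_op UNIV UNIV x (munit UNIV (K ! j) (L ! j))) (munit (words (n - 1)) (omit j K) (omit j L))"
proof (rule blk_eqI)
  have z: "tensor_op UNIV UNIV x (munit UNIV (K ! j) (L ! j)) \<in> bop UNIV"
    by (intro tensor_op_bop_UNIV x munit_bop) auto
  have c: "munit (words (n - 1)) (omit j K) (omit j L) \<in> bop (words (n - 1))"
    by (intro munit_bop omit_words K L jn)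
  show "tensor_op UNIV (words n) x (munit (words n) K L) \<in> bop (UNIV \<times> words n)"
    by (intro tensor_op_bop x munit_bop K L) simp
  show "place n j (tensor_op UNIV UNIV x (munit UNIV (K ! j) (L ! j))) (munit (words (n - 1)) (omit j K) (omit j L)) \<in> bop (UNIV \<times> words n)"
    by (rule place_bop[OF z c])
  fix I M :: "'k list" assume I: "I \<in> words n" and M: "M \<in> words n"
  have "blk (place n j (tensor_op UNIV UNIV x (munit UNIV (K ! j) (L ! j))) (munit (words (n - 1)) (omit j K) (omit j L))) I M
      = oscale (if omit j I = omit j K \<and> omit j M = omit j L then 1 else 0) (if I ! j = K ! j \<and> M ! j = L ! j then x else 0)"
    unfolding place_blk[OF z c I M] munit_ket[OF omit_words[OF M jn]]
    by (subst blk_tensor_munit[OF x]) auto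
  also have "\<dots> = (if I = K \<and> M = L then x else 0)"
    unfolding omit_eq_iff[OF I K jn] omit_eq_iff[OF M L jn] by (auto simp: fun_eq_iff[of "oscale _ _"])
  also have "\<dots> = blk (tensor_op UNIV (words n) x (munit (words n) K L)) I M"
    by (subst blk_tensor_munit[OF x]) (use I M K L in auto)
  finally show "blk (tensor_op UNIV (words n) x (munit (words n) K L)) I M
    = blk (place n j (tensor_op UNIV UNIV x (munit UNIV (K ! j) (L ! j))) (munit (words (n - 1)) (omit j K) (omit j L))) I M" ..
qed

context
  fixes \<alpha> :: "('a \<times> 'k::finite) op \<Rightarrow> ('a \<times> 'k) op"
  assumes \<alpha>_bop: "\<And>z. z \<in> bop UNIV \<Longrightarrow> \<alpha> z \<in> bop UNIV"
    and \<alpha>_lin: "clinear_map_on (bop UNIV) oscale oscale \<alpha>"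
begin

text \<open>All letters except those at position \<open>j\<close> are frozen; the blocks with
  varying letters at \<open>j\<close> form an operator on one copy, to which \<open>\<alpha>\<close>
  is applied before the block at \<open>K ! j\<close> and \<open>L ! j\<close> is read off.\<close>

definition slot_blk :: "('a \<times> 'k list) op \<Rightarrow> 'k list \<Rightarrow> 'k list \<Rightarrow> 'a op" where
  "slot_blk Z K L = (\<Sum>k\<in>UNIV. \<Sum>l\<in>UNIV.
     blk (\<alpha> (tensor_op UNIV UNIV (blk Z (K[j := k]) (L[j := l])) (munit UNIV k l))) (K ! j) (L ! j))"

lemma \<alpha>_tensor_bop: "x \<in> bop UNIV \<Longrightarrow> \<alpha> (tensor_op UNIV UNIV x (munit UNIV k l)) \<in> bop UNIV"
  by (intro \<alpha>_bop tensor_op_bop_UNIV munit_bop) auto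

lemma \<alpha>_tensor_plus:
  assumes x: "x \<in> bop UNIV" and y: "y \<in> bop UNIV"
  shows "\<alpha> (tensor_op UNIV UNIV (x + y) (munit UNIV k l))
    = \<alpha> (tensor_op UNIV UNIV x (munit UNIV k l)) + \<alpha> (tensor_op UNIV UNIV y (munit UNIV k l))"
proof -
  have m: "munit UNIV k l \<in> bop UNIV"
    by (rule munit_bop) auto
  show ?thesis
    unfolding tensor_op_plus_left[OF x y m finite]
    using \<alpha>_lin tensor_op_bop_UNIV[OF x m] tensor_op_bop_UNIV[OF y m] by (simp add: clinear_map_on_def)
qed

lemma \<alpha>_tensor_oscale:
  assumes x: "x \<in> bop UNIV"
  shows "\<alpha> (tensor_op UNIV UNIV (oscale b x) (munit UNIV k l)) = oscale b (\<alpha> (tensor_op UNIV UNIV x (munit UNIV k l)))"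
proof -
  have m: "munit UNIV k l \<in> bop UNIV"
    by (rule munit_bop) auto
  show ?thesis
    unfolding tensor_op_oscale_left[OF x m finite]
    using \<alpha>_lin tensor_op_bop_UNIV[OF x m] by (simp add: clinear_map_on_def)
qed

lemma slot_blk_bop: "Z \<in> bop (UNIV \<times> words n) \<Longrightarrow> L \<in> words n \<Longrightarrow> slot_blk Z K L \<in> bop UNIV"
  unfolding slot_blk_def
  by (intro bop_sum_ops blk_bop_UNIV \<alpha>_tensor_bop blk_bop[where B = "words n"] update_words finite_words)

lemma slot_mat_bop: "Z \<in> bop (UNIV \<times> words n) \<Longrightarrow> mat_op (words n) (slot_blk Z) \<in> bop (UNIV \<times> words n)"
  by (intro mat_op_bop slot_blk_bop finite_words)

lemma blk_slot_mat: "Z \<in> bop (UNIV \<times> words n) \<Longrightarrow> K \<in> words n \<Longrightarrow> L \<in> words n \<Longrightarrow> blk (mat_op (words n) (slot_blk Z)) K L = slot_blk Z K L"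
  by (intro blk_mat_op slot_blk_bop finite_words)

lemma slot_linear: "clinear_map_on (bop (UNIV \<times> words n)) oscale oscale (\<lambda>Z. mat_op (words n) (slot_blk Z))"
  unfolding clinear_map_on_def
proof (intro conjI ballI allI)
  fix x y :: "('a \<times> 'k list) op" assume x: "x \<in> bop (UNIV \<times> words n)" and y: "y \<in> bop (UNIV \<times> words n)"
  show "mat_op (words n) (slot_blk (x + y)) = mat_op (words n) (slot_blk x) + mat_op (words n) (slot_blk y)"
  proof (rule blk_eqI[OF slot_mat_bop bop_plus[OF slot_mat_bop[OF x] slot_mat_bop[OF y]]])
    fix K L :: "'k list" assume K: "K \<in> words n" and L: "L \<in> words n"
    have "slot_blk (x + y) K L = slot_blk x K L + slot_blk y K L"
      unfolding slot_blk_def sum.distrib[symmetric] blk_plus[of x y]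
      by (intro sum.cong refl)
        (simp only: \<alpha>_tensor_plus blk_bop[OF x update_words[OF L] finite_words] blk_bop[OF y update_words[OF L] finite_words] blk_plus)
    then show "blk (mat_op (words n) (slot_blk (x + y))) K L = blk (mat_op (words n) (slot_blk x) + mat_op (words n) (slot_blk y)) K L"
      by (simp only: blk_slot_mat[OF bop_plus[OF x y] K L] blk_plus blk_slot_mat[OF x K L] blk_slot_mat[OF y K L])
  qed (use x y in simp)
next
  fix b and x :: "('a \<times> 'k list) op" assume x: "x \<in> bop (UNIV \<times> words n)"
  show "mat_op (words n) (slot_blk (oscale b x)) = oscale b (mat_op (words n) (slot_blk x))"
  proof (rule blk_eqI[OF slot_mat_bop bop_oscale[OF slot_mat_bop[OF x]]])
    fix K L :: "'k list" assume K: "K \<in> words n" and L: "L \<in> words n"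
    have os: "oscale b (\<Sum>i\<in>I. t i) = (\<Sum>i\<in>I. oscale b (t i))" for t :: "'k \<Rightarrow> 'a op" and I
      by (rule ext) (simp add: op_sum_apply vscale_sum)
    have "slot_blk (oscale b x) K L = oscale b (slot_blk x K L)"
      unfolding slot_blk_def os blk_oscale[of b x]
      by (intro sum.cong refl)
        (simp only: \<alpha>_tensor_oscale blk_bop[OF x update_words[OF L] finite_words] blk_oscale)
    then show "blk (mat_op (words n) (slot_blk (oscale b x))) K L = blk (oscale b (mat_op (words n) (slot_blk x))) K L"
      by (simp only: blk_slot_mat[OF bop_oscale[OF x] K L] blk_oscale blk_slot_mat[OF x K L])
  qed (use x in simp)
qed

lemma sum_\<alpha>_tensor:
  assumes z: "z \<in> bop UNIV"
  shows "(\<Sum>k\<in>UNIV. \<Sum>l\<in>UNIV. \<alpha> (tensor_op UNIV UNIV (blk z k l) (munit UNIV k l))) = \<alpha> z"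
proof -
  have "\<alpha> z = (\<Sum>k\<in>UNIV. \<Sum>l\<in>UNIV. \<alpha> (tensor_op UNIV UNIV (blk z k l) (munit UNIV k l)))"
    by (rule linear_tensor_expand[where B = UNIV and t = oscale])
      (use z \<alpha>_lin in \<open>simp_all add: fun_eq_iff[of "oscale 0 _"]\<close>)
  then show ?thesis ..
qed

lemma slot_place:
  assumes z: "z \<in> bop UNIV" and c: "c \<in> bop (words (n - 1))"
  shows "mat_op (words n) (slot_blk (place n j z c)) = place n j (\<alpha> z) c"
proof (rule blk_eqI[OF slot_mat_bop[OF place_bop[OF z c]] place_bop[OF \<alpha>_bop[OF z] c]])
  fix K L :: "'k list" assume K: "K \<in> words n" and L: "L \<in> words n"
  define b where "b = c (ket (omit j L)) (omit j K)"
  have len: "j < length K" "j < length L"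
    using K L jn by (auto simp: words_def)
  have os: "oscale b (\<Sum>i\<in>I. t i) = (\<Sum>i\<in>I. oscale b (t i))" for t :: "'k \<Rightarrow> 'a op" and I
    by (rule ext) (simp add: op_sum_apply vscale_sum)
  have "slot_blk (place n j z c) K L = (\<Sum>k\<in>UNIV. \<Sum>l\<in>UNIV. oscale b (blk (\<alpha> (tensor_op UNIV UNIV (blk z k l) (munit UNIV k l))) (K ! j) (L ! j)))"
    unfolding slot_blk_def
  proof (intro sum.cong refl)
    fix k l :: 'k
    have "blk (place n j z c) (K[j := k]) (L[j := l]) = oscale b (blk z k l)"
      unfolding place_blk[OF z c update_words[OF K] update_words[OF L]] omit_update b_def using len by simp
    then show "blk (\<alpha> (tensor_op UNIV UNIV (blk (place n j z c) (K[j := k]) (L[j := l])) (munit UNIV k l))) (K ! j) (L ! j)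
        = oscale b (blk (\<alpha> (tensor_op UNIV UNIV (blk z k l) (munit UNIV k l))) (K ! j) (L ! j))"
      by (simp only: \<alpha>_tensor_oscale[OF blk_bop_UNIV[OF z]] blk_oscale)
  qed
  also have "\<dots> = oscale b (blk (\<alpha> z) (K ! j) (L ! j))"
    unfolding os[symmetric] blk_sum[symmetric] sum_\<alpha>_tensor[OF z] ..
  finally show "blk (mat_op (words n) (slot_blk (place n j z c))) K L = blk (place n j (\<alpha> z) c) K L"
    unfolding blk_slot_mat[OF place_bop[OF z c] K L] place_blk[OF \<alpha>_bop[OF z] c K L] b_def .
qed

text \<open>Existence is \<open>slot_place\<close>; uniqueness follows by expanding in matrix units,
  each of which gives a placed operator.\<close>

lemma slot_map_eq: "slot_map n j \<alpha> = (\<lambda>Z\<in>bop (UNIV \<times> words n). mat_op (words n) (slot_blk Z))"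
  unfolding slot_map_def
proof (rule the_linear)
  show "clinear_map_on (bop (UNIV \<times> words n)) oscale oscale (\<lambda>Z. mat_op (words n) (slot_blk Z))"
    by (rule slot_linear)
  show "\<forall>z\<in>bop UNIV. \<forall>c\<in>bop (words (n - 1)). (\<lambda>Z\<in>bop (UNIV \<times> words n). mat_op (words n) (slot_blk Z)) (place n j z c) = place n j (\<alpha> z) c"
  proof (intro ballI)
    fix z :: "('a \<times> 'k) op" and c :: "'k list op" assume z: "z \<in> bop UNIV" and c: "c \<in> bop (words (n - 1))"
    show "(\<lambda>Z\<in>bop (UNIV \<times> words n). mat_op (words n) (slot_blk Z)) (place n j z c) = place n j (\<alpha> z) c"
      unfolding restrict_apply'[OF place_bop[OF z c]] by (rule slot_place[OF z c])
  qed
  fix L :: "('a \<times> 'k list) op \<Rightarrow> ('a \<times> 'k list) op" and z :: "('a \<times> 'k list) op"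
  assume L: "clinear_map_on (bop (UNIV \<times> words n)) oscale oscale L"
    and Q: "\<forall>z\<in>bop UNIV. \<forall>c\<in>bop (words (n - 1)). L (place n j z c) = place n j (\<alpha> z) c"
    and z: "z \<in> bop (UNIV \<times> words n)"
  have zero: "oscale 0 T = 0" for T :: "('a \<times> 'k list) op"
    by (rule ext) simp
  have e: "L (tensor_op UNIV (words n) (blk z K M) (munit (words n) K M)) = mat_op (words n) (slot_blk (tensor_op UNIV (words n) (blk z K M) (munit (words n) K M)))"
    if K: "K \<in> words n" and M: "M \<in> words n" for K M
  proof -
    have x: "blk z K M \<in> bop UNIV"
      by (rule blk_bop[OF z M]) simp
    have a: "tensor_op UNIV UNIV (blk z K M) (munit UNIV (K ! j) (M ! j)) \<in> bop UNIV"
      by (intro tensor_op_bop_UNIV x munit_bop) auto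
    have b: "munit (words (n - 1)) (omit j K) (omit j M) \<in> bop (words (n - 1))"
      by (intro munit_bop omit_words K M jn)
    show ?thesis
      unfolding tensor_munit_eq_place[OF x K M] slot_place[OF a b] by (rule Q[rule_format, OF a b])
  qed
  have "L z = (\<Sum>K\<in>words n. \<Sum>M\<in>words n. L (tensor_op UNIV (words n) (blk z K M) (munit (words n) K M)))"
    by (rule linear_tensor_expand[where L = L and t = oscale, OF L zero z finite_words])
  also have "\<dots> = (\<Sum>K\<in>words n. \<Sum>M\<in>words n. mat_op (words n) (slot_blk (tensor_op UNIV (words n) (blk z K M) (munit (words n) K M))))"
    by (rule sum.cong[OF refl], rule sum.cong[OF refl], rule e)
  also have "\<dots> = mat_op (words n) (slot_blk z)"
    by (rule linear_tensor_expand[where L = "\<lambda>Z. mat_op (words n) (slot_blk Z)" and t = oscale, OF slot_linear zero z finite_words, symmetric])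
  finally show "L z = mat_op (words n) (slot_blk z)" .
qed auto

end

end

section \<open>Blocks of the iterated transition\<close>

definition step_blk :: "(('a \<times> 'k::finite) op \<Rightarrow> ('a \<times> 'k) op) \<Rightarrow> 'k \<Rightarrow> 'k \<Rightarrow> 'a op \<Rightarrow> 'a op" where
  "step_blk \<alpha> k l x = blk (\<alpha> (tensor_op UNIV UNIV x (id_op UNIV))) k l"

fun word_blk :: "(('a \<times> 'k::finite) op \<Rightarrow> ('a \<times> 'k) op) \<Rightarrow> 'k list \<Rightarrow> 'k list \<Rightarrow> 'a op \<Rightarrow> 'a op" where
  "word_blk \<alpha> (k # K) (l # L) x = step_blk \<alpha> k l (word_blk \<alpha> K L x)"
| "word_blk \<alpha> _ _ x = x"

lemma id_op_eq_sum_munit: "id_op (UNIV :: 'k::finite set) = (\<Sum>k\<in>UNIV. munit UNIV k k)"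
  using proj_eq_butterfly_sum[of "UNIV :: 'k set"] by (simp add: proj_UNIV munit_def)

lemma tensor_op_sum_right:
  fixes x :: "'a op"
  assumes "x \<in> bop UNIV" "\<And>i. i \<in> I \<Longrightarrow> c i \<in> bop B" "finite B"
  shows "tensor_op UNIV B x (\<Sum>i\<in>I. c i) = (\<Sum>i\<in>I. tensor_op UNIV B x (c i))"
proof (rule blk_eqI)
  show "tensor_op UNIV B x (\<Sum>i\<in>I. c i) \<in> bop (UNIV \<times> B)"
    using assms by (intro tensor_op_bop bop_sum_ops)
  show "(\<Sum>i\<in>I. tensor_op UNIV B x (c i)) \<in> bop (UNIV \<times> B)"
    using assms by (intro tensor_op_bop bop_sum_ops)
  fix k l assume kl: "k \<in> B" "l \<in> B"
  have "blk (tensor_op UNIV B x (\<Sum>i\<in>I. c i)) k l = oscale ((\<Sum>i\<in>I. c i) (ket l) k) x"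
    using assms kl by (intro blk_tensor_op bop_sum_ops)
  also have "\<dots> = (\<Sum>i\<in>I. oscale (c i (ket l) k) x)"
    by (rule ext) (simp add: op_sum_apply sum_fun_apply fun_eq_iff vscale_apply sum_distrib_right)
  also have "\<dots> = (\<Sum>i\<in>I. blk (tensor_op UNIV B x (c i)) k l)"
    using assms kl by (intro sum.cong refl blk_tensor_op[symmetric])
  finally show "blk (tensor_op UNIV B x (\<Sum>i\<in>I. c i)) k l = blk (\<Sum>i\<in>I. tensor_op UNIV B x (c i)) k l"
    by (simp only: blk_sum)
qed

text \<open>Downward induction on \<open>i\<close>: the slot maps from \<open>n - 1\<close> down to
  \<open>i\<close> have been applied, and the first \<open>i\<close> letters still carry the
  identity, so only blocks with equal prefixes are nonzero.\<close>

lemma Jn_blk: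
  fixes \<alpha> :: "('a \<times> 'k::finite) op \<Rightarrow> ('a \<times> 'k) op"
  assumes \<alpha>_bop: "\<And>z. z \<in> bop UNIV \<Longrightarrow> \<alpha> z \<in> bop UNIV"
    and \<alpha>_lin: "clinear_map_on (bop UNIV) oscale oscale \<alpha>" and a: "a \<in> bop UNIV"
  shows "Jn \<alpha> n a \<in> bop (UNIV \<times> words n)"
    and "K \<in> words n \<Longrightarrow> L \<in> words n \<Longrightarrow> blk (Jn \<alpha> n a) K L = word_blk \<alpha> K L a"
proof -
  define J where "J i = foldr (\<lambda>j. slot_map n j \<alpha>) [i..<n] (tensor_op UNIV (words n) a (id_op (words n)))" for i
  have w: "word_blk \<alpha> K L a \<in> bop UNIV" if "length K = length L" for K L
    using that
    by (induction K L rule: list_induct2) (simp_all add: a step_blk_def blk_bop_UNIV \<alpha>_bop tensor_op_bop_UNIV)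
  have "J i \<in> bop (UNIV \<times> words n) \<and> (\<forall>K\<in>words n. \<forall>L\<in>words n.
      blk (J i) K L = (if take i K = take i L then word_blk \<alpha> (drop i K) (drop i L) a else 0))" if "i \<le> n" for i
    using that
  proof (induction i rule: inc_induct)
    case base
    have "blk (J n) K L = (if take n K = take n L then word_blk \<alpha> (drop n K) (drop n L) a else 0)"
      if "K \<in> words n" "L \<in> words n" for K L
    proof -
      have "blk (J n) K L = oscale (id_op (words n) (ket L) K) a"
        unfolding J_def using blk_tensor_op[OF a bop_id finite_words that] by simp
      also have "id_op (words n) (ket L) = ket L"
        using that by (intro id_op_apply ell2_ket)
      finally show ?thesis
        using that by (auto simp: words_def ket_apply[of L] fun_eq_iff[of "oscale _ _"])
    qed
    moreover have "J n \<in> bop (UNIV \<times> words n)"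
      unfolding J_def using a by simp
    ultimately show ?case
      by blast
  next
    case (step j)
    then have jn: "j < n"
      by simp
    let ?Z = "J (Suc j)"
    have Z: "?Z \<in> bop (UNIV \<times> words n)" and blkZ: "blk ?Z K L = (if take (Suc j) K = take (Suc j) L then word_blk \<alpha> (drop (Suc j) K) (drop (Suc j) L) a else 0)"
      if "K \<in> words n" "L \<in> words n" for K L
      using step.IH that by auto
    have Z: "?Z \<in> bop (UNIV \<times> words n)"
      using step.IH by auto
    have sl1: "mat_op (words n) (slot_blk j \<alpha> ?Z) \<in> bop (UNIV \<times> words n)"
      by (rule slot_mat_bop[OF jn]) (use \<alpha>_bop \<alpha>_lin Z in auto)
    have sl2: "blk (mat_op (words n) (slot_blk j \<alpha> ?Z)) K L = slot_blk j \<alpha> ?Z K L" if "K \<in> words n" "L \<in> words n" for K L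
      by (rule blk_slot_mat[OF jn]) (use \<alpha>_bop \<alpha>_lin Z that in auto)
    have sl3: "slot_map n j \<alpha> = (\<lambda>Z\<in>bop (UNIV \<times> words n). mat_op (words n) (slot_blk j \<alpha> Z))"
      by (rule slot_map_eq[OF jn]) (use \<alpha>_bop \<alpha>_lin in auto)
    have Jj: "J j = mat_op (words n) (slot_blk j \<alpha> ?Z)"
    proof -
      have "J j = slot_map n j \<alpha> ?Z"
        unfolding J_def upt_conv_Cons[OF jn] by simp
      also have "\<dots> = mat_op (words n) (slot_blk j \<alpha> ?Z)"
        unfolding sl3 using Z by simp
      finally show ?thesis .
    qed
    have "blk (J j) K L = (if take j K = take j L then word_blk \<alpha> (drop j K) (drop j L) a else 0)"
      if K: "K \<in> words n" and L: "L \<in> words n" for K L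
    proof -
      have len: "length K = n" "length L = n"
        using K L by (auto simp: words_def)
      define x where "x = word_blk \<alpha> (drop (Suc j) K) (drop (Suc j) L) a"
      have x: "x \<in> bop UNIV"
        unfolding x_def by (rule w) (simp add: len)
      have dr: "drop j K = K ! j # drop (Suc j) K" "drop j L = L ! j # drop (Suc j) L"
        using jn len by (simp_all add: Cons_nth_drop_Suc)
      have zero: "blk (\<alpha> (tensor_op UNIV UNIV 0 (munit UNIV k l))) i i' = 0" for k l i i' :: 'k
      proof -
        have z0: "oscale 0 0 = (0 :: 'a op)"
          by (rule ext) simp
        have "\<alpha> (tensor_op UNIV UNIV (oscale 0 0) (munit UNIV k l)) = oscale 0 (\<alpha> (tensor_op UNIV UNIV 0 (munit UNIV k l)))"
          using \<alpha>_bop \<alpha>_lin bop_zero by (rule \<alpha>_tensor_oscale[OF jn])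
        then have "\<alpha> (tensor_op UNIV UNIV 0 (munit UNIV k l)) = oscale 0 (\<alpha> (tensor_op UNIV UNIV 0 (munit UNIV k l)))"
          unfolding z0 .
        also have "\<dots> = 0"
          by (rule ext) simp
        finally show ?thesis
          by (simp only: blk_zero)
      qed
      \<comment> \<open>Before this step the letter at \<open>j\<close> carries the identity, so
        only \<open>l = k\<close> contributes; summing the matrix units
        \<open>munit UNIV k k\<close> restores \<open>id_op UNIV\<close>, which yields
        \<open>step_blk\<close>.\<close>
      have "blk (J j) K L = (\<Sum>k\<in>UNIV. \<Sum>l\<in>UNIV. blk (\<alpha> (tensor_op UNIV UNIV (blk ?Z (K[j := k]) (L[j := l])) (munit UNIV k l))) (K ! j) (L ! j))"
        unfolding Jj sl2[OF K L] by (rule slot_blk_def) (use jn \<alpha>_bop \<alpha>_lin in auto)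
      also have "\<dots> = (\<Sum>k\<in>UNIV. \<Sum>l\<in>UNIV. if l = k then (if take j K = take j L then blk (\<alpha> (tensor_op UNIV UNIV x (munit UNIV k k))) (K ! j) (L ! j) else 0) else 0)"
      proof (intro sum.cong refl)
        fix k l :: 'k
        have "take (Suc j) (K[j := k]) = take j K @ [k]" "take (Suc j) (L[j := l]) = take j L @ [l]"
          using jn len by (simp_all add: take_Suc_conv_app_nth)
        then have "blk ?Z (K[j := k]) (L[j := l]) = (if l = k \<and> take j K = take j L then x else 0)"
          unfolding blkZ[OF update_words[OF K] update_words[OF L]] x_def by auto
        then show "blk (\<alpha> (tensor_op UNIV UNIV (blk ?Z (K[j := k]) (L[j := l])) (munit UNIV k l))) (K ! j) (L ! j)
          = (if l = k then (if take j K = take j L then blk (\<alpha> (tensor_op UNIV UNIV x (munit UNIV k k))) (K ! j) (L ! j) else 0) else 0)"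
          using zero by simp
      qed
      also have "\<dots> = (if take j K = take j L then \<Sum>k\<in>UNIV. blk (\<alpha> (tensor_op UNIV UNIV x (munit UNIV k k))) (K ! j) (L ! j) else 0)"
        by simp
      also have "(\<Sum>k\<in>UNIV. blk (\<alpha> (tensor_op UNIV UNIV x (munit UNIV k k))) (K ! j) (L ! j)) = word_blk \<alpha> (drop j K) (drop j L) a"
      proof -
        have t: "tensor_op UNIV UNIV x (munit UNIV k k) \<in> bop UNIV" for k :: 'k
          by (intro tensor_op_bop_UNIV x munit_bop) auto
        have "tensor_op UNIV UNIV x (id_op UNIV) = (\<Sum>k\<in>(UNIV :: 'k set). tensor_op UNIV UNIV x (munit UNIV k k))"
          unfolding id_op_eq_sum_munit by (rule tensor_op_sum_right[OF x munit_bop finite]) auto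
        then have "\<alpha> (tensor_op UNIV UNIV x (id_op UNIV)) = \<alpha> (\<Sum>k\<in>UNIV. tensor_op UNIV UNIV x (munit UNIV k k))"
          by (rule arg_cong)
        also have "\<dots> = (\<Sum>k\<in>UNIV. \<alpha> (tensor_op UNIV UNIV x (munit UNIV k k)))"
          by (rule clinear_sum[OF \<alpha>_lin]) (use t in \<open>simp_all add: fun_eq_iff[of "oscale 0 _"]\<close>)
        finally show ?thesis
          unfolding dr word_blk.simps step_blk_def x_def[symmetric] by (simp only: blk_sum)
      qed
      finally show ?thesis .
    qed
    moreover have "J j \<in> bop (UNIV \<times> words n)"
      unfolding Jj by (rule sl1)
    ultimately show ?case
      by blast
  qed
  from this[of 0] show "Jn \<alpha> n a \<in> bop (UNIV \<times> words n)"
    "K \<in> words n \<Longrightarrow> L \<in> words n \<Longrightarrow> blk (Jn \<alpha> n a) K L = word_blk \<alpha> K L a"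
    by (simp_all add: J_def Jn_def)
qed

subsection \<open>Couplings with an invariant product state\<close>

lemma oscale_0: "oscale 0 T = 0" and oscale_1: "oscale 1 T = T"
  by (rule ext, simp)+

lemma sandwich:
  fixes x z :: "'j \<Rightarrow> 'a op"
  assumes x: "\<And>k. k \<in> I \<Longrightarrow> x k \<in> bop A" and y: "y \<in> bop A" and z: "\<And>k. k \<in> I \<Longrightarrow> z k \<in> bop A"
  shows "adj A (\<Sum>k\<in>I. oscale (b k) (x k)) \<circ> y \<circ> (\<Sum>l\<in>I. oscale (b l) (z l))
    = (\<Sum>k\<in>I. \<Sum>l\<in>I. oscale (cnj (b k) * b l) (adj A (x k) \<circ> y \<circ> z l))"
proof (rule ext)
  fix f
  have "adj A (\<Sum>k\<in>I. oscale (b k) (x k)) = (\<Sum>k\<in>I. oscale (cnj (b k)) (adj A (x k)))"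
    using x by (simp add: adj_sum adj_oscale)
  moreover have "y (\<Sum>l\<in>I. vscale (b l) (z l f)) = (\<Sum>l\<in>I. vscale (b l) (y (z l f)))"
    using z by (subst bop_sum[OF y]) (simp_all add: bop_scale[OF y])
  moreover have "adj A (x k) (\<Sum>l\<in>I. vscale (b l) (y (z l f))) = (\<Sum>l\<in>I. vscale (b l) (adj A (x k) (y (z l f))))" if "k \<in> I" for k
    using x[OF that] y by (subst bop_sum[where A = A]) (simp_all add: bop_scale[where A = A])
  ultimately show "(adj A (\<Sum>k\<in>I. oscale (b k) (x k)) \<circ> y \<circ> (\<Sum>l\<in>I. oscale (b l) (z l))) f
    = (\<Sum>k\<in>I. \<Sum>l\<in>I. oscale (cnj (b k) * b l) (adj A (x k) \<circ> y \<circ> z l)) f"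
    by (simp add: op_sum_apply vscale_sum vscale_vscale)
qed

lemma state_sandwich:
  assumes s: "state A \<phi>" and x: "\<And>k. k \<in> I \<Longrightarrow> x k \<in> bop A" and y: "y \<in> bop A" and z: "\<And>k. k \<in> I \<Longrightarrow> z k \<in> bop A"
  shows "\<phi> (adj A (\<Sum>k\<in>I. oscale (b k) (x k)) \<circ> y \<circ> (\<Sum>l\<in>I. oscale (b l) (z l)))
    = (\<Sum>k\<in>I. \<Sum>l\<in>I. cnj (b k) * b l * \<phi> (adj A (x k) \<circ> y \<circ> z l))"
proof -
  have xyz: "adj A (x k) \<circ> y \<circ> z l \<in> bop A" if "k \<in> I" "l \<in> I" for k l
    using x y z that by (intro bop_comp adj_bop)
  have "\<phi> (\<Sum>k\<in>I. \<Sum>l\<in>I. oscale (cnj (b k) * b l) (adj A (x k) \<circ> y \<circ> z l))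
      = (\<Sum>k\<in>I. \<Sum>l\<in>I. \<phi> (oscale (cnj (b k) * b l) (adj A (x k) \<circ> y \<circ> z l)))"
    using xyz by (subst state_sum[OF s], intro bop_sum_ops bop_oscale) (auto intro!: sum.cong state_sum[OF s] bop_oscale)
  also have "\<dots> = (\<Sum>k\<in>I. \<Sum>l\<in>I. cnj (b k) * b l * \<phi> (adj A (x k) \<circ> y \<circ> z l))"
    by (intro sum.cong refl state_scale[OF s] xyz)
  moreover have "adj A (\<Sum>k\<in>I. oscale (b k) (x k)) \<circ> y \<circ> (\<Sum>l\<in>I. oscale (b l) (z l))
      = (\<Sum>k\<in>I. \<Sum>l\<in>I. oscale (cnj (b k) * b l) (adj A (x k) \<circ> y \<circ> z l))"
    by (rule sandwich[OF _ y]) (use x z in auto)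
  ultimately show ?thesis
    by (simp only:)
qed

lemma UNIV_2_cases: "k = 0 \<or> k = (1 :: 2)"
  using exhaust_2[of k] by auto

text \<open>Strict positivity makes the Schur complement \<open>q - (cmod w)\<^sup>2 / p\<close>
  positive, so the triangular factor has a nonzero diagonal and its inverse \<open>d\<close> can be
  written down.\<close>

lemma Cholesky_2:
  fixes s :: "2 \<Rightarrow> 2 \<Rightarrow> complex"
  assumes "\<And>v. v 0 \<noteq> 0 \<or> v 1 \<noteq> 0 \<Longrightarrow> \<exists>r>0. (\<Sum>k\<in>UNIV. \<Sum>l\<in>UNIV. cnj (v k) * v l * s k l) = of_real r"
    and herm: "s 1 0 = cnj (s 0 1)"
  obtains c d where "\<And>l l'. (\<Sum>t\<in>(UNIV :: 2 set). cnj (c t l) * c t l') = s l l'"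
    "\<And>l l'. (\<Sum>t\<in>(UNIV :: 2 set). d l t * c t l') = (if l = l' then 1 else 0)"
proof -
  obtain p where p: "p > 0" "s 0 0 = of_real p"
    using assms(1)[of "\<lambda>k. if k = 0 then 1 else 0"] by (auto simp: sum_UNIV_2)
  obtain q where q: "q > 0" "s 1 1 = of_real q"
    using assms(1)[of "\<lambda>k. if k = 0 then 0 else 1"] by (auto simp: sum_UNIV_2)
  define w where "w = s 0 1"
  \<comment> \<open>On this vector the quadratic form takes the value
    \<open>p * (p * q - (cmod w)\<^sup>2)\<close>.\<close>
  obtain r where r: "r > 0" "(\<Sum>k\<in>UNIV. \<Sum>l\<in>UNIV. cnj (if k = 0 then - w else of_real p) * (if l = 0 then - w else of_real p) * s k l) = of_real r"
    using assms(1)[of "\<lambda>k. if k = 0 then - w else of_real p"] p by auto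
  have "complex_of_real (p * (p * q - (cmod w)\<^sup>2)) = of_real r"
    using r(2) herm p q by (simp add: sum_UNIV_2 w_def[symmetric] complex_norm_square algebra_simps del: of_real_power)
  then have "p * (p * q - (cmod w)\<^sup>2) = r"
    by (simp only: of_real_eq_iff)
  then have "p * q - (cmod w)\<^sup>2 > 0"
    using r(1) p(1) by (metis zero_less_mult_pos)
  then have e: "q - (cmod w)\<^sup>2 / p > 0"
    using p(1) by (simp add: field_simps)
  define g where "g = sqrt p"
  define h where "h = sqrt (q - (cmod w)\<^sup>2 / p)"
  have gh: "g > 0" "h > 0" "g * g = p" "h * h = q - (cmod w)\<^sup>2 / p"
    using p(1) e by (simp_all add: g_def h_def)
  define c :: "2 \<Rightarrow> 2 \<Rightarrow> complex" where "c t l = (if t = 0 then if l = 0 then of_real g else w / of_real g else if l = 0 then 0 else of_real h)" for t l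
  define d :: "2 \<Rightarrow> 2 \<Rightarrow> complex" where "d l t = (if l = 0 then if t = 0 then 1 / of_real g else - w / (of_real g * of_real g * of_real h) else if t = 0 then 0 else 1 / of_real h)" for l t
  have gg: "complex_of_real g * of_real g = of_real p" "complex_of_real h * of_real h = of_real q - w * cnj w / of_real p"
    using gh(3,4) by (simp_all add: complex_norm_square[symmetric] flip: of_real_mult of_real_diff of_real_divide of_real_power)
  have "(\<Sum>t\<in>UNIV. cnj (c t l) * c t l') = s l l'" for l l'
    using UNIV_2_cases[of l] UNIV_2_cases[of l'] gh(1,2) gg p q herm
    by (auto simp: sum_UNIV_2 c_def w_def[symmetric] mult.commute)
  moreover have "(\<Sum>t\<in>UNIV. d l t * c t l') = (if l = l' then 1 else 0)" for l l'
    using UNIV_2_cases[of l] UNIV_2_cases[of l'] gh(1,2)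
    by (auto simp: sum_UNIV_2 c_def d_def)
  ultimately show thesis
    by (rule that)
qed

text \<open>Words over pairs are pairs of words; this lets block rows and rows of the Cholesky
  factor be summed separately.\<close>

lemma sum_words_zip:
  "(\<Sum>S\<in>words n. F S) = (\<Sum>M\<in>(words n :: 'k::finite list set). \<Sum>T\<in>(words n :: 'l::finite list set). F (zip M T))"
proof (induction n arbitrary: F)
  case (Suc n)
  have "(\<Sum>S\<in>words (Suc n). F S) = (\<Sum>m\<in>UNIV. \<Sum>t\<in>UNIV. \<Sum>M\<in>words n. \<Sum>T\<in>words n. F ((m, t) # zip M T))"
    unfolding sum_words_Suc sum_pairs Suc ..
  also have "\<dots> = (\<Sum>m\<in>UNIV. \<Sum>M\<in>words n. \<Sum>t\<in>UNIV. \<Sum>T\<in>words n. F ((m, t) # zip M T))"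
    by (rule sum.cong[OF refl], rule sum.swap)
  finally show ?case
    by (simp only: sum_words_Suc zip_Cons_Cons)
qed simp

fun word_coeff :: "('k \<Rightarrow> 'k \<Rightarrow> complex) \<Rightarrow> 'k list \<Rightarrow> 'k list \<Rightarrow> complex" where
  "word_coeff c (t # T) (l # L) = c t l * word_coeff c T L"
| "word_coeff c _ _ = 1"

text \<open>The factorization is multiplicative over letters, so the product state on words has the
  word coefficients as its factor.\<close>

lemma word_weight_eq:
  fixes \<psi> :: "'k::finite op \<Rightarrow> complex"
  assumes c: "\<And>l l'. (\<Sum>t\<in>UNIV. cnj (c t l) * c t l') = \<psi> (munit UNIV l l')"
  shows "length K = length L \<Longrightarrow> word_weight \<psi> K L = (\<Sum>T\<in>words (length K). cnj (word_coeff c T K) * word_coeff c T L)"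
proof (induction K L rule: list_induct2)
  case (Cons k K l L)
  have "(\<Sum>T\<in>words (length (k # K)). cnj (word_coeff c T (k # K)) * word_coeff c T (l # L))
     = (\<Sum>t\<in>UNIV. \<Sum>T\<in>words (length K). (cnj (c t k) * c t l) * (cnj (word_coeff c T K) * word_coeff c T L))"
    by (simp add: sum_words_Suc mult_ac)
  also have "\<dots> = \<psi> (munit UNIV k l) * word_weight \<psi> K L"
    by (simp add: sum_distrib_left[symmetric] sum_distrib_right[symmetric] c Cons.IH)
  finally show ?case
    by simp
qed simp

lemma blk_conj:
  fixes u z :: "('a \<times> 'k::finite) op"
  assumes u: "u \<in> bop UNIV" and z: "z \<in> bop UNIV"
  shows "blk (adj UNIV u \<circ> z \<circ> u) k l = (\<Sum>i\<in>UNIV. \<Sum>j\<in>UNIV. adj UNIV (blk u i k) \<circ> blk z i j \<circ> blk u j l)"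
proof -
  have comp: "blk (x \<circ> y) k l = (\<Sum>m\<in>UNIV. blk x k m \<circ> blk y m l)" if "x \<in> bop UNIV" "y \<in> bop UNIV" for x y :: "('a \<times> 'k) op" and k l
    using blk_comp[of x UNIV y l k] that by simp
  have adj: "blk (adj UNIV u) k l = adj UNIV (blk u l k)" for k l
    using blk_adj[of u UNIV k l] u by simp
  have "blk (adj UNIV u \<circ> z \<circ> u) k l = (\<Sum>j\<in>UNIV. (\<Sum>i\<in>UNIV. adj UNIV (blk u i k) \<circ> blk z i j) \<circ> blk u j l)"
    using u z by (simp only: comp adj bop_comp adj_bop)
  also have "\<dots> = (\<Sum>j\<in>UNIV. \<Sum>i\<in>UNIV. adj UNIV (blk u i k) \<circ> blk z i j \<circ> blk u j l)"
    by (simp only: sum_comp)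
  also have "\<dots> = (\<Sum>i\<in>UNIV. \<Sum>j\<in>UNIV. adj UNIV (blk u i k) \<circ> blk z i j \<circ> blk u j l)"
    by (rule sum.swap)
  finally show ?thesis .
qed

lemma blk_conj_tensor_id:
  fixes u :: "('a \<times> 'k::finite) op"
  assumes u: "u \<in> bop UNIV" and x: "x \<in> bop UNIV"
  shows "blk (adj UNIV u \<circ> tensor_op UNIV UNIV x (id_op UNIV) \<circ> u) k l = dil_T (blk u) k l x"
proof -
  have t: "blk (tensor_op UNIV UNIV x (id_op (UNIV :: 'k set))) i j = (if i = j then x else 0)" for i j
  proof -
    have "blk (tensor_op UNIV UNIV x (id_op (UNIV :: 'k set))) i j = oscale (id_op UNIV (ket j) i) x"
      by (rule blk_tensor_op[OF x bop_id finite]) auto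
    also have "id_op UNIV (ket j) = ket j"
      by simp
    finally show ?thesis
      by (cases "i = j") (simp_all only: ket_apply simp_thms if_True if_False oscale_0 oscale_1)
  qed
  have z: "tensor_op UNIV UNIV x (id_op (UNIV :: 'k set)) \<in> bop UNIV"
    by (rule tensor_op_bop_UNIV[OF x bop_id])
  have b0: "adj UNIV (blk u i k) \<circ> 0 \<circ> blk u j l = 0" for i j
    by (rule ext) (simp add: bop_0[OF adj_bop[OF blk_bop_UNIV[OF u]]])
  have "blk (adj UNIV u \<circ> tensor_op UNIV UNIV x (id_op UNIV) \<circ> u) k l
      = (\<Sum>i\<in>UNIV. \<Sum>j\<in>UNIV. if j = i then adj UNIV (blk u i k) \<circ> x \<circ> blk u i l else 0)"
    unfolding blk_conj[OF u z] t by (intro sum.cong refl) (auto simp: b0)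
  also have "\<dots> = (\<Sum>i\<in>UNIV. adj UNIV (blk u i k) \<circ> x \<circ> blk u i l)"
    by simp
  finally show ?thesis
    by (simp only: dil_T_def)
qed

lemma coupling_bop: "u \<in> bop UNIV \<Longrightarrow> z \<in> bop UNIV \<Longrightarrow> coupling u z \<in> bop UNIV"
  unfolding coupling_def by (intro bop_comp adj_bop)

lemma coupling_linear: "u \<in> bop UNIV \<Longrightarrow> clinear_map_on (bop UNIV) oscale oscale (coupling u)"
  unfolding clinear_map_on_def coupling_def
  by (auto simp: fun_eq_iff[where 'b = "'a \<Rightarrow> complex"] bop_add[where A = UNIV] bop_scale[where A = UNIV])

locale coupled_states =
  fixes u :: "(nat \<times> 2) op" and \<phi> :: "nat op \<Rightarrow> complex" and \<psi> :: "2 op \<Rightarrow> complex"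
  assumes u_bop: "u \<in> bop UNIV" and u_iso: "adj UNIV u \<circ> u = id_op UNIV" and u_coiso: "u \<circ> adj UNIV u = id_op UNIV"
    and inv: "invariant_states (coupling u) \<phi> \<psi>"
begin

lemma faithful_states: "faithful_normal_state UNIV \<phi>" "faithful_normal_state UNIV \<psi>"
  using inv by (simp_all only: invariant_states_def)

lemma normal: "normal_state UNIV \<phi>" "normal_state UNIV \<psi>"
  using faithful_states by (simp_all only: faithful_normal_state_def)

lemma \<phi>: "state UNIV \<phi>" and \<psi>: "state UNIV \<psi>"
  using normal by (simp_all only: normal_state_def)

lemma faithful:
  "x \<in> bop UNIV \<Longrightarrow> \<phi> (adj UNIV x \<circ> x) = 0 \<Longrightarrow> x = 0"
  "y \<in> bop UNIV \<Longrightarrow> \<psi> (adj UNIV y \<circ> y) = 0 \<Longrightarrow> y = 0"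
  using faithful_states by (simp_all only: faithful_normal_state_def Ball_def)

lemma lin: "clinear_map_on (bop UNIV) oscale (*) \<phi>" "clinear_map_on (bop UNIV) oscale (*) \<psi>"
  using \<phi> \<psi> by (auto simp: state_def)

abbreviation U where "U \<equiv> blk u"

lemma U_bop: "U i k \<in> bop UNIV"
  by (rule blk_bop_UNIV[OF u_bop])

lemma U_iso: "(\<Sum>i\<in>UNIV. adj UNIV (U i k) \<circ> U i l) = (if k = l then id_op UNIV else 0)"
proof -
  have "(\<Sum>i\<in>UNIV. adj UNIV (U i k) \<circ> U i l) = blk (adj UNIV u \<circ> u) k l"
    using blk_comp[of "adj UNIV u" UNIV u l k] blk_adj[of u UNIV] u_bop by simp
  then show ?thesis
    using blk_id[of l UNIV k] unfolding u_iso by simp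
qed

lemma U_coiso: "(\<Sum>k\<in>UNIV. U i k \<circ> adj UNIV (U j k)) = (if i = j then id_op UNIV else 0)"
proof -
  have "(\<Sum>k\<in>UNIV. U i k \<circ> adj UNIV (U j k)) = blk (u \<circ> adj UNIV u) i j"
    using blk_comp[of u UNIV "adj UNIV u" j i] blk_adj[of u UNIV] u_bop by simp
  then show ?thesis
    using blk_id[of j UNIV i] unfolding u_coiso by simp
qed

definition s :: "2 \<Rightarrow> 2 \<Rightarrow> complex" where
  "s k l = \<psi> (munit UNIV k l)"

lemma invariance:
  assumes z: "z \<in> bop UNIV"
  shows "(\<Sum>k\<in>UNIV. \<Sum>l\<in>UNIV. \<phi> (blk (adj UNIV u \<circ> z \<circ> u) k l) * s k l) = (\<Sum>k\<in>UNIV. \<Sum>l\<in>UNIV. \<phi> (blk z k l) * s k l)"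
proof -
  have pf: "product_functional UNIV UNIV \<phi> \<psi> w = (\<Sum>k\<in>UNIV. \<Sum>l\<in>UNIV. \<phi> (blk w k l) * s k l)" if "w \<in> bop UNIV" for w
    using product_functional_eq[OF lin finite] that by (simp add: s_def)
  show ?thesis
    using inv z pf[OF z] pf[OF coupling_bop[OF u_bop z]] unfolding invariant_states_def coupling_def by simp
qed

lemma adj_munit: "adj UNIV (munit UNIV k l) = munit UNIV l (k :: 2)"
  unfolding munit_def by (rule adj_butterfly) auto

lemma s_herm: "s l k = cnj (s k l)"
  using state_adj[OF \<psi>, of "munit UNIV k l"] by (simp add: s_def adj_munit)

text \<open>For the operator \<open>y\<close> whose row \<open>0\<close> is \<open>v\<close> and
  whose other entries vanish, the form is \<open>\<psi>\<close> at
  \<open>adj UNIV y \<circ> y\<close>; since \<open>y \<noteq> 0\<close>, faithfulness of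
  \<open>\<psi>\<close> excludes the value \<open>0\<close>.\<close>

lemma s_pos:
  assumes v: "v 0 \<noteq> 0 \<or> v 1 \<noteq> 0"
  shows "\<exists>r>0. (\<Sum>k\<in>UNIV. \<Sum>l\<in>UNIV. cnj (v k) * v l * s k l) = of_real r"
proof -
  let ?y = "\<Sum>l\<in>UNIV. oscale (v l) (munit UNIV 0 l) :: 2 op"
  have y: "?y \<in> bop UNIV"
    by (intro bop_sum_ops bop_oscale munit_bop) auto
  have mm: "adj UNIV (munit UNIV 0 k) \<circ> id_op UNIV \<circ> munit UNIV 0 l = munit UNIV k (l :: 2)" for k l
  proof -
    have "adj UNIV (munit UNIV 0 k) \<circ> id_op UNIV \<circ> munit UNIV 0 l = munit UNIV k 0 \<circ> munit UNIV 0 (l :: 2)"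
      by (simp only: adj_munit comp_id_op munit_bop UNIV_I)
    also have "\<dots> = oscale (ip (ket (0 :: 2)) (ket 0)) (munit UNIV k l)"
      unfolding munit_def by (rule butterfly_comp_butterfly) auto
    also have "ip (ket 0) (ket (0 :: 2)) = 1"
      by (simp only: ip_ket_left) (simp add: ket_apply)
    finally show ?thesis
      by (simp only: oscale_1)
  qed
  have "\<psi> (adj UNIV ?y \<circ> ?y) = \<psi> (adj UNIV ?y \<circ> id_op UNIV \<circ> ?y)"
    using y by (simp only: comp_id_op adj_bop)
  also have "\<dots> = (\<Sum>k\<in>UNIV. \<Sum>l\<in>UNIV. cnj (v k) * v l * s k l)"
    by (subst state_sandwich[OF \<psi>]) (simp_all only: munit_bop UNIV_I bop_id mm s_def)
  finally have eq: "\<psi> (adj UNIV ?y \<circ> ?y) = (\<Sum>k\<in>UNIV. \<Sum>l\<in>UNIV. cnj (v k) * v l * s k l)" .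
  have "?y \<noteq> 0"
  proof
    assume "?y = 0"
    then have "(\<Sum>l\<in>UNIV. oscale (v l) (munit UNIV 0 l)) (ket k) 0 = 0" for k :: 2
      by (simp only: op_apply zero_fun_apply)
    then have "v k = 0" for k
      unfolding op_sum_apply sum_fun_apply by (simp add: vscale_apply munit_ket if_distrib cong: if_cong)
    then show False
      using v by simp
  qed
  then have "\<psi> (adj UNIV ?y \<circ> ?y) \<noteq> 0"
    using faithful(2)[OF y] by blast
  then have "(state_norm UNIV \<psi> ?y)\<^sup>2 > 0"
    unfolding state_norm_power2(1)[OF \<psi> y] by simp
  then show ?thesis
    using eq state_norm_power2(1)[OF \<psi> y] by metis
qed

lemma s_trace: "(\<Sum>l\<in>UNIV. s l l) = 1"
proof -
  have "(\<Sum>l\<in>UNIV. s l l) = \<psi> (\<Sum>l\<in>UNIV. munit UNIV l l)"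
    unfolding s_def by (rule state_sum[OF \<psi>, symmetric]) simp
  then show ?thesis
    using state_id[OF \<psi>] by (simp only: id_op_eq_sum_munit)
qed

text \<open>A fixed choice of the factorization turns \<open>c\<close> and \<open>d\<close> into
  constants, which can then be parameters of the sublocale below.\<close>

definition factors :: "(2 \<Rightarrow> 2 \<Rightarrow> complex) \<times> (2 \<Rightarrow> 2 \<Rightarrow> complex)" where
  "factors = (SOME cd. (\<forall>l l'. (\<Sum>t\<in>UNIV. cnj (fst cd t l) * fst cd t l') = s l l') \<and>
     (\<forall>l l'. (\<Sum>t\<in>UNIV. snd cd l t * fst cd t l') = (if l = l' then 1 else 0)))"

lemma factors:
  "(\<forall>l l'. (\<Sum>t\<in>UNIV. cnj (fst factors t l) * fst factors t l') = s l l') \<and>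
     (\<forall>l l'. (\<Sum>t\<in>UNIV. snd factors l t * fst factors t l') = (if l = l' then 1 else 0))"
proof -
  obtain c d where cd: "\<And>l l'. (\<Sum>t\<in>(UNIV :: 2 set). cnj (c t l) * c t l') = s l l'"
    "\<And>l l'. (\<Sum>t\<in>(UNIV :: 2 set). d l t * c t l') = (if l = l' then 1 else 0)"
    using Cholesky_2[OF s_pos s_herm] by blast
  have "\<exists>cd. (\<forall>l l'. (\<Sum>t\<in>(UNIV :: 2 set). cnj (fst cd t l) * fst cd t l') = s l l') \<and>
     (\<forall>l l'. (\<Sum>t\<in>(UNIV :: 2 set). snd cd l t * fst cd t l') = (if l = l' then 1 else 0))"
    by (rule exI[of _ "(c, d)"]) (simp only: fst_conv snd_conv cd simp_thms)
  then show ?thesis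
    unfolding factors_def by (rule someI_ex)
qed

definition c where "c = fst factors"
definition d where "d = snd factors"

lemma c: "(\<Sum>t\<in>UNIV. cnj (c t l) * c t l') = s l l'"
  and d: "(\<Sum>t\<in>UNIV. d l t * c t l') = (if l = l' then 1 else 0)"
  unfolding c_def d_def using factors by blast+

lemma c_norm: "(\<Sum>t\<in>UNIV. \<Sum>l\<in>UNIV. (cmod (c t l))\<^sup>2) = 1"
proof -
  have "complex_of_real (\<Sum>t\<in>UNIV. \<Sum>l\<in>UNIV. (cmod (c t l))\<^sup>2) = (\<Sum>t\<in>UNIV. \<Sum>l\<in>UNIV. cnj (c t l) * c t l)"
    unfolding of_real_sum complex_norm_square by (simp only: mult.commute)
  also have "\<dots> = (\<Sum>l\<in>UNIV. s l l)"
    unfolding c[symmetric] by (rule sum.swap)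
  finally show ?thesis
    unfolding s_trace of_real_eq_1_iff .
qed

text \<open>Invariance is tested on \<open>w = (adj x \<otimes> 1) u (y \<otimes> 1) (adj u) (z
  \<otimes> 1)\<close>. Its conjugate under \<open>u\<close> is
  \<open>adj (J x) (y \<otimes> 1) (J z)\<close> and produces the sum over \<open>R\<close>; in
  \<open>w\<close> itself the middle factor \<open>u (y \<otimes> 1) (adj u)\<close> is turned into
  \<open>P y\<close> by the weights of \<open>\<psi>\<close>.\<close>

lemma duality:
  assumes x: "x \<in> bop UNIV" and y: "y \<in> bop UNIV" and z: "z \<in> bop UNIV"
  shows "(\<Sum>r\<in>UNIV. \<phi> (adj UNIV (dil_R U c r x) \<circ> y \<circ> dil_R U c r z)) = \<phi> (adj UNIV x \<circ> dil_P U c y \<circ> z)"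
proof -
  have Tb: "dil_T U k l x \<in> bop UNIV" "dil_T U k l z \<in> bop UNIV" for k l
    unfolding dil_T_def using x z by (intro bop_sum_ops bop_comp adj_bop U_bop; simp)+
  let ?t = "\<lambda>x :: nat op. tensor_op UNIV UNIV x (id_op (UNIV :: 2 set))"
  have t: "?t x \<in> bop UNIV" "?t y \<in> bop UNIV" "?t z \<in> bop UNIV"
    using x y z by (auto intro: tensor_op_bop_UNIV)
  have tblk: "blk (?t w) i j = (if i = j then w else 0)" if "w \<in> bop UNIV" for w i j
  proof -
    have "blk (?t w) i j = oscale (id_op UNIV (ket j) i) w"
      by (rule blk_tensor_op[OF that bop_id finite]) auto
    also have "id_op UNIV (ket j) = ket j"
      by simp
    finally show ?thesis
      by (cases "i = j") (simp_all only: ket_apply simp_thms if_True if_False oscale_0 oscale_1)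
  qed
  have comp: "blk (x \<circ> y) k l = (\<Sum>m\<in>UNIV. blk x k m \<circ> blk y m l)" if "x \<in> bop UNIV" "y \<in> bop UNIV" for x y :: "(nat \<times> 2) op" and k l
    using blk_comp[of x UNIV y l k] that by simp
  have adj: "blk (adj UNIV w) k l = adj UNIV (blk w l k)" if "w \<in> bop UNIV" for w :: "(nat \<times> 2) op" and k l
    using blk_adj[of w UNIV k l] that by simp
  let ?v = "u \<circ> ?t y \<circ> adj UNIV u"
  let ?w = "adj UNIV (?t x) \<circ> ?v \<circ> ?t z"
  have v: "?v \<in> bop UNIV"
    using t u_bop by (intro bop_comp adj_bop)
  have w: "?w \<in> bop UNIV"
    using t v u_bop by (intro bop_comp adj_bop)
  have b0: "S \<circ> (0 :: nat op) = 0" "(0 :: nat op) \<circ> S = 0" if "S \<in> bop UNIV" for S :: "nat op"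
    by (rule ext, simp add: bop_0[OF that])+
  have b00: "(0 :: nat op) \<circ> (0 :: nat op) = 0"
    by (rule ext) simp
  have Jx: "adj UNIV u \<circ> ?t x \<circ> u \<in> bop UNIV" "adj UNIV u \<circ> ?t z \<circ> u \<in> bop UNIV"
    using t u_bop by (auto intro!: bop_comp adj_bop)
  have lhs: "blk (adj UNIV u \<circ> ?w \<circ> u) k l = (\<Sum>m\<in>UNIV. adj UNIV (dil_T U m k x) \<circ> y \<circ> dil_T U m l z)" for k l
  proof -
    have "adj UNIV u \<circ> ?w \<circ> u = adj UNIV (adj UNIV u \<circ> ?t x \<circ> u) \<circ> ?t y \<circ> (adj UNIV u \<circ> ?t z \<circ> u)"
      using t u_bop by (simp add: adj_comp comp_assoc)
    then have "blk (adj UNIV u \<circ> ?w \<circ> u) k l = blk (adj UNIV (adj UNIV u \<circ> ?t x \<circ> u) \<circ> ?t y \<circ> (adj UNIV u \<circ> ?t z \<circ> u)) k l"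
      by (simp only:)
    also have "\<dots> = (\<Sum>m\<in>UNIV. \<Sum>m'\<in>UNIV. (adj UNIV (dil_T U m' k x) \<circ> (if m' = m then y else 0)) \<circ> dil_T U m l z)"
      unfolding comp[OF bop_comp[OF adj_bop[OF Jx(1)] t(2)] Jx(2)] comp[OF adj_bop[OF Jx(1)] t(2)] adj[OF Jx(1)]
        tblk[OF y] blk_conj_tensor_id[OF u_bop x] blk_conj_tensor_id[OF u_bop z] sum_comp ..
    also have "\<dots> = (\<Sum>m\<in>UNIV. \<Sum>m'\<in>UNIV. if m' = m then adj UNIV (dil_T U m k x) \<circ> y \<circ> dil_T U m l z else 0)"
    proof (intro sum.cong refl)
      show "(adj UNIV (dil_T U m' k x) \<circ> (if m' = m then y else 0)) \<circ> dil_T U m l z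
        = (if m' = m then adj UNIV (dil_T U m k x) \<circ> y \<circ> dil_T U m l z else 0)" for m m'
        by (cases "m' = m") (simp_all only: simp_thms if_True if_False b0 adj_bop Tb)
    qed
    also have "\<dots> = (\<Sum>m\<in>UNIV. adj UNIV (dil_T U m k x) \<circ> y \<circ> dil_T U m l z)"
      by (simp only: sum.delta finite UNIV_I if_True)
    finally show ?thesis .
  qed
  have rhs: "blk ?w k l = adj UNIV x \<circ> (\<Sum>m\<in>UNIV. U k m \<circ> y \<circ> adj UNIV (U l m)) \<circ> z" for k l
  proof -
    have vb: "blk ?v k l = (\<Sum>m\<in>UNIV. U k m \<circ> y \<circ> adj UNIV (U l m))" for k l
    proof -
      have "blk ?v k l = (\<Sum>m\<in>UNIV. \<Sum>m'\<in>UNIV. (U k m' \<circ> (if m' = m then y else 0)) \<circ> adj UNIV (U l m))"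
        unfolding comp[OF bop_comp[OF u_bop t(2)] adj_bop[OF u_bop]] comp[OF u_bop t(2)] adj[OF u_bop] tblk[OF y] sum_comp ..
      also have "\<dots> = (\<Sum>m\<in>UNIV. \<Sum>m'\<in>UNIV. if m' = m then U k m \<circ> y \<circ> adj UNIV (U l m) else 0)"
      proof (intro sum.cong refl)
        show "(U k m' \<circ> (if m' = m then y else 0)) \<circ> adj UNIV (U l m) = (if m' = m then U k m \<circ> y \<circ> adj UNIV (U l m) else 0)" for m m'
          by (cases "m' = m") (simp_all only: simp_thms if_True if_False b0 adj_bop U_bop)
      qed
      also have "\<dots> = (\<Sum>m\<in>UNIV. U k m \<circ> y \<circ> adj UNIV (U l m))"
        by (simp only: sum.delta finite UNIV_I if_True)
      finally show ?thesis .
    qed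
    have vbb: "blk ?v k l \<in> bop UNIV" for k l
      by (rule blk_bop_UNIV[OF v])
    have tx: "adj UNIV (blk (?t x) m k) = (if m = k then adj UNIV x else 0)" for m k
      by (simp add: tblk[OF x])
    have "blk ?w k l = (\<Sum>m\<in>UNIV. \<Sum>m'\<in>UNIV. ((if m' = k then adj UNIV x else 0) \<circ> blk ?v m' m) \<circ> (if m = l then z else 0))"
      unfolding comp[OF bop_comp[OF adj_bop[OF t(1)] v] t(3)] comp[OF adj_bop[OF t(1)] v] adj[OF t(1)] tx tblk[OF z] sum_comp ..
    also have "\<dots> = (\<Sum>m\<in>UNIV. \<Sum>m'\<in>UNIV. if m' = k then (if m = l then (adj UNIV x \<circ> blk ?v k l) \<circ> z else 0) else 0)"
    proof (intro sum.cong refl)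
      show "((if m' = k then adj UNIV x else 0) \<circ> blk ?v m' m) \<circ> (if m = l then z else 0)
        = (if m' = k then (if m = l then (adj UNIV x \<circ> blk ?v k l) \<circ> z else 0) else 0)" for m m'
        by (cases "m' = k"; cases "m = l") (simp_all only: simp_thms if_True if_False b0 b00 bop_comp adj_bop vbb x z)
    qed
    also have "\<dots> = adj UNIV x \<circ> blk ?v k l \<circ> z"
      by (simp only: sum.delta finite UNIV_I if_True)
    finally show ?thesis
      unfolding vb .
  qed
  have "(\<Sum>r\<in>UNIV. \<phi> (adj UNIV (dil_R U c r x) \<circ> y \<circ> dil_R U c r z))
      = (\<Sum>m\<in>UNIV. \<Sum>t\<in>UNIV. \<Sum>k\<in>UNIV. \<Sum>l\<in>UNIV. cnj (c t k) * c t l * \<phi> (adj UNIV (dil_T U m k x) \<circ> y \<circ> dil_T U m l z))"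
    unfolding sum_pairs dil_R_def fst_conv snd_conv
    by (intro sum.cong refl state_sandwich[OF \<phi>] Tb y)
  also have "\<dots> = (\<Sum>k\<in>UNIV. \<Sum>l\<in>UNIV. \<phi> (\<Sum>m\<in>UNIV. adj UNIV (dil_T U m k x) \<circ> y \<circ> dil_T U m l z) * s k l)"
  proof -
    have "\<phi> (\<Sum>m\<in>UNIV. adj UNIV (dil_T U m k x) \<circ> y \<circ> dil_T U m l z) = (\<Sum>m\<in>UNIV. \<phi> (adj UNIV (dil_T U m k x) \<circ> y \<circ> dil_T U m l z))" for k l
      by (rule state_sum[OF \<phi>]) (intro bop_comp adj_bop Tb y)
    then show ?thesis
      unfolding c[symmetric] by (simp add: sum_UNIV_2 algebra_simps)
  qed
  also have "\<dots> = (\<Sum>k\<in>UNIV. \<Sum>l\<in>UNIV. \<phi> (blk ?w k l) * s k l)"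
    unfolding lhs[symmetric] by (rule invariance[OF w])
  also have "\<dots> = \<phi> (adj UNIV x \<circ> dil_P U c y \<circ> z)"
  proof -
    have Wb: "dil_W U c r \<in> bop UNIV" for r
      unfolding dil_W_def by (intro bop_sum_ops bop_oscale adj_bop U_bop)
    have Uy: "adj UNIV (adj UNIV (U k m)) \<circ> y \<circ> adj UNIV (U l m) \<in> bop UNIV" for k l m
      by (intro bop_comp adj_bop U_bop y)
    have P: "dil_P U c y = (\<Sum>m\<in>UNIV. \<Sum>t\<in>UNIV. \<Sum>k\<in>UNIV. \<Sum>l\<in>UNIV. oscale (cnj (c t k) * c t l) (U k m \<circ> y \<circ> adj UNIV (U l m)))"
    proof -
      have "adj UNIV (dil_W U c (m, t)) \<circ> y \<circ> dil_W U c (m, t)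
        = (\<Sum>k\<in>UNIV. \<Sum>l\<in>UNIV. oscale (cnj (c t k) * c t l) (adj UNIV (adj UNIV (U k m)) \<circ> y \<circ> adj UNIV (U l m)))" for m t
        unfolding dil_W_def fst_conv snd_conv by (intro sandwich y adj_bop U_bop)
      then show ?thesis
        unfolding dil_P_def sum_pairs by (simp only: adj_adj[OF U_bop])
    qed
    have Uyz: "adj UNIV x \<circ> (U k m \<circ> y \<circ> adj UNIV (U l m)) \<circ> z \<in> bop UNIV" for k l m
      using x y z by (intro bop_comp adj_bop U_bop)
    have Ub: "U k m \<circ> y \<circ> adj UNIV (U l m) \<in> bop UNIV" for k l m
      using y by (intro bop_comp adj_bop U_bop)
    define F where "F k l m = \<phi> (adj UNIV x \<circ> (U k m \<circ> y \<circ> adj UNIV (U l m)) \<circ> z)" for k l m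
    have L: "\<phi> (blk ?w k l) = (\<Sum>m\<in>UNIV. F k l m)" for k l
    proof -
      have "blk ?w k l = (\<Sum>m\<in>UNIV. adj UNIV x \<circ> (U k m \<circ> y \<circ> adj UNIV (U l m)) \<circ> z)"
        unfolding rhs comp_sum[OF adj_bop[OF x] Ub] sum_comp ..
      moreover have "\<phi> (\<Sum>m\<in>UNIV. adj UNIV x \<circ> (U k m \<circ> y \<circ> adj UNIV (U l m)) \<circ> z) = (\<Sum>m\<in>UNIV. F k l m)"
        unfolding F_def by (rule state_sum[OF \<phi> Uyz])
      ultimately show ?thesis
        by (simp only:)
    qed
    have lin4: "\<phi> (adj UNIV x \<circ> (\<Sum>i\<in>I. S i) \<circ> z) = (\<Sum>i\<in>I. \<phi> (adj UNIV x \<circ> S i \<circ> z))" if "\<And>i. i \<in> I \<Longrightarrow> S i \<in> bop UNIV" for I :: "2 set" and S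
    proof -
      have "adj UNIV x \<circ> (\<Sum>i\<in>I. S i) \<circ> z = (\<Sum>i\<in>I. adj UNIV x \<circ> S i \<circ> z)"
        using that x by (simp only: comp_sum[where A = UNIV] adj_bop sum_comp)
      moreover have "\<phi> (\<Sum>i\<in>I. adj UNIV x \<circ> S i \<circ> z) = (\<Sum>i\<in>I. \<phi> (adj UNIV x \<circ> S i \<circ> z))"
        using that x z by (intro state_sum[OF \<phi>] bop_comp adj_bop)
      ultimately show ?thesis
        by simp
    qed
    have sc: "\<phi> (adj UNIV x \<circ> oscale b (U k m \<circ> y \<circ> adj UNIV (U l m)) \<circ> z) = b * F k l m" for b k l m
    proof -
      have "adj UNIV x \<circ> oscale b (U k m \<circ> y \<circ> adj UNIV (U l m)) \<circ> z = oscale b (adj UNIV x \<circ> (U k m \<circ> y \<circ> adj UNIV (U l m)) \<circ> z)"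
        by (simp only: comp_oscale[OF adj_bop[OF x] Ub] oscale_comp)
      moreover have "\<phi> (oscale b (adj UNIV x \<circ> (U k m \<circ> y \<circ> adj UNIV (U l m)) \<circ> z)) = b * F k l m"
        unfolding F_def by (rule state_scale[OF \<phi> Uyz])
      ultimately show ?thesis
        by (simp only:)
    qed
    have "\<phi> (adj UNIV x \<circ> dil_P U c y \<circ> z) = (\<Sum>m\<in>UNIV. \<Sum>t\<in>UNIV. \<Sum>k\<in>UNIV. \<Sum>l\<in>UNIV. (cnj (c t k) * c t l) * F k l m)"
      unfolding P by (simp only: lin4 bop_sum_ops bop_oscale Ub sc)
    also have "\<dots> = (\<Sum>k\<in>UNIV. \<Sum>l\<in>UNIV. (\<Sum>m\<in>UNIV. F k l m) * s k l)"
      unfolding c[symmetric] by (simp add: sum_UNIV_2 algebra_simps)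
    finally show ?thesis
      unfolding L by simp
  qed
  finally show ?thesis .
qed

sublocale dilation U c d \<phi>
  by (rule dilation.intro[OF \<phi> U_bop U_iso U_coiso c_norm d duality])

end

section \<open>The deviation in the product state\<close>

context coupled_states
begin

lemma step_blk_eq: "x \<in> bop UNIV \<Longrightarrow> step_blk (coupling u) k l x = T k l x"
  unfolding step_blk_def coupling_def by (rule blk_conj_tensor_id[OF u_bop])

lemma word_blk_bop:
  "length K = length L \<Longrightarrow> a \<in> bop UNIV \<Longrightarrow> word_blk (coupling u) K L a \<in> bop UNIV"
  by (induction K L rule: list_induct2) (simp_all add: step_blk_eq)

text \<open>Multilinear expansion over the column indices \<open>L\<close>: the rows
  \<open>M\<close> of the blocks are kept, and the rows \<open>S\<close> of \<open>c\<close> enter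
  only as coefficients.\<close>

lemma Rw_zip:
  assumes a: "a \<in> bop UNIV"
  shows "length M = length S \<Longrightarrow> Rw (zip M S) a = (\<Sum>L\<in>words (length M). oscale (word_coeff c S L) (word_blk (coupling u) M L a))"
proof (induction M S rule: list_induct2)
  case Nil
  show ?case
    by (simp add: oscale_1)
next
  case (Cons m M t S)
  let ?w = "\<lambda>L. word_blk (coupling u) M L a"
  have w: "?w L \<in> bop UNIV" if "L \<in> words (length M)" for L
    using that by (intro word_blk_bop[OF _ a]) (simp add: words_def)
  have "Rw (zip (m # M) (t # S)) a = Rw [(m, t)] (\<Sum>L\<in>words (length M). oscale (word_coeff c S L) (?w L))"
    unfolding zip_Cons_Cons Rw_simps Cons.IH ..
  also have "\<dots> = (\<Sum>L\<in>words (length M). Rw [(m, t)] (oscale (word_coeff c S L) (?w L)))"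
    using w by (intro Rw_sum bop_oscale)
  also have "\<dots> = (\<Sum>L\<in>words (length M). \<Sum>l\<in>UNIV. oscale (c t l * word_coeff c S L) (T m l (?w L)))"
  proof (rule sum.cong[OF refl])
    fix L :: "2 list" assume L: "L \<in> words (length M)"
    show "Rw [(m, t)] (oscale (word_coeff c S L) (?w L)) = (\<Sum>l\<in>UNIV. oscale (c t l * word_coeff c S L) (T m l (?w L)))"
      unfolding Rw_simps R_oscale[OF w[OF L]]
      by (rule ext) (simp add: dil_R_def op_sum_apply vscale_sum vscale_vscale mult.commute)
  qed
  also have "\<dots> = (\<Sum>L\<in>words (length M). \<Sum>l\<in>UNIV. oscale (word_coeff c (t # S) (l # L)) (word_blk (coupling u) (m # M) (l # L) a))"
    using w by (intro sum.cong refl) (simp add: step_blk_eq)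
  also have "\<dots> = (\<Sum>L\<in>words (length (m # M)). oscale (word_coeff c (t # S) L) (word_blk (coupling u) (m # M) L a))"
    unfolding list.size(4) add_0_right add_Suc_right One_nat_def sum_words_Suc by (rule sum.swap)
  finally show ?case .
qed

text \<open>The sign arises because asymptotic completeness is stated for \<open>Q J - J\<close>,
  while \<open>Y\<close> is an operator minus its mean; the norm does not see it.\<close>

lemma Y_zip:
  assumes a: "a \<in> bop UNIV" and M: "M \<in> words n" and S: "S \<in> words n"
  shows "(\<Sum>L\<in>words n. oscale (word_coeff c S L)
      (oscale (\<phi> (word_blk (coupling u) M L a)) (id_op UNIV) - word_blk (coupling u) M L a)) = oscale (- 1) (Y a (zip M S))"
proof -
  let ?w = "\<lambda>L. word_blk (coupling u) M L a"
  have w: "?w L \<in> bop UNIV" if "L \<in> words n" for L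
    using that M by (intro word_blk_bop[OF _ a]) (simp add: words_def)
  have R: "Rw (zip M S) a = (\<Sum>L\<in>words n. oscale (word_coeff c S L) (?w L))"
    using Rw_zip[OF a, of M S] M S by (simp add: words_def)
  have "\<phi> (Rw (zip M S) a) = (\<Sum>L\<in>words n. \<phi> (oscale (word_coeff c S L) (?w L)))"
    unfolding R by (rule state_sum[OF \<phi>]) (intro bop_oscale w)
  also have "\<dots> = (\<Sum>L\<in>words n. word_coeff c S L * \<phi> (?w L))"
    by (intro sum.cong refl state_scale[OF \<phi>] w)
  finally have p: "\<phi> (Rw (zip M S) a) = (\<Sum>L\<in>words n. word_coeff c S L * \<phi> (?w L))" .
  show ?thesis
    unfolding Y_def p unfolding R
  proof (rule ext, rule ext)
    fix f i
    show "(\<Sum>L\<in>words n. oscale (word_coeff c S L) (oscale (\<phi> (?w L)) (id_op UNIV) - ?w L)) f i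
      = oscale (- 1) ((\<Sum>L\<in>words n. oscale (word_coeff c S L) (?w L)) - oscale (\<Sum>L\<in>words n. word_coeff c S L * \<phi> (?w L)) (id_op UNIV)) f i"
      by (simp add: op_sum_apply sum_fun_apply pointwise sum_distrib_left sum_distrib_right sum_subtractf sum_negf right_diff_distrib mult_ac)
  qed
qed

text \<open>Writing the weights as sums over \<open>S\<close> of products of coefficients turns the
  product state of \<open>adj D \<circ> D\<close> into a sum of squares, one for each pair of
  \<open>M\<close> and \<open>S\<close>, and such pairs are the words in \<open>dev\<close>.\<close>

lemma state_norm_Jn:
  assumes a: "a \<in> bop UNIV"
  shows "state_norm (UNIV \<times> words n) (product_functional UNIV (words n) \<phi> (power_functional n \<psi>))
    (Qn \<phi> n (Jn (coupling u) n a) - Jn (coupling u) n a) = sqrt (dev a n)"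
proof -
  let ?w = "\<lambda>K L. word_blk (coupling u) K L a"
  let ?c = "word_coeff c"
  define Z where "Z = Jn (coupling u) n a"
  have Z: "Z \<in> bop (UNIV \<times> words n)" and blkZ: "K \<in> words n \<Longrightarrow> L \<in> words n \<Longrightarrow> blk Z K L = ?w K L" for K L
    unfolding Z_def using Jn_blk[OF coupling_bop[OF u_bop] coupling_linear[OF u_bop] a] by blast+
  have w: "?w K L \<in> bop UNIV" if "K \<in> words n" "L \<in> words n" for K L
    using that by (intro word_blk_bop[OF _ a]) (simp add: words_def)
  define D where "D = Qn \<phi> n Z - Z"
  define X where "X K L = oscale (\<phi> (?w K L)) (id_op UNIV) - ?w K L" for K L
  have Q: "Qn \<phi> n Z = mat_op (words n) (\<lambda>K L. oscale (\<phi> (blk Z K L)) (id_op UNIV))"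
    unfolding Qn_eq[OF lin(1)] using Z by simp
  have ob: "oscale b (id_op UNIV) \<in> bop UNIV" for b
    by (intro bop_oscale bop_id)
  have D: "D \<in> bop (UNIV \<times> words n)"
    unfolding D_def Q by (intro bop_minus mat_op_bop Z ob finite_words)
  have blkD: "blk D K L = X K L" if "K \<in> words n" "L \<in> words n" for K L
  proof -
    have "blk (Qn \<phi> n Z) K L = oscale (\<phi> (blk Z K L)) (id_op UNIV)"
      unfolding Q by (rule blk_mat_op[OF ob finite_words that])
    then show ?thesis
      unfolding D_def X_def blk_minus by (simp only: blkZ[OF that])
  qed
  have Xb: "X K L \<in> bop UNIV" if "K \<in> words n" "L \<in> words n" for K L
    unfolding X_def by (intro bop_minus ob w that)
  have DD: "blk (adj (UNIV \<times> words n) D \<circ> D) K L = (\<Sum>M\<in>words n. adj UNIV (X M K) \<circ> id_op UNIV \<circ> X M L)"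
    if KL: "K \<in> words n" "L \<in> words n" for K L
  proof -
    have "blk (adj (UNIV \<times> words n) D \<circ> D) K L = (\<Sum>M\<in>words n. blk (adj (UNIV \<times> words n) D) K M \<circ> blk D M L)"
      by (rule blk_comp[OF adj_bop[OF D] D finite_words KL(2)])
    also have "\<dots> = (\<Sum>M\<in>words n. adj UNIV (X M K) \<circ> id_op UNIV \<circ> X M L)"
    proof (rule sum.cong[OF refl])
      fix M :: "2 list" assume M: "M \<in> words n"
      show "blk (adj (UNIV \<times> words n) D) K M \<circ> blk D M L = adj UNIV (X M K) \<circ> id_op UNIV \<circ> X M L"
        unfolding blk_adj[OF D finite_words KL(1) M] blkD[OF M KL(1)] blkD[OF M KL(2)]
          comp_id_op[OF adj_bop[OF Xb[OF M KL(1)]]] ..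
    qed
    finally show ?thesis .
  qed
  have Xid: "adj UNIV (X M K) \<circ> id_op UNIV \<circ> X M L \<in> bop UNIV" if "M \<in> words n" "K \<in> words n" "L \<in> words n" for M K L
    using that by (intro bop_comp adj_bop bop_id Xb)
  define F where "F M K L = \<phi> (adj UNIV (X M K) \<circ> id_op UNIV \<circ> X M L)" for M K L
  have ww: "word_weight \<psi> K L = (\<Sum>S\<in>words n. cnj (?c S K) * ?c S L)" if "K \<in> words n" "L \<in> words n" for K L
    using word_weight_eq[of c \<psi> K L] that by (simp add: c s_def words_def)
  have "product_functional UNIV (words n) \<phi> (power_functional n \<psi>) (adj (UNIV \<times> words n) D \<circ> D)
      = (\<Sum>K\<in>words n. \<Sum>L\<in>words n. \<phi> (blk (adj (UNIV \<times> words n) D \<circ> D) K L) * word_weight \<psi> K L)"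
    by (rule product_power_functional[OF lin bop_comp[OF adj_bop[OF D] D]])
  also have "\<dots> = (\<Sum>K\<in>words n. \<Sum>L\<in>words n. \<Sum>M\<in>words n. \<Sum>S\<in>words n. cnj (?c S K) * ?c S L * F M K L)"
  proof (intro sum.cong refl)
    fix K L :: "2 list" assume KL: "K \<in> words n" "L \<in> words n"
    have "\<phi> (blk (adj (UNIV \<times> words n) D \<circ> D) K L) = (\<Sum>M\<in>words n. F M K L)"
      unfolding DD[OF KL] F_def by (rule state_sum[OF \<phi>]) (rule Xid[OF _ KL])
    then show "\<phi> (blk (adj (UNIV \<times> words n) D \<circ> D) K L) * word_weight \<psi> K L
        = (\<Sum>M\<in>words n. \<Sum>S\<in>words n. cnj (?c S K) * ?c S L * F M K L)"
      unfolding ww[OF KL] by (simp add: sum_product mult.commute)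
  qed
  also have "\<dots> = (\<Sum>K\<in>words n. \<Sum>M\<in>words n. \<Sum>S\<in>words n. \<Sum>L\<in>words n. cnj (?c S K) * ?c S L * F M K L)"
    by (rule sum.cong[OF refl], subst sum.swap, rule sum.cong[OF refl], rule sum.swap)
  also have "\<dots> = (\<Sum>M\<in>words n. \<Sum>S\<in>words n. \<Sum>K\<in>words n. \<Sum>L\<in>words n. cnj (?c S K) * ?c S L * F M K L)"
    by (subst sum.swap, rule sum.cong[OF refl], rule sum.swap)
  also have "\<dots> = (\<Sum>M\<in>words n. \<Sum>S\<in>words n. complex_of_real ((sn (Y a (zip M S)))\<^sup>2))"
  proof (intro sum.cong refl)
    fix M S :: "2 list" assume M: "M \<in> words n" and S: "S \<in> words n"
    let ?V = "\<Sum>L\<in>words n. oscale (?c S L) (X M L)"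
    have V: "?V \<in> bop UNIV"
      by (intro bop_sum_ops bop_oscale Xb M)
    have "(\<Sum>K\<in>words n. \<Sum>L\<in>words n. cnj (?c S K) * ?c S L * F M K L) = \<phi> (adj UNIV ?V \<circ> id_op UNIV \<circ> ?V)"
      unfolding F_def by (rule state_sandwich[OF \<phi> Xb[OF M] bop_id Xb[OF M], symmetric])
    also have "\<dots> = \<phi> (adj UNIV ?V \<circ> ?V)"
      unfolding comp_id_op[OF adj_bop[OF V]] ..
    also have "\<dots> = of_real ((sn ?V)\<^sup>2)"
      by (rule state_norm_power2(1)[OF \<phi> V])
    also have "sn ?V = sn (Y a (zip M S))"
      unfolding X_def Y_zip[OF a M S] state_norm_oscale[OF \<phi> Y_bop[OF a]] by simp
    finally show "(\<Sum>K\<in>words n. \<Sum>L\<in>words n. cnj (?c S K) * ?c S L * F M K L) = complex_of_real ((sn (Y a (zip M S)))\<^sup>2)" .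
  qed
  also have "\<dots> = of_real (dev a n)"
    unfolding dev_def sum_words_zip[of _ n] of_real_sum ..
  finally have "Re (product_functional UNIV (words n) \<phi> (power_functional n \<psi>) (adj (UNIV \<times> words n) D \<circ> D)) = dev a n"
    by (simp only: Re_complex_of_real)
  then show ?thesis
    unfolding state_norm_def[of "UNIV \<times> words n"] D_def Z_def by (simp only:)
qed

lemma transition_asymptotically_complete_coupling:
  assumes "observable_dilation U c d \<phi>"
  shows "transition_asymptotically_complete \<phi> \<psi> (coupling u)"
  unfolding transition_asymptotically_complete_def
proof
  interpret observable_dilation U c d \<phi>
    by (rule assms)
  fix a :: "nat op" assume a: "a \<in> bop UNIV"
  have "(\<lambda>n. sqrt (dev a n)) \<longlonglongrightarrow> sqrt 0"
    by (intro tendsto_real_sqrt dev_tendsto a)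
  then show "(\<lambda>n. state_norm (UNIV \<times> words n) (product_functional UNIV (words n) \<phi> (power_functional n \<psi>))
    (Qn \<phi> n (Jn (coupling u) n a) - Jn (coupling u) n a)) \<longlonglongrightarrow> 0"
    unfolding state_norm_Jn[OF a] by simp
qed

end

lemma micromaser_transition_asymptotically_complete:
  assumes u: "generalized_micromaser u \<alpha> \<alpha>p \<beta> \<beta>p" and \<beta>: "\<forall>n\<ge>1. \<beta> n \<noteq> 0"
    and inv: "invariant_states (coupling u) \<phi> \<psi>"
  shows "transition_asymptotically_complete \<phi> \<psi> (coupling u)"
proof -
  interpret coupled_states u \<phi> \<psi>
    using u inv by unfold_locales (simp_all only: generalized_micromaser_def unitary_op_def)
  have ket: "u (ket (0, 0)) = vscale (\<alpha> 0) (ket (0, 0))"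
    "u (ket (n, 1)) = vscale (\<alpha>p (Suc n)) (ket (n, 1)) + vscale (\<beta> (Suc n)) (ket (Suc n, 0))"
    "u (ket (Suc n, 0)) = vscale (\<beta>p (Suc n)) (ket (n, 1)) + vscale (\<alpha> (Suc n)) (ket (Suc n, 0))" for n
    using u unfolding generalized_micromaser_def by (auto dest!: spec[of _ "Suc n"])
  have blk_ket: "U k l (ket n) = slice (u (ket (n, l))) k" for k l n
    by (simp add: blk_apply tensor_ket_ket)
  have slice_ket: "slice (ket (n, l)) k = (if k = l then ket n else 0)" for n :: nat and k l :: 2
    unfolding tensor_ket_ket[symmetric] by (rule slice_tensor_ket)
  have v0: "vscale b 0 = (0 :: nat vec)" for b
    by (rule ext) (simp add: vscale_apply)
  have "micromaser_dilation U c d \<phi> \<alpha> \<alpha>p \<beta> \<beta>p"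
  proof
    show "U 0 0 (ket n) = vscale (\<alpha> n) (ket n)" for n
      by (cases n) (simp_all add: blk_ket ket slice_plus slice_vscale slice_ket v0)
    show "cmod (\<alpha> 0) = 1"
      using u unfolding generalized_micromaser_def by simp
    show "\<beta> (Suc n) \<noteq> 0" for n
      using \<beta> by simp
  qed (simp_all add: normal blk_ket ket slice_plus slice_vscale slice_ket v0)
  then show ?thesis
    using micromaser_dilation.observable_dilation faithful(1) by (blast intro: transition_asymptotically_complete_coupling)
qed

subsection \<open>Diagonal states\<close>

lemma ip_quadratic_expand:
  assumes T: "T \<in> bop A" and f: "f \<in> ell2 A" and g: "g \<in> ell2 A"
  shows "ip (f + vscale c g) (T (f + vscale c g)) = ip f (T f) + c * ip f (T g) + cnj c * ip g (T f) + cnj c * c * ip g (T g)"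
proof -
  have e: "T f \<in> ell2 A" "T g \<in> ell2 A" "vscale c g \<in> ell2 A" "vscale c (T g) \<in> ell2 A" "T f + vscale c (T g) \<in> ell2 A"
    using assms by simp_all
  show ?thesis
    unfolding bop_add[OF T f e(3)] bop_scale[OF T g] ip_add_left[OF e(5) f e(3)]
      ip_add_right[OF f e(1) e(4)] ip_add_right[OF e(3) e(1) e(4)] ip_add_right[OF g e(1) e(4)] ip_scale_right ip_scale_left
    by (simp add: algebra_simps)
qed

lemma pos_op_form:
  assumes "pos_op A T" "f \<in> ell2 A"
  shows "Im (ip f (T f)) = 0" "0 \<le> Re (ip f (T f))"
  using assms by (auto simp: pos_op_def complex_nonneg_Reals_iff)

lemma pos_opI:
  assumes "T \<in> bop A" "\<And>f. f \<in> ell2 A \<Longrightarrow> Im (ip f (T f)) = 0" "\<And>f. f \<in> ell2 A \<Longrightarrow> 0 \<le> Re (ip f (T f))"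
  shows "pos_op A T"
  using assms by (auto simp: pos_op_def complex_nonneg_Reals_iff)

lemma pos_op_bop: "pos_op A T \<Longrightarrow> T \<in> bop A"
  by (simp add: pos_op_def)

lemma ip_op_diff: "S \<in> bop A \<Longrightarrow> T \<in> bop A \<Longrightarrow> f \<in> ell2 A \<Longrightarrow> g \<in> ell2 A \<Longrightarrow> ip g ((T - S) f) = ip g (T f) - ip g (S f)"
  unfolding op_apply by (rule ip_diff_right[where A = A and B = A and B' = A]) simp_all

lemma pos_op_add: "pos_op A S \<Longrightarrow> pos_op A T \<Longrightarrow> pos_op A (S + T)"
  by (rule pos_opI) (auto simp: pos_op_form pos_op_bop ip_add_right[where A = A and B = A and B' = A])

lemma pos_op_hermitian:
  assumes T: "pos_op A T" and f: "f \<in> ell2 A" and g: "g \<in> ell2 A"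
  shows "ip g (T f) = cnj (ip f (T g))"
proof -
  have "Im (ip (f + vscale c g) (T (f + vscale c g))) = 0" for c
    using f g by (intro pos_op_form(1)[OF T]) simp
  note * = this[unfolded ip_quadratic_expand[OF pos_op_bop[OF T] f g]]
  show ?thesis
    using *[of 1] *[of \<i>] pos_op_form(1)[OF T f] pos_op_form(1)[OF T g] by (simp add: complex_eq_iff)
qed

lemma pos_op_Cauchy_Schwarz:
  assumes T: "pos_op A T" and f: "f \<in> ell2 A" and g: "g \<in> ell2 A"
  shows "(cmod (ip f (T g)))\<^sup>2 \<le> Re (ip f (T f)) * Re (ip g (T g))"
proof (rule quadratic_Cauchy_Schwarz)
  fix c
  have "0 \<le> Re (ip (f + vscale c g) (T (f + vscale c g)))"
    using f g by (intro pos_op_form(2)[OF T]) simp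
  also have "\<dots> = Re (ip f (T f)) + 2 * Re (c * ip f (T g)) + (cmod c)\<^sup>2 * Re (ip g (T g))"
    unfolding ip_quadratic_expand[OF pos_op_bop[OF T] f g] pos_op_hermitian[OF T f g]
    using pos_op_form(1)[OF T g] by (simp add: cmod_def power2_eq_square algebra_simps)
  finally show "0 \<le> Re (ip f (T f)) + 2 * Re (c * ip f (T g)) + (cmod c)\<^sup>2 * Re (ip g (T g))" .
qed (use pos_op_form(2)[OF T] f g in auto)

lemma op_leD:
  assumes "op_le A S T" "S \<in> bop A" "T \<in> bop A" "f \<in> ell2 A"
  shows "Re (ip f (S f)) \<le> Re (ip f (T f))"
  using pos_op_form(2)[of A "T - S" f] ip_op_diff[of S A T f f] assms by (simp add: op_le_def del: op_apply)

text \<open>Cauchy--Schwarz for the form of \<open>X\<close>, at \<open>X f\<close> and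
  \<open>f\<close>, bounds the fourth power of the norm of \<open>X f\<close>. One factor is the
  form at \<open>X f\<close>, which is at most \<open>C * (ell2_norm (X f))\<^sup>2\<close> because
  \<open>X\<close> lies below \<open>T\<close>.\<close>

lemma pos_op_norm_le:
  assumes X: "pos_op A X" and TX: "pos_op A (T - X)" and T: "T \<in> bop A"
    and C: "0 \<le> C" "\<And>f. ell2_norm (T f) \<le> C * ell2_norm f" and f: "f \<in> ell2 A"
  shows "(ell2_norm (X f))\<^sup>2 \<le> C * Re (ip f (X f))"
proof -
  let ?g = "X f"
  have g: "?g \<in> ell2 A"
    by (rule bop_ell2[OF pos_op_bop[OF X]])
  have "Re (ip ?g (X ?g)) \<le> Re (ip ?g (T ?g))"
    using TX by (intro op_leD[OF _ pos_op_bop[OF X] T g]) (simp add: op_le_def)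
  also have "\<dots> \<le> ell2_norm ?g * (C * ell2_norm ?g)"
    using complex_Re_le_cmod[of "ip ?g (T ?g)"] ip_Cauchy_Schwarz[OF g bop_ell2[OF T, of ?g]]
      mult_left_mono[OF C(2)[of ?g] ell2_norm_ge_0[of ?g]] by linarith
  finally have 1: "Re (ip ?g (X ?g)) \<le> C * (ell2_norm ?g)\<^sup>2"
    by (simp add: power2_eq_square mult_ac)
  have p: "0 \<le> Re (ip f (X f))"
    by (rule pos_op_form(2)[OF X f])
  have "((ell2_norm ?g)\<^sup>2)\<^sup>2 = (cmod (ip ?g (X f)))\<^sup>2"
    unfolding ip_self[OF g] norm_of_real by simp
  also have "\<dots> \<le> Re (ip ?g (X ?g)) * Re (ip f (X f))"
    by (rule pos_op_Cauchy_Schwarz[OF X g f])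
  also have "\<dots> \<le> (C * (ell2_norm ?g)\<^sup>2) * Re (ip f (X f))"
    by (rule mult_right_mono[OF 1 p])
  finally have "(ell2_norm ?g)\<^sup>2 * (ell2_norm ?g)\<^sup>2 \<le> (C * Re (ip f (X f))) * (ell2_norm ?g)\<^sup>2"
    by (simp add: power2_eq_square mult_ac)
  then show ?thesis
    by (rule mult_self_le_cancel) (use C p in simp_all)
qed

text \<open>
  The vectors \<open>(T - S) f\<close> converge along the net \<open>D\<close> to some \<open>v\<close>, and Cauchy--Schwarz for the
  forms \<open>T - S\<close> shows that a positive multiple of \<open>|v\<rangle>\<langle>v|\<close> can be subtracted from the upper
  bound \<open>T\<close>.  Hence \<open>v = 0\<close>.
\<close>

lemma op_lub_form_approx:
  assumes D: "D \<noteq> {}" and pos: "\<And>S. S \<in> D \<Longrightarrow> pos_op A S"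
    and dir: "\<And>S S'. S \<in> D \<Longrightarrow> S' \<in> D \<Longrightarrow> \<exists>R\<in>D. op_le A S R \<and> op_le A S' R"
    and lub: "op_lub A D T" and f: "f \<in> ell2 A" and e: "e > 0"
  shows "\<exists>S\<in>D. Re (ip f (T f)) - e < Re (ip f (S f))"
proof -
  have T: "T \<in> bop A" and ub: "\<And>S. S \<in> D \<Longrightarrow> op_le A S T"
    and least: "\<And>R. R \<in> bop A \<Longrightarrow> (\<And>S. S \<in> D \<Longrightarrow> op_le A S R) \<Longrightarrow> op_le A T R"
    using lub by (auto simp: op_lub_def)
  have Sb: "S \<in> bop A" if "S \<in> D" for S
    by (rule pos_op_bop[OF pos[OF that]])
  define q where "q S = Re (ip f (S f))" for S
  define s where "s = (SUP S\<in>D. q S)"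
  have bdd: "bdd_above (q ` D)"
    unfolding q_def by (rule bdd_aboveI2[where M = "Re (ip f (T f))"]) (rule op_leD[OF ub Sb T f])
  have qs: "q S \<le> s" if "S \<in> D" for S
    unfolding s_def using that bdd by (rule cSUP_upper)
  obtain C where C: "0 \<le> C" "\<And>f. ell2_norm (T f) \<le> C * ell2_norm f"
    by (rule bop_bound[OF T]) blast
  \<comment> \<open>\<open>R - S\<close> is positive and lies below \<open>T\<close>, as
    \<open>T - (R - S)\<close> is the sum of the positive operators \<open>T - R\<close> and
    \<open>S\<close>; so its form at \<open>f\<close> controls the norm of
    \<open>(R - S) f\<close>.\<close>
  have step: "ell2_norm (R f - S f) \<le> sqrt (C * (s - q S))" if "R \<in> D" "S \<in> D" "op_le A S R" for R S
  proof -
    have X: "pos_op A (R - S)"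
      using that by (simp add: op_le_def)
    have TX: "pos_op A (T - (R - S))"
    proof -
      have "pos_op A ((T - R) + S)"
        using ub[OF that(1)] pos[OF that(2)] by (intro pos_op_add) (simp_all add: op_le_def)
      moreover have "(T - R) + S = T - (R - S)"
        by (simp only: algebra_simps)
      ultimately show ?thesis
        by (simp only:)
    qed
    have "(ell2_norm (R f - S f))\<^sup>2 \<le> C * (q R - q S)"
      using pos_op_norm_le[OF X TX T C f] ip_op_diff[OF Sb[OF that(2)] Sb[OF that(1)] f f]
      by (simp add: q_def)
    also have "\<dots> \<le> C * (s - q S)"
      using C(1) qs[OF that(1)] by (intro mult_left_mono) auto
    finally show ?thesis
      by (rule real_le_rsqrt)
  qed
  have "\<exists>S\<in>D. s - inverse (Suc k) < q S" for k
    using less_cSUP_iff[OF D bdd, of "s - inverse (Suc k)"] by (simp add: s_def)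
  then obtain S where S: "\<And>k. S k \<in> D" "\<And>k. s - inverse (Suc k) < q (S k)"
    by metis
  define h where "h k = sqrt (C * inverse (Suc k))" for k
  have h: "ell2_norm (R f - S k f) \<le> h k" if "R \<in> D" "op_le A (S k) R" for R k
  proof -
    have "ell2_norm (R f - S k f) \<le> sqrt (C * (s - q (S k)))"
      by (rule step[OF that(1) S(1) that(2)])
    also have "\<dots> \<le> h k"
      unfolding h_def using S(2)[of k] C(1) by (intro real_sqrt_le_mono mult_left_mono) auto
    finally show ?thesis .
  qed
  have h_lim: "h \<longlonglongrightarrow> 0"
  proof -
    have "h \<longlonglongrightarrow> sqrt (C * 0)"
      unfolding h_def by (intro tendsto_intros LIMSEQ_inverse_real_of_nat)
    then show ?thesis
      by simp
  qed
  define V where "V k = T f - S k f" for k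
  have V: "V k \<in> ell2 A" for k
    unfolding V_def using T Sb[OF S(1)] by simp
  have cauchy: "ell2_norm (V m - V k) \<le> h m + h k" for m k
  proof -
    obtain R where R: "R \<in> D" "op_le A (S m) R" "op_le A (S k) R"
      using dir[OF S(1) S(1)] by blast
    have "ell2_norm (V m - V k) = ell2_norm ((R f - S m f) - (R f - S k f))"
      by (rule arg_cong[of _ _ ell2_norm]) (simp add: V_def fun_eq_iff pointwise)
    also have "\<dots> \<le> ell2_norm (R f - S m f) + ell2_norm (R f - S k f)"
      using Sb[OF R(1)] Sb[OF S(1)] by (intro ell2_norm_triangle_diff[where A = A and B = A]) simp_all
    also have "\<dots> \<le> h m + h k"
      using h[OF R(1)] R(2,3) by (intro add_mono) auto
    finally show ?thesis .
  qed
  obtain v where v: "v \<in> ell2 A" "(\<lambda>k. ell2_norm (V k - v)) \<longlonglongrightarrow> 0"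
  proof (rule ell2_complete[where X = V, OF V])
    fix e :: real assume "e > 0"
    then obtain N where N: "\<And>k. k \<ge> N \<Longrightarrow> \<bar>h k\<bar> < e / 2"
      using LIMSEQ_D[OF h_lim, of "e / 2"] by auto
    have "ell2_norm (V m - V n) \<le> e" if "m \<ge> N" "n \<ge> N" for m n
      using cauchy[of m n] N[OF that(1)] N[OF that(2)] by linarith
    then show "\<exists>N. \<forall>m\<ge>N. \<forall>n\<ge>N. ell2_norm (V m - V n) \<le> e"
      by blast
  qed (use that in blast)
  have qT: "0 \<le> q T"
    using D pos_op_form(2)[OF pos f] op_leD[OF ub Sb T f] by (force simp: q_def)
  have key: "(cmod (ip v x))\<^sup>2 \<le> Re (ip x ((T - S') x)) * q T" if S': "S' \<in> D" and x: "x \<in> ell2 A" for S' x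
  proof -
    \<comment> \<open>\<open>R k\<close> lies above \<open>S k\<close> to keep
      \<open>(T - R k) f\<close> close to \<open>v\<close>, and above \<open>S'\<close> to bound the
      form of \<open>T - R k\<close> by that of \<open>T - S'\<close>.\<close>
    have "\<exists>R. R \<in> D \<and> op_le A S' R \<and> op_le A (S k) R" for k
      using dir[OF S' S(1)] by blast
    then obtain R where R: "\<And>k. R k \<in> D" "\<And>k. op_le A S' (R k)" "\<And>k. op_le A (S k) (R k)"
      by metis
    define g where "g k = (T - R k) f" for k
    have gb: "g k \<in> ell2 A" for k
      unfolding g_def using T Sb[OF R(1)] by simp
    have bound: "(cmod (ip (g k) x))\<^sup>2 \<le> Re (ip x ((T - S') x)) * q T" for k
    proof -
      have TR: "pos_op A (T - R k)"
        using ub[OF R(1)] by (simp add: op_le_def)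
      have "cmod (ip (g k) x) = cmod (ip x ((T - R k) f))"
        unfolding g_def ip_cnj[of x, symmetric] by simp
      then have "(cmod (ip (g k) x))\<^sup>2 \<le> Re (ip x ((T - R k) x)) * Re (ip f ((T - R k) f))"
        using pos_op_Cauchy_Schwarz[OF TR x f] by simp
      also have "\<dots> \<le> Re (ip x ((T - S') x)) * q T"
      proof (rule mult_mono)
        show "Re (ip x ((T - R k) x)) \<le> Re (ip x ((T - S') x))"
          using op_leD[OF R(2) Sb[OF S'] Sb[OF R(1)] x] ip_op_diff[OF Sb[OF S'] T x x] ip_op_diff[OF Sb[OF R(1)] T x x]
          by (simp del: op_apply)
        show "Re (ip f ((T - R k) f)) \<le> q T"
          using pos_op_form(2)[OF pos[OF R(1)] f] ip_op_diff[OF Sb[OF R(1)] T f f] by (simp add: q_def del: op_apply)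
        show "0 \<le> Re (ip x ((T - S') x))"
          using ub[OF S'] unfolding op_le_def by (rule pos_op_form(2)[OF _ x])
        show "0 \<le> Re (ip f ((T - R k) f))"
          by (rule pos_op_form(2)[OF TR f])
      qed
      finally show ?thesis .
    qed
    have "(\<lambda>k. ip (g k) x - ip v x) \<longlonglongrightarrow> 0"
    proof (rule Lim_null_comparison)
      have "norm (ip (g k) x - ip v x) \<le> (ell2_norm (V k - v) + h k) * ell2_norm x" for k
      proof -
        have "ell2_norm (g k - v) = ell2_norm ((V k - v) - (R k f - S k f))"
          by (rule arg_cong[of _ _ ell2_norm]) (simp add: g_def V_def fun_eq_iff pointwise)
        also have "\<dots> \<le> ell2_norm (V k - v) + ell2_norm (R k f - S k f)"
          using Sb[OF R(1)] Sb[OF S(1)] V v(1) by (intro ell2_norm_triangle_diff[where A = A and B = A]) simp_all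
        also have "\<dots> \<le> ell2_norm (V k - v) + h k"
          using h[OF R(1) R(3)] by simp
        finally have "ell2_norm (g k - v) * ell2_norm x \<le> (ell2_norm (V k - v) + h k) * ell2_norm x"
          by (rule mult_right_mono) simp
        then show ?thesis
          using ip_Cauchy_Schwarz[OF ell2_diff[OF gb v(1)] x, of k] unfolding ip_diff_left[OF x gb v(1)]
          by (rule order_trans[rotated])
      qed
      then show "\<forall>\<^sub>F k in sequentially. norm (ip (g k) x - ip v x) \<le> (ell2_norm (V k - v) + h k) * ell2_norm x"
        by simp
      show "(\<lambda>k. (ell2_norm (V k - v) + h k) * ell2_norm x) \<longlonglongrightarrow> 0"
        using tendsto_mult_right[OF tendsto_add[OF v(2) h_lim], of "ell2_norm x"] by simp
    qed
    then have "(\<lambda>k. (cmod (ip (g k) x))\<^sup>2) \<longlonglongrightarrow> (cmod (ip v x))\<^sup>2"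
      by (intro tendsto_power tendsto_norm) (rule LIM_zero_cancel)
    then show ?thesis
      by (rule LIMSEQ_le_const2) (use bound in blast)
  qed
  have "v = 0"
  proof -
    \<comment> \<open>With \<open>\<delta> * q T \<le> 1\<close> the estimate \<open>key\<close>
      says that \<open>T\<close> minus \<open>\<delta>\<close> times \<open>|v><v|\<close> is still
      an upper bound of \<open>D\<close>.\<close>
    define \<delta> where "\<delta> = 1 / (q T + 1)"
    have \<delta>: "0 < \<delta>" "\<delta> * q T \<le> 1"
      using qT by (simp_all add: \<delta>_def)
    define R where "R = T - oscale (of_real \<delta>) (butterfly A v v)"
    have B: "oscale (of_real \<delta>) (butterfly A v v) \<in> bop A"
      using v(1) by simp
    have R: "R \<in> bop A"
      unfolding R_def using T B by simp
    have form: "ip x (oscale (of_real \<delta>) (butterfly A v v) x) = of_real (\<delta> * (cmod (ip v x))\<^sup>2)" if x: "x \<in> ell2 A" for x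
      unfolding oscale_apply butterfly_apply[OF x] ip_scale_right ip_cnj[of v, symmetric] of_real_mult complex_norm_square by simp
    have "op_le A S' R" if S': "S' \<in> D" for S'
      unfolding op_le_def
    proof (rule pos_opI)
      show "R - S' \<in> bop A"
        using R Sb[OF S'] by simp
      fix x assume x: "x \<in> ell2 A"
      have "R - S' = (T - S') - oscale (of_real \<delta>) (butterfly A v v)"
        unfolding R_def by (simp only: algebra_simps)
      then have eq: "ip x ((R - S') x) = ip x ((T - S') x) - of_real (\<delta> * (cmod (ip v x))\<^sup>2)"
        using ip_op_diff[OF B bop_minus[OF T Sb[OF S']] x x] form[OF x] by (simp only:)
      have TS: "pos_op A (T - S')"
        using ub[OF S'] by (simp add: op_le_def)
      show "Im (ip x ((R - S') x)) = 0"
        unfolding eq using pos_op_form(1)[OF TS x] by simp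
      have "\<delta> * (cmod (ip v x))\<^sup>2 \<le> (\<delta> * q T) * Re (ip x ((T - S') x))"
        using mult_left_mono[OF key[OF S' x], of \<delta>] \<delta>(1) by (simp add: mult_ac)
      also have "\<dots> \<le> Re (ip x ((T - S') x))"
        using mult_right_mono[OF \<delta>(2) pos_op_form(2)[OF TS x]] by simp
      finally show "0 \<le> Re (ip x ((R - S') x))"
        unfolding eq by simp
    qed
    then have "op_le A T R"
      by (rule least[OF R])
    then have "Re (ip v (T v)) \<le> Re (ip v (R v))"
      by (rule op_leD[OF _ T R v(1)])
    also have "\<dots> = Re (ip v (T v)) - \<delta> * (cmod (ip v v))\<^sup>2"
      unfolding R_def ip_op_diff[OF B T v(1) v(1)] form[OF v(1)] by simp
    finally have "\<delta> * (cmod (ip v v))\<^sup>2 \<le> 0"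
      by simp
    then have "ip v v = 0"
      using \<delta>(1) by (simp add: mult_le_0_iff)
    then show "v = 0"
      using ell2_norm_eq_0[OF v(1)] unfolding ip_self[OF v(1)] by simp
  qed
  have "\<exists>k. ell2_norm f * ell2_norm (V k) < e"
  proof -
    have "(\<lambda>k. ell2_norm f * ell2_norm (V k)) \<longlonglongrightarrow> 0"
      using tendsto_mult_left[OF v(2), of "ell2_norm f"] \<open>v = 0\<close> by simp
    then show ?thesis
      using order_tendstoD(2)[OF _ e] eventually_happens'[OF sequentially_bot] by blast
  qed
  then obtain k where k: "ell2_norm f * ell2_norm (V k) < e" ..
  have "ip f (T f) - ip f (S k f) = ip f (V k)"
    unfolding V_def by (rule ip_diff_right[OF f bop_ell2[OF T] bop_ell2[OF Sb[OF S(1)]], symmetric])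
  then have "Re (ip f (T f)) - Re (ip f (S k f)) < e"
    using complex_Re_le_cmod[of "ip f (V k)"] ip_Cauchy_Schwarz[OF f V[of k]] k by (metis minus_complex.sel(1) order_le_less_trans)
  then show ?thesis
    using S(1) by (intro bexI[of _ "S k"]) auto
qed

text \<open>Directedness merges the approximants found for single vectors.\<close>

lemma op_lub_forms_approx:
  assumes D: "D \<noteq> {}" and pos: "\<And>S. S \<in> D \<Longrightarrow> pos_op A S"
    and dir: "\<And>S S'. S \<in> D \<Longrightarrow> S' \<in> D \<Longrightarrow> \<exists>R\<in>D. op_le A S R \<and> op_le A S' R"
    and lub: "op_lub A D T" and f: "\<And>i. i \<in> F \<Longrightarrow> f i \<in> ell2 A" and e: "e > 0" and F: "finite F"
  shows "\<exists>S\<in>D. \<forall>i\<in>F. Re (ip (f i) (T (f i))) - e < Re (ip (f i) (S (f i)))"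
  using F f
proof (induction F)
  case empty
  show ?case
    using D by blast
next
  case (insert j F)
  obtain S where S: "S \<in> D" "\<And>i. i \<in> F \<Longrightarrow> Re (ip (f i) (T (f i))) - e < Re (ip (f i) (S (f i)))"
    using insert.IH insert.prems by blast
  obtain S' where S': "S' \<in> D" "Re (ip (f j) (T (f j))) - e < Re (ip (f j) (S' (f j)))"
    using op_lub_form_approx[OF D pos dir lub insert.prems[of j] e] by blast
  obtain R where R: "R \<in> D" "op_le A S R" "op_le A S' R"
    using dir[OF S(1) S'(1)] by blast
  have "Re (ip (f i) (S (f i))) \<le> Re (ip (f i) (R (f i)))" "Re (ip (f i) (S' (f i))) \<le> Re (ip (f i) (R (f i)))"
    if "i \<in> insert j F" for i
    using op_leD[OF R(2)] op_leD[OF R(3)] pos_op_bop[OF pos] S(1) S'(1) R(1) insert.prems[OF that] by auto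
  then show ?case
    using S(2) S'(2) R(1) by (intro bexI[of _ R]) (fastforce intro: less_le_trans)+
qed

section \<open>Diagonal density operators\<close>

locale diagonal_weights =
  fixes w :: "'i \<Rightarrow> real"
  assumes w_pos: "\<And>i. 0 < w i" and w_sum: "(w has_sum 1) UNIV"
begin

definition \<phi> :: "'i op \<Rightarrow> complex" where
  "\<phi> T = (\<Sum>\<^sub>\<infinity>i. of_real (w i) * T (ket i) i)"

lemma w_finite_sum: "finite F \<Longrightarrow> sum w F \<le> 1"
  using finite_sum_le_has_sum[OF w_sum] w_pos by (auto simp: less_imp_le)

lemma summable_entries:
  assumes T: "T \<in> bop UNIV"
  shows "(\<lambda>i. of_real (w i) * T (ket i) i) summable_on UNIV"
proof -
  obtain C where C: "0 \<le> C" "\<And>f. ell2_norm (T f) \<le> C * ell2_norm f"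
    by (rule bop_bound[OF T]) blast
  have "cmod (T (ket i) i) \<le> C" for i
    using cmod_le_ell2_norm[OF bop_ell2[OF T], of "ket i" i] C(2)[of "ket i"] by simp
  then have le: "norm (of_real (w i) * T (ket i) i) \<le> norm (w i * C)" for i
    using w_pos[of i] C(1) by (simp add: norm_mult mult_left_mono less_imp_le)
  have "(\<lambda>i. w i * C) summable_on UNIV"
    using w_sum by (intro summable_on_cmult_left) (auto simp: summable_on_def)
  then have "(\<lambda>i. norm (w i * C)) summable_on UNIV"
    by (rule summable_on_iff_abs_summable_on_real[THEN iffD1])
  then have "(\<lambda>i. norm (of_real (w i) * T (ket i) i)) summable_on UNIV"
    by (rule Infinite_Sum.abs_summable_on_comparison_test) (rule le)
  then show ?thesis
    by (rule abs_summable_summable)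
qed

lemma linear: "clinear_map_on (bop UNIV) oscale (*) \<phi>"
  unfolding clinear_map_on_def
proof (intro conjI ballI allI)
  fix x y :: "'i op" assume xy: "x \<in> bop UNIV" "y \<in> bop UNIV"
  show "\<phi> (x + y) = \<phi> x + \<phi> y"
    unfolding \<phi>_def infsum_add[OF summable_entries[OF xy(1)] summable_entries[OF xy(2)], symmetric]
    by (simp add: pointwise distrib_left)
next
  fix b and x :: "'i op" assume "x \<in> bop UNIV"
  show "\<phi> (oscale b x) = b * \<phi> x"
    unfolding \<phi>_def infsum_cmult_right'[symmetric] by (simp add: vscale_apply mult_ac)
qed

lemma pos_form:
  assumes T: "pos_op UNIV T"
  shows "T (ket i) i = of_real (Re (T (ket i) i))" "0 \<le> Re (T (ket i) i)"
  using pos_op_form[OF T ell2_ket[OF UNIV_I, of i]] by (simp_all add: complex_eq_iff)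

lemma pos_summable:
  assumes T: "pos_op UNIV T"
  shows "(\<lambda>i. w i * Re (T (ket i) i)) summable_on UNIV"
    and "\<phi> T = of_real (\<Sum>\<^sub>\<infinity>i. w i * Re (T (ket i) i))"
proof -
  have eq: "of_real (w i) * T (ket i) i = of_real (w i * Re (T (ket i) i))" for i
    by (subst pos_form(1)[OF T]) simp
  show s: "(\<lambda>i. w i * Re (T (ket i) i)) summable_on UNIV"
    using summable_on_Re[OF summable_entries[OF pos_op_bop[OF T]]] by simp
  show "\<phi> T = of_real (\<Sum>\<^sub>\<infinity>i. w i * Re (T (ket i) i))"
    unfolding \<phi>_def eq using has_sum_infsum[OF s] by (intro infsumI) (simp only: has_sum_of_real_iff)
qed

lemma state: "state UNIV \<phi>"
  unfolding state_def
proof (intro conjI allI impI linear)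
  fix T :: "'i op" assume T: "pos_op UNIV T"
  have "0 \<le> (\<Sum>\<^sub>\<infinity>i. w i * Re (T (ket i) i))"
    using pos_form(2)[OF T] w_pos by (intro infsum_nonneg) (simp add: less_imp_le)
  then show "\<phi> T \<in> \<real>\<^sub>\<ge>\<^sub>0"
    unfolding pos_summable(2)[OF T] by simp
next
  have "((\<lambda>i. complex_of_real (w i)) has_sum of_real 1) UNIV"
    using w_sum by (simp only: has_sum_of_real_iff)
  then show "\<phi> (id_op UNIV) = 1"
    unfolding \<phi>_def by (intro infsumI) (simp add: ket_apply)
qed

text \<open>Choose finitely many diagonal entries carrying \<open>\<phi> T\<close> up to
  \<open>e / 2\<close>, then one \<open>S\<close> in \<open>D\<close> that is within
  \<open>e / 2\<close> of \<open>T\<close> on these; the weights sum to at most \<open>1\<close>, so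
  the total error is at most \<open>e\<close>.\<close>

lemma normal_state: "normal_state UNIV \<phi>"
  unfolding normal_state_def
proof (intro conjI state allI impI)
  fix D and T :: "'i op"
  assume "D \<noteq> {} \<and> (\<forall>S\<in>D. pos_op UNIV S) \<and> (\<forall>S\<in>D. \<forall>S'\<in>D. \<exists>R\<in>D. op_le UNIV S R \<and> op_le UNIV S' R) \<and> op_lub UNIV D T"
  then have D: "D \<noteq> {}" and pos: "\<And>S. S \<in> D \<Longrightarrow> pos_op UNIV S"
    and dir: "\<And>S S'. S \<in> D \<Longrightarrow> S' \<in> D \<Longrightarrow> \<exists>R\<in>D. op_le UNIV S R \<and> op_le UNIV S' R" and lub: "op_lub UNIV D T"
    by blast+
  have T: "T \<in> bop UNIV" and ub: "\<And>S. S \<in> D \<Longrightarrow> op_le UNIV S T"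
    using lub by (auto simp: op_lub_def)
  have posT: "pos_op UNIV T"
  proof -
    obtain S where S: "S \<in> D"
      using D by blast
    have "pos_op UNIV ((T - S) + S)"
      using ub[OF S] pos[OF S] by (intro pos_op_add) (simp_all add: op_le_def)
    then show ?thesis
      by simp
  qed
  have Re_\<phi>: "Re (\<phi> S) = (\<Sum>\<^sub>\<infinity>i. w i * Re (S (ket i) i))" if "pos_op UNIV S" for S
    unfolding pos_summable(2)[OF that] by simp
  have le: "Re (\<phi> S) \<le> Re (\<phi> T)" if S: "S \<in> D" for S
    unfolding Re_\<phi>[OF pos[OF S]] Re_\<phi>[OF posT]
  proof (rule infsum_mono[OF pos_summable(1)[OF pos[OF S]] pos_summable(1)[OF posT]])
    fix i :: 'i
    show "w i * Re (S (ket i) i) \<le> w i * Re (T (ket i) i)"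
      using op_leD[OF ub[OF S] pos_op_bop[OF pos[OF S]] T ell2_ket[OF UNIV_I, of i]] w_pos[of i] by simp
  qed
  show "Re (\<phi> T) = (SUP S\<in>D. Re (\<phi> S))"
  proof (rule antisym)
    show "(SUP S\<in>D. Re (\<phi> S)) \<le> Re (\<phi> T)"
      using D le by (rule cSUP_least)
    show "Re (\<phi> T) \<le> (SUP S\<in>D. Re (\<phi> S))"
    proof (rule field_le_epsilon)
      fix e :: real assume e: "e > 0"
      obtain F where F: "finite F" "dist (\<Sum>i\<in>F. w i * Re (T (ket i) i)) (Re (\<phi> T)) \<le> e / 2"
        using infsum_finite_approximation[OF pos_summable(1)[OF posT], of "e / 2"] e unfolding Re_\<phi>[OF posT] by auto
      obtain S where S: "S \<in> D" "\<And>i. i \<in> F \<Longrightarrow> Re (T (ket i) i) - e / 2 < Re (S (ket i) i)"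
        using op_lub_forms_approx[OF D pos dir lub, of F ket "e / 2"] F(1) e by auto
      have "Re (\<phi> T) \<le> (\<Sum>i\<in>F. w i * Re (T (ket i) i)) + e / 2"
        using F(2) unfolding dist_real_def by linarith
      also have "(\<Sum>i\<in>F. w i * Re (T (ket i) i)) \<le> (\<Sum>i\<in>F. w i * Re (S (ket i) i) + w i * (e / 2))"
        unfolding distrib_left[symmetric] using S(2) w_pos by (intro sum_mono mult_left_mono) (auto intro: less_imp_le simp: field_simps)
      also have "\<dots> = (\<Sum>i\<in>F. w i * Re (S (ket i) i)) + sum w F * (e / 2)"
        by (simp add: sum.distrib sum_distrib_right)
      also have "sum w F * (e / 2) \<le> e / 2"
        using w_finite_sum[OF F(1)] e by simp
      also have "(\<Sum>i\<in>F. w i * Re (S (ket i) i)) \<le> Re (\<phi> S)"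
        unfolding Re_\<phi>[OF pos[OF S(1)]] using pos_form(2)[OF pos[OF S(1)]] w_pos F(1)
        by (intro finite_sum_le_infsum[OF pos_summable(1)[OF pos[OF S(1)]]]) (auto simp: less_imp_le)
      also have "Re (\<phi> S) \<le> (SUP S\<in>D. Re (\<phi> S))"
        by (rule cSUP_upper[OF S(1) bdd_aboveI2[OF le]])
      finally show "Re (\<phi> T) \<le> (SUP S\<in>D. Re (\<phi> S)) + e"
        by simp
    qed
  qed
qed

lemma faithful_normal_state: "faithful_normal_state UNIV \<phi>"
  unfolding faithful_normal_state_def
proof (intro conjI normal_state ballI impI)
  fix x :: "'i op" assume x: "x \<in> bop UNIV" and 0: "\<phi> (adj UNIV x \<circ> x) = 0"
  have entry: "(adj UNIV x \<circ> x) (ket i) i = of_real ((ell2_norm (x (ket i)))\<^sup>2)" for i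
    using ip_adj_comp[OF x ell2_ket[OF UNIV_I, of i]] by simp
  have p: "pos_op UNIV (adj UNIV x \<circ> x)"
    by (rule pos_op_adj_comp[OF x])
  have "x (ket i) = 0" for i
  proof -
    have "w i * Re ((adj UNIV x \<circ> x) (ket i) i) = 0"
      using 0 pos_summable(2)[OF p] pos_form(2)[OF p] w_pos
      by (intro nonneg_infsum_le_0D[OF _ pos_summable(1)[OF p]]) (auto simp: less_imp_le)
    then have "ell2_norm (x (ket i)) = 0"
      unfolding entry using w_pos[of i] by simp
    then show ?thesis
      by (rule ell2_norm_eq_0[OF bop_ell2[OF x]])
  qed
  then show "x = 0"
    by (intro op_eqI[OF x bop_zero]) simp
qed

end

subsection \<open>Existence of invariant states\<close>

text \<open>A square matrix with orthonormal columns has orthonormal rows. For the mixed relation,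
  the expression is annihilated by multiplication with \<open>p\<close> and with \<open>q\<close>,
  which are not both \<open>0\<close>.\<close>

lemma unitary_2_rows:
  fixes p b q a :: complex
  assumes 1: "cnj p * p + cnj b * b = 1" and 2: "cnj q * q + cnj a * a = 1" and 3: "cnj p * q + cnj b * a = 0"
  shows "cnj p * p + cnj q * q = 1" "cnj b * b + cnj a * a = 1" "cnj p * b + cnj q * a = 0"
proof -
  have 4: "cnj p * q = - (cnj b * a)"
    using 3 by (simp add: eq_neg_iff_add_eq_0)
  then have 5: "p * cnj q = - (b * cnj a)"
    by (metis complex_cnj_cnj complex_cnj_minus complex_cnj_mult)
  have A: "cnj a * a = 1 - cnj q * q" and B: "cnj b * b = 1 - cnj p * p"
    using 1 2 by (simp_all add: algebra_simps)
  have "(cnj p * q) * (p * cnj q) = (cnj b * a) * (b * cnj a)"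
    unfolding 4 5 by simp
  then have "(cnj p * p) * (cnj q * q) = (cnj b * b) * (cnj a * a)"
    by (simp add: mult_ac)
  then show P: "cnj p * p + cnj q * q = 1"
    unfolding A B by (simp add: algebra_simps)
  then show "cnj b * b + cnj a * a = 1"
    unfolding A B by (simp add: algebra_simps)
  have "(cnj p * b + cnj q * a) * q = (cnj p * q) * b + cnj q * q * a"
    by (simp add: algebra_simps)
  also have "\<dots> = (cnj q * q - cnj b * b) * a"
    unfolding 4 by (simp add: algebra_simps)
  also have "\<dots> = 0"
    unfolding B using P by (simp add: algebra_simps)
  finally have q: "(cnj p * b + cnj q * a) * q = 0" .
  have "(cnj p * b + cnj q * a) * p = cnj p * p * b + (p * cnj q) * a"
    by (simp add: algebra_simps)
  also have "\<dots> = (cnj p * p - cnj a * a) * b"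
    unfolding 5 by (simp add: algebra_simps)
  also have "\<dots> = 0"
    unfolding A using P by (simp add: algebra_simps)
  finally show "cnj p * b + cnj q * a = 0"
    using q P by auto
qed

lemma infsum_nat_shift:
  fixes f :: "nat \<Rightarrow> 'b::{topological_comm_monoid_add, t2_space}"
  assumes "(\<lambda>n. f (Suc n)) summable_on UNIV"
  shows "infsum f UNIV = f 0 + (\<Sum>\<^sub>\<infinity>n. f (Suc n))"
proof -
  have U: "(UNIV :: nat set) = {0} \<union> range Suc"
    by (auto simp: image_iff) (metis not0_implies_Suc)
  have "f summable_on range Suc"
    using assms by (simp add: summable_on_reindex o_def)
  then have "infsum f ({0} \<union> range Suc) = infsum f {0} + infsum f (range Suc)"
    by (intro infsum_Un_disjoint) auto
  then have "infsum f UNIV = infsum f {0} + infsum f (range Suc)"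
    unfolding U[symmetric] .
  then show ?thesis
    by (simp add: infsum_reindex o_def)
qed

definition ladder_weight :: "nat \<Rightarrow> real" where
  "ladder_weight n = (1 / 2) ^ Suc n"

text \<open>The ratio \<open>1 / 2\<close> of excited to ground weight equals the ratio of
  consecutive ladder weights, so a quantum moving between atom and ladder leaves the product weight
  unchanged.\<close>

definition atom_weight :: "2 \<Rightarrow> real" where
  "atom_weight k = (if k = 0 then 2 / 3 else 1 / 3)"

interpretation ladder: diagonal_weights ladder_weight
proof
  show "(ladder_weight has_sum 1) UNIV"
    unfolding ladder_weight_def[abs_def] by (rule sums_nonneg_imp_has_sum[OF power_half_series]) simp
qed (simp add: ladder_weight_def)

interpretation atom: diagonal_weights atom_weight
proof
  show "(atom_weight has_sum 1) UNIV"
    by (rule has_sum_finiteI) (simp_all add: sum_UNIV_2 atom_weight_def)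
qed (simp add: atom_weight_def)

lemma atom_munit: "atom.\<phi> (munit UNIV k l) = (if k = l then of_real (atom_weight k) else 0)"
  using UNIV_2_cases[of k] UNIV_2_cases[of l]
  by (auto simp: atom.\<phi>_def sum_UNIV_2 munit_ket)

text \<open>
  \<open>ket (Suc n, 0)\<close> and \<open>ket (n, 1)\<close> span an invariant subspace of the coupling, and both have the
  weight \<open>(1 / 2) ^ Suc n / 3\<close> in the product state.
\<close>

lemma product_state_eq:
  assumes z: "z \<in> bop UNIV"
  shows "product_functional UNIV UNIV ladder.\<phi> atom.\<phi> z = (z (ket (0, 0)) (0, 0)
    + (\<Sum>\<^sub>\<infinity>n. of_real (ladder_weight n) * (z (ket (Suc n, 0)) (Suc n, 0) + z (ket (n, 1)) (n, 1)))) / 3"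
proof -
  let ?t = "\<lambda>n k. z (ket (n, k)) (n, k)"
  have b: "blk z k k \<in> bop UNIV" for k
    by (rule blk_bop_UNIV[OF z])
  have \<phi>: "ladder.\<phi> (blk z k k) = (\<Sum>\<^sub>\<infinity>n. of_real (ladder_weight n) * ?t n k)" for k
    by (simp add: ladder.\<phi>_def blk_entry)
  have s: "(\<lambda>n. of_real (ladder_weight n) * ?t n k) summable_on UNIV" for k
    using ladder.summable_entries[OF b, of k] by (simp add: blk_entry)
  have half: "complex_of_real (ladder_weight (Suc n)) = of_real (ladder_weight n) / 2" for n
    by (simp add: ladder_weight_def)
  have s': "(\<lambda>n. of_real (ladder_weight (Suc n)) * ?t (Suc n) k) summable_on UNIV" for k
    using summable_on_subset_banach[OF s, of "range Suc" k] by (simp add: summable_on_reindex o_def)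
  then have s'': "(\<lambda>n. of_real (ladder_weight n) * ?t (Suc n) k) summable_on UNIV" for k
    using summable_on_cmult_right[OF s', of 2 k] by (simp add: half)
  \<comment> \<open>The vacuum term is split off and the rest shifted by one, so that both atom
    states are summed over the same invariant blocks.\<close>
  have "(\<Sum>\<^sub>\<infinity>n. of_real (ladder_weight n) * ?t n 0) = ?t 0 0 / 2 + (\<Sum>\<^sub>\<infinity>n. of_real (ladder_weight n) * ?t (Suc n) 0) / 2"
  proof -
    have "(\<Sum>\<^sub>\<infinity>n. of_real (ladder_weight n) * ?t n 0) = of_real (ladder_weight 0) * ?t 0 0 + (\<Sum>\<^sub>\<infinity>n. of_real (ladder_weight (Suc n)) * ?t (Suc n) 0)"
      by (rule infsum_nat_shift[OF s'])
    also have "(\<Sum>\<^sub>\<infinity>n. of_real (ladder_weight (Suc n)) * ?t (Suc n) 0) = (1 / 2) * (\<Sum>\<^sub>\<infinity>n. of_real (ladder_weight n) * ?t (Suc n) 0)"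
      unfolding infsum_cmult_right'[symmetric] half by (intro infsum_cong) simp
    finally show ?thesis
      by (simp add: ladder_weight_def)
  qed
  note 0 = this
  have "product_functional UNIV UNIV ladder.\<phi> atom.\<phi> z = (\<Sum>k\<in>UNIV. \<Sum>l\<in>UNIV. ladder.\<phi> (blk z k l) * atom.\<phi> (munit UNIV k l))"
    using product_functional_eq[OF ladder.linear atom.linear finite] z by simp
  also have "\<dots> = ladder.\<phi> (blk z 0 0) * (2 / 3) + ladder.\<phi> (blk z 1 1) * (1 / 3)"
    by (simp add: sum_UNIV_2 atom_munit atom_weight_def)
  also have "\<dots> = (?t 0 0 + ((\<Sum>\<^sub>\<infinity>n. of_real (ladder_weight n) * ?t (Suc n) 0) + (\<Sum>\<^sub>\<infinity>n. of_real (ladder_weight n) * ?t n 1))) / 3"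
    unfolding \<phi> 0 by (simp add: field_simps)
  also have "(\<Sum>\<^sub>\<infinity>n. of_real (ladder_weight n) * ?t (Suc n) 0) + (\<Sum>\<^sub>\<infinity>n. of_real (ladder_weight n) * ?t n 1)
      = (\<Sum>\<^sub>\<infinity>n. of_real (ladder_weight n) * (?t (Suc n) 0 + ?t n 1))"
    unfolding infsum_add[OF s'' s, symmetric] by (simp only: distrib_left)
  finally show ?thesis .
qed

text \<open>The product state is a multiple of the trace on each invariant block of
  \<open>u\<close>, and conjugation by a unitary block preserves traces.\<close>

lemma micromaser_invariant_states:
  assumes u: "generalized_micromaser u \<alpha> \<alpha>p \<beta> \<beta>p"
  shows "invariant_states (coupling u) ladder.\<phi> atom.\<phi>"
  unfolding invariant_states_def
proof (intro conjI ladder.faithful_normal_state atom.faithful_normal_state ballI)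
  fix z :: "(nat \<times> 2) op" assume z: "z \<in> bop UNIV"
  have ub: "u \<in> bop UNIV" and iso: "adj UNIV u \<circ> u = id_op UNIV"
    using u by (simp_all only: generalized_micromaser_def unitary_op_def)
  have ket: "u (ket (0, 0)) = vscale (\<alpha> 0) (ket (0, 0))"
    "u (ket (n, 1)) = vscale (\<alpha>p (Suc n)) (ket (n, 1)) + vscale (\<beta> (Suc n)) (ket (Suc n, 0))"
    "u (ket (Suc n, 0)) = vscale (\<beta>p (Suc n)) (ket (n, 1)) + vscale (\<alpha> (Suc n)) (ket (Suc n, 0))" for n
    using u unfolding generalized_micromaser_def by (auto dest!: spec[of _ "Suc n"])
  have kU: "ket x \<in> ell2 UNIV" for x :: "nat \<times> 2"
    by simp
  have c: "coupling u z (ket x) x = ip (u (ket x)) (z (u (ket x)))" for x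
    using adj_ip_right[OF ub kU bop_ell2[OF z], of x "u (ket x)"] by (simp add: coupling_def)
  have u_ip: "ip (u (ket x)) (u (ket y)) = ket y x" for x y
  proof -
    have "ip (u (ket x)) (u (ket y)) = ip (ket x) ((adj UNIV u \<circ> u) (ket y))"
      using adj_ip_right[OF ub kU bop_ell2[OF ub], of x "ket y"] by simp
    then show ?thesis
      unfolding iso by (simp add: ket_apply[of x y] ket_apply[of y x])
  qed
  have expand: "ip (vscale a (ket x) + vscale b (ket y)) (z (vscale a (ket x) + vscale b (ket y)))
      = cnj a * a * z (ket x) x + cnj a * b * z (ket y) x + cnj b * a * z (ket x) y + cnj b * b * z (ket y) y" for a b x y
    using ip_quadratic_expand[OF z ell2_scale[OF kU] kU, of a x b y] by (simp add: bop_scale[OF z] algebra_simps)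
  have t0: "coupling u z (ket (0, 0)) (0, 0) = z (ket (0, 0)) (0, 0)"
  proof -
    have "cnj (\<alpha> 0) * \<alpha> 0 = 1"
      using u complex_norm_square[of "\<alpha> 0"] unfolding generalized_micromaser_def by (simp add: mult.commute)
    then show ?thesis
      unfolding c ket by (simp add: bop_scale[OF z] mult.commute[of "\<alpha> 0"] flip: mult.assoc)
  qed
  have tn: "coupling u z (ket (Suc n, 0)) (Suc n, 0) + coupling u z (ket (n, 1)) (n, 1)
      = z (ket (Suc n, 0)) (Suc n, 0) + z (ket (n, 1)) (n, 1)" for n
  proof -
    let ?p = "\<alpha>p (Suc n)" and ?b = "\<beta> (Suc n)" and ?q = "\<beta>p (Suc n)" and ?a = "\<alpha> (Suc n)"
    have ips: "ip (vscale p (ket (n, 1)) + vscale b (ket (Suc n, 0))) (vscale q (ket (n, 1)) + vscale a (ket (Suc n, 0)))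
        = cnj p * q + cnj b * a" for p b q a
      by (simp add: ip_add_left[where A = UNIV and B = UNIV and B' = UNIV] pointwise ket_apply)
    have "cnj ?p * ?p + cnj ?b * ?b = 1" "cnj ?q * ?q + cnj ?a * ?a = 1" "cnj ?p * ?q + cnj ?b * ?a = 0"
      using u_ip[of "(n, 1)" "(n, 1)"] u_ip[of "(Suc n, 0)" "(Suc n, 0)"] u_ip[of "(n, 1)" "(Suc n, 0)"]
      unfolding ket ips by (simp_all add: ket_apply)
    \<comment> \<open>In the trace after conjugation the entries of \<open>z\<close> carry inner
      products of rows of the block, while \<open>u_ip\<close> provides orthonormality of the
      columns.\<close>
    note rows = unitary_2_rows[OF this]
    have row': "cnj ?b * ?p + cnj ?a * ?q = 0"
      using arg_cong[OF rows(3), of cnj] by (simp add: mult.commute)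
    have "coupling u z (ket (Suc n, 0)) (Suc n, 0) + coupling u z (ket (n, 1)) (n, 1)
        = (cnj ?p * ?p + cnj ?q * ?q) * z (ket (n, 1)) (n, 1) + (cnj ?p * ?b + cnj ?q * ?a) * z (ket (Suc n, 0)) (n, 1)
        + (cnj ?b * ?p + cnj ?a * ?q) * z (ket (n, 1)) (Suc n, 0) + (cnj ?b * ?b + cnj ?a * ?a) * z (ket (Suc n, 0)) (Suc n, 0)"
      unfolding c ket expand by (simp add: algebra_simps)
    then show ?thesis
      unfolding rows row' by simp
  qed
  show "product_functional UNIV UNIV ladder.\<phi> atom.\<phi> (coupling u z) = product_functional UNIV UNIV ladder.\<phi> atom.\<phi> z"
    unfolding product_state_eq[OF coupling_bop[OF ub z]] product_state_eq[OF z] t0 tn ..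
qed

theorem theorem7p3:
  fixes u :: "(nat \<times> 2) op" and \<alpha> \<alpha>p \<beta> \<beta>p :: "nat \<Rightarrow> complex"
  assumes "generalized_micromaser u \<alpha> \<alpha>p \<beta> \<beta>p"
    and "\<forall>n\<ge>1. \<beta> n \<noteq> 0"
  shows "asymptotically_complete (coupling u)"
  unfolding asymptotically_complete_def
  using micromaser_invariant_states[OF assms(1)] micromaser_transition_asymptotically_complete[OF assms]
  by blast

end
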